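(* Every free contact circle action on the standard contact sphere $\mathbb{S}^3$ is topologically symmetric.
   Context: $\mathbb{S}^3$ carries the standard cooriented contact structure $\xi$. A contact circle action is a smooth action of the Lie group $\mathbb{S}^1=\mathbb{R}/\mathbb{Z}$ on a contact manifold by contactomorphisms; it is regarded as a 1-periodic flow $\varphi_t$, $t\in\mathbb{R}$, of an autonomous vector field. Let $\varphi_t:(\mathbb{S}^{3},\xi)\to(\mathbb{S}^{3},\xi)$ be a free contact circle action, let $Y$ be the vector field that generates $\varphi_t$, and let $P\subset\mathbb{S}^{3}$ be the set of points at which $Y$ represents the positive coorientation of $\xi$ (i.e. $\alpha(Y)>0$ for a contact form $\alpha$ inducing the coorientation of $\xi$). The action $\varphi$ is called topologically symmetric if there exists $m\in\mathbb{Z}$ such that $\dim\tilde H_{m-k}(P;\mathbb{Z}_2)=\dim\tilde H_k(P;\mathbb{Z}_2)$ for all $k\in\mathbb{Z}$, where $\tilde H_*$ denotes reduced singular homology. *)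

theory Defs
  imports "HOL-Analysis.Analysis" "HOL-Homology.Homology" "HOL-Library.Z2"
begin

section \<open>Smooth maps\<close>

text \<open>Class \<open>C\<^sup>n\<close> on an open set, by recursion on directional derivatives.\<close>

primrec C_k_on ::
  "nat \<Rightarrow> 'a set \<Rightarrow> ('a::real_normed_vector \<Rightarrow> 'b::real_normed_vector) \<Rightarrow> bool" where
  "C_k_on 0 U f \<longleftrightarrow> continuous_on U f"
| "C_k_on (Suc n) U f \<longleftrightarrow>
     (\<forall>x\<in>U. f differentiable (at x)) \<and>
     (\<forall>v. C_k_on n U (\<lambda>x. frechet_derivative f (at x) v))"

text \<open>A map on an arbitrary subset \<open>S\<close> of a Euclidean space, here a submanifold, is smooth if
  near each point of \<open>S\<close> it is the restriction of a \<open>C\<^sup>\<infinity>\<close> map on an open subset of the ambient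
  space. Values outside \<open>S\<close> are irrelevant.\<close>

definition smooth_map_on ::
  "'a::euclidean_space set \<Rightarrow> ('a \<Rightarrow> 'b::euclidean_space) \<Rightarrow> bool" where
  "smooth_map_on S f \<longleftrightarrow>
     (\<forall>x\<in>S. \<exists>U g. open U \<and> x \<in> U \<and> (\<forall>n. C_k_on n U g) \<and> (\<forall>y\<in>S \<inter> U. g y = f y))"


section \<open>The standard contact three-sphere\<close>

abbreviation S3 :: "(complex \<times> complex) set" where
  "S3 \<equiv> sphere 0 1"

text \<open>\<open>\<alpha> = x\<^sub>1 dy\<^sub>1 - y\<^sub>1 dx\<^sub>1 + x\<^sub>2 dy\<^sub>2 - y\<^sub>2 dx\<^sub>2\<close>, written as \<open>\<alpha>\<^sub>z(v) = \<langle>\<i>z, v\<rangle>\<close>. Its restriction to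
  \<open>S3\<close> is a contact form inducing the standard coorientation.\<close>

definition std_contact_form :: "complex \<times> complex \<Rightarrow> complex \<times> complex \<Rightarrow> real" where
  "std_contact_form z v = inner (\<i> * fst z, \<i> * snd z) v"

definition std_contact_plane :: "complex \<times> complex \<Rightarrow> (complex \<times> complex) set" where
  "std_contact_plane z = {v. inner z v = 0 \<and> std_contact_form z v = 0}"

text \<open>The derivative within \<open>S3\<close> is uniquely determined on vectors tangent to \<open>S3\<close>, where it is
  the differential of \<open>\<psi>\<close>; its value in the normal direction plays no role below.
  Contactomorphisms preserve the plane field; for the maps in a flow, preservation of the
  coorientation follows, since such maps are isotopic to the identity through
  contactomorphisms.\<close>

definition contactomorphism :: "(complex \<times> complex \<Rightarrow> complex \<times> complex) \<Rightarrow> bool" where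
  "contactomorphism \<psi> \<longleftrightarrow>
     bij_betw \<psi> S3 S3 \<and> smooth_map_on S3 \<psi> \<and> smooth_map_on S3 (inv_into S3 \<psi>) \<and>
     (\<forall>z\<in>S3. frechet_derivative \<psi> (at z within S3) ` std_contact_plane z
              = std_contact_plane (\<psi> z))"


section \<open>Contact circle actions\<close>

text \<open>An action of \<open>\<real>/\<int>\<close> is given as a 1-periodic flow.\<close>

definition contact_circle_action ::
  "(real \<Rightarrow> complex \<times> complex \<Rightarrow> complex \<times> complex) \<Rightarrow> bool" where
  "contact_circle_action \<phi> \<longleftrightarrow>
     smooth_map_on (UNIV \<times> S3) (\<lambda>(t, z). \<phi> t z) \<and>
     (\<forall>z\<in>S3. \<phi> 0 z = z) \<and>
     (\<forall>s t. \<forall>z\<in>S3. \<phi> (s + t) z = \<phi> s (\<phi> t z)) \<and>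
     (\<forall>z\<in>S3. \<phi> 1 z = z) \<and>
     (\<forall>t. contactomorphism (\<phi> t))"

definition free_circle_action ::
  "(real \<Rightarrow> complex \<times> complex \<Rightarrow> complex \<times> complex) \<Rightarrow> bool" where
  "free_circle_action \<phi> \<longleftrightarrow> (\<forall>t. \<forall>z\<in>S3. \<phi> t z = z \<longrightarrow> t \<in> \<int>)"

definition generating_field ::
  "(real \<Rightarrow> complex \<times> complex \<Rightarrow> complex \<times> complex) \<Rightarrow> complex \<times> complex \<Rightarrow> complex \<times> complex" where
  "generating_field \<phi> z = vector_derivative (\<lambda>t. \<phi> t z) (at 0)"

definition positive_set ::
  "(real \<Rightarrow> complex \<times> complex \<Rightarrow> complex \<times> complex) \<Rightarrow> (complex \<times> complex) set" where
  "positive_set \<phi> = {z \<in> S3. std_contact_form z (generating_field \<phi> z) > 0}"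


section \<open>Reduced singular homology with \<open>\<int>\<^sub>2\<close> coefficients\<close>

text \<open>The augmented singular complex. In degree \<open>-1\<close> there is exactly one simplex, the map from
  the empty standard simplex (the unique function that is extensional on the empty set). Hence
  the chain group in degree \<open>-1\<close> is \<open>\<int>\<^sub>2\<close> and the boundary from degree \<open>0\<close> is the augmentation.
  In particular the empty space has \<open>\<int>\<^sub>2\<close> as reduced homology in degree \<open>-1\<close>.\<close>

definition aug_simplices :: "int \<Rightarrow> 'a topology \<Rightarrow> ((nat \<Rightarrow> real) \<Rightarrow> 'a) set" where
  "aug_simplices p X =
     (if p \<ge> 0 then {f. singular_simplex (nat p) X f}
      else if p = -1 then {\<lambda>_. undefined} else {})"

definition aug_face :: "nat \<Rightarrow> nat \<Rightarrow> ((nat \<Rightarrow> real) \<Rightarrow> 'a) \<Rightarrow> (nat \<Rightarrow> real) \<Rightarrow> 'a" where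
  "aug_face p k f = (if p = 0 then (\<lambda>_. undefined) else singular_face p k f)"

type_synonym 'a chain2 = "((nat \<Rightarrow> real) \<Rightarrow> 'a) \<Rightarrow>\<^sub>0 bit"

definition chain2_group :: "int \<Rightarrow> 'a topology \<Rightarrow> 'a chain2 monoid" where
  "chain2_group p X =
     \<lparr>carrier = {c. Poly_Mapping.keys c \<subseteq> aug_simplices p X}, monoid.mult = (+), one = 0\<rparr>"

text \<open>The usual signs \<open>(-1)\<^sup>k\<close> are all \<open>1\<close> in \<open>\<int>\<^sub>2\<close>.\<close>

definition boundary2 :: "int \<Rightarrow> 'a chain2 \<Rightarrow> 'a chain2" where
  "boundary2 p c =
     (if p < 0 then 0
      else \<Sum>f\<in>Poly_Mapping.keys c. \<Sum>k\<le>nat p.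
             Poly_Mapping.single (aug_face (nat p) k f) (Poly_Mapping.lookup c f))"

definition reduced_homology2 :: "int \<Rightarrow> 'a topology \<Rightarrow> 'a chain2 set monoid" where
  "reduced_homology2 p X =
     (chain2_group p X)\<lparr>carrier := {c \<in> carrier (chain2_group p X). boundary2 p c = 0}\<rparr>
       Mod (boundary2 (p + 1) ` carrier (chain2_group (p + 1) X))"

text \<open>A \<open>\<int>\<^sub>2\<close> vector space is its additive group, and a linear combination is the sum of a finite
  set of vectors, namely those with coefficient \<open>1\<close>. (Groups are written multiplicatively in
  HOL-Algebra.) The dimension is the cardinality of a basis as a cardinal, so that infinite
  dimensions are not identified with \<open>0\<close> or with each other.\<close>

definition is_Z2_basis :: "('g, 'm) monoid_scheme \<Rightarrow> 'g set \<Rightarrow> bool" where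
  "is_Z2_basis G B \<longleftrightarrow>
     B \<subseteq> carrier G \<and>
     (\<forall>x\<in>carrier G. \<exists>!T. T \<subseteq> B \<and> finite T \<and> finprod G (\<lambda>b. b) T = x)"

definition Z2_dim :: "('g, 'm) monoid_scheme \<Rightarrow> 'g rel" where
  "Z2_dim G = card_of (SOME B. is_Z2_basis G B)"


section \<open>Topological symmetry\<close>

definition topologically_symmetric ::
  "(real \<Rightarrow> complex \<times> complex \<Rightarrow> complex \<times> complex) \<Rightarrow> bool" where
  "topologically_symmetric \<phi> \<longleftrightarrow>
     (\<exists>m::int. \<forall>k::int.
        ordIso2 (Z2_dim (reduced_homology2 (m - k) (top_of_set (positive_set \<phi>))))
                (Z2_dim (reduced_homology2 k (top_of_set (positive_set \<phi>)))))"

end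

theory Submission
 imports Defs
begin

text \<open>The circle action is lifted to a homogeneous symplectic flow \<open>\<psi>\<close> on \<open>\<complex>\<^sup>2 - {0}\<close> with Hamiltonian \<open>h\<close>; the sets
\<open>P = {h > 0}\<close> and \<open>N = {h < 0}\<close> are cones over the positive and the negative part of the sphere. For small \<open>\<epsilon>\<close>,
\<open>\<psi>\<^sub>\<epsilon>\<close> and \<open>\<psi>\<^sub>-\<^sub>\<epsilon>\<close> have generating functions with negative sublevels equivalent to \<open>P\<close> and \<open>N\<close>. A polygon with many
vertices carries an action function for each time: at time \<open>\<epsilon>\<close> it is the small generating function plus a
nondegenerate quadratic form, and at time \<open>1 - \<epsilon>\<close>, since \<open>\<psi>\<^sub>1 = id\<close>, it is of this kind for \<open>- \<epsilon>\<close>. Freeness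
keeps the origin the only critical point in between, so the homology of \<open>N\<close> is that of \<open>P\<close> shifted by some \<open>d\<close>.
A duality in codimension one (\<open>H\<^sub>2(P) \<cong> H\<^sub>0(N)\<close>, \<open>H\<^sub>2(N) \<cong> H\<^sub>0(P)\<close> and nothing above degree 2) then forces symmetry
about \<open>m = 2 - d\<close>.\<close>

text \<open>The lifted Hamiltonian is only homogeneous of degree 2, so it and the action functions
  need not have a second derivative at the origin. Two first-order facts are used instead: the
  gradient is Lipschitz, and it is bounded below by a multiple of the norm, which follows from
  freeness and compactness. Together they make one explicit step decrease the function; such steps
  replace flows, and in the duality also regularity of the zero set. The end of the path is the hard
  point: for \<open>K\<close> steps of length \<open>1 / K\<close> the action is not quadratic in
  the fibre over a fixed last midpoint. In the fibre over 0 it is merely homogeneous. Over a nonzero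
  point, however, it is twice differentiable at its critical polygon, and it behaves at infinity
  like the homogeneous function; comparing local with global sublevels identifies the two. The
  indices of the quadratic forms are never computed, only their difference \<open>d\<close> matters.
  The dimension of the sphere enters last: duality pairs degrees 0 and 2, and degree 1 then has no
  freedom left.\<close>

notation scaleR (infixr "*." 75)

abbreviation "keys \<equiv> Poly_Mapping.keys"
abbreviation "lookup \<equiv> Poly_Mapping.lookup"
abbreviation "single \<equiv> Poly_Mapping.single"

type_synonym C2 = "complex \<times> complex"
type_synonym 'v loop = "nat \<Rightarrow>\<^sub>0 'v"

section \<open>Singular homology modulo two\<close>

subsection \<open>A natural prism operator for integral chains\<close>

text \<open>The identity is homotopic to a constant, so a cycle is homologous to its image in one
  point, where every cycle of positive degree bounds. The complex is unreduced here, hence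
  \<open>1 <= p\<close>.\<close>

lemma contractible_cycle_is_boundary:
 assumes X: "contractible_space X" and p: "1 <= p" and c: "singular_relcycle p X {} c"
 shows "singular_relboundary p X {} c"
proof (cases "topspace X = {}")
 case True
 hence "c = 0" using c singular_chain_empty[OF True] by (auto simp: singular_cycle)
 thus ?thesis by simp
next
 case False
 obtain a where a: "homotopic_with (%x. True) X X id (%x. a)" using X by (auto simp: contractible_space_def)
 hence "homotopic_with (%h. h : {} \<rightarrow> {}) X X id (%x. a)" by simp
 from homotopic_imp_homologous_rel_chain_maps[OF this c]
 have *: "homologous_rel p X {} (chain_map p id c) (chain_map p (%x. a) c)" .
 have ac: "continuous_map X X (%x. a)" using homotopic_with_imp_continuous_maps[OF a] by blast
 hence aX: "a : topspace X" using False by (auto simp: continuous_map_def)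
 have cont: "continuous_map X (subtopology X {a}) (%x. a)" using ac by (auto simp: continuous_map_in_subtopology)
 have "singular_relcycle p (subtopology X {a}) {} (chain_map p (%x. a) c)" using singular_relcycle_chain_map[OF c cont] by simp
 hence "singular_relboundary p (subtopology X {a}) {} (chain_map p (%x. a) c)" using singular_boundary_eq_cycle_singleton[of "subtopology X {a}" a p] aX p by auto
 hence "singular_relboundary p X {} (chain_map p (%x. a) c)" by (metis singular_boundary_mono subset_UNIV subtopology_UNIV)
 moreover have "chain_map p id c = c" using c by (auto simp: singular_cycle chain_map_ident)
 ultimately show ?thesis using * by (metis diff_add_cancel homologous_rel_def singular_relboundary_add)
qed

abbreviation simplex_space :: "nat => (nat => real) topology" where
 "simplex_space q \<equiv> subtopology (powertop_real UNIV) (standard_simplex q)"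

abbreviation prism_space :: "nat => (real \<times> (nat => real)) topology" where
 "prism_space q \<equiv> prod_topology (top_of_set {0..1}) (simplex_space q)"

abbreviation id_simplex :: "nat => (nat => real) chain" where
 "id_simplex q \<equiv> frag_of (restrict id (standard_simplex q))"

lemma contractible_simplex_space: "contractible_space (simplex_space q)"
proof -
 define a where "a = (%j::nat. if j = 0 then 1 else (0::real))"
 have a: "a : standard_simplex q" using basis_in_standard_simplex[of 0 q] by (simp add: a_def)
 let ?h = "%z::real \<times> (nat => real). %j. (1 - fst z) * snd z j + fst z * a j"
 have 1: "continuous_map (prism_space q) (powertop_real UNIV) ?h"
 proof (rule continuous_map_componentwise_UNIV[THEN iffD2], intro allI)
  fix k
  have "continuous_map (prism_space q) euclideanreal (%z. snd z k)" by (rule continuous_map_compose[of _ "simplex_space q" snd _ "%x. x k", unfolded o_def])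
     (auto simp: continuous_map_snd intro!: continuous_map_from_subtopology continuous_map_product_projection)
  moreover have "continuous_map (prism_space q) euclideanreal fst" using continuous_map_fst continuous_map_into_fulltopology by blast
  ultimately show "continuous_map (prism_space q) euclideanreal (%z. (1 - fst z) * snd z k + fst z * a k)" by (intro continuous_intros) auto
 qed
 have 2: "?h z : standard_simplex q" if "z : topspace (prism_space q)" for z using that a convex_standard_simplex[of "snd z" q a "fst z"] by (auto simp: algebra_simps)
 have "continuous_map (prism_space q) (simplex_space q) ?h" using 1 2 by (auto simp: continuous_map_in_subtopology simp del: topspace_prod_topology)
 hence "homotopic_with (%x. True) (simplex_space q) (simplex_space q) id (%x. a)" unfolding homotopic_with_def by (intro exI[of _ ?h]) auto
 thus ?thesis unfolding contractible_space_def by blast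
qed

lemma contractible_prism_space: "contractible_space (prism_space q)"
proof -
 have "contractible_space (top_of_set {0..1::real})" by (simp add: convex_imp_contractible)
 thus ?thesis using contractible_simplex_space contractible_space_prod_topology by blast
qed

text \<open>A mod 2 cycle lifts to an integral chain that need not be a cycle, so homotopy
  invariance mod 2 needs a chain homotopy on all integral chains. It is built by acyclic models: one
  chain on the prism over the standard simplex is chosen per degree and transported along every
  simplex, which makes the operator additive and natural.\<close>

definition prism_along ::
 "(real \<times> (nat => real)) chain => nat => (real \<times> 'b => 'c) => 'b chain => 'c chain" where
 "prism_along P q H c = frag_extend (%m. chain_map (Suc q) (%(t, x). H (t, m x)) P) c"

text \<open>Boundary of a prism: top minus bottom minus the sides, where the sides are filled with
  the chain \<open>P'\<close> chosen one degree lower.\<close>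

definition prism_model :: "nat => (real \<times> (nat => real)) chain => (real \<times> (nat => real)) chain => bool" where
 "prism_model q P' P \<longleftrightarrow> singular_chain (Suc q) (prism_space q) P &
   chain_boundary (Suc q) P = chain_map q (Pair 1) (id_simplex q) - chain_map q (Pair 0) (id_simplex q)
    - prism_along P' (q - 1) id (chain_boundary q (id_simplex q))"

lemma prism_along_0 [simp]: "prism_along P q H 0 = 0"
 and prism_along_diff: "prism_along P q H (a - b) = prism_along P q H a - prism_along P q H b" by (auto simp: prism_along_def frag_extend_diff)

lemma continuous_map_prism:
 assumes H: "continuous_map (prod_topology (top_of_set {0..1}) X) U H" and m: "singular_simplex q X m"
 shows "continuous_map (prism_space q) U (%(t, x). H (t, m x))"
proof -
 have "continuous_map (prism_space q) (prod_topology (top_of_set {0..1}) X) (%z. (fst z, m (snd z)))"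
 proof (subst continuous_map_pairwise, intro conjI)
  show "continuous_map (prism_space q) (top_of_set {0..1}) (fst \<circ> (%z. (fst z, m (snd z))))" by (simp add: o_def continuous_map_fst)
  have "continuous_map (simplex_space q) X m" using m by (simp add: singular_simplex_def)
  from continuous_map_compose[OF continuous_map_snd this]
  show "continuous_map (prism_space q) X (snd \<circ> (%z. (fst z, m (snd z))))" by (simp add: o_def)
 qed
 from continuous_map_compose[OF this H] show ?thesis by (simp add: o_def case_prod_unfold)
qed

lemma prism_along_chain:
 assumes P: "singular_chain (Suc q) (prism_space q) P"
  and H: "continuous_map (prod_topology (top_of_set {0..1}) X) U H"
  and c: "singular_chain q X c"
 shows "singular_chain (Suc q) U (prism_along P q H c)" using c unfolding singular_chain_def
proof (induction c rule: frag_induction)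
 case (one m)
 thus ?case using singular_chain_chain_map[OF P continuous_map_prism[OF H]] by (simp add: prism_along_def singular_chain_def)
next
 case (diff a b)
 thus ?case by (simp add: prism_along_diff singular_chain_diff[unfolded singular_chain_def])
qed auto

lemma prism_along_boundary:
 assumes P: "prism_model q P' P" and P': "q > 0 ==> singular_chain q (prism_space (q - 1)) P'"
  and H: "continuous_map (prod_topology (top_of_set {0..1}) X) U H"
  and c: "singular_chain q X c"
 shows "chain_boundary (Suc q) (prism_along P q H c) =
   chain_map q (%x. H (1, x)) c - chain_map q (%x. H (0, x)) c - prism_along P' (q - 1) H (chain_boundary q c)" using c unfolding singular_chain_def
proof (induction c rule: frag_induction)
 case (one m)
 hence m: "singular_simplex q X m" by simp
 let ?G = "%(t, x). H (t, m x)"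
 have Pc: "singular_chain (Suc q) (prism_space q) P"
  and Pb: "chain_boundary (Suc q) P = chain_map q (Pair 1) (id_simplex q) - chain_map q (Pair 0) (id_simplex q)
    - prism_along P' (q - 1) id (chain_boundary q (id_simplex q))" using P by (auto simp: prism_model_def)
 have end_map: "chain_map q ?G (chain_map q (Pair t) (id_simplex q)) = chain_map q (%x. H (t, x)) (frag_of m)" for t
  by (simp add: simplex_map_def o_def restrict_def fun_eq_iff)
    (rule arg_cong[where f=frag_of], auto simp: fun_eq_iff)
 \<comment> \<open>Naturality: each side is the lower model transported along a face of the standard
   simplex, and following this by \<open>?G\<close> is transport along the face of
   \<open>m\<close>.\<close>
 have last: "chain_map q ?G (prism_along P' (q - 1) id (chain_boundary q (id_simplex q)))
   = prism_along P' (q - 1) H (chain_boundary q (frag_of m))"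
 proof (cases "q = 0")
  case True
  thus ?thesis by (simp add: chain_boundary_def)
 next
  case False
  hence q: "Suc (q - 1) = q" by simp
  have face: "chain_map q ?G (chain_map q (%(t, x). (t, singular_face q k (restrict id (standard_simplex q)) x)) P')
   = chain_map q (%(t, x). H (t, singular_face q k m x)) P'" if k: "k <= q" for k
  proof -
   have "chain_map q ?G (chain_map q (%(t, x). (t, singular_face q k (restrict id (standard_simplex q)) x)) P')
    = chain_map q (?G \<circ> (%(t, x). (t, singular_face q k (restrict id (standard_simplex q)) x))) P'" by (simp add: chain_map_compose)
   also have "... = chain_map q (%(t, x). H (t, singular_face q k m x)) P'" using P' False k by (intro chain_map_eq[where X="prism_space (q - 1)"])
      (auto simp: singular_face_def simplical_face_in_standard_simplex)
   finally show ?thesis .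
  qed
  show ?thesis using False
   apply (simp add: chain_boundary_of prism_along_def frag_extend_sum chain_map_sum frag_extend_cmul o_def) using face q by (simp add: o_def)
 qed
 have "chain_boundary (Suc q) (prism_along P q H (frag_of m)) = chain_boundary (Suc q) (chain_map (Suc q) ?G P)" by (simp add: prism_along_def)
 also have "... = chain_map q ?G (chain_boundary (Suc q) P)" using chain_boundary_chain_map[OF Pc, of ?G] by simp
 also have "... = chain_map q (%x. H (1, x)) (frag_of m) - chain_map q (%x. H (0, x)) (frag_of m)
   - prism_along P' (q - 1) H (chain_boundary q (frag_of m))" unfolding Pb chain_map_diff end_map last ..
 finally show ?case .
next
 case (diff a b)
 thus ?case by (simp add: prism_along_diff chain_boundary_diff chain_map_diff)
qed auto

text \<open>Induction on the degree: the prescribed boundary is a cycle by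
  \<open>prism_along_boundary\<close> one degree lower, and the prism is contractible.
  \<open>?good\<close> keeps the predecessor \<open>P'\<close> because that boundary formula
  mentions it.\<close>

lemma prism_models_exist: "EX P. prism_model 0 0 (P 0) & (ALL q. prism_model (Suc q) (P q) (P (Suc q)))"
proof -
 let ?good = "%q P. EX P'. prism_model q P' P & (q > 0 --> singular_chain q (prism_space (q - 1)) P') & (q = 0 --> P' = 0)"
 have "EX P. ALL q. ?good q (P q) & prism_model (Suc q) (P q) (P (Suc q))"
 proof (rule dependent_nat_choice)
  \<comment> \<open>Degree 0 is outside the reach of \<open>contractible_cycle_is_boundary\<close>;
    the model is the interval itself, parametrised by coordinate 1 of the 1-simplex.\<close>
  let ?v = "%j::nat. if j = 0 then 1 else (0::real)"
  let ?f = "restrict (%y. (y 1, ?v)) (standard_simplex 1) :: (nat => real) => _"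
  have v: "?v : standard_simplex 0" by (simp add: standard_simplex_0)
  have "continuous_map (simplex_space 1) (top_of_set {0..1}) (%y. y 1)" by (auto simp: continuous_map_in_subtopology standard_simplex_def
     intro!: continuous_map_from_subtopology continuous_map_product_projection)
  hence "continuous_map (simplex_space 1) (prism_space 0) (%y. (y 1, ?v))" using v by (auto simp: continuous_map_pairwise o_def)
  hence 1: "singular_simplex 1 (prism_space 0) ?f" by (auto simp: singular_simplex_def elim!: continuous_map_eq)
  have 2: "simplical_face 0 ?v 1 = (1::real)" "simplical_face 1 ?v 1 = (0::real)" by (auto simp: simplical_face_def)
  have 3: "singular_face 1 k ?f = simplex_map 0 (Pair (simplical_face k ?v 1)) (restrict id (standard_simplex 0))" if "k <= 1" for k
  proof
   fix x
   show "singular_face 1 k ?f x = simplex_map 0 (Pair (simplical_face k ?v 1)) (restrict id (standard_simplex 0)) x"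
    using that simplical_face_in_standard_simplex[of 1 k "?v"] v by (cases "x = ?v") (simp_all add: singular_face_def simplex_map_def standard_simplex_0)
  qed
  have "chain_boundary (Suc 0) (frag_of ?f) = frag_of (singular_face 1 0 ?f) - frag_of (singular_face 1 1 ?f)" by (simp add: chain_boundary_of)
  also have "... = chain_map 0 (Pair 1) (id_simplex 0) - chain_map 0 (Pair 0) (id_simplex 0)" using 3[of 0] 3[of 1] 2 by simp
  finally have "prism_model 0 0 (frag_of ?f)" using 1 by (simp add: prism_model_def singular_chain_of chain_boundary_def[of 0])
  thus "EX P. ?good 0 P" by auto
 next
  fix P q assume "?good q P"
  then obtain P' where P': "prism_model q P' P" "q > 0 ==> singular_chain q (prism_space (q - 1)) P'" "q = 0 ==> P' = 0" by blast
  let ?X = "simplex_space (Suc q)"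
  let ?c = "id_simplex (Suc q)"
  have Hid: "continuous_map (prod_topology (top_of_set {0..1}) ?X) (prism_space (Suc q)) id" by simp
  have c: "singular_chain (Suc q) ?X ?c" by (auto simp: singular_chain_of singular_simplex_def elim!: continuous_map_eq)
  have bc: "singular_chain q ?X (chain_boundary (Suc q) ?c)" using singular_chain_boundary_alt[OF c] .
  have Pc: "singular_chain (Suc q) (prism_space q) P" using P' by (simp add: prism_model_def)
  have cont: "continuous_map ?X (prism_space (Suc q)) (Pair t)" if "t : {0..1}" for t using that by (auto simp: continuous_map_pairwise o_def)
  define R where "R = chain_map (Suc q) (Pair 1) ?c - chain_map (Suc q) (Pair 0) ?c
    - prism_along P q id (chain_boundary (Suc q) ?c)"
  have R: "singular_chain (Suc q) (prism_space (Suc q)) R" unfolding R_def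
   by (intro singular_chain_diff singular_chain_chain_map[OF c] cont prism_along_chain[OF Pc Hid bc]) auto
  have zero: "prism_along P' (q - 1) id (chain_boundary q (chain_boundary (Suc q) ?c)) = 0" using chain_boundary_boundary_alt[OF c] by simp
  have "chain_boundary (Suc q) R = 0" unfolding R_def chain_boundary_diff using prism_along_boundary[OF P'(1,2) Hid bc] zero
    chain_boundary_chain_map[OF c, of "Pair (1::real)"] chain_boundary_chain_map[OF c, of "Pair (0::real)"] by simp
  hence "singular_relcycle (Suc q) (prism_space (Suc q)) {} R" using R by (simp add: singular_cycle)
  hence "singular_relboundary (Suc q) (prism_space (Suc q)) {} R" by (intro contractible_cycle_is_boundary contractible_prism_space) auto
  then obtain Q where "singular_chain (Suc (Suc q)) (prism_space (Suc q)) Q" "chain_boundary (Suc (Suc q)) Q = R" by (auto simp: singular_boundary)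
  hence "prism_model (Suc q) P Q" by (simp add: prism_model_def R_def)
  with Pc show "EX Q. ?good (Suc q) Q & prism_model (Suc q) P Q" by auto
 qed
 then obtain P where P: "ALL q. ?good q (P q) & prism_model (Suc q) (P q) (P (Suc q))" by blast
 hence "prism_model 0 0 (P 0)" by blast
 thus ?thesis using P by blast
qed

lemma chain_homotopic_chain_maps:
 fixes H :: "real \<times> 'b => 'c"
 assumes H: "continuous_map (prod_topology (top_of_set {0..1}) X) U H"
 obtains pr where "!!q a b. pr q (a - b) = pr q a - pr q b"
  "!!q c. singular_chain q X c ==> singular_chain (Suc q) U (pr q c)"
  "!!q c. singular_chain q X c ==> chain_boundary (Suc q) (pr q c) =
    chain_map q (%x. H (1, x)) c - chain_map q (%x. H (0, x)) c - pr (q - 1) (chain_boundary q c)"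
proof -
 obtain P where P: "prism_model 0 0 (P 0)" "!!q. prism_model (Suc q) (P q) (P (Suc q))" using prism_models_exist by blast
 have Pc: "singular_chain (Suc q) (prism_space q) (P q)" for q using P by (cases q) (auto simp: prism_model_def)
 show thesis
 proof (rule that[of "%q. prism_along (P q) q H"])
  fix q c assume c: "singular_chain q X c"
  show "chain_boundary (Suc q) (prism_along (P q) q H c) =
    chain_map q (%x. H (1, x)) c - chain_map q (%x. H (0, x)) c - prism_along (P (q - 1)) (q - 1) H (chain_boundary q c)"
  proof (cases q)
   case 0
   thus ?thesis using prism_along_boundary[OF P(1) _ H, of c] c by (simp add: chain_boundary_def[of 0])
  next
   case (Suc r)
   thus ?thesis using prism_along_boundary[OF P(2)[of r] _ H, of c] c Pc by simp
  qed
 qed (auto simp: prism_along_diff prism_along_chain[OF Pc H])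
qed

subsection \<open>Reduction modulo two\<close>

definition red2 :: "('a \<Rightarrow>\<^sub>0 int) => ('a \<Rightarrow>\<^sub>0 bit)" where
 "red2 c = Poly_Mapping.map of_int c"

text \<open>The representatives 0 and 1 are chosen, so this lift is additive only up to even
  chains.\<close>

definition lift2 :: "('a \<Rightarrow>\<^sub>0 bit) => ('a \<Rightarrow>\<^sub>0 int)" where
 "lift2 c = Poly_Mapping.map (%b. if b = 1 then 1 else 0) c"

declare add_bit_eq_xor [simp del] mult_bit_eq_and [simp del]

lemma of_int_bit: "(of_int n :: bit) = of_bool (odd n)" by (cases "even n") (auto elim!: evenE oddE)

lemma bit_double [simp]: "x + x = (0::bit)" by (cases x) auto

lemma bit_minus [simp]: "- x = (x::bit)" by (cases x) auto

lemma pm_double [simp]: "c + c = (0 :: 'a \<Rightarrow>\<^sub>0 bit)" by (intro poly_mapping_eqI) (simp add: lookup_add)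

lemma pm_double_left [simp]: "c + (c + d) = (d :: 'a \<Rightarrow>\<^sub>0 bit)" by (simp add: add.assoc[symmetric])

lemma pm_minus [simp]: "- c = (c :: 'a \<Rightarrow>\<^sub>0 bit)" by (metis add.inverse_unique pm_double)

lemma pm_diff: "c - d = (c + d :: 'a \<Rightarrow>\<^sub>0 bit)" by (metis diff_conv_add_uminus pm_minus)

lemma pm_add_eq_0_iff: "c + d = 0 \<longleftrightarrow> c = (d :: 'a \<Rightarrow>\<^sub>0 bit)" by (metis pm_double pm_double_left add.right_neutral)

lemma lookup_red2: "lookup (red2 c) f = of_int (lookup c f)" by (simp add: red2_def Poly_Mapping.map.rep_eq when_def)

lemma lookup_lift2: "lookup (lift2 c) f = (if lookup c f = 1 then 1 else 0)" by (simp add: lift2_def Poly_Mapping.map.rep_eq when_def)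

lemma red2_0 [simp]: "red2 0 = 0"
 and red2_add: "red2 (a + b) = red2 a + red2 b"
 and red2_diff: "red2 (a - b) = red2 a - red2 b"
 and red2_minus: "red2 (- a) = red2 a" by (intro poly_mapping_eqI; simp add: lookup_red2 lookup_add lookup_minus)+

lemma red2_of [simp]: "red2 (frag_of f) = single f 1" by (intro poly_mapping_eqI) (simp add: lookup_red2 lookup_single when_def)

lemma red2_cmul: "red2 (frag_cmul k c) = (if even k then 0 else red2 c)" by (intro poly_mapping_eqI) (auto simp: lookup_red2 of_int_bit)

lemma red2_sum: "red2 (sum g I) = (SUM i:I. red2 (g i))" by (induction I rule: infinite_finite_induct) (auto simp: red2_add)

lemma red2_lift2 [simp]: "red2 (lift2 c) = c"
proof (intro poly_mapping_eqI)
 fix f show "lookup (red2 (lift2 c)) f = lookup c f" by (cases "lookup c f") (auto simp: lookup_red2 lookup_lift2)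
qed

lemma keys_lift2: "keys (lift2 c) = keys c"
proof -
 have "lookup c x = 0 | lookup c x = 1" for x by (cases "lookup c x") auto
 thus ?thesis by (auto simp: in_keys_iff lookup_lift2) (metis zero_neq_one)
qed

lemma keys_red2: "keys (red2 c) <= keys c" by (auto simp: in_keys_iff lookup_red2)

lemma red2_eqD:
 assumes "red2 a = red2 b"
 obtains d where "a - b = d + d"
proof -
 have even: "even (lookup a f - lookup b f)" for f
 proof -
  have "(of_int (lookup a f) :: bit) = of_int (lookup b f)" using assms by (metis lookup_red2)
  thus ?thesis by (auto simp: of_int_bit split: if_splits)
 qed
 have "a - b = Poly_Mapping.map (%x. x div 2) (a - b) + Poly_Mapping.map (%x. x div 2) (a - b)"
 proof (intro poly_mapping_eqI)
  fix k
  obtain j where j: "lookup a k - lookup b k = 2 * j" using even[of k] by blast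
  thus "lookup (a - b) k = lookup
    (Poly_Mapping.map (%x. x div 2) (a - b) + Poly_Mapping.map (%x. x div 2) (a - b)) k" by (simp add: lookup_add Poly_Mapping.map.rep_eq when_def lookup_minus)
 qed
 thus thesis using that by blast
qed

text \<open>Equal reductions differ by some \<open>d + d\<close>, which an additive operator maps to
  an even chain again.\<close>

lemma red2_cong_additive:
 fixes T :: "('a \<Rightarrow>\<^sub>0 int) => ('b \<Rightarrow>\<^sub>0 int)"
 assumes T: "!!a b. T (a - b) = T a - T b" and "red2 a = red2 b"
 shows "red2 (T a) = red2 (T b)"
proof -
 obtain d where d: "a - b = d + d" using red2_eqD assms(2) by blast
 have T0: "T 0 = 0" using T[of 0 0] by simp
 have "T (d + d) = T d + T d" using T[of d "- d"] T[of 0 d] T0 by simp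
 hence "T a = T b + (T d + T d)" using T[of a b] d by (simp add: algebra_simps)
 thus ?thesis by (simp add: red2_add)
qed

text \<open>The way in which integral operators act mod 2; additivity makes the result independent
  of the lift, see \<open>descend_red2\<close>.\<close>

definition descend :: "(('a \<Rightarrow>\<^sub>0 int) => ('b \<Rightarrow>\<^sub>0 int)) => ('a \<Rightarrow>\<^sub>0 bit) => ('b \<Rightarrow>\<^sub>0 bit)" where
 "descend T c = red2 (T (lift2 c))"

lemma descend_red2:
 assumes "!!a b. T (a - b) = T a - T b"
 shows "descend T (red2 c) = red2 (T c)" unfolding descend_def by (rule red2_cong_additive[OF assms]) simp

lemma descend_add:
 assumes "!!a b. T (a - b) = T a - T b"
 shows "descend T (a + b) = descend T a + descend T b"
proof -
 have "descend T (red2 (lift2 a - lift2 b)) = red2 (T (lift2 a - lift2 b))" by (rule descend_red2[OF assms])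
 thus ?thesis by (simp add: assms red2_diff pm_diff descend_def)
qed

subsection \<open>The augmented complex modulo two\<close>

lemma boundary2_alt:
 assumes "finite K" "keys c <= K"
 shows "boundary2 p c = (if p < 0 then 0 else SUM f:K. SUM k<=nat p.
       single (aug_face (nat p) k f) (lookup c f))" unfolding boundary2_def
 by (intro if_cong refl sum.mono_neutral_left) (use assms in \<open>auto simp: in_keys_iff\<close>)

lemma boundary2_add: "boundary2 p (a + b) = boundary2 p a + boundary2 p b"
proof -
 let ?K = "keys a Un keys b"
 have "keys (a + b) <= ?K" by (rule keys_add)
 thus ?thesis by (simp add: boundary2_alt[of ?K] lookup_add single_add sum.distrib)
qed

lemma boundary2_0 [simp]: "boundary2 p 0 = 0" by (simp add: boundary2_def)

lemma boundary2_neg [simp]: "p < 0 ==> boundary2 p c = 0" by (simp add: boundary2_def)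

lemma boundary2_single:
 "p >= 0 ==> boundary2 p (single f 1) = (SUM k<=nat p. single (aug_face (nat p) k f) 1)" by (simp add: boundary2_alt[of "{f}"])

lemma boundary2_red2:
 assumes "p >= 1"
 shows "boundary2 (int p) (red2 c) = red2 (chain_boundary p c)"
proof -
 have "keys c <= UNIV" by simp
 thus ?thesis
 proof (induction c rule: frag_induction)
  case (one f)
  have "red2 (chain_boundary p (frag_of f)) = (SUM k<=p. single (singular_face p k f) 1)" using assms by (simp add: chain_boundary_of red2_sum red2_cmul)
  also have "... = boundary2 (int p) (red2 (frag_of f))" using assms by (simp add: boundary2_single aug_face_def)
  finally show ?case by simp
 next
  case (diff a b)
  thus ?case by (simp add: red2_diff pm_diff boundary2_add chain_boundary_diff)
 qed simp
qed

lemma boundary2_0_eq: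
 assumes "finite K" "keys c <= K"
 shows "boundary2 0 c = single (%_. undefined) (SUM f:K. lookup c f)"
proof -
 have "single u (sum g K) = (SUM f:K. single u (g f))"
  for u :: "(nat => real) => 'a" and g :: "_ => bit" using assms(1) by (induction K rule: finite_induct) (auto simp: single_add)
 thus ?thesis by (simp add: boundary2_alt[OF assms] aug_face_def)
qed

definition chains2 :: "'a::topological_space set => int => 'a chain2 set" where
 "chains2 A p = {c. keys c <= aug_simplices p (top_of_set A)}"

definition cycles2 :: "'a::topological_space set => int => 'a chain2 set" where
 "cycles2 A p = {c:chains2 A p. boundary2 p c = 0}"

definition bounds2 :: "'a::topological_space set => int => 'a chain2 set" where
 "bounds2 A p = boundary2 (p + 1) ` chains2 A (p + 1)"

lemma chains2_0 [simp]: "0 : chains2 A p" by (simp add: chains2_def)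

lemma chains2_add: "a : chains2 A p ==> b : chains2 A p ==> a + b : chains2 A p" using keys_add[of a b] by (auto simp: chains2_def)

lemma chains2_neg: "p < -1 ==> chains2 A p = {0}" by (auto simp: chains2_def aug_simplices_def)

lemma chains2_nat: "chains2 A (int p) = {c. keys c <= singular_simplex_set p (top_of_set A)}" by (simp add: chains2_def aug_simplices_def)

lemma red2_chain: "singular_chain p (top_of_set A) c ==> red2 c : chains2 A (int p)" using keys_red2[of c] by (auto simp: chains2_nat singular_chain_def)

lemma lift2_chain: "c : chains2 A (int p) ==> singular_chain p (top_of_set A) (lift2 c)" by (simp add: chains2_nat singular_chain_def keys_lift2)

lemma aug_simplices_mono: "A <= B ==> aug_simplices p (top_of_set A) <= aug_simplices p (top_of_set B)" using singular_simplex_mono by (auto simp: aug_simplices_def)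

lemma chains2_mono: "A <= B ==> chains2 A p <= chains2 B p" unfolding chains2_def using aug_simplices_mono[of A B p] by blast

lemma chains2_Int: "chains2 A p Int chains2 B p = chains2 (A Int B) p"
proof -
 have "aug_simplices p (top_of_set A) Int aug_simplices p (top_of_set B) = aug_simplices p (top_of_set (A Int B))"
  by (auto simp: aug_simplices_def singular_simplex_subtopology image_subset_iff)
 thus ?thesis unfolding chains2_def by blast
qed

lemma boundary2_chains2:
 assumes "c : chains2 A p" shows "boundary2 p c : chains2 A (p - 1)"
proof -
 consider "p < 0" | "p = 0" | q where "p = int q" "q >= 1" by (metis linorder_not_less nonneg_int_cases not_less_eq_eq One_nat_def less_one of_nat_0)
 thus ?thesis
 proof cases
  case 2
  thus ?thesis using boundary2_0_eq[of "keys c" c] by (auto simp: chains2_def aug_simplices_def)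
 next
  case 3
  have "singular_chain (q - 1) (top_of_set A) (chain_boundary q (lift2 c))"
   using singular_chain_boundary[of q "top_of_set A" "lift2 c"] lift2_chain[of c A q] assms 3 by simp
  hence "red2 (chain_boundary q (lift2 c)) : chains2 A (int (q - 1))" by (rule red2_chain)
  thus ?thesis using boundary2_red2[of q "lift2 c"] 3 by (simp add: of_nat_diff)
 qed auto
qed

lemma boundary2_boundary2:
 assumes c: "c : chains2 A p" shows "boundary2 (p - 1) (boundary2 p c) = 0"
proof -
 consider "p < 1" | "p = 1" | q where "p = int (Suc q)" "q >= 1"
 proof -
  have "p = int (Suc (nat p - 1)) & nat p - 1 >= 1" if "\<not> p < 1" "p ~= 1" using that by auto
  thus thesis using that by blast
 qed
 thus ?thesis
 proof cases
  case 2
  \<comment> \<open>Degree 1 is not covered by the integral complex: the next boundary is the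
    augmentation, under which the two endpoints of a path cancel.\<close>
  have "boundary2 0 (red2 (chain_boundary 1 d)) = 0" for d :: "'a chain"
  proof -
   have "keys d <= UNIV" by simp
   thus ?thesis
   proof (induction d rule: frag_induction)
    case (one f)
    have "red2 (chain_boundary 1 (frag_of f)) =
     single (singular_face 1 0 f) 1 + single (singular_face 1 1 f) 1" by (simp add: chain_boundary_of red2_add red2_minus red2_diff pm_diff)
    thus ?case by (simp add: boundary2_add boundary2_single aug_face_def)
   next
    case (diff a b)
    thus ?case by (simp add: red2_diff pm_diff boundary2_add chain_boundary_diff)
   qed (simp)
  qed
  from this[of "lift2 c"] show ?thesis using 2 boundary2_red2[of 1 "lift2 c"] by simp
 next
  case 3
  have "singular_chain (Suc q) (top_of_set A) (lift2 c)" using lift2_chain c 3 by blast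
  hence "chain_boundary q (chain_boundary (Suc q) (lift2 c)) = 0" by (rule chain_boundary_boundary_alt)
  thus ?thesis using boundary2_red2[of "Suc q" "lift2 c"] boundary2_red2[of q "chain_boundary (Suc q) (lift2 c)"] 3 by simp
 qed (simp)
qed

lemma bounds2_cycles2: "bounds2 A p <= cycles2 A p"
proof
 fix x assume "x : bounds2 A p"
 then obtain c where c: "c : chains2 A (p + 1)" "x = boundary2 (p + 1) c" by (auto simp: bounds2_def)
 thus "x : cycles2 A p" using boundary2_chains2[of c A "p + 1"] boundary2_boundary2[of c A "p + 1"] by (simp add: cycles2_def)
qed

lemma cycles2_0 [simp]: "0 : cycles2 A p" by (simp add: cycles2_def)

lemma bounds2_0 [simp]: "0 : bounds2 A p" unfolding bounds2_def by (rule image_eqI[of _ _ 0]) auto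

lemma cycles2_add: "a : cycles2 A p ==> b : cycles2 A p ==> a + b : cycles2 A p" by (auto simp: cycles2_def chains2_add boundary2_add)

lemma bounds2_add: "a : bounds2 A p ==> b : bounds2 A p ==> a + b : bounds2 A p" unfolding bounds2_def by (auto simp: boundary2_add[symmetric] intro!: imageI chains2_add)

lemma cycles2_mono: "A <= B ==> cycles2 A p <= cycles2 B p" using chains2_mono[of A B p] by (auto simp: cycles2_def)

lemma bounds2_mono: "A <= B ==> bounds2 A p <= bounds2 B p" using chains2_mono[of A B "p + 1"] by (auto simp: bounds2_def)

lemma boundary_in_bounds2: "c : chains2 A (p + 1) ==> boundary2 (p + 1) c : bounds2 A p" by (simp add: bounds2_def)

lemma bounds2E:
 assumes "x : bounds2 A p" obtains c where "c : chains2 A (p + 1)" "boundary2 (p + 1) c = x" using assms by (auto simp: bounds2_def)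

subsection \<open>Induced maps and homotopy invariance\<close>

text \<open>Below degree 0 only the coefficient of the empty simplex is copied; the empty simplices
  of the two spaces are functions of different types.\<close>

definition cmap :: "int => ('b => 'a) => 'b chain2 => 'a chain2" where
 "cmap p f c = (if p < 0 then single (%_. undefined) (lookup c (%_. undefined))
   else descend (chain_map (nat p) f) c)"

lemma cmap_add: "cmap p f (a + b) = cmap p f a + cmap p f b" by (simp add: cmap_def lookup_add single_add descend_add chain_map_diff)

lemma cmap_0 [simp]: "cmap p f 0 = 0" using cmap_add[of p f 0 0] by simp

lemma cmap_red2: "cmap (int p) f (red2 c) = red2 (chain_map p f c)" by (simp add: cmap_def descend_red2 chain_map_diff)

lemma cmap_chains2:
 assumes f: "continuous_on A f" "f ` A <= B" and c: "c : chains2 A p"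
 shows "cmap p f c : chains2 B p"
proof (cases "p < 0")
 case True
 with c show ?thesis by (cases "p = -1") (auto simp: cmap_def chains2_def aug_simplices_def)
next
 case False
 then obtain q where q: "p = int q" by (metis nonneg_int_cases not_less)
 have "continuous_map (top_of_set A) (top_of_set B) f" using f by auto
 hence "singular_chain q (top_of_set B) (chain_map q f (lift2 c))" using singular_chain_chain_map lift2_chain c q by blast
 thus ?thesis using q by (simp add: cmap_def descend_def red2_chain)
qed

lemma cmap_boundary2:
 assumes c: "c : chains2 A p"
 shows "boundary2 p (cmap p f c) = cmap (p - 1) f (boundary2 p c)"
proof -
 consider "p < 0" | "p = 0" | q where "p = int q" "q >= 1" by (metis linorder_not_less nonneg_int_cases not_less_eq_eq One_nat_def less_one of_nat_0)
 thus ?thesis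
 proof cases
  case 2
  have "boundary2 0 (red2 (chain_map 0 f d)) = cmap (-1) f (boundary2 0 (red2 d))" for d
  proof -
   have "keys d <= UNIV" by simp
   thus ?thesis
   proof (induction d rule: frag_induction)
    case (one x)
    thus ?case by (simp add: boundary2_single aug_face_def cmap_def)
   next
    case (diff a b)
    thus ?case by (simp add: chain_map_diff red2_diff pm_diff boundary2_add cmap_add)
   qed simp
  qed
  from this[of "lift2 c"] show ?thesis using 2 cmap_red2[of 0 f "lift2 c"] by simp
 next
  case 3
  have sc: "singular_chain q (top_of_set A) (lift2 c)" using lift2_chain c 3 by blast
  have "boundary2 p (cmap p f c) = boundary2 (int q) (red2 (chain_map q f (lift2 c)))" using 3 cmap_red2[of q f "lift2 c"] by simp
  also have "... = red2 (chain_map (q - 1) f (chain_boundary q (lift2 c)))"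
   using boundary2_red2[of q "chain_map q f (lift2 c)"] 3 chain_boundary_chain_map[OF sc, of f] by simp
  also have "... = cmap (int (q - 1)) f (red2 (chain_boundary q (lift2 c)))" by (simp only: cmap_red2)
  also have "... = cmap (p - 1) f (boundary2 p c)" using boundary2_red2[of q "lift2 c"] 3 by (simp add: of_nat_diff)
  finally show ?thesis .
 qed (simp add: cmap_def)
qed

lemma cmap_compose: "cmap p g (cmap p f c) = cmap p (g \<circ> f) c"
proof (cases "p < 0")
 case False
 have "red2 (chain_map (nat p) g (lift2 (red2 (chain_map (nat p) f (lift2 c)))))
   = red2 (chain_map (nat p) g (chain_map (nat p) f (lift2 c)))" by (rule red2_cong_additive) (auto simp: chain_map_diff)
 thus ?thesis using False by (simp add: cmap_def descend_def chain_map_compose)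
qed (simp add: cmap_def)

lemma cmap_id:
 assumes "c : chains2 A p" shows "cmap p id c = c"
proof (cases "p < 0")
 case True
 hence "keys c <= {%_. undefined}" using assms by (auto simp: chains2_def aug_simplices_def split: if_splits)
 thus ?thesis using True by (intro poly_mapping_eqI) (auto simp: cmap_def lookup_single when_def in_keys_iff)
next
 case False
 then obtain q where q: "p = int q" by (metis nonneg_int_cases not_less)
 hence "chain_map q id (lift2 c) = lift2 c" using lift2_chain[of c A q] assms chain_map_ident by blast
 thus ?thesis using q by (simp add: cmap_def descend_def)
qed

lemma cmap_cycles2:
 assumes "continuous_on A f" "f ` A <= B" "c : cycles2 A p"
 shows "cmap p f c : cycles2 B p" using assms cmap_chains2[OF assms(1,2)] cmap_boundary2[of c A p f] by (simp add: cycles2_def)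

lemma cmap_bounds2:
 assumes "continuous_on A f" "f ` A <= B" "c : bounds2 A p"
 shows "cmap p f c : bounds2 B p"
proof -
 obtain e where e: "e : chains2 A (p + 1)" "boundary2 (p + 1) e = c" using assms(3) bounds2E by blast
 hence "cmap p f c = boundary2 (p + 1) (cmap (p + 1) f e)" using cmap_boundary2[of e A "p + 1" f] by simp
 thus ?thesis using cmap_chains2[OF assms(1,2) e(1)] boundary_in_bounds2 by metis
qed

lemma cmap_homotopic:
 assumes hom: "homotopic_with_canon (%_. True) A B f g" and c: "c : cycles2 A p"
 shows "cmap p f c + cmap p g c : bounds2 B p"
proof (cases "p < 0")
 case False
 then obtain q where q: "p = int q" by (metis nonneg_int_cases not_less)
 obtain H where H: "continuous_map (prod_topology (top_of_set {0..1::real}) (top_of_set A)) (top_of_set B) H"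
  and H0: "!!x. H (0, x) = f x" and H1: "!!x. H (1, x) = g x" using hom unfolding homotopic_with_def by auto
 obtain pr where pr: "!!q a b. pr q (a - b) = pr q a - pr q b"
  "!!q c. singular_chain q (top_of_set A) c ==> singular_chain (Suc q) (top_of_set B) (pr q c)"
  "!!q c. singular_chain q (top_of_set A) c ==> chain_boundary (Suc q) (pr q c) =
    chain_map q (%x. H (1, x)) c - chain_map q (%x. H (0, x)) c - pr (q - 1) (chain_boundary q c)" using chain_homotopic_chain_maps[OF H] by metis
 let ?d = "lift2 c"
 have d: "singular_chain q (top_of_set A) ?d" using c q lift2_chain by (auto simp: cycles2_def)
 have pr0: "pr r 0 = 0" for r using pr(1)[of r 0 0] by simp
 \<comment> \<open>The lift is not a cycle, but its boundary is even and the additive operator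
   \<open>pr\<close> keeps it even, so this error term disappears mod 2.\<close>
 have zero: "red2 (pr (q - 1) (chain_boundary q ?d)) = 0"
 proof (cases "q = 0")
  case True
  thus ?thesis by (simp add: chain_boundary_def pr0)
 next
  case False
  hence "red2 (chain_boundary q ?d) = red2 0" using boundary2_red2[of q ?d] c q by (simp add: cycles2_def)
  from red2_cong_additive[of "pr (q - 1)", OF pr(1) this] show ?thesis by (simp add: pr0)
 qed
 have "boundary2 (p + 1) (red2 (pr q ?d)) = red2 (chain_boundary (Suc q) (pr q ?d))" using boundary2_red2[of "Suc q" "pr q ?d"] q by (simp add: add.commute)
 also have "... = red2 (chain_map q g ?d) + red2 (chain_map q f ?d)" using pr(3)[OF d] zero by (simp add: red2_diff pm_diff H0 H1)
 also have "... = cmap p f c + cmap p g c" using q by (simp add: cmap_def descend_def add.commute)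
 finally show ?thesis using red2_chain[OF pr(2)[OF d]] q boundary_in_bounds2[of "red2 (pr q ?d)" B p] by (simp add: add.commute)
qed (simp add: cmap_def)

subsection \<open>Isomorphic homology groups\<close>

text \<open>An isomorphism of homology groups is given by an additive correspondence between cycles;
  this covers connecting homomorphisms as well as induced maps.\<close>

definition correspondence ::
 "'a::topological_space set => int => 'b::topological_space set => int => ('a chain2 \<times> 'b chain2) set => bool" where
 "correspondence A p B q R \<longleftrightarrow> R <= cycles2 A p \<times> cycles2 B q &
   (ALL x:cycles2 A p. EX y. (x, y) : R) & (ALL y:cycles2 B q. EX x. (x, y) : R) &
   (ALL x y x' y'. (x, y) : R --> (x', y') : R --> (x + x', y + y') : R) &
   (ALL x y. (x, y) : R --> x : bounds2 A p \<longleftrightarrow> y : bounds2 B q)"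

lemma correspondenceD:
 assumes "correspondence A p B q R"
 shows "R <= cycles2 A p \<times> cycles2 B q" "ALL x:cycles2 A p. EX y. (x, y) : R" "ALL y:cycles2 B q. EX x. (x, y) : R"
  "(x, y) : R ==> (x', y') : R ==> (x + x', y + y') : R" "(x, y) : R ==> x : bounds2 A p \<longleftrightarrow> y : bounds2 B q"
 using assms by (auto simp: correspondence_def)

definition hiso :: "'a::topological_space set => int => 'b::topological_space set => int => bool" where
 "hiso A p B q \<longleftrightarrow> (EX R. correspondence A p B q R)"

lemma hisoI:
 assumes "!!x y. (x, y) : R ==> x : cycles2 A p & y : cycles2 B q"
  "!!x. x : cycles2 A p ==> EX y. (x, y) : R" "!!y. y : cycles2 B q ==> EX x. (x, y) : R"
  "!!x y x' y'. (x, y) : R ==> (x', y') : R ==> (x + x', y + y') : R"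
  "!!x y. (x, y) : R ==> x : bounds2 A p \<longleftrightarrow> y : bounds2 B q"
 shows "hiso A p B q" unfolding hiso_def correspondence_def by (rule exI[of _ R]) (use assms in auto)

lemma hiso_refl: "hiso A p A p" by (rule hisoI[of "{(x, x) |x. x : cycles2 A p}"]) (auto simp: cycles2_add)

lemma hiso_sym:
 assumes "hiso A p B q" shows "hiso B q A p"
proof -
 obtain R where R: "correspondence A p B q R" using assms by (auto simp: hiso_def)
 show ?thesis by (rule hisoI[of "R\<inverse>"]) (use R[unfolded correspondence_def] in auto)
qed

lemma hiso_trans:
 assumes "hiso A p B q" "hiso B q C r" shows "hiso A p C r"
proof -
 obtain R S where "correspondence A p B q R" "correspondence B q C r S" using assms by (auto simp: hiso_def)
 note R = correspondenceD[OF this(1)] and S = correspondenceD[OF this(2)]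
 show ?thesis
 proof (rule hisoI[of "R O S"])
  show "x : cycles2 A p & y : cycles2 C r" if "(x, y) : R O S" for x y using that R(1) S(1) by blast
  show "EX y. (x, y) : R O S" if "x : cycles2 A p" for x using that R(1,2) S(2) by blast
  show "EX x. (x, y) : R O S" if "y : cycles2 C r" for y using that R(3) S(1,3) by blast
  show "(x + x', y + y') : R O S" if "(x, y) : R O S" "(x', y') : R O S" for x y x' y' using that R(4) S(4) by blast
  show "x : bounds2 A p \<longleftrightarrow> y : bounds2 C r" if "(x, y) : R O S" for x y using that R(5) S(5) by blast
 qed
qed

lemma hiso_both_zero:
 assumes "cycles2 A p <= bounds2 A p" "cycles2 B q <= bounds2 B q"
 shows "hiso A p B q" by (rule hisoI[of "cycles2 A p \<times> cycles2 B q"]) (use assms in \<open>auto simp: cycles2_add intro: cycles2_0\<close>)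

lemma hiso_zero:
 assumes "hiso A p B q" "cycles2 A p <= bounds2 A p"
 shows "cycles2 B q <= bounds2 B q" using assms unfolding hiso_def correspondence_def by blast

text \<open>A cycle \<open>x\<close> corresponds to every cycle homologous to its image under
  \<open>f\<close>. The inverse up to homotopy yields surjectivity and detects whether
  \<open>x\<close> bounds.\<close>

lemma hiso_homotopy_equivalence:
 assumes f: "continuous_on A f" "f ` A <= B" and g: "continuous_on B g" "g ` B <= A"
  and gf: "homotopic_with_canon (%_. True) A A (g \<circ> f) id"
  and fg: "homotopic_with_canon (%_. True) B B (f \<circ> g) id"
 shows "hiso A p B p"
proof -
 let ?R = "{(x, y). x : cycles2 A p & y : cycles2 B p & cmap p f x + y : bounds2 B p}"
 show ?thesis
 proof (rule hisoI[of ?R])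
 fix x assume x: "x : cycles2 A p"
 thus "EX y. (x, y) : ?R" using cmap_cycles2[OF f x] by (auto intro!: exI[of _ "cmap p f x"])
next
 fix y assume y: "y : cycles2 B p"
 have "cmap p f (cmap p g y) + y : bounds2 B p" using cmap_homotopic[OF fg y] cmap_id[of y B p] y by (simp add: cmap_compose cycles2_def)
 thus "EX x. (x, y) : ?R" using cmap_cycles2[OF g y] y by blast
next
 fix x y x' y'
 assume "(x, y) : ?R"
  "(x', y') : ?R"
 moreover from this have "(cmap p f x + y) + (cmap p f x' + y') : bounds2 B p" by (auto intro: bounds2_add)
 ultimately show "(x + x', y + y') : ?R" by (auto simp: cycles2_add cmap_add algebra_simps)
next
 fix x y
 assume "(x, y) : ?R"
 hence x: "x : cycles2 A p" and y: "y : cycles2 B p" and xy: "cmap p f x + y : bounds2 B p" by auto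
 show "x : bounds2 A p \<longleftrightarrow> y : bounds2 B p"
 proof
  assume "x : bounds2 A p"
  from cmap_bounds2[OF f this] xy have "cmap p f x + (cmap p f x + y) : bounds2 B p" by (rule bounds2_add)
  thus "y : bounds2 B p" by simp
 next
  assume "y : bounds2 B p"
  with xy have "(cmap p f x + y) + y : bounds2 B p" by (rule bounds2_add)
  hence "cmap p f x : bounds2 B p" by (simp add: add.assoc)
  from cmap_bounds2[OF g this] have "cmap p (g \<circ> f) x : bounds2 A p" by (simp add: cmap_compose)
  from bounds2_add[OF this cmap_homotopic[OF gf x]] show "x : bounds2 A p" using cmap_id[of x A p] x by (simp add: cycles2_def)
 qed
qed auto
qed

lemma hiso_inverse:
 assumes "continuous_on A f" "continuous_on B g" "!!x. x : A ==> f x : B & g (f x) = x" "!!y. y : B ==> g y : A & f (g y) = y"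
 shows "hiso A p B p"
proof (rule hiso_homotopy_equivalence[of A f B g])
 show "homotopic_with_canon (%_. True) A A (g \<circ> f) id" "homotopic_with_canon (%_. True) B B (f \<circ> g) id"
  by (rule homotopic_with_eq[of _ _ _ id id]; use assms in \<open>auto intro: homotopic_with_refl[THEN iffD2]\<close>)+
qed (use assms in auto)

subsection \<open>Acyclic sets\<close>

text \<open>All degrees count, including \<open>-1\<close>, so the empty set is not acyclic.\<close>

definition acyclic_set :: "'a::topological_space set => bool" where
 "acyclic_set A \<longleftrightarrow> (ALL p. cycles2 A p <= bounds2 A p)"

lemma acyclic_setD: "acyclic_set A ==> x : cycles2 A p ==> x : bounds2 A p" by (auto simp: acyclic_set_def)

lemma acyclic_set_hiso: "acyclic_set A ==> (!!p. hiso A p B p) ==> acyclic_set B" using hiso_zero unfolding acyclic_set_def by blast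

text \<open>The constant simplex of dimension \<open>q\<close> has \<open>q + 1\<close> equal faces,
  so mod 2 its boundary vanishes for odd \<open>q\<close> and is the constant simplex one dimension
  lower for even positive \<open>q\<close>; the augmentation handles the vertex.\<close>

lemma acyclic_singleton: "acyclic_set {a::'a::topological_space}" unfolding acyclic_set_def
proof (intro allI subsetI)
 fix p c assume c: "c : cycles2 {a} p"
 let ?s = "%q. restrict (%x. a) (standard_simplex q)"
 have top: "topspace (top_of_set {a}) = {a}" by simp
 have sch: "single (?s q) 1 : chains2 {a} (int q)" for q using singular_simplex_singleton[OF top, of q "?s q"] by (simp add: chains2_nat)
 have bd: "boundary2 (int q) (single (?s q) 1) =
   (if q = 0 then single (%_. undefined) 1 else if odd q then 0 else single (?s (q - 1)) 1)" for q
 proof (cases "q = 0")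
  case True
  thus ?thesis by (simp add: boundary2_single aug_face_def)
 next
  case False
  have "singular_chain q (top_of_set {a}) (frag_of (?s q))" using singular_simplex_singleton[OF top] by (simp add: singular_chain_of)
  from chain_boundary_of_singleton[OF top this] show ?thesis using boundary2_red2[of q "frag_of (?s q)"] False by auto
 qed
 show "c : bounds2 {a} p"
 proof (cases "c = 0")
  case False
  hence p: "p >= -1" using c chains2_neg[of p "{a}"] by (force simp: cycles2_def)
  show ?thesis
  proof (cases "p = -1")
   case True
   hence "keys c <= {%_. undefined}" using c by (auto simp: cycles2_def chains2_def aug_simplices_def)
   hence "c = single (%_. undefined) (lookup c (%_. undefined))" by (intro poly_mapping_eqI) (auto simp: lookup_single when_def in_keys_iff)
   hence "c = single (%_. undefined) 1" using False by (cases "lookup c (%_. undefined)") auto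
   thus ?thesis using True sch[of 0] bd[of 0] boundary_in_bounds2[of "single (?s 0) 1" "{a}" "-1"] by simp
  next
   case False
   then obtain q where q: "p = int q" using p by (metis nonneg_int_cases antisym_conv not_less zless_imp_add1_zle add.left_inverse minus_add_cancel linorder_linear zle_diff1_eq diff_0)
   have "keys c <= {?s q}" using c q singular_simplex_singleton[OF top] by (auto simp: cycles2_def chains2_nat)
   hence "c = single (?s q) (lookup c (?s q))" by (intro poly_mapping_eqI) (auto simp: lookup_single when_def in_keys_iff)
   hence cs: "c = single (?s q) 1" using \<open>c ~= 0\<close> by (cases "lookup c (?s q)") auto
   have nz: "single x (1::bit) ~= 0" for x :: "(nat => real) => 'a" by (metis lookup_single_eq lookup_zero zero_neq_one)
   have "odd q" using bd[of q] c cs q nz by (auto simp: cycles2_def split: if_splits)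
   thus ?thesis using bd[of "Suc q"] sch[of "Suc q"] cs q boundary_in_bounds2[of "single (?s (Suc q)) 1" "{a}" p] by (simp add: add.commute)
  qed
 qed simp
qed

lemma acyclic_contractible:
 assumes "contractible A" "A ~= {}" shows "acyclic_set A"
proof -
 obtain a where a: "homotopic_with_canon (%_. True) A A id (%x. a)" using assms(1) by (auto simp: contractible_def)
 hence "(%x. a) ` A <= A" using homotopic_with_imp_subset2 by fast
 hence aA: "a : A" using assms(2) by auto
 have "hiso {a} p A p" for p
 proof (rule hiso_homotopy_equivalence[of "{a}" id A "%x. a"])
  show "homotopic_with_canon (%_. True) A A (id \<circ> (%x. a)) id" using a by (simp add: homotopic_with_symD o_def)
  show "homotopic_with_canon (%_. True) {a} {a} ((%x. a) \<circ> id) id" by (rule homotopic_with_eq[of _ _ _ id id]) (auto intro: homotopic_with_refl[THEN iffD2])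
 qed (use aA in auto)
 thus ?thesis using acyclic_set_hiso acyclic_singleton by blast
qed

subsection \<open>Small chains and Mayer--Vietoris\<close>

lemma boundary2_boundary2_Suc:
 "c : chains2 A (p + 1 + 1) ==> boundary2 (p + 1) (boundary2 (p + 1 + 1) c) = 0" using boundary2_boundary2[of c A "p + 1 + 1"] unfolding add_diff_cancel_right' .

lemma small_chain_exists:
 assumes oA: "openin (top_of_set (A Un B)) A" and oB: "openin (top_of_set (A Un B)) B"
  and c: "c : chains2 (A Un B) p" and xy: "boundary2 p c = x + y"
  and x: "x : chains2 A (p - 1)" and y: "y : chains2 B (p - 1)"
 obtains a b e where "a : chains2 A p" "b : chains2 B p" "e : chains2 (A Un B) (p + 1)"
  "c + boundary2 (p + 1) e = a + b"
proof (cases "p < 0")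
 case True
 hence "c : chains2 A p" using c by (auto simp: chains2_def aug_simplices_def)
 thus ?thesis using that[of c 0 0] by simp
next
 case False
 then obtain q where q: "p = int q" by (metis nonneg_int_cases not_less)
 let ?X = "top_of_set (A Un B)"
 let ?d = "lift2 c"
 have d: "singular_chain q ?X ?d" using lift2_chain c q by blast
 obtain n where n: "!!m f. [|n <= m; f : keys ((singular_subdivision q ^^ m) ?d)|]
             ==> EX V:{A, B}. f : (standard_simplex q) \<rightarrow> V"
  by (rule sufficient_iterated_singular_subdivision_exists[of "{A, B}" ?X q ?d]) (use oA oB d in auto)
 obtain h where h0: "!!p. h p 0 = (0 :: 'a chain)"
  and hd: "!!p c1 c2. h p (c1 - c2) = h p c1 - h p c2"
  and hc: "!!p X c. singular_chain p X c ==> singular_chain (Suc p) X (h p c)"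
  and hb: "!!p X c. singular_chain p X c
         ==> chain_boundary (Suc p) (h p c) + h (p - Suc 0) (chain_boundary p c)
          = (singular_subdivision p ^^ n) c - c" by (rule chain_homotopic_iterated_singular_subdivision[of n]) blast
 let ?S = "(singular_subdivision q ^^ n) ?d"
 have Sch: "singular_chain q ?X ((singular_subdivision q ^^ m) ?d)" for m by (induction m) (auto simp: singular_chain_singular_subdivision d)
 have "keys ?S <= singular_simplex_set q (top_of_set A) Un singular_simplex_set q (top_of_set B)"
 proof
  fix f assume f: "f : keys ?S"
  hence "singular_simplex q ?X f" using Sch[of n] by (auto simp: singular_chain_def)
  moreover have "EX V:{A, B}. f : (standard_simplex q) \<rightarrow> V" using n f by blast
  ultimately show "f : singular_simplex_set q (top_of_set A) Un singular_simplex_set q (top_of_set B)" by (auto simp: singular_simplex_subtopology)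
 qed
 then obtain a0 b0 where a0: "keys a0 <= singular_simplex_set q (top_of_set A)"
  and b0: "keys b0 <= singular_simplex_set q (top_of_set B)" and ab0: "a0 + b0 = ?S" using frag_split by metis
 have a0': "red2 a0 : chains2 A p" and b0': "red2 b0 : chains2 B p" using a0 b0 q red2_chain unfolding singular_chain_def by blast+
 obtain a1 b1 where a1: "a1 : chains2 A p" and b1: "b1 : chains2 B p"
  and ab1: "red2 (h (q - Suc 0) (chain_boundary q ?d)) = a1 + b1"
 proof (cases "q = 0")
  case True
  thus ?thesis using that[of 0 0] by (simp add: chain_boundary_def h0)
 next
  case False
  have "red2 (chain_boundary q ?d) = red2 (lift2 x - lift2 y)" using boundary2_red2[of q ?d] False q xy by (simp add: red2_diff pm_diff)
  from red2_cong_additive[of "h (q - Suc 0)", OF hd this]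
  have "red2 (h (q - Suc 0) (chain_boundary q ?d)) = red2 (h (q - Suc 0) (lift2 x)) + red2 (h (q - Suc 0) (lift2 y))" by (simp add: hd red2_diff pm_diff)
  moreover have "red2 (h (q - Suc 0) (lift2 z)) : chains2 E p" if "z : chains2 E (p - 1)" for z E
  proof -
   have "z : chains2 E (int (q - Suc 0))" using that q False by (simp add: of_nat_diff)
   hence "singular_chain (Suc (q - Suc 0)) (top_of_set E) (h (q - Suc 0) (lift2 z))" using hc lift2_chain by blast
   thus ?thesis using red2_chain[of q E] q False by simp
  qed
  ultimately show ?thesis using that x y by metis
 qed
 have "red2 (chain_boundary (Suc q) (h q ?d) + h (q - Suc 0) (chain_boundary q ?d)) = red2 ?S + c" unfolding hb[OF d] by (simp add: red2_diff pm_diff)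
 hence "red2 (chain_boundary (Suc q) (h q ?d)) + (a1 + b1) = (red2 a0 + red2 b0) + c" unfolding red2_add ab1 ab0[symmetric] .
 moreover have "boundary2 (p + 1) (red2 (h q ?d)) = red2 (chain_boundary (Suc q) (h q ?d))" using boundary2_red2[of "Suc q" "h q ?d"] q by (simp add: add.commute)
 moreover have "c + u = (r + a1) + (t + b1)" if "u + (a1 + b1) = (r + t) + c" for u r t :: "'a chain2"
 proof -
  have "u = (r + t) + c + (a1 + b1)" using that by (metis add.assoc add.right_neutral pm_double)
  thus ?thesis by (simp add: ac_simps)
 qed
 ultimately have "c + boundary2 (p + 1) (red2 (h q ?d)) = (red2 a0 + a1) + (red2 b0 + b1)" by simp
 moreover have "red2 (h q ?d) : chains2 (A Un B) (p + 1)" using red2_chain[OF hc[OF d]] q by (simp add: add.commute)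
 ultimately show ?thesis using that a0' a1 b0' b1 chains2_add by metis
qed

text \<open>Exactness at the intersection: a filling of \<open>a + b\<close> is split into
  \<open>eA + eB\<close>. Then \<open>a\<close> plus the boundary of \<open>eA\<close> equals
  \<open>b\<close> plus the boundary of \<open>eB\<close>, so it lies in both sets and still fills
  \<open>z\<close>.\<close>

lemma Mayer_Vietoris_inter:
 assumes oA: "openin (top_of_set (A Un B)) A" and oB: "openin (top_of_set (A Un B)) B"
  and a: "a : chains2 A (p + 1)" and b: "b : chains2 B (p + 1)"
  and za: "boundary2 (p + 1) a = z" and zb: "boundary2 (p + 1) b = z"
  and ab: "a + b : bounds2 (A Un B) (p + 1)"
 shows "z : bounds2 (A Int B) p"
proof -
 obtain e where e: "e : chains2 (A Un B) (p + 1 + 1)" and be: "boundary2 (p + 1 + 1) e = a + b" using ab bounds2E by blast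
 have a': "a : chains2 A (p + 1 + 1 - 1)" and b': "b : chains2 B (p + 1 + 1 - 1)" unfolding add_diff_cancel_right' by fact+
 obtain eA eB g where eA: "eA : chains2 A (p + 1 + 1)" and eB: "eB : chains2 B (p + 1 + 1)"
  and g: "g : chains2 (A Un B) (p + 1 + 1 + 1)" and eg: "e + boundary2 (p + 1 + 1 + 1) g = eA + eB" using small_chain_exists[OF oA oB e be a' b'] by metis
 have "boundary2 (p + 1 + 1) (eA + eB) = a + b" using be boundary2_boundary2_Suc[OF g] unfolding eg[symmetric] boundary2_add by simp
 hence eq: "a + boundary2 (p + 1 + 1) eA = b + boundary2 (p + 1 + 1) eB" unfolding boundary2_add by (metis add.commute add.left_commute pm_double_left)
 let ?w = "a + boundary2 (p + 1 + 1) eA"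
 have "?w : chains2 A (p + 1)" "b + boundary2 (p + 1 + 1) eB : chains2 B (p + 1)"
  using boundary2_chains2[OF eA, unfolded add_diff_cancel_right'] boundary2_chains2[OF eB, unfolded add_diff_cancel_right'] a b by (auto intro: chains2_add)
 hence "?w : chains2 (A Int B) (p + 1)" using eq chains2_Int by (metis IntI)
 moreover have "boundary2 (p + 1) ?w = z" using boundary2_boundary2_Suc[OF eA] za unfolding boundary2_add by simp
 ultimately show ?thesis using boundary_in_bounds2 by metis
qed

lemma Mayer_Vietoris_split:
 assumes oA: "openin (top_of_set (A Un B)) A" and oB: "openin (top_of_set (A Un B)) B"
  and w: "w : cycles2 (A Un B) (p + 1)"
 obtains a b where "a : chains2 A (p + 1)" "b : chains2 B (p + 1)"
  "boundary2 (p + 1) a = boundary2 (p + 1) b" "boundary2 (p + 1) a : cycles2 (A Int B) p"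
  "a + b + w : bounds2 (A Un B) (p + 1)"
proof -
 have "w : chains2 (A Un B) (p + 1)" "boundary2 (p + 1) w = 0 + 0" using w by (auto simp: cycles2_def)
 from small_chain_exists[OF oA oB this] obtain a b e where a: "a : chains2 A (p + 1)" and b: "b : chains2 B (p + 1)"
  and e: "e : chains2 (A Un B) (p + 1 + 1)" and abe: "w + boundary2 (p + 1 + 1) e = a + b" by auto
 have "boundary2 (p + 1) (a + b) = 0" using boundary2_boundary2_Suc[OF e] w unfolding abe[symmetric] boundary2_add cycles2_def by simp
 hence eq: "boundary2 (p + 1) a = boundary2 (p + 1) b" by (simp add: boundary2_add pm_add_eq_0_iff)
 hence "boundary2 (p + 1) a : chains2 (A Int B) p" using boundary2_chains2[OF a] boundary2_chains2[OF b] chains2_Int by (metis IntI add_diff_cancel_right')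
 hence "boundary2 (p + 1) a : cycles2 (A Int B) p" using boundary2_boundary2[OF a] by (simp add: cycles2_def)
 moreover have "a + b + w : bounds2 (A Un B) (p + 1)" using abe boundary_in_bounds2[OF e] by (metis add.commute pm_double_left)
 ultimately show ?thesis using that a b eq by blast
qed

text \<open>\<open>L z w\<close> says that \<open>w\<close> is homologous to the sum of two fillings
  of \<open>z\<close>, one on each side: the inverse of the connecting homomorphism, written as a
  relation. Acyclicity of the sides provides the fillings and makes them unique up to
  boundaries.\<close>

lemma hiso_suspension:
 assumes oA: "openin (top_of_set (A Un B)) A" and oB: "openin (top_of_set (A Un B)) B"
  and A: "acyclic_set A" and B: "acyclic_set B"
 shows "hiso (A Int B) p (A Un B) (p + 1)"
proof -
 let ?U = "A Un B" and ?q = "p + 1"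
 define L where "L z w \<longleftrightarrow> z : cycles2 (A Int B) p & w : cycles2 ?U ?q &
  (EX a b. a : chains2 A ?q & b : chains2 B ?q & boundary2 ?q a = z &
   boundary2 ?q b = z & a + b + w : bounds2 ?U ?q)" for z w
 show ?thesis
 proof (rule hisoI[of "{(z, w). L z w}"], unfold mem_Collect_eq case_prod_conv, goal_cases)
  case (1 x y)
  thus ?case by (simp add: L_def)
next
 case (2 z)
 hence "z : cycles2 A p" "z : cycles2 B p" using cycles2_mono[of "A Int B"] by blast+
 then obtain a b where ab: "a : chains2 A ?q" "boundary2 ?q a = z"
   "b : chains2 B ?q" "boundary2 ?q b = z" using acyclic_setD[OF A] acyclic_setD[OF B] by (metis bounds2E)
 hence "a + b : cycles2 ?U ?q" using chains2_mono[of A ?U] chains2_mono[of B ?U] by (auto simp: cycles2_def boundary2_add intro!: chains2_add)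
 moreover have "a + b + (a + b) : bounds2 ?U ?q" by simp
 ultimately show ?case using 2 ab unfolding L_def by blast
next
 case (3 w)
 from Mayer_Vietoris_split[OF oA oB 3] obtain a b where "a : chains2 A ?q" "b : chains2 B ?q"
  "boundary2 ?q a = boundary2 ?q b" "boundary2 ?q a : cycles2 (A Int B) p"
  "a + b + w : bounds2 ?U ?q" by metis
 thus ?case using 3 unfolding L_def by metis
next
 case (4 x y x' y')
 from 4(1)[unfolded L_def] obtain a b where ab: "a : chains2 A ?q" "b : chains2 B ?q" "boundary2 ?q a = x"
   "boundary2 ?q b = x" "a + b + y : bounds2 ?U ?q"
   and xy: "x : cycles2 (A Int B) p" "y : cycles2 ?U ?q" by blast
 from 4(2)[unfolded L_def] obtain a' b' where ab': "a' : chains2 A ?q" "b' : chains2 B ?q" "boundary2 ?q a' = x'"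
   "boundary2 ?q b' = x'" "a' + b' + y' : bounds2 ?U ?q"
   and xy': "x' : cycles2 (A Int B) p" "y' : cycles2 ?U ?q" by blast
 have "(a + a') + (b + b') + (y + y') : bounds2 ?U ?q" using bounds2_add[OF ab(5) ab'(5)] by (simp add: algebra_simps)
 moreover have "boundary2 ?q (a + a') = x + x'" "boundary2 ?q (b + b') = x + x'" using ab ab' by (simp_all add: boundary2_add)
 moreover have "a + a' : chains2 A ?q" "b + b' : chains2 B ?q" using ab ab' chains2_add by blast+
 moreover have "x + x' : cycles2 (A Int B) p" "y + y' : cycles2 ?U ?q" using xy xy' cycles2_add by blast+
 ultimately show ?case unfolding L_def by blast
next
 case (5 z w)
 from 5[unfolded L_def] obtain a b where ab: "a : chains2 A ?q" "b : chains2 B ?q" "boundary2 ?q a = z"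
   "boundary2 ?q b = z" "a + b + w : bounds2 ?U ?q" by blast
 show ?case
 proof
  assume "z : bounds2 (A Int B) p"
  then obtain c where c: "c : chains2 (A Int B) ?q" "boundary2 ?q c = z" by (metis bounds2E)
  hence "c : chains2 A ?q" "c : chains2 B ?q" using chains2_Int by blast+
  hence "a + c : cycles2 A ?q" "b + c : cycles2 B ?q" using ab c by (auto simp: cycles2_def boundary2_add chains2_add)
  hence "a + c : bounds2 ?U ?q" "b + c : bounds2 ?U ?q" using acyclic_setD[OF A] acyclic_setD[OF B] bounds2_mono[of A ?U] bounds2_mono[of B ?U] by blast+
  hence "(a + c) + (b + c) + (a + b + w) : bounds2 ?U ?q" using bounds2_add ab(5) by blast
  moreover have "(a + c) + (b + c) + (a + b + w) = w" by (simp add: ac_simps)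
  ultimately show "w : bounds2 ?U ?q" by simp
 next
  assume "w : bounds2 ?U ?q"
  hence "(a + b + w) + w : bounds2 ?U ?q" using ab(5) bounds2_add by blast
  hence "a + b : bounds2 ?U ?q" by (simp add: add.assoc)
  thus "z : bounds2 (A Int B) p" using Mayer_Vietoris_inter[OF oA oB] ab by blast
 qed
qed
qed

text \<open>The Mayer--Vietoris sequence with two acyclic terms. In the application \<open>B\<close>
  is a neighbourhood of the critical point and the union a thickened sublevel set.\<close>

lemma hiso_excision:
 assumes oA: "openin (top_of_set (A Un B)) A" and oB: "openin (top_of_set (A Un B)) B"
  and AB: "acyclic_set (A Un B)" and B: "acyclic_set B"
 shows "hiso (A Int B) p A p"
proof (rule hisoI[of "{(z, w). z : cycles2 (A Int B) p & w : cycles2 A p & z + w : bounds2 A p}"], goal_cases)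
 case (1 x y)
 thus ?case by auto
next
 case (2 z)
 thus ?case using cycles2_mono[of "A Int B" A p] by (auto intro!: exI[of _ z])
next
 case (3 w)
 hence "w : cycles2 (A Un B) p" using cycles2_mono[of A "A Un B"] by blast
 then obtain e where e: "e : chains2 (A Un B) (p + 1)" "boundary2 (p + 1) e = w" using acyclic_setD[OF AB] by (metis bounds2E)
 have w: "w : chains2 A (p + 1 - 1)" using 3 by (simp add: cycles2_def)
 have "boundary2 (p + 1) e = w + 0" using e by simp
 from small_chain_exists[OF oA oB e(1) this w chains2_0] obtain a b g where
  a: "a : chains2 A (p + 1)" and b: "b : chains2 B (p + 1)" and g: "g : chains2 (A Un B) (p + 1 + 1)"
  and eg: "e + boundary2 (p + 1 + 1) g = a + b" by metis
 have "boundary2 (p + 1) (a + b) = w" using e boundary2_boundary2_Suc[OF g] unfolding eg[symmetric] boundary2_add by simp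
 hence eq: "boundary2 (p + 1) b = boundary2 (p + 1) a + w" unfolding boundary2_add by (metis pm_double_left)
 have ca: "boundary2 (p + 1) a + w : cycles2 A p" using bounds2_cycles2[of A p] boundary_in_bounds2[OF a] 3 cycles2_add by blast
 have "boundary2 (p + 1) b : cycles2 B p" using bounds2_cycles2[of B p] boundary_in_bounds2[OF b] by blast
 hence "boundary2 (p + 1) b : cycles2 (A Int B) p" using ca eq chains2_Int by (auto simp: cycles2_def)
 moreover have "boundary2 (p + 1) b + w : bounds2 A p" using boundary_in_bounds2[OF a] by (simp add: eq add.assoc)
 ultimately show ?case using 3 by blast
next
 case (4 x y x' y')
 moreover from this have "(x + y) + (x' + y') : bounds2 A p" by (auto intro: bounds2_add)
 ultimately show ?case by (auto simp: cycles2_add algebra_simps)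
next
 case (5 z w)
 hence z: "z : cycles2 (A Int B) p" and zw: "z + w : bounds2 A p" by auto
 show ?case
 proof
  assume "z : bounds2 (A Int B) p"
  hence "z + (z + w) : bounds2 A p" using bounds2_mono[of "A Int B" A p] zw bounds2_add by blast
  thus "w : bounds2 A p" by simp
 next
  assume "w : bounds2 A p"
  hence "(z + w) + w : bounds2 A p" using zw bounds2_add by blast
  hence "z : bounds2 A p" by (simp add: add.assoc)
  then obtain a where a: "a : chains2 A (p + 1)" "boundary2 (p + 1) a = z" by (metis bounds2E)
  have "z : cycles2 B p" using z cycles2_mono[of "A Int B" B p] by blast
  then obtain b where b: "b : chains2 B (p + 1)" "boundary2 (p + 1) b = z" using acyclic_setD[OF B] by (metis bounds2E)
  have "a + b : cycles2 (A Un B) (p + 1)" using chains2_mono[of A "A Un B"] chains2_mono[of B "A Un B"] a b by (auto simp: cycles2_def boundary2_add intro!: chains2_add)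
  hence "a + b : bounds2 (A Un B) (p + 1)" by (rule acyclic_setD[OF AB])
  thus "z : bounds2 (A Int B) p" using Mayer_Vietoris_inter[OF oA oB] a b by blast
 qed
qed

subsection \<open>Dimension over \<open>\<int>\<^sub>2\<close>\<close>

text \<open>A vector space over Z2 is in bijection with the finite subsets of a basis, so its
  cardinality alone determines the dimension and no exchange argument is required. Finite sets are
  compared through their power sets; an infinite set is equinumerous with its finite
  subsets.\<close>

lemma card_of_Fpow_cancel:
 fixes B :: "'a set" and C :: "'b set"
 assumes "ordIso2 (card_of (Fpow B)) (card_of (Fpow C))"
 shows "ordIso2 (card_of B) (card_of C)"
proof -
 have fin: "finite (Fpow X) \<longleftrightarrow> finite X" for X :: "'x set" by (metis Fpow_subset_Pow eqpoll_Fpow eqpoll_finite_iff finite_Pow_iff rev_finite_subset)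
 have iff: "finite B \<longleftrightarrow> finite C" using card_of_ordIso_finite[OF assms] by (simp add: fin)
 show ?thesis
 proof (cases "finite B")
  case True
  have Pow: "Fpow X = Pow X" if "finite X" for X :: "'x set" using that by (auto simp: Fpow_def finite_subset)
  obtain f where "bij_betw f (Pow B) (Pow C)" using assms iff True Pow card_of_ordIso by metis
  hence "card B = card C" using True iff bij_betw_same_card by (fastforce simp: card_Pow)
  thus ?thesis using True iff card_of_ordIso finite_same_card_bij by blast
 next
  case False
  thus ?thesis using iff card_of_Fpow_infinite[of B] card_of_Fpow_infinite[of C] assms by (meson ordIso_symmetric ordIso_transitive)
 qed
qed

lemma Z2_basis_card:
 assumes "comm_group G" and B: "is_Z2_basis G B"
 shows "ordIso2 (card_of (Fpow B)) (card_of (carrier G))"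
proof -
 interpret comm_group G by fact
 have BG: "B <= carrier G" and ex: "!!x. x : carrier G ==> EX! T. T <= B & finite T & finprod G (%b. b) T = x" using B by (auto simp: is_Z2_basis_def)
 have closed: "finprod G (%b. b) T : carrier G" if "T : Fpow B" for T using that BG by (intro finprod_closed) (auto simp: Fpow_def)
 have "bij_betw (finprod G (%b. b)) (Fpow B) (carrier G)"
 proof (rule bij_betw_imageI[OF inj_onI])
  fix S T assume "S : Fpow B" "T : Fpow B" "finprod G (%b. b) S = finprod G (%b. b) T"
  thus "S = T" using ex[OF closed[of S]] unfolding Fpow_def by auto
 next
  show "finprod G (%b. b) ` Fpow B = carrier G" using closed ex unfolding Fpow_def by (auto, blast)
 qed
 thus ?thesis using card_of_ordIso by blast
qed

lemma is_Z2_basis_iso: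
 assumes "comm_group G" "comm_group H" and F: "F : iso G H" and B: "is_Z2_basis G B"
 shows "is_Z2_basis H (F ` B)"
proof -
 interpret G: comm_group G by fact
 interpret H: comm_group H by fact
 have hom: "F : hom G H" and im: "F ` carrier G = carrier H" and inj: "inj_on F (carrier G)" using F by (auto simp: iso_iff)
 have BG: "B <= carrier G" and ex: "!!x. x : carrier G ==> EX! T. T <= B & finite T & finprod G (%b. b) T = x" using B by (auto simp: is_Z2_basis_def)
 have prod: "finprod H (%b. b) (F ` T) = F (finprod G (%b. b) T)" if "finite T" "T <= carrier G" for T using that
 proof (induction T rule: finite_induct)
  case empty
  thus ?case using hom_one[OF hom] by (simp add: G.is_group H.is_group)
 next
  case (insert x T)
  have "F x ~: F ` T" using inj insert by (auto dest: inj_onD)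
  moreover have "F ` T <= carrier H" using insert.prems im by blast
  moreover have "F x : carrier H" using insert.prems im by blast
  ultimately show ?case using insert im hom_mult[OF hom, of x "finprod G (%b. b) T"] by (simp add: Pi_iff subset_iff)
 qed
 show ?thesis unfolding is_Z2_basis_def
 proof (intro conjI ballI)
  show "F ` B <= carrier H" using BG im by blast
  fix y assume "y : carrier H"
  then obtain x where x: "x : carrier G" "y = F x" using im by blast
  from ex[OF x(1)] obtain T where T: "T <= B & finite T & finprod G (%b. b) T = x"
   and u: "ALL S. S <= B & finite S & finprod G (%b. b) S = x --> S = T" by (rule ex1E)
  show "EX! S. S <= F ` B & finite S & finprod H (%b. b) S = y"
  proof (rule ex1I[of _ "F ` T"])
   show "F ` T <= F ` B & finite (F ` T) & finprod H (%b. b) (F ` T) = y" using T x(2) prod[of T] subset_trans[OF _ BG, of T] by (simp add: image_mono)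
   fix S assume S: "S <= F ` B & finite S & finprod H (%b. b) S = y"
   then obtain T' where T': "T' <= B" "finite T'" "S = F ` T'" by (metis finite_subset_image)
   have G: "T' <= carrier G" using T'(1) BG by (rule subset_trans)
   hence "finprod G (%b. b) T' : carrier G" by (intro G.finprod_closed) auto
   moreover have "F (finprod G (%b. b) T') = F x" using S T'(3) prod[OF T'(2) G] x(2) by simp
   ultimately have "finprod G (%b. b) T' = x" using x(1) by (intro inj_onD[OF inj])
   thus "S = F ` T" using u T' by simp
  qed
 qed
qed

text \<open>If there is no basis, both choices are made from the same empty predicate.\<close>

lemma Z2_dim_iso:
 fixes G H :: "'g monoid"
 assumes GH: "comm_group G" "comm_group H" and F: "F : iso G H"
 shows "ordIso2 (Z2_dim G) (Z2_dim H)"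
proof (cases "EX B. is_Z2_basis G B")
 case True
 hence "EX B. is_Z2_basis H B" using is_Z2_basis_iso[OF GH F] by blast
 hence b: "is_Z2_basis G (SOME B. is_Z2_basis G B)" "is_Z2_basis H (SOME B. is_Z2_basis H B)" using True by (auto intro: someI_ex)
 have "ordIso2 (card_of (carrier G)) (card_of (carrier H))" using F card_of_ordIso unfolding iso_def by blast
 from ordIso_transitive[OF Z2_basis_card[OF GH(1) b(1)] ordIso_transitive[OF this ordIso_symmetric[OF Z2_basis_card[OF GH(2) b(2)]]]]
 show ?thesis unfolding Z2_dim_def by (rule card_of_Fpow_cancel)
next
 case False
 have "inv_into (carrier G) F : iso H G" by (rule group.iso_set_sym[OF comm_group.axioms(2)[OF GH(1)] F])
 hence "\<not> is_Z2_basis H B" for B using is_Z2_basis_iso[OF GH(2,1)] False by blast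
 hence "is_Z2_basis G = is_Z2_basis H" using False by (intro ext) blast
 thus ?thesis by (simp add: Z2_dim_def card_of_refl)
qed

definition cycle_group2 :: "int => 'a topology => 'a chain2 monoid" where
 "cycle_group2 p X = (chain2_group p X)\<lparr>carrier := {c:carrier (chain2_group p X). boundary2 p c = 0}\<rparr>"

lemma carrier_cycle_group2: "carrier (cycle_group2 p (top_of_set A)) = cycles2 A p" by (auto simp: cycle_group2_def chain2_group_def cycles2_def chains2_def)

lemma mult_cycle_group2: "x \<otimes>\<^bsub>cycle_group2 p X\<^esub> y = x + y"
 and one_cycle_group2: "\<one>\<^bsub>cycle_group2 p X\<^esub> = 0" by (auto simp: cycle_group2_def chain2_group_def)

lemma reduced_homology2_eq:
 "reduced_homology2 p (top_of_set A) = cycle_group2 p (top_of_set A) Mod bounds2 A p"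
 by (simp add: reduced_homology2_def cycle_group2_def bounds2_def chains2_def chain2_group_def)

lemma comm_group_cycle_group2: "comm_group (cycle_group2 p (top_of_set A))" by (rule comm_groupI)
   (auto simp: carrier_cycle_group2 mult_cycle_group2 one_cycle_group2 cycles2_add ac_simps, metis pm_double)

lemma subgroup_bounds2: "subgroup (bounds2 A p) (cycle_group2 p (top_of_set A))"
proof -
 interpret comm_group "cycle_group2 p (top_of_set A)" by (rule comm_group_cycle_group2)
 have "inv\<^bsub>cycle_group2 p (top_of_set A)\<^esub> x = x" if "x : cycles2 A p" for x
  by (rule inv_equality) (use that in \<open>auto simp: carrier_cycle_group2 mult_cycle_group2 one_cycle_group2\<close>)
 thus ?thesis using bounds2_cycles2[of A p] by (intro subgroupI) (auto simp: carrier_cycle_group2 mult_cycle_group2 bounds2_add subset_iff intro: bounds2_0)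
qed

definition hclass :: "'a::topological_space set => int => 'a chain2 => 'a chain2 set" where
 "hclass A p z = {h + z |h. h : bounds2 A p}"

lemma carrier_reduced_homology2: "carrier (reduced_homology2 p (top_of_set A)) = hclass A p ` cycles2 A p"
 by (auto simp: reduced_homology2_eq FactGroup_def RCOSETS_def r_coset_def carrier_cycle_group2 mult_cycle_group2 hclass_def)

lemma hclass_eq_iff: "hclass A p x = hclass A p y \<longleftrightarrow> x + y : bounds2 A p"
proof
 assume eq: "hclass A p x = hclass A p y"
 have "0 + x : hclass A p x" unfolding hclass_def using bounds2_0 by blast
 hence "x : hclass A p y" using eq by simp
 then obtain h where "h : bounds2 A p" "x = h + y" by (auto simp: hclass_def)
 thus "x + y : bounds2 A p" by (simp add: add.assoc)
next
 have sub: "hclass A p x <= hclass A p y" if "x + y : bounds2 A p" for x y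
 proof
  fix c assume "c : hclass A p x"
  then obtain h where "h : bounds2 A p" "c = h + x" by (auto simp: hclass_def)
  hence "c = (h + (x + y)) + y" "h + (x + y) : bounds2 A p" using that bounds2_add by (auto simp: add.assoc)
  thus "c : hclass A p y" unfolding hclass_def by blast
 qed
 assume "x + y : bounds2 A p"
 thus "hclass A p x = hclass A p y" using sub[of x y] sub[of y x] by (simp add: add.commute)
qed

lemma comm_group_reduced_homology2: "comm_group (reduced_homology2 p (top_of_set A))"
 unfolding reduced_homology2_eq by (rule comm_group.abelian_FactGroup[OF comm_group_cycle_group2 subgroup_bounds2])

lemma mult_reduced_homology2:
 assumes "x : cycles2 A p" "y : cycles2 A p"
 shows "hclass A p x \<otimes>\<^bsub>reduced_homology2 p (top_of_set A)\<^esub> hclass A p y = hclass A p (x + y)"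
proof -
 let ?G = "cycle_group2 p (top_of_set A)"
 have *: "hclass A p z = bounds2 A p #>\<^bsub>?G\<^esub> z" for z by (auto simp: hclass_def r_coset_def mult_cycle_group2)
 have "normal (bounds2 A p) ?G" using comm_group.normal_iff_subgroup[OF comm_group_cycle_group2] subgroup_bounds2 by blast
 from normal.rcos_sum[OF this, of x y] assms show ?thesis by (simp add: * reduced_homology2_eq FactGroup_def carrier_cycle_group2 mult_cycle_group2)
qed

lemma hiso_iso:
 assumes "hiso A p B q"
 obtains F where "F : iso (reduced_homology2 p (top_of_set A)) (reduced_homology2 q (top_of_set B))"
proof -
 obtain R where "correspondence A p B q R" using assms by (auto simp: hiso_def)
 note R = correspondenceD[OF this]
 have key: "hclass A p x = hclass A p x' \<longleftrightarrow> hclass B q y = hclass B q y'" if "(x, y) : R" "(x', y') : R" for x y x' y'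
  using that R(4,5) by (auto simp: hclass_eq_iff)
 define F where "F c = hclass B q (SOME y. EX x. (x, y) : R & hclass A p x = c)" for c
 have F: "F (hclass A p x) = hclass B q y" if "(x, y) : R" for x y
 proof -
  let ?y = "SOME y. EX x'. (x', y) : R & hclass A p x' = hclass A p x"
  have "EX x'. (x', ?y) : R & hclass A p x' = hclass A p x" by (rule someI[of _ y]) (use that in blast)
  thus ?thesis using key that unfolding F_def by blast
 qed
 let ?G = "reduced_homology2 p (top_of_set A)" and ?H = "reduced_homology2 q (top_of_set B)"
 have rep: "EX x y. (x, y) : R & x : cycles2 A p & y : cycles2 B q & c = hclass A p x & F c = hclass B q y" if c: "c : carrier ?G" for c
 proof -
  obtain x where x: "x : cycles2 A p" "c = hclass A p x" using c by (auto simp: carrier_reduced_homology2)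
  then obtain y where "(x, y) : R" using R(2) by blast
  thus ?thesis using x F R(1) by blast
 qed
 show thesis
 proof (rule that[of F], unfold iso_iff, intro conjI homI inj_onI)
  fix c d assume c: "c : carrier ?G" "d : carrier ?G"
  obtain x y where x: "(x, y) : R" "x : cycles2 A p" "y : cycles2 B q" "c = hclass A p x" "F c = hclass B q y" using rep[OF c(1)] by blast
  obtain x' y' where x': "(x', y') : R" "x' : cycles2 A p" "y' : cycles2 B q" "d = hclass A p x'" "F d = hclass B q y'" using rep[OF c(2)] by blast
  show "F (c \<otimes>\<^bsub>?G\<^esub> d) = F c \<otimes>\<^bsub>?H\<^esub> F d" using F[OF R(4)[OF x(1) x'(1)]] x(2-) x'(2-) by (simp add: mult_reduced_homology2)
  show "c = d" if "F c = F d" using that key[OF x(1) x'(1)] x(4,5) x'(4,5) by simp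
 next
  show "F c : carrier ?H" if "c : carrier ?G" for c using rep[OF that] by (auto simp: carrier_reduced_homology2)
  hence "F ` carrier ?G <= carrier ?H" by blast
  moreover have "carrier ?H <= F ` carrier ?G"
  proof
   fix d assume "d : carrier ?H"
   then obtain y where y: "y : cycles2 B q" "d = hclass B q y" by (auto simp: carrier_reduced_homology2)
   then obtain x where x: "(x, y) : R" using R(3) by blast
   hence "d = F (hclass A p x)" "x : cycles2 A p" using F R(1) y by auto
   thus "d : F ` carrier ?G" by (auto simp: carrier_reduced_homology2)
  qed
  ultimately show "F ` carrier ?G = carrier ?H" by blast
 qed
qed

lemma hiso_Z2_dim:
 fixes A B :: "'a::topological_space set"
 assumes "hiso A p B q"
 shows "ordIso2 (Z2_dim (reduced_homology2 p (top_of_set A))) (Z2_dim (reduced_homology2 q (top_of_set B)))"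
 using hiso_iso[OF assms] Z2_dim_iso[OF comm_group_reduced_homology2 comm_group_reduced_homology2] by metis

section \<open>Sublevel sets of pushable functions\<close>

lemma homotopic_withI_canon:
 fixes H :: "real => 'a::topological_space => 'b::topological_space"
 assumes "continuous_on ({0..1} \<times> A) (%z. H (fst z) (snd z))"
  and "!!s x. 0 <= s ==> s <= 1 ==> x : A ==> H s x : B"
  and "!!x. x : A ==> H 0 x = f x" "!!x. x : A ==> H 1 x = g x"
 shows "homotopic_with_canon (%_. True) A B f g" by (subst homotopic_with, simp, rule exI[of _ "%z. H (fst z) (snd z)"]) (use assms in auto)

lemma continuous_on_slice:
 assumes "continuous_on ({0..1::real} \<times> A) (%z. H (fst z) (snd z))" "0 <= s" "s <= 1"
 shows "continuous_on A (H s)"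
proof -
 have "continuous_on A ((%z. H (fst z) (snd z)) \<circ> Pair s)"
  by (rule continuous_on_compose) (use assms in \<open>auto intro!: continuous_intros elim: continuous_on_subset\<close>)
 thus ?thesis by (simp add: o_def)
qed

text \<open>The smaller set has to be preserved but not fixed pointwise, so that pushes qualify as
  deformations.\<close>

lemma hiso_deformation:
 fixes H :: "real => 'a::topological_space => 'a"
 assumes AB: "A <= B" and H: "continuous_on ({0..1} \<times> B) (%z. H (fst z) (snd z))"
  and HB: "!!s x. 0 <= s ==> s <= 1 ==> x : B ==> H s x : B"
  and HA: "!!s x. 0 <= s ==> s <= 1 ==> x : A ==> H s x : A"
  and H0: "!!x. x : B ==> H 0 x = x" and H1: "!!x. x : B ==> H 1 x : A"
 shows "hiso A p B p"
proof (rule hiso_homotopy_equivalence[of A id B "H 1"])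
 show "continuous_on B (H 1)" by (rule continuous_on_slice[OF H]) auto
 have HAc: "continuous_on ({0..1} \<times> A) (%z. H (fst z) (snd z))" using H by (rule continuous_on_subset) (use AB in auto)
 have "homotopic_with_canon (%_. True) A A id (H 1 \<circ> id)" by (rule homotopic_withI_canon[OF HAc]) (use HA H0 AB in auto)
 thus "homotopic_with_canon (%_. True) A A (H 1 \<circ> id) id" by (rule homotopic_with_symD)
 have "homotopic_with_canon (%_. True) B B id (id \<circ> H 1)" by (rule homotopic_withI_canon[OF H]) (use HB H0 in auto)
 thus "homotopic_with_canon (%_. True) B B (id \<circ> H 1) id" by (rule homotopic_with_symD)
qed (use AB H1 in auto)

text \<open>One explicit step along \<open>- v\<close> decreases \<open>F\<close>; this replaces gradient flows.\<close>

definition pushable :: "'a::real_inner set => ('a => real) => ('a => 'a) => real => real => bool" where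
 "pushable S F v k C \<longleftrightarrow> 0 < k & 0 <= C & continuous_on S v &
   (ALL x:S. norm (v x) <= C * norm x) &
   (ALL x:S. ALL s. 0 <= s --> s <= 1 --> x - s *. v x : S & F (x - s *. v x) <= F x - s * k * (norm x)^2)"

lemma pushableD:
 assumes "pushable S F v k C"
 shows "0 < k" "0 <= C" "continuous_on S v" "!!x. x : S ==> norm (v x) <= C * norm x"
  "!!x s. x : S ==> 0 <= s ==> s <= 1 ==> x - s *. v x : S"
  "!!x s. x : S ==> 0 <= s ==> s <= 1 ==> F (x - s *. v x) <= F x - s * k * (norm x)^2" using assms by (auto simp: pushable_def)

lemma pushable_mono:
 assumes "pushable S F v k C" "0 < k'" "k' <= k" "C <= C'"
 shows "pushable S F v k' C'" unfolding pushable_def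
proof (intro conjI ballI allI impI)
 note p = pushableD[OF assms(1)]
 show "0 < k'" "0 <= C'" "continuous_on S v" using assms p by auto
 fix x assume x: "x : S"
 show "norm (v x) <= C' * norm x" using p(4)[OF x] mult_right_mono[OF assms(4) norm_ge_zero[of x]] by linarith
 fix s :: real assume s: "0 <= s" "s <= 1"
 show "x - s *. v x : S" using p(5)[OF x s] .
 have "s * k' * (norm x)^2 <= s * k * (norm x)^2" using s assms by (intro mult_right_mono mult_left_mono) auto
 thus "F (x - s *. v x) <= F x - s * k' * (norm x)^2" using p(6)[OF x s] by linarith
qed

lemma pushable_continuous:
 assumes "pushable S F v k C"
 shows "continuous_on (T \<times> S) (%z. snd z - fst z *. v (snd z))" by (intro continuous_intros continuous_on_compose2[OF pushableD(3)[OF assms]]) auto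

text \<open>Squaring the triangle inequality gives \<open>(1 + s * C)^2\<close>, which is convex in
  \<open>s\<close> and therefore lies below its chord over the unit interval.\<close>

lemma pushable_norm:
 assumes "pushable S F v k C" "x : S" "0 <= s" "s <= 1"
 shows "(norm (x - s *. v x))^2 <= (1 + s * ((1 + C)^2 - 1)) * (norm x)^2"
proof -
 note p = pushableD[OF assms(1)]
 have "norm (x - s *. v x) <= norm x + s * norm (v x)" using norm_triangle_ineq4[of x "s *. v x"] assms(3) by simp
 also have "... <= norm x + s * (C * norm x)" using p(4)[OF assms(2)] assms(3) by (simp add: mult_left_mono)
 finally have "norm (x - s *. v x) <= (1 + s * C) * norm x" by (simp add: algebra_simps)
 hence "(norm (x - s *. v x))^2 <= ((1 + s * C) * norm x)^2" by (rule power_mono) simp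
 also have "... = (1 + s * C)^2 * (norm x)^2" by (simp add: power_mult_distrib)
 also have "... <= (1 + s * ((1 + C)^2 - 1)) * (norm x)^2"
 proof (rule mult_right_mono)
  have "s * (s * (C * C)) <= 1 * (s * (C * C))" using assms p(2) by (intro mult_right_mono) auto
  thus "(1 + s * C)^2 <= 1 + s * ((1 + C)^2 - 1)" by (simp add: power2_eq_square algebra_simps)
 qed simp
 finally show ?thesis .
qed

text \<open>The level is undercut by a margin proportional to the squared norm plus
  \<open>R\<close>. A push may enlarge the norm, but the decrease of \<open>F\<close> pays for this
  as long as \<open>d * (1 + C)^2 <= k\<close>.\<close>

lemma pushable_level:
 assumes p: "pushable S F v k C" and x: "x : S" "0 <= s" "s <= 1"
  and d: "0 <= d" "d * (1 + C)^2 <= k" and F: "F x - a <= - d * ((norm x)^2 + R)"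
 shows "F (x - s *. v x) - a <= - d * ((norm (x - s *. v x))^2 + R)"
proof -
 have "d * (norm (x - s *. v x))^2 <= d * ((1 + s * ((1 + C)^2 - 1)) * (norm x)^2)" using pushable_norm[OF p x] d by (intro mult_left_mono)
 also have "... = d * (norm x)^2 + s * (d * (1 + C)^2 - d) * (norm x)^2" by (simp add: algebra_simps)
 also have "s * (d * (1 + C)^2 - d) * (norm x)^2 <= s * k * (norm x)^2" using d x by (intro mult_right_mono mult_left_mono) auto
 finally show ?thesis using pushableD(6)[OF p x] F by (simp add: algebra_simps)
qed

lemma pushable_decreasing:
 assumes "pushable S F v k C" "x : S" "0 <= s" "s <= 1"
 shows "F (x - s *. v x) <= F x"
proof -
 have "0 <= s * k * (norm x)^2" using pushableD(1)[OF assms(1)] assms(3) by simp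
 thus ?thesis using pushableD(6)[OF assms] by linarith
qed

text \<open>The nonstrict bound on \<open>\<bar>F - G\<bar>\<close> also covers the points where the weight vanishes.\<close>

lemma pushable_close_levels:
 assumes F: "pushable S F v k C" and G: "pushable S G w k C"
  and d: "0 < d" "d * (1 + C)^2 <= k" "d' < d" and R: "0 <= R"
  and Fd: "!!x. x : S ==> F x < a ==> F (x - v x) - a <= - 2 * d * ((norm (x - v x))^2 + R)"
  and Gd: "!!x. x : S ==> G x < a ==> G (x - w x) - a <= - 2 * d * ((norm (x - w x))^2 + R)"
  and FG: "!!x. x : S ==> \<bar>F x - G x\<bar> <= d' * ((norm x)^2 + R)"
 shows "hiso {x:S. F x < a} p {x:S. G x < a} p"
proof -
 let ?n = "%x :: 'a. (norm x)^2 + R"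
 have cmp: "g < a & (f - a <= - 2 * d * m --> g - a <= - d * m)"
  if "\<bar>f - g\<bar> <= d' * m" "0 <= m" "f < a" "f - a <= - d * m" for f g m :: real
 proof (cases "m = 0")
  case False
  hence "d' * m < d * m" using that(2) d by simp
  thus ?thesis using that by linarith
 qed (use that in auto)
 \<comment> \<open>The two pushes are homotopy inverse to each other. After one push along
   \<open>v\<close> the point lies so far below the level that \<open>F\<close> and \<open>G\<close>
   agree about it, and this margin survives the subsequent push along \<open>w\<close>.\<close>
 have equiv: "homotopic_with_canon (%_. True) {x:S. F x < a} {x:S. F x < a} ((%x. x - w x) \<circ> (%x. x - v x)) id &
   continuous_on {x:S. F x < a} (%x. x - v x) & (%x. x - v x) ` {x:S. F x < a} <= {x:S. G x < a}"
  if F: "pushable S F v k C" and G: "pushable S G w k C"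
   and Fd: "!!x. x : S ==> F x < a ==> F (x - v x) - a <= - 2 * d * ?n (x - v x)"
   and FG: "!!x. x : S ==> \<bar>F x - G x\<bar> <= d' * ?n x" for F G v w
 proof (intro conjI)
  let ?A = "{x:S. F x < a}"
  note P = pushableD[OF F] and Q = pushableD[OF G]
  have P1: "x - v x : S" "G (x - v x) < a" "G (x - v x) - a <= - d * ?n (x - v x)" if x: "x : ?A" for x
  proof -
   let ?y = "x - v x"
   have y: "?y : S" "F ?y < a" using P(5)[of x 1] pushable_decreasing[OF F, of x 1] x by auto
   have "0 <= d * ?n ?y" using d R by simp
   hence "F ?y - a <= - d * ?n ?y" using Fd[of x] x by simp
   thus "?y : S" "G ?y < a" "G ?y - a <= - d * ?n ?y" using cmp[OF FG[OF y(1)] _ y(2)] Fd[of x] x y R by auto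
  qed
  have c1: "continuous_on ?A v" using P(3) by (rule continuous_on_subset) auto
  thus "continuous_on ?A (%x. x - v x)" by (intro continuous_intros)
  show "(%x. x - v x) ` ?A <= {x:S. G x < a}" using P1 by auto
  have "homotopic_with_canon (%_. True) ?A ?A id (%x. x - v x)"
  proof (rule homotopic_withI_canon[of ?A "%s x. x - s *. v x"])
   show "x - s *. v x : ?A" if "0 <= s" "s <= 1" "x : ?A" for s x using P(5)[of x s] pushable_decreasing[OF F, of x s] that by auto
  qed (auto intro: continuous_on_subset[OF pushable_continuous[OF F]])
  moreover have "homotopic_with_canon (%_. True) ?A ?A (%x. x - v x) ((%x. x - w x) \<circ> (%x. x - v x))"
  proof (rule homotopic_withI_canon[of ?A "%s x. x - v x - s *. w (x - v x)"])
   show "continuous_on ({0..1} \<times> ?A) (%z. snd z - v (snd z) - fst z *. w (snd z - v (snd z)))"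
    by (intro continuous_intros continuous_on_compose2[OF c1] continuous_on_compose2[OF Q(3)]) (use P1 in auto)
   fix s :: real and x assume s: "0 <= s" "s <= 1" and x: "x : ?A"
   let ?z = "x - v x - s *. w (x - v x)"
   have z: "?z : S" "G ?z < a" using Q(5)[OF _ s] pushable_decreasing[OF G _ s] P1[OF x] by fastforce+
   have "G ?z - a <= - d * ?n ?z" by (rule pushable_level[OF G P1(1)[OF x] s _ d(2) P1(3)[OF x]]) (use d in simp)
   hence "F ?z < a" using cmp[OF _ _ z(2)] FG[OF z(1)] R by (simp add: abs_minus_commute)
   thus "?z : ?A" using z by simp
  qed auto
  ultimately show "homotopic_with_canon (%_. True) ?A ?A ((%x. x - w x) \<circ> (%x. x - v x)) id" using homotopic_with_trans homotopic_with_symD by blast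
 qed
 have GF: "\<bar>G x - F x\<bar> <= d' * ?n x" if "x : S" for x using FG[OF that] by (simp add: abs_minus_commute)
 show ?thesis by (rule hiso_homotopy_equivalence[of _ "%x. x - v x" _ "%x. x - w x"]) (use equiv[OF F G Fd FG] equiv[OF G F Gd GF] in auto)
qed

lemma pushable_close:
 assumes F: "pushable S F v k C" and G: "pushable S G w k C"
  and d: "d' < k / (2 * (1 + C)^2)" and FG: "!!x. x : S ==> \<bar>F x - G x\<bar> <= d' * (norm x)^2"
 shows "hiso {x:S. F x < 0} p {x:S. G x < 0} p"
proof -
 define d where "d = k / (2 * (1 + C)^2)"
 have C: "0 < (1 + C)^2" using pushableD(2)[OF F] by (auto intro: zero_less_power)
 have k: "0 < k" using pushableD(1)[OF F] .
 have d0: "0 < d" "2 * d * (1 + C)^2 = k" using C k by (auto simp: d_def)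
 have le: "H (x - u x) - 0 <= - 2 * d * ((norm (x - u x))^2 + 0)" if "pushable S H u k C" "x : S" "H x < 0" for H u x
 proof -
  have "2 * d * (norm (x - u x))^2 <= 2 * d * ((1 + C)^2 * (norm x)^2)" using pushable_norm[OF that(1,2), of 1] d0(1) by (intro mult_left_mono) auto
  also have "... = k * (norm x)^2" by (simp add: d0(2)[symmetric])
  finally show ?thesis using pushableD(6)[OF that(1,2), of 1] that(3) by simp
 qed
 show ?thesis by (rule pushable_close_levels[OF F G d0(1) _ d[folded d_def] order_refl le[OF F] le[OF G]]) (use d0 k FG in auto)
qed

text \<open>\<open>k\<close> and \<open>C\<close> do not depend on the parameter, so one mesh width
  works on the whole interval and finitely many applications of \<open>pushable_close\<close>
  suffice.\<close>

lemma pushable_family: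
 fixes F :: "real => 'a::real_inner => real"
 assumes F: "!!s. 0 <= s ==> s <= 1 ==> pushable S (F s) (v s) k C"
  and eq: "!!d. d > 0 ==> EX e>0. ALL s s'. 0 <= s --> s <= 1 --> 0 <= s' --> s' <= 1 --> \<bar>s - s'\<bar> < e -->
   (ALL x:S. \<bar>F s x - F s' x\<bar> <= d * (norm x)^2)"
 shows "hiso {x:S. F 0 x < 0} p {x:S. F 1 x < 0} p"
proof -
 note p = pushableD[OF F[of 0]]
 define d where "d = k / (4 * (1 + C)^2)"
 have C: "0 < (1 + C)^2" using p(2) by (auto intro: zero_less_power)
 have d: "0 < d" "d < k / (2 * (1 + C)^2)" using C p(1) by (auto simp: d_def field_simps)
 obtain e where e: "e > 0" "!!s s' x. 0 <= s ==> s <= 1 ==> 0 <= s' ==> s' <= 1 ==> \<bar>s - s'\<bar> < e ==>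
   x : S ==> \<bar>F s x - F s' x\<bar> <= d * (norm x)^2" using eq[OF d(1)] by blast
 obtain N where N: "inverse (real (Suc N)) < e" using reals_Archimedean[OF e(1)] by blast
 let ?t = "%i. real i / real (Suc N)"
 have "hiso {x:S. F 0 x < 0} p {x:S. F (?t i) x < 0} p" if "i <= Suc N" for i using that
 proof (induction i)
  case 0
  thus ?case by (simp add: hiso_refl)
 next
  case (Suc i)
  have t: "0 <= ?t i" "?t i <= 1" "0 <= ?t (Suc i)" "?t (Suc i) <= 1" using Suc.prems by (auto simp: divide_simps)
  have "?t i - ?t (Suc i) = - inverse (real (Suc N))" unfolding diff_divide_distrib[symmetric] by (simp add: inverse_eq_divide del: of_nat_Suc) (simp add: divide_simps)
  hence "\<bar>?t i - ?t (Suc i)\<bar> = inverse (real (Suc N))" by simp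
  hence cl: "\<bar>?t i - ?t (Suc i)\<bar> < e" using N by linarith
  have "hiso {x:S. F (?t i) x < 0} p {x:S. F (?t (Suc i)) x < 0} p" by (rule pushable_close[OF F F d(2)]) (use t e(2)[OF t cl] in auto)
  thus ?case using Suc hiso_trans by fastforce
 qed
 from this[of "Suc N"] show ?thesis by simp
qed

text \<open>Between the two levels all points keep away from the origin, so each push lowers
  \<open>F\<close> by at least \<open>k * r\<close>.\<close>

lemma pushable_levels:
 assumes F: "pushable S F v k C" and ba: "b <= a" and r: "0 < r"
  and gap: "!!x. x : S ==> b <= F x ==> F x < a ==> r <= (norm x)^2"
 shows "hiso {x:S. F x < b} p {x:S. F x < a} p"
proof -
 note P = pushableD[OF F]
 have step: "hiso {x:S. F x < b'} p {x:S. F x < a'} p"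
  if step: "b <= b'" "b' <= a'" "a' <= a" "a' <= b' + k * r" for a' b'
 proof (rule hiso_deformation[where H="%s x. x - s *. v x"])
  show "continuous_on ({0..1} \<times> {x:S. F x < a'}) (%z. snd z - fst z *. v (snd z))" by (rule continuous_on_subset[OF pushable_continuous[OF F]]) auto
  note mono = pushable_decreasing[OF F]
  show "x - s *. v x : {x:S. F x < a'}" if "0 <= s" "s <= 1" "x : {x:S. F x < a'}" for s x using mono[of x s] P(5)[of x s] that by auto
  show "x - s *. v x : {x:S. F x < b'}" if "0 <= s" "s <= 1" "x : {x:S. F x < b'}" for s x using mono[of x s] P(5)[of x s] that by auto
  show "x - 1 *. v x : {x:S. F x < b'}" if x: "x : {x:S. F x < a'}" for x
  proof (cases "F x < b'")
   case True
   thus ?thesis using mono[of x 1] P(5)[of x 1] x by auto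
  next
   case False
   hence "r <= (norm x)^2" using gap[of x] x \<open>b <= b'\<close> \<open>a' <= a\<close> by auto
   hence "k * r <= k * (norm x)^2" using P(1) by simp
   thus ?thesis using P(6)[of x 1] P(5)[of x 1] x step by auto
  qed
 qed (use that in auto)
 obtain N where N: "a - b < real N * (k * r)" using reals_Archimedean3[of "k * r"] P(1) r by auto
 define c where "c i = min a (b + real i * (k * r))" for i
 have "hiso {x:S. F x < b} p {x:S. F x < c i} p" for i
 proof (induction i)
  case 0
  thus ?case using ba by (simp add: c_def hiso_refl)
 next
  case (Suc i)
  have kr: "0 < k * r" using P(1) r by simp
  moreover have "0 <= real i * (k * r)" using kr by simp
  ultimately have "hiso {x:S. F x < c i} p {x:S. F x < c (Suc i)} p" by (intro step) (use ba in \<open>auto simp: c_def min_def distrib_right\<close>)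
  thus ?case using Suc hiso_trans by blast
 qed
 moreover have "c N = a" using N by (simp add: c_def)
 ultimately show ?thesis by metis
qed

text \<open>At level \<open>c\<close> the natural scale is \<open>R = c / C\<close>. Where the
  squared norm is at least \<open>R / 2\<close> a push gains enough. Elsewhere both functions are
  below \<open>c / 2\<close> in absolute value, so only the level \<open>c\<close> itself can
  matter, and it is undercut by \<open>c / 2\<close> anyway.\<close>

lemma pushable_levels_asymptotic:
 assumes F: "pushable S F v k C" and G: "pushable S G w k C" and C: "1 <= C"
  and FC: "!!x. x : S ==> \<bar>F x\<bar> <= C * (norm x)^2" and GC: "!!x. x : S ==> \<bar>G x\<bar> <= C * (norm x)^2"
  and FG: "!!d. d > 0 ==> EX K. ALL x:S. \<bar>F x - G x\<bar> <= d * (norm x)^2 + K"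
 shows "EX c0. ALL c>=c0. ALL p. hiso {x:S. F x < c} p {x:S. G x < c} p & hiso {x:S. F x < - c} p {x:S. G x < - c} p"
proof -
 have k: "0 < k" using pushableD(1)[OF F] .
 define D where "D = (1 + C)^2"
 have D: "1 <= D" using C by (simp add: D_def one_le_power)
 \<comment> \<open>The first bound serves points far from 0, the second one points near 0, where
   \<open>d * (D + 2) * R\<close> must not exceed \<open>c / 2\<close>.\<close>
 define d where "d = min (k / (8 * D)) (C / (2 * (D + 2)))"
 have d: "0 < d" "8 * d * D <= k" "d * (2 * (D + 2)) <= C"
 proof -
  show "0 < d" using k D C by (simp add: d_def)
  have "d <= k / (8 * D)" "d <= C / (2 * (D + 2))" by (auto simp: d_def)
  thus "8 * d * D <= k" "d * (2 * (D + 2)) <= C" using D by (simp_all add: pos_le_divide_eq algebra_simps)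
 qed
 have d8: "8 * d <= k" using d(1,2) D mult_left_mono[of 1 D "8 * d"] by linarith
 obtain K where K: "!!x. x : S ==> \<bar>F x - G x\<bar> <= d / 2 * (norm x)^2 + K" using FG[of "d / 2"] d by auto
 define c0 where "c0 = max 1 (2 * C * K / d)"
 have main: "hiso {x:S. F x < a} p {x:S. G x < a} p" if c: "c0 <= c" and a: "\<bar>a\<bar> = c" for a c p
 proof -
  define R where "R = c / C"
  have c1: "1 <= c" using c by (simp add: c0_def)
  have R: "0 < R" "C * R = c" using c1 C by (auto simp: R_def)
  have KR: "K <= d / 2 * R"
  proof -
   have "2 * C * K / d <= c" using c by (simp add: c0_def)
   hence "2 * C * K <= c * d" using d(1) by (simp add: pos_divide_le_eq)
   hence "C * (2 * K) <= C * (R * d)" by (simp add: R(2)[symmetric] mult.assoc mult.left_commute)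
   thus ?thesis using C by (simp add: algebra_simps)
  qed
  have le: "H (x - u x) - a <= - 2 * d * ((norm (x - u x))^2 + R)"
   if H: "pushable S H u k C" and x: "x : S" and Hx: "H x < a" and HC: "\<bar>H x\<bar> <= C * (norm x)^2" for H u x
  proof -
   have n: "(norm (x - u x))^2 <= D * (norm x)^2" using pushable_norm[OF H x, of 1] by (simp add: D_def)
   have H1: "H (x - u x) <= H x - k * (norm x)^2" using pushableD(6)[OF H x, of 1] by simp
   have n2: "2 * d * (norm (x - u x))^2 <= 2 * d * (D * (norm x)^2)" using n d by (intro mult_left_mono) auto
   show ?thesis
   proof (cases "R <= 2 * (norm x)^2")
    case True
    have "2 * d * (D * (norm x)^2) <= k / 4 * (norm x)^2" using mult_right_mono[OF d(2), of "(norm x)^2"] by (simp add: algebra_simps)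
    moreover have "2 * d * R <= k / 2 * (norm x)^2"
    proof -
     have "2 * d * R <= 2 * d * (2 * (norm x)^2)" using True d by (intro mult_left_mono) auto
     also have "... <= k / 2 * (norm x)^2" using mult_right_mono[OF d8, of "(norm x)^2"] by (simp add: algebra_simps)
     finally show ?thesis .
    qed
    moreover have "0 <= k * (norm x)^2" using k by simp
    ultimately show ?thesis using n2 H1 Hx by (simp add: algebra_simps)
   next
    case False
    hence "C * (2 * (norm x)^2) < C * R" using C by simp
    hence Hc: "\<bar>H x\<bar> < c / 2" using HC R(2) by linarith
    hence "a = c" using a Hx by (auto simp: abs_if split: if_splits)
    have "2 * d * (D * (norm x)^2) <= d * (D * R)" using False d D mult_left_mono[of "2 * (norm x)^2" R "d * D"] by (simp add: algebra_simps)
    hence "2 * d * ((norm (x - u x))^2 + R) <= d * (D + 2) * R" using n2 by (simp add: algebra_simps)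
    also have "... <= C / 2 * R" by (rule mult_right_mono) (use d(3) R(1) in \<open>simp_all add: algebra_simps\<close>)
    also have "... = c / 2" using R(2) by simp
    finally have "2 * d * ((norm (x - u x))^2 + R) <= c / 2" .
    moreover have "0 <= k * (norm x)^2" using k by simp
    ultimately show ?thesis using H1 Hc \<open>a = c\<close> by (simp add: abs_if split: if_splits)
   qed
  qed
  have "0 <= d * D" using d(1) D by simp
  hence "d * (1 + C)^2 <= k" using d(2) unfolding D_def by linarith
  moreover have "\<bar>F x - G x\<bar> <= d / 2 * ((norm x)^2 + R)" if "x : S" for x using K[OF that] KR by (simp add: algebra_simps)
  ultimately show ?thesis using d R FC GC by (intro pushable_close_levels[OF F G d(1) _ _ _ le[OF F] le[OF G], of "d / 2"]) auto
 qed
 show ?thesis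
 proof (intro exI[of _ c0] allI impI conjI)
  fix c p assume c: "c0 <= c"
  hence "1 <= c" by (simp add: c0_def)
  thus "hiso {x:S. F x < c} p {x:S. G x < c} p" "hiso {x:S. F x < - c} p {x:S. G x < - c} p" by (intro main[OF c]; simp)+
 qed
qed

section \<open>Homogeneous functions; local against global sublevels\<close>

definition homogeneous2 :: "('a::real_vector => real) => bool" where
 "homogeneous2 f \<longleftrightarrow> (ALL c x. 0 <= c --> f (c *. x) = c^2 * f x)"

lemma homogeneous2D: "homogeneous2 f ==> 0 <= c ==> f (c *. x) = c^2 * f x" by (simp add: homogeneous2_def)

lemma homogeneous2_0: "homogeneous2 f ==> f 0 = 0" using homogeneous2D[of f 0 0] by simp

lemma acyclic_starlike:
 fixes A :: "'a::real_normed_vector set"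
 assumes "a : A" "!!x u. x : A ==> 0 <= u ==> u <= 1 ==> (1 - u) *. a + u *. x : A"
 shows "acyclic_set A"
proof (rule acyclic_contractible)
 have "starlike A" unfolding starlike_def by (rule bexI[OF _ assms(1)]) (use assms(2) in \<open>auto simp: closed_segment_def\<close>)
 thus "contractible A" by (rule starlike_imp_contractible)
qed (use assms in auto)

lemma openin_sublevel:
 assumes "continuous_on S (F :: _ => real)"
 shows "openin (top_of_set S) {x:S. F x < a}"
proof -
 have "{x:S. F x < a} = S Int F -` {..<a}" by auto
 thus ?thesis using continuous_openin_preimage_gen[OF assms, of "{..<a}"] by simp
qed

text \<open>Radial stretching. The factor \<open>1 + sqrt (c / - G x)\<close> exceeds the one that
  would reach the level \<open>- c\<close> exactly, which makes the inequality strict however close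
  \<open>G x\<close> is to 0.\<close>

lemma homogeneous2_levels_below:
 fixes G :: "'a::real_normed_vector => real"
 assumes S: "subspace S" and hG: "homogeneous2 G" and G: "continuous_on S G" and c: "0 < c"
 shows "hiso {x:S. G x < - c} p {x:S. G x < 0} p"
proof (rule hiso_deformation[where H="%s x. (1 + s * sqrt (c / - G x)) *. x"])
 show "continuous_on ({0..1} \<times> {x:S. G x < 0}) (%z. (1 + fst z * sqrt (c / - G (snd z))) *. snd z)" by (intro continuous_intros continuous_on_compose2[OF G]) auto
 have le: "G ((1 + s * sqrt (c / - G x)) *. x) <= G x" if "0 <= s" "G x < 0" for s x
 proof -
  define r where "r = 1 + s * sqrt (c / - G x)"
  have "0 <= sqrt (c / - G x)" using that c by (intro real_sqrt_ge_zero divide_nonneg_pos) auto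
  hence r: "1 <= r" using that by (simp add: r_def)
  hence "1 <= r^2" by (rule one_le_power)
  hence "r^2 * G x <= 1 * G x" using that by (intro mult_right_mono_neg) auto
  thus ?thesis using homogeneous2D[OF hG, of r x] r by (simp add: r_def)
 qed
 show "(1 + s * sqrt (c / - G x)) *. x : {x:S. G x < 0}" if "0 <= s" "s <= 1" "x : {x:S. G x < 0}" for s x using le[of s x] that S by (auto simp: subspace_scale)
 show "(1 + s * sqrt (c / - G x)) *. x : {x:S. G x < - c}" if "0 <= s" "s <= 1" "x : {x:S. G x < - c}" for s x using le[of s x] that S c by (auto simp: subspace_scale)
 show "(1 + 1 * sqrt (c / - G x)) *. x : {x:S. G x < - c}" if "x : {x:S. G x < 0}" for x
 proof -
  define t where "t = sqrt (c / - G x)"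
  have Gx: "G x < 0" "x : S" using that by auto
  have "0 <= c / - G x" using Gx c by (intro divide_nonneg_pos) auto
  hence t: "0 <= t" "t^2 = c / - G x" by (auto simp: t_def)
  have "t^2 < (1 + t)^2" using t by (simp add: power2_eq_square algebra_simps)
  hence "(1 + t)^2 * G x < t^2 * G x" using Gx by (simp add: mult_strict_right_mono_neg)
  also have "... = - c" using t Gx by simp
  finally have "(1 + t) *. x : {x:S. G x < - c}" using homogeneous2D[OF hG, of "1 + t" x] t Gx S by (simp add: subspace_scale)
  thus ?thesis unfolding t_def by (simp only: mult_1_left)
 qed
qed (use c in auto)

text \<open>Near the critical point \<open>0\<close> the function \<open>F\<close> equals \<open>F0\<close>, at infinity it looks like \<open>G\<close>; since \<open>0\<close>
  is the only critical point, both carry its local homology. The set \<open>{F < 0}\<close> is thickened by the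
  neighbourhood \<open>D\<close> of \<open>0\<close>, which is left downwards only through \<open>{F < 0}\<close>.\<close>

lemma hiso_local_global:
 assumes S: "subspace S" and F: "pushable S F v k C" and G: "pushable S G w k C" and C: "1 <= C"
  and FC: "!!x. x : S ==> \<bar>F x\<bar> <= C * (norm x)^2" and GC: "!!x. x : S ==> \<bar>G x\<bar> <= C * (norm x)^2"
  and cF: "continuous_on S F" and cG: "continuous_on S G"
  and hG: "homogeneous2 G" and hF0: "homogeneous2 F0"
  and e: "0 < e" and FF0: "!!x. x : S ==> norm x <= e ==> F x = F0 x"
  and FG: "!!d. d > 0 ==> EX K. ALL x:S. \<bar>F x - G x\<bar> <= d * (norm x)^2 + K"
 shows "hiso {x:S. F0 x < 0} p {x:S. G x < 0} p"
proof -
 note P = pushableD[OF F]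
 have k: "0 < k" by (rule P(1))
 have F_0: "F 0 = 0" using FC[of 0] S by (simp add: subspace_0)
 note push_mono = pushable_decreasing[OF F]
 \<comment> \<open>\<open>L * k = (1 + C)^2\<close> lets the drop of \<open>L * F\<close> along a
   push outweigh the growth of the squared norm, so \<open>D\<close> is kept until \<open>F\<close>
   becomes negative. \<open>c1\<close> is so small that a push from the rest of
   \<open>{F < c1}\<close> reaches \<open>{F < 0}\<close> at once.\<close>
 define L where "L = (1 + C)^2 / k"
 have L: "0 < L" "L * k = (1 + C)^2" using k C by (auto simp: L_def)
 define c1 where "c1 = min (e^2 / (2 * L)) (k * e^2 / 4)"
 have c1: "0 < c1" "L * c1 <= e^2 / 2" "c1 <= k * e^2 / 4"
 proof -
  show "0 < c1" "c1 <= k * e^2 / 4" using L k e by (auto simp: c1_def)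
  have "c1 <= e^2 / (2 * L)" by (simp add: c1_def)
  thus "L * c1 <= e^2 / 2" using L(1) by (simp add: field_simps)
 qed
 define A where "A = {x:S. F x < 0}"
 define D where "D = {x:S. (norm x)^2 + L * max (F x) 0 < e^2 & F x < c1}"
 have normD: "norm x < e" if "x : D" for x
 proof -
  have "0 <= L * max (F x) 0" using L(1) by simp
  hence "(norm x)^2 < e^2" using that by (auto simp: D_def)
  thus ?thesis using e by (meson less_le power_mono_iff not_le power_less_imp_less_base norm_ge_zero less_imp_le)
 qed
 have AD: "A Int D = {x:S. F0 x < 0 & norm x < e}"
 proof (intro equalityI subsetI)
  fix x assume "x : A Int D"
  thus "x : {x:S. F0 x < 0 & norm x < e}" using normD[of x] FF0[of x] by (auto simp: A_def)
 next
  fix x assume x: "x : {x:S. F0 x < 0 & norm x < e}"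
  hence "(norm x)^2 < e^2" using e by (auto intro: power_strict_mono)
  thus "x : A Int D" using x FF0[of x] c1(1) by (auto simp: A_def D_def max_def)
 qed
 have h1: "hiso (A Int D) p {x:S. F0 x < 0} p" unfolding AD
 proof (rule hiso_deformation[where H="%s x. (1 / (1 + s * norm x / e)) *. x"])
  have nz: "1 + s * norm x / e ~= 0" if "0 <= s" for s and x :: 'a using that e by (smt (verit) divide_nonneg_pos mult_nonneg_nonneg norm_ge_zero)
  show "continuous_on ({0..1} \<times> {x:S. F0 x < 0}) (%z. (1 / (1 + fst z * norm (snd z) / e)) *. snd z)" by (intro continuous_intros) (use nz e in auto)
  fix s :: real and x :: 'a
  assume s: "0 <= s" "s <= 1"
  define r where "r = 1 / (1 + s * norm x / e)"
  have "0 <= s * norm x / e" using s e by simp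
  hence r: "0 < r" "r <= 1" by (auto simp: r_def)
  have F0r: "F0 (r *. x) < 0" if "F0 x < 0" using that homogeneous2D[OF hF0, of r x] r by (simp add: mult_pos_neg)
  show "(1 / (1 + s * norm x / e)) *. x : {x:S. F0 x < 0}" if "x : {x:S. F0 x < 0}" using that F0r S by (simp add: r_def[symmetric] subspace_scale)
  show "(1 / (1 + s * norm x / e)) *. x : {x:S. F0 x < 0 & norm x < e}"
   if "x : {x:S. F0 x < 0 & norm x < e}" using that F0r S r mult_right_mono[of r 1 "norm x"] by (simp add: r_def[symmetric] subspace_scale)
 next
  fix x assume x: "x : {x:S. F0 x < 0}"
  define r where "r = 1 / (1 + 1 * norm x / e)"
  have "0 <= norm x / e" using e by simp
  hence r: "0 < r" by (simp add: r_def)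
  have "norm x < (1 + 1 * norm x / e) * e" using e by (simp add: distrib_right)
  moreover have "0 < 1 + 1 * norm x / e" using e by (intro add_pos_nonneg) auto
  ultimately have "norm (r *. x) < e" using r by (simp add: r_def divide_simps mult.commute)
  moreover have "F0 (r *. x) < 0" using x homogeneous2D[OF hF0, of r x] r by (simp add: mult_pos_neg)
  ultimately have "r *. x : {x:S. F0 x < 0 & norm x < e}" using x S by (simp add: subspace_scale)
  thus "(1 / (1 + 1 * norm x / e)) *. x : {x:S. F0 x < 0 & norm x < e}" unfolding r_def .
 qed auto
 have D: "acyclic_set D"
 proof (rule acyclic_starlike[of 0])
  show "0 : D" using F_0 S e c1(1) by (simp add: D_def subspace_0)
  fix x and u :: real assume x: "x : D" and u: "0 <= u" "u <= 1"
  have xe: "norm x < e" by (rule normD[OF x])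
  have ux: "norm (u *. x) <= norm x" using u mult_right_mono[of u 1 "norm x"] by simp
  have xS: "x : S" using x by (simp add: D_def)
  have "F (u *. x) = u^2 * F x" using FF0[of x] FF0[of "u *. x"] homogeneous2D[OF hF0 u(1)] xS ux xe S by (simp add: subspace_scale)
  moreover have "u^2 <= 1" using u by (simp add: power_le_one)
  hence "u^2 * max (F x) 0 <= 1 * max (F x) 0" by (intro mult_right_mono) auto
  moreover have "u^2 * F x <= u^2 * max (F x) 0" by (intro mult_left_mono) auto
  ultimately have le: "max (F (u *. x)) 0 <= max (F x) 0" by simp
  hence 1: "L * max (F (u *. x)) 0 <= L * max (F x) 0" using L(1) by simp
  have 2: "(norm (u *. x))^2 <= (norm x)^2" using ux by (rule power_mono) simp
  have "(norm x)^2 + L * max (F x) 0 < e^2" using x by (simp add: D_def)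
  hence "(norm (u *. x))^2 + L * max (F (u *. x)) 0 < e^2" using 1 2 by linarith
  moreover have "F (u *. x) < c1" using le x c1(1) by (auto simp: D_def max_def split: if_splits)
  ultimately have "u *. x : D" unfolding D_def using subspace_scale[OF S xS] by blast
  thus "(1 - u) *. 0 + u *. x : D" by simp
 qed
 text \<open>The union is a deformation retract of a sublevel set above the critical level.\<close>
 have keep: "x - s *. v x : A Un D" if s: "0 <= s" "s <= 1" and x: "x : A Un D" for s x
 proof -
  let ?y = "x - s *. v x"
  have xS: "x : S" using x by (auto simp: A_def D_def)
  have yS: "?y : S" by (rule P(5)[OF xS s])
  have Fy: "F ?y <= F x" by (rule push_mono[OF xS s])
  show ?thesis
  proof (cases "F ?y < 0")
   case False
   hence x0: "0 <= F x" and xD: "x : D" using Fy x by (auto simp: A_def)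
   have n: "(norm ?y)^2 <= (norm x)^2 + s * ((1 + C)^2 - 1) * (norm x)^2" using pushable_norm[OF F xS s] by (simp add: algebra_simps)
   have "s * ((1 + C)^2 - 1) * (norm x)^2 <= s * (1 + C)^2 * (norm x)^2" using s by (intro mult_right_mono mult_left_mono) auto
   also have "... = L * (s * k * (norm x)^2)" by (simp add: L(2)[symmetric])
   also have "... <= L * (F x - F ?y)" using P(6)[OF xS s] L(1) by (intro mult_left_mono) auto
   finally have "(norm ?y)^2 + L * F ?y <= (norm x)^2 + L * F x" using n by (simp add: algebra_simps)
   moreover have "max (F ?y) 0 = F ?y" "max (F x) 0 = F x" using False x0 by simp_all
   moreover have "(norm x)^2 + L * max (F x) 0 < e^2" "F x < c1" using xD by (simp_all add: D_def)
   ultimately have "?y : D" unfolding D_def using Fy yS by simp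
   thus ?thesis by blast
  qed (use yS in \<open>auto simp: A_def\<close>)
 qed
 have h2: "hiso (A Un D) q {x:S. F x < c1} q" for q
 proof (rule hiso_deformation[where H="%s x. x - s *. v x"])
  show "A Un D <= {x:S. F x < c1}" using c1(1) by (auto simp: A_def D_def)
  show "continuous_on ({0..1} \<times> {x:S. F x < c1}) (%z. snd z - fst z *. v (snd z))" by (rule continuous_on_subset[OF pushable_continuous[OF F]]) auto
  show "x - s *. v x : {x:S. F x < c1}" if "0 <= s" "s <= 1" "x : {x:S. F x < c1}" for s x using push_mono[of x s] P(5)[of x s] that by auto
  show "x - s *. v x : A Un D" if "0 <= s" "s <= 1" "x : A Un D" for s x by (rule keep[OF that])
  show "x - 1 *. v x : A Un D" if x: "x : {x:S. F x < c1}" for x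
  proof (cases "x : A Un D")
   case True
   thus ?thesis using keep[of 1 x] by simp
  next
   case False
   hence x0: "0 <= F x" "e^2 <= (norm x)^2 + L * F x" using x by (auto simp: A_def D_def max_def)
   have "L * F x <= L * c1" using x L(1) by simp
   hence "e^2 / 2 <= (norm x)^2" using x0 c1(2) by simp
   hence "k * (e^2 / 2) <= k * (norm x)^2" using k by (intro mult_left_mono) auto
   moreover have "0 < k * e^2" using k e by simp
   ultimately have "F (x - 1 *. v x) < 0" using P(6)[of x 1] x c1(3) by (simp add: algebra_simps)
   thus ?thesis using P(5)[of x 1] x by (auto simp: A_def)
  qed
 qed auto
 obtain c0 where c0: "!!c p. c0 <= c ==> hiso {x:S. F x < c} p {x:S. G x < c} p & hiso {x:S. F x < - c} p {x:S. G x < - c} p"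
  using pushable_levels_asymptotic[OF F G C FC GC FG] by blast
 define c2 where "c2 = k * e^2 / 8"
 have c2: "0 < c2" using k e by (simp add: c2_def)
 define c where "c = max c0 (max c1 c2)"
 have c: "c0 <= c" "c1 <= c" "c2 <= c" "0 < c" using c1(1) by (auto simp: c_def)
 have Fnorm: "b / C <= (norm x)^2" if "b <= \<bar>F x\<bar>" "x : S" for b x using FC[OF that(2)] that(1) C by (simp add: pos_divide_le_eq mult.commute)
 \<comment> \<open>Positive sublevels of the homogeneous \<open>G\<close> are star-shaped about 0.
   The asymptotic comparison, and the absence of critical levels between \<open>c1\<close> and
   \<open>c\<close>, carry acyclicity over to \<open>A Un D\<close>, as excision requires.\<close>
 have "acyclic_set {x:S. G x < c}"
 proof (rule acyclic_starlike[of 0])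
  show "0 : {x:S. G x < c}" using S homogeneous2_0[OF hG] c by (simp add: subspace_0)
  fix x and u :: real assume x: "x : {x:S. G x < c}" and u: "0 <= u" "u <= 1"
  have "u^2 <= 1" using u by (simp add: power_le_one)
  hence "u^2 * G x <= max (G x) 0" by (cases "0 <= G x") (auto simp: mult_left_le_one_le max_def mult_nonneg_nonpos not_le)
  thus "(1 - u) *. 0 + u *. x : {x:S. G x < c}" using x S c homogeneous2D[OF hG u(1), of x] by (auto simp: subspace_scale)
 qed
 hence "acyclic_set {x:S. F x < c}" by (rule acyclic_set_hiso) (use c0[OF c(1)] hiso_sym in blast)
 hence "acyclic_set {x:S. F x < c1}"
 proof (rule acyclic_set_hiso)
  show "hiso {x:S. F x < c} p {x:S. F x < c1} p" for p by (rule hiso_sym, rule pushable_levels[OF F c(2), of "c1 / C"]) (use c1(1) C Fnorm in auto)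
 qed
 hence AuD: "acyclic_set (A Un D)" by (rule acyclic_set_hiso) (rule hiso_sym[OF h2])
 have oA: "openin (top_of_set S) A" unfolding A_def by (rule openin_sublevel[OF cF])
 have "D = {x:S. (norm x)^2 + L * max (F x) 0 < e^2} Int {x:S. F x < c1}" by (auto simp: D_def)
 hence oD: "openin (top_of_set S) D" by (simp only:) (intro openin_Int openin_sublevel continuous_intros cF)
 have sub: "A Un D <= S" by (auto simp: A_def D_def)
 have h3: "hiso (A Int D) p A p" by (rule hiso_excision[OF _ _ AuD D]) (use openin_subset_trans[OF oA _ sub] openin_subset_trans[OF oD _ sub] in auto)
 \<comment> \<open>Near 0 a push gains too little. Therefore \<open>g\<close> first moves points of
   \<open>{F < 0}\<close> radially out to norm \<open>e / 2\<close>, which does not increase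
   \<open>F\<close> because \<open>F\<close> is homogeneous there; the push that follows gains
   \<open>k * (e / 2)^2\<close>, more than \<open>c2\<close>.\<close>
 have h4: "hiso {x:S. F x < - c2} p A p"
 proof -
  let ?B = "{x:S. F x < 0}"
  define g where "g s x = (1 + s * max 0 (e / (2 * norm x) - 1)) *. x" for s and x :: 'a
  have x0: "x ~= 0" if "x : ?B" for x using that F_0 by auto
  have g: "g s x : S & F (g s x) <= F x" if s: "0 <= s" "s <= 1" and x: "x : ?B" for s x
  proof (cases "norm x < e / 2")
   case False
   hence "e / (2 * norm x) - 1 <= 0" using x0[OF x] by (simp add: field_simps)
   thus ?thesis using x by (simp add: g_def)
  next
   case True
   have nx: "0 < norm x" using x0[OF x] by simp
   define m where "m = e / (2 * norm x) - 1"
   have m: "0 <= m" "(1 + m) * norm x = e / 2" using True nx by (auto simp: m_def field_simps)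
   define r where "r = 1 + s * m"
   have r: "1 <= r" "r <= 1 + m" using s m mult_right_mono[of s 1 m] by (auto simp: r_def)
   have gr: "g s x = r *. x" using m by (simp add: g_def r_def m_def[symmetric] max_def)
   have xS: "x : S" using x by simp
   have "norm (r *. x) <= e / 2" using mult_right_mono[OF r(2), of "norm x"] m(2) r(1) by simp
   hence "F (r *. x) = F0 (r *. x)" using FF0[of "r *. x"] e xS S by (simp add: subspace_scale)
   also have "... = r^2 * F x" using homogeneous2D[OF hF0, of r x] r(1) FF0[OF xS] True e by simp
   also have "... <= 1 * F x" using x one_le_power[OF r(1), of 2] by (intro mult_right_mono_neg) auto
   finally show ?thesis using gr xS S by (simp add: subspace_scale)
  qed
  have g1: "e / 2 <= norm (g 1 x)" if x: "x : ?B" for x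
  proof (cases "norm x < e / 2")
   case False
   hence "e / (2 * norm x) - 1 <= 0" using x0[OF x] by (simp add: field_simps)
   thus ?thesis using False by (simp add: g_def)
  next
   case True
   hence "0 <= e / (2 * norm x) - 1" using x0[OF x] by (simp add: field_simps)
   thus ?thesis using x0[OF x] e by (simp add: g_def max_def)
  qed
  have gc: "continuous_on ({0..1} \<times> ?B) (%z. g (fst z) (snd z))" unfolding g_def by (intro continuous_intros) (use x0 in auto)
  show ?thesis unfolding A_def
  proof (rule hiso_deformation[where H="%s x. g s x - s *. v (g s x)"])
   have "continuous_on ({0..1} \<times> ?B) (%z. v (g (fst z) (snd z)))" by (rule continuous_on_compose2[OF P(3) gc]) (use g in auto)
   thus "continuous_on ({0..1} \<times> ?B) (%z. g (fst z) (snd z) - fst z *. v (g (fst z) (snd z)))" using gc by (intro continuous_intros)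
   have le: "g s x - s *. v (g s x) : S & F (g s x - s *. v (g s x)) <= F x"
    if s: "0 <= s" "s <= 1" and x: "x : ?B" for s x
   proof -
    have gs: "g s x : S" "F (g s x) <= F x" using g[OF s x] by auto
    show ?thesis using push_mono[OF gs(1) s] P(5)[OF gs(1) s] gs(2) by linarith
   qed
   show "g s x - s *. v (g s x) : ?B" if "0 <= s" "s <= 1" "x : ?B" for s x using le[OF that] that(3) by simp
   show "g s x - s *. v (g s x) : {x:S. F x < - c2}" if "0 <= s" "s <= 1" "x : {x:S. F x < - c2}" for s x
   proof -
    have "x : ?B" using that(3) c2 by simp
    from le[OF that(1,2) this] show ?thesis using that(3) by simp
   qed
   show "g 1 x - 1 *. v (g 1 x) : {x:S. F x < - c2}" if x: "x : ?B" for x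
   proof -
    have "(e / 2)^2 <= (norm (g 1 x))^2" using g1[OF x] e by (intro power_mono) auto
    hence "k * (e / 2)^2 <= k * (norm (g 1 x))^2" using k by (intro mult_left_mono) auto
    hence "F (g 1 x - 1 *. v (g 1 x)) <= F x - k * (e / 2)^2" using P(6)[of "g 1 x" 1] g[of 1 x, OF _ _ x] by simp
    moreover have "c2 < k * (e / 2)^2" using k e by (simp add: c2_def power2_eq_square)
    ultimately show ?thesis using le[of 1 x, OF _ _ x] x by simp
   qed
  qed (use c2 in \<open>auto simp: g_def\<close>)
 qed
 have h5: "hiso {x:S. F x < - c} p {x:S. F x < - c2} p"
 proof (rule pushable_levels[OF F])
  show "- c <= - c2" "0 < c2 / C" using c c2 C by auto
  show "c2 / C <= (norm x)^2" if "x : S" "F x < - c2" for x using Fnorm[OF _ that(1), of c2] that(2) by simp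
 qed
 have h6: "hiso {x:S. F x < - c} p {x:S. G x < - c} p" using c0[OF c(1)] by blast
 have h7: "hiso {x:S. G x < - c} p {x:S. G x < 0} p" by (rule homogeneous2_levels_below[OF S hG cG c(4)])
 have "hiso {x:S. F0 x < 0} p {x:S. F x < - c2} p" by (rule hiso_trans[OF hiso_sym[OF h1] hiso_trans[OF h3 hiso_sym[OF h4]]])
 thus ?thesis by (rule hiso_trans[OF _ hiso_trans[OF hiso_sym[OF h5] hiso_trans[OF h6 h7]]])
qed

section \<open>Functions with Lipschitz gradient\<close>

definition gradient_on :: "'a::real_inner set => ('a => real) => ('a => 'a) => bool" where
 "gradient_on S F g \<longleftrightarrow> (ALL x:S. (F has_derivative (%h. inner (g x) h)) (at x within S))"

lemma gradient_on_mvt: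
 assumes S: "convex S" and F: "gradient_on S F g" and x: "x : S" and y: "y : S"
 obtains t where "0 < t" "t < 1" "F y - F x = inner (g (x + t *. (y - x))) (y - x)"
proof -
 let ?c = "%t. x + t *. (y - x)"
 have c: "?c t : S" if "0 <= t" "t <= 1" for t using convexD_alt[OF S x y that] by (simp add: algebra_simps)
 have der: "((%t. F (?c t)) has_derivative (%h. inner (g (?c t)) (h *. (y - x)))) (at t within {0..1})"
  if "t : {0..1}" for t
 proof (rule has_derivative_in_compose2[of S F "%z h. inner (g z) h" "?c" "{0..1}" t "%h. h *. (y - x)"])
  show "(?c has_derivative (%h. h *. (y - x))) (at t within {0..1})" by (auto intro!: derivative_eq_intros)
 qed (use F c that in \<open>auto simp: gradient_on_def\<close>)
 have "EX t:{0<..<1}. F (?c 1) - F (?c 0) = inner (g (?c t)) ((1 - 0) *. (y - x))" by (rule mvt_simple[where f="%t. F (?c t)"]) (use der in auto)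
 thus thesis using that by auto
qed

text \<open>The mean value theorem stands in for the integral form of the remainder, at the price of
  \<open>L\<close> in place of \<open>L / 2\<close>.\<close>

lemma gradient_on_descent:
 assumes S: "convex S" and F: "gradient_on S F g" and L: "L-lipschitz_on S g"
  and x: "x : S" and y: "y : S"
 shows "F y <= F x + inner (g x) (y - x) + L * (norm (y - x))^2"
proof -
 obtain t where t: "0 < t" "t < 1" "F y - F x = inner (g (x + t *. (y - x))) (y - x)" using gradient_on_mvt[OF S F x y] by blast
 have z: "x + t *. (y - x) : S" using convexD_alt[OF S x y, of t] t by (simp add: algebra_simps)
 have "norm (g (x + t *. (y - x)) - g x) <= L * norm (t *. (y - x))" using lipschitz_onD[OF L z x] by (simp add: dist_norm)
 also have "... <= L * norm (y - x)" using t lipschitz_on_nonneg[OF L] by (intro mult_left_mono) (auto intro: mult_left_le_one_le)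
 finally have "inner (g (x + t *. (y - x)) - g x) (y - x) <= L * norm (y - x) * norm (y - x)" using norm_cauchy_schwarz[of "g (x + t *. (y - x)) - g x" "y - x"]
   mult_right_mono[of "norm (g (x + t *. (y - x)) - g x)" "L * norm (y - x)" "norm (y - x)"] by simp
 thus ?thesis using t(3) by (simp add: inner_diff_left power2_eq_square)
qed

lemma gradient_on_bound:
 assumes S: "subspace S" and F: "gradient_on S F g" and L: "L-lipschitz_on S g" and F0: "F 0 = 0" and g0: "g 0 = 0"
  and x: "x : S"
 shows "norm (g x) <= L * norm x" "\<bar>F x\<bar> <= L * (norm x)^2"
proof -
 have b: "norm (g y) <= L * norm y" if "y : S" for y using lipschitz_onD[OF L that subspace_0[OF S]] g0 by (simp add: dist_norm)
 thus "norm (g x) <= L * norm x" using x .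
 obtain t where t: "0 < t" "t < 1" "F x - F 0 = inner (g (0 + t *. (x - 0))) (x - 0)" using gradient_on_mvt[OF subspace_imp_convex[OF S] F subspace_0[OF S] x] by blast
 have "\<bar>F x\<bar> <= norm (g (t *. x)) * norm x" using t F0 Cauchy_Schwarz_ineq2 by simp
 also have "... <= (L * norm (t *. x)) * norm x" using b[of "t *. x"] x S by (intro mult_right_mono) (auto simp: subspace_scale)
 also have "... <= (L * norm x) * norm x" using t lipschitz_on_nonneg[OF L] by (intro mult_right_mono mult_left_mono) (auto intro: mult_left_le_one_le)
 finally show "\<bar>F x\<bar> <= L * (norm x)^2" by (simp add: power2_eq_square mult.assoc)
qed

lemma gradient_on_continuous: "gradient_on S F g ==> continuous_on S F" unfolding gradient_on_def by (meson has_derivative_continuous_on)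

text \<open>With the step \<open>1 / (2 * L)\<close> along the gradient the quadratic error is at
  most half of the linear gain; the lower bound on the gradient turns the rest into a multiple of
  the squared norm.\<close>

lemma pushable_gradient:
 assumes S: "subspace S" and F: "gradient_on S F g" and L: "L-lipschitz_on S g" "0 < L"
  and g: "!!x. x : S ==> g x : S" and g0: "g 0 = 0" and r: "0 < r" "!!x. x : S ==> r * norm x <= norm (g x)"
 shows "pushable S F (%x. (1 / (2 * L)) *. g x) (r^2 / (4 * L)) (1 / 2)" unfolding pushable_def
proof (intro conjI ballI allI impI)
 show "0 < r^2 / (4 * L)" using r L by simp
 show "continuous_on S (%x. (1 / (2 * L)) *. g x)" by (intro continuous_intros lipschitz_on_continuous_on[OF L(1)])
 fix x assume x: "x : S"
 have gx: "norm (g x) <= L * norm x" using lipschitz_onD[OF L(1) x subspace_0[OF S]] g0 by (simp add: dist_norm)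
 thus "norm ((1 / (2 * L)) *. g x) <= 1 / 2 * norm x" using L by (simp add: field_simps)
 fix s :: real assume s: "0 <= s" "s <= 1"
 show yS: "x - s *. (1 / (2 * L)) *. g x : S" using S x g by (simp add: subspace_scale subspace_diff)
 let ?G = "(norm (g x))^2"
 have "F (x - s *. (1 / (2 * L)) *. g x) <= F x - s / (2 * L) * ?G + L * (s / (2 * L))^2 * ?G" using gradient_on_descent[OF subspace_imp_convex[OF S] F L(1) x yS] s L
  by (simp add: power_mult_distrib dot_square_norm power_divide)
 also have "... = F x - s / (4 * L) * ?G * (2 - s)" using L by (simp add: field_simps power2_eq_square)
 also have "... <= F x - s / (4 * L) * ?G * 1" using s L by (intro diff_left_mono mult_left_mono) auto
 also have "... <= F x - s / (4 * L) * (r^2 * (norm x)^2)"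
 proof -
  have "(r * norm x)^2 <= ?G" using r x by (intro power_mono) auto
  hence "s / (4 * L) * (r^2 * (norm x)^2) <= s / (4 * L) * ?G" using s L by (intro mult_left_mono) (auto simp: power_mult_distrib)
  thus ?thesis by simp
 qed
 finally show "F (x - s *. (1 / (2 * L)) *. g x) <= F x - s * (r^2 / (4 * L)) * (norm x)^2" by simp
qed auto

text \<open>Here \<open>F\<close> is replaced near \<open>0\<close> by the homogeneous \<open>F0\<close>, using a cutoff that is only Lipschitz: the
  push along the gradient of \<open>F\<close> still decreases the interpolated function.\<close>

lemma hiso_critical_point:
 assumes S: "subspace S"
  and F: "gradient_on S F g" "L-lipschitz_on S g" "F 0 = 0" "g 0 = 0"
   "!!x. x : S ==> g x : S" "!!x. x : S ==> r * norm x <= norm (g x)"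
  and G: "gradient_on S G h" "L-lipschitz_on S h" "homogeneous2 G" "h 0 = 0"
   "!!x. x : S ==> h x : S" "!!x. x : S ==> r * norm x <= norm (h x)"
  and F0: "gradient_on S F0 g0" "homogeneous2 F0"
  and r: "0 < r" and gh: "!!x. x : S ==> norm (g x - h x) <= K"
  and gg0: "!!d. 0 < d ==> EX e>0. ALL x:S. norm x <= e --> norm (g x - g0 x) <= d * norm x"
 shows "hiso {x:S. F0 x < 0} p {x:S. G x < 0} p"
proof -
 note cS = subspace_imp_convex[OF S]
 define M where "M = max 1 L"
 have M: "1 <= M" "0 < M" "L <= M" by (auto simp: M_def)
 have FM: "M-lipschitz_on S g" and GM: "M-lipschitz_on S h" using F(2) G(2) M(3) by (auto intro: lipschitz_on_mono)
 define k where "k = r^2 / (4 * M)"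
 have k: "0 < k" using r M by (simp add: k_def)
 let ?v = "%x. (1 / (2 * M)) *. g x"
 have pF: "pushable S F ?v k (1 / 2)" unfolding k_def by (rule pushable_gradient[OF S F(1) FM M(2) F(5,4) r F(6)])
 have pG: "pushable S G (%x. (1 / (2 * M)) *. h x) k (1 / 2)" unfolding k_def by (rule pushable_gradient[OF S G(1) GM M(2) G(5,4) r G(6)])
 note P = pushableD[OF pF]
 define R where "R x = F x - F0 x" for x
 have R: "gradient_on S R (%x. g x - g0 x)" using F(1) F0(1) unfolding gradient_on_def R_def inner_diff_left by (auto intro!: has_derivative_diff)
 \<comment> \<open>The change of the correction term along a push is bounded by
   \<open>3 * s * d * (norm x)^2\<close>, and half of the decrease of \<open>F\<close> is given up
   for it; hence \<open>k / 6\<close>.\<close>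
 define d where "d = min 1 (k / 6)"
 have d: "0 < d" "d <= k / 6" "d <= 1" using k by (auto simp: d_def)
 obtain e1 where e1: "0 < e1" "!!x. x : S ==> norm x <= e1 ==> norm (g x - g0 x) <= d * norm x" using gg0[OF d(1)] by blast
 \<comment> \<open>A push from a point of norm at most \<open>4 * e\<close> stays within norm
   \<open>8 * e\<close>, the region in which \<open>g\<close> and \<open>g0\<close> have been
   compared.\<close>
 define e where "e = e1 / 8"
 have e: "0 < e" using e1 by (simp add: e_def)
 have R_0: "R 0 = 0" using F(3) homogeneous2_0[OF F0(2)] by (simp add: R_def)
 have R_diff: "\<bar>R y - R x\<bar> <= d * m * norm (y - x)"
  if xy: "x : S" "y : S" "norm x <= m" "norm y <= m" "m <= e1" for x y m
 proof -
  obtain t where t: "0 < t" "t < 1" "R y - R x = inner (g (x + t *. (y - x)) - g0 (x + t *. (y - x))) (y - x)" using gradient_on_mvt[OF cS R xy(1,2)] by blast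
  let ?z = "x + t *. (y - x)"
  have z: "?z = (1 - t) *. x + t *. y" by (simp add: algebra_simps)
  have zS: "?z : S" unfolding z using convexD_alt[OF cS xy(1,2), of t] t by simp
  have "norm ?z <= (1 - t) * norm x + t * norm y" unfolding z using norm_triangle_ineq[of "(1 - t) *. x" "t *. y"] t by simp
  also have "... <= (1 - t) * m + t * m" using xy t by (intro add_mono mult_left_mono) auto
  finally have zm: "norm ?z <= m" by (simp add: algebra_simps)
  have "\<bar>R y - R x\<bar> <= norm (g ?z - g0 ?z) * norm (y - x)" using t(3) Cauchy_Schwarz_ineq2 by simp
  also have "... <= (d * norm ?z) * norm (y - x)" using e1(2)[OF zS] zm xy(5) by (intro mult_right_mono) auto
  also have "... <= d * m * norm (y - x)" using zm d(1) by (intro mult_right_mono mult_left_mono) auto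
  finally show ?thesis .
 qed
 have R_bound: "\<bar>R x\<bar> <= d * (norm x)^2" if "x : S" "norm x <= e1" for x
  using R_diff[OF subspace_0[OF S] that(1) _ order_refl that(2)] R_0 by (simp add: power2_eq_square mult.assoc)
 \<comment> \<open>Equal to 1 up to norm \<open>e\<close> and to 0 from \<open>2 * e\<close> on. The
   slope \<open>1 / e\<close> is harmless because \<open>R\<close> is quadratically small near
   0.\<close>
 define c where "c x = max 0 (min 1 (2 - norm x / e))" for x :: 'a
 have c01: "0 <= c x" "c x <= 1" for x by (auto simp: c_def)
 have c0: "c x = 0" if "2 * e <= norm x" for x using that e by (simp add: c_def field_simps)
 have c1: "c x = 1" if "norm x <= e" for x using that e by (simp add: c_def field_simps)
 have c_lip: "\<bar>c y - c x\<bar> <= norm (y - x) / e" for x y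
 proof -
  have "\<bar>c y - c x\<bar> <= \<bar>norm y / e - norm x / e\<bar>" by (auto simp: c_def)
  also have "... = \<bar>norm y - norm x\<bar> / e" using e by (simp add: diff_divide_distrib[symmetric])
  also have "... <= norm (y - x) / e" using e by (intro divide_right_mono norm_triangle_ineq3) auto
  finally show ?thesis .
 qed
 define X where "X x = F x - c x * R x" for x
 have cR: "\<bar>c x * R x\<bar> <= d * (norm x)^2" "\<bar>c x * R x\<bar> <= d * (2 * e)^2" if x: "x : S" for x
 proof -
  have "\<bar>c x * R x\<bar> <= d * (norm x)^2 & \<bar>c x * R x\<bar> <= d * (2 * e)^2"
  proof (cases "2 * e <= norm x")
   case False
   have "\<bar>c x * R x\<bar> <= 1 * \<bar>R x\<bar>" using c01[of x] by (simp add: abs_mult mult_left_le_one_le)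
   also have "... <= d * (norm x)^2" using R_bound[OF x] False e_def e by simp
   finally have 1: "\<bar>c x * R x\<bar> <= d * (norm x)^2" .
   also have "... <= d * (2 * e)^2" using False d(1) by (intro mult_left_mono power_mono) auto
   finally show ?thesis using 1 by blast
  qed (use c0 d in simp)
  thus "\<bar>c x * R x\<bar> <= d * (norm x)^2" "\<bar>c x * R x\<bar> <= d * (2 * e)^2" by blast+
 qed
 have pX: "pushable S X ?v (k / 2) (1 / 2)" unfolding pushable_def
 proof (intro conjI ballI allI impI)
  fix x and s :: real assume x: "x : S" and s: "0 <= s" "s <= 1"
  let ?y = "x - s *. ?v x"
  show yS: "?y : S" by (rule P(5)[OF x s])
  have "norm (?y - x) = s * norm (?v x)" using s by simp
  also have "... <= s * (1 / 2 * norm x)" using P(4)[OF x] s by (intro mult_left_mono)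
  finally have yx: "norm (?y - x) <= s * norm x / 2" by simp
  have "s * norm x <= norm x" using s by (simp add: mult_left_le_one_le)
  hence yx2: "norm (?y - x) <= norm x / 2" using yx by simp
  have yn: "norm ?y <= 2 * norm x" "norm x / 2 <= norm ?y"
   using yx2 norm_triangle_sub[of ?y x] norm_triangle_sub[of x ?y] norm_ge_zero[of x] by (auto simp: norm_minus_commute)
  have diff: "\<bar>c ?y * R ?y - c x * R x\<bar> <= s * (k / 2) * (norm x)^2"
  proof (cases "norm x <= 4 * e")
   case False
   hence "c x = 0" "c ?y = 0" using yn e by (auto intro!: c0)
   thus ?thesis using s k by simp
  next
   case True
   have x1: "norm x <= e1" "2 * norm x <= e1" using True e by (auto simp: e_def)
   have "\<bar>c ?y * (R ?y - R x)\<bar> <= \<bar>R ?y - R x\<bar>" using c01[of ?y] by (simp add: abs_mult mult_left_le_one_le)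
   also have "... <= d * (2 * norm x) * norm (?y - x)" using R_diff[OF x yS _ yn(1) x1(2)] by simp
   also have "... <= d * (2 * norm x) * (s * norm x / 2)" using yx d by (intro mult_left_mono) auto
   finally have 1: "\<bar>c ?y * (R ?y - R x)\<bar> <= s * d * (norm x)^2" by (simp add: power2_eq_square algebra_simps)
   have "\<bar>(c ?y - c x) * R x\<bar> <= (norm (?y - x) / e) * (d * (norm x)^2)" unfolding abs_mult by (rule mult_mono[OF c_lip R_bound[OF x x1(1)]]) (use e in auto)
   also have "... <= ((s * (4 * e) / 2) / e) * (d * (norm x)^2)"
   proof (intro mult_right_mono divide_right_mono)
    have "s * norm x / 2 <= s * (4 * e) / 2" using True s by (intro divide_right_mono mult_left_mono) auto
    thus "norm (?y - x) <= s * (4 * e) / 2" using yx by linarith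
   qed (use d e in auto)
   also have "... = 2 * (s * d * (norm x)^2)" using e by simp
   finally have 2: "\<bar>(c ?y - c x) * R x\<bar> <= 2 * (s * d * (norm x)^2)" .
   have "c ?y * R ?y - c x * R x = c ?y * (R ?y - R x) + (c ?y - c x) * R x" by (simp add: algebra_simps)
   hence "\<bar>c ?y * R ?y - c x * R x\<bar> <= 3 * (s * d * (norm x)^2)" using 1 2 by linarith
   also have "... <= 3 * (s * (k / 6) * (norm x)^2)" using d(2) s by (intro mult_left_mono mult_right_mono) auto
   finally show ?thesis by (simp add: ac_simps)
  qed
  have "X ?y - X x = (F ?y - F x) - (c ?y * R ?y - c x * R x)" by (simp add: X_def)
  also have "... <= - s * k * (norm x)^2 + s * (k / 2) * (norm x)^2" using P(6)[OF x s] diff by linarith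
  finally show "X ?y <= X x - s * (k / 2) * (norm x)^2" by (simp add: algebra_simps)
 qed (use P k in auto)
 define C where "C = M + 1"
 have G0: "G 0 = 0" by (rule homogeneous2_0[OF G(3)])
 have FM2: "\<bar>F x\<bar> <= M * (norm x)^2" and GM2: "\<bar>G x\<bar> <= M * (norm x)^2" if "x : S" for x
  using gradient_on_bound(2)[OF S F(1) FM F(3,4) that] gradient_on_bound(2)[OF S G(1) GM G0 G(4) that] .
 have FG: "\<bar>F x - G x\<bar> <= K * norm x" if x: "x : S" for x
 proof -
  have "gradient_on S (%x. F x - G x) (%x. g x - h x)" using F(1) G(1) unfolding gradient_on_def inner_diff_left by (auto intro!: has_derivative_diff)
  from gradient_on_mvt[OF cS this subspace_0[OF S] x] obtain t where t: "0 < t" "t < 1"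
   "F x - G x = inner (g (t *. x) - h (t *. x)) x" using F(3) G0 by auto
  hence "\<bar>F x - G x\<bar> <= norm (g (t *. x) - h (t *. x)) * norm x" using Cauchy_Schwarz_ineq2 by simp
  also have "... <= K * norm x" using gh[of "t *. x"] x S by (intro mult_right_mono) (auto simp: subspace_scale)
  finally show ?thesis .
 qed
 show ?thesis
 proof (rule hiso_local_global[where F=X and v="?v" and k="k / 2" and C=C and w="%x. (1 / (2 * M)) *. h x",
    OF S _ _ _ _ _ _ _ G(3) F0(2) e])
  show "pushable S X ?v (k / 2) C" by (rule pushable_mono[OF pX]) (use k M in \<open>auto simp: C_def\<close>)
  show "pushable S G (%x. (1 / (2 * M)) *. h x) (k / 2) C" by (rule pushable_mono[OF pG]) (use k M in \<open>auto simp: C_def\<close>)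
  show "1 <= C" using M by (simp add: C_def)
  show "continuous_on S G" by (rule gradient_on_continuous[OF G(1)])
  show "continuous_on S X" unfolding X_def R_def c_def using e by (intro continuous_intros gradient_on_continuous[OF F(1)] gradient_on_continuous[OF F0(1)]) auto
  fix x assume x: "x : S"
  have "d * (norm x)^2 <= 1 * (norm x)^2" using d(3) by (intro mult_right_mono) auto
  hence "\<bar>X x\<bar> <= M * (norm x)^2 + (norm x)^2" using FM2[OF x] cR(1)[OF x] unfolding X_def by linarith
  thus "\<bar>X x\<bar> <= C * (norm x)^2" by (simp add: C_def algebra_simps)
  show "\<bar>G x\<bar> <= C * (norm x)^2" using GM2[OF x] zero_le_power2[of "norm x"] unfolding C_def distrib_right by linarith
  show "X x = F0 x" if "norm x <= e" using c1[OF that] by (simp add: X_def R_def)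
 next
  fix b :: real assume b: "0 < b"
  have "\<bar>X x - G x\<bar> <= b * (norm x)^2 + (K^2 / b + d * (2 * e)^2)" if x: "x : S" for x
  proof -
   have "2 * ((b * norm x) * K) <= (b * norm x)^2 + K^2" using zero_le_power2[of "b * norm x - K"] by (simp add: power2_eq_square algebra_simps)
   hence "(b * norm x) * K <= (b * norm x)^2 + K^2" using zero_le_power2[of "b * norm x"] zero_le_power2[of K] by linarith
   hence "b * (K * norm x) <= b * (b * (norm x)^2 + K^2 / b)" using b by (simp add: power2_eq_square algebra_simps)
   hence "K * norm x <= b * (norm x)^2 + K^2 / b" using b by simp
   moreover have "X x - G x = (F x - G x) - c x * R x" by (simp add: X_def)
   ultimately show ?thesis using FG[OF x] cR(2)[OF x] by linarith
  qed
  thus "EX K. ALL x:S. \<bar>X x - G x\<bar> <= b * (norm x)^2 + K" by blast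
 qed
qed

subsection \<open>Adding a nondegenerate quadratic form\<close>

text \<open>A positive square is retracted away. A negative one suspends: the parts with
  \<open>c x > 0\<close> and with \<open>c x < 0\<close>, each enlarged by the points whose
  projection along \<open>u\<close> has negative \<open>F\<close>, are star-shaped about
  \<open>u\<close> and \<open>- u\<close>, and they meet in a set that retracts onto the slice
  \<open>c x = 0\<close>.\<close>

lemma hiso_add_line:
 fixes F :: "'a::real_normed_vector => real"
 assumes T: "subspace T" and u: "u : T" and c: "linear c" "continuous_on T c" "c u = 1"
  and F: "continuous_on T F" and hF: "homogeneous2 F"
  and Fq: "!!x. x : T ==> F x = F (x - c x *. u) + b * (c x)^2"
 shows "0 < b ==> hiso {x:T. c x = 0 & F x < 0} p {x:T. F x < 0} p"
  and "b < 0 ==> hiso {x:T. c x = 0 & F x < 0} p {x:T. F x < 0} (p + 1)"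
proof -
 let ?r = "%x. x - c x *. u"
 have rT: "x - t *. u : T" if "x : T" for x t using T u that by (simp add: subspace_diff subspace_scale)
 have cr: "c (x - t *. u) = c x - t" for x t using c by (simp add: linear_diff linear_cmul)
 have split: "F (x - t *. u) = F (?r x) + b * (c x - t)^2" if "x : T" for x t using Fq[OF rT[OF that, of t]] by (simp add: cr algebra_simps)
 have cont: "continuous_on ({0..1} \<times> {x:T. P x}) (%z. snd z - (fst z * c (snd z)) *. u)" for P by (intro continuous_intros continuous_on_compose2[OF c(2)]) auto
 {
  assume b: "0 < b"
  show "hiso {x:T. c x = 0 & F x < 0} p {x:T. F x < 0} p"
  proof (rule hiso_deformation[where H="%s x. x - (s * c x) *. u"])
   show "continuous_on ({0..1} \<times> {x:T. F x < 0}) (%z. snd z - (fst z * c (snd z)) *. u)" by (rule cont)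
   show "x - (s * c x) *. u : {x:T. F x < 0}" if s: "0 <= s" "s <= 1" and x: "x : {x:T. F x < 0}" for s x
   proof -
    have "(1 - s)^2 <= 1" using s by (simp add: power_le_one)
    hence "b * ((1 - s)^2 * (c x)^2) <= b * (1 * (c x)^2)" using b by (intro mult_left_mono mult_right_mono) auto
    moreover have "(c x - s * c x)^2 = (1 - s)^2 * (c x)^2" by (simp add: power2_eq_square algebra_simps)
    ultimately show ?thesis using split[of x "s * c x"] Fq[of x] x rT by simp
   qed
   show "x - (1 * c x) *. u : {x:T. c x = 0 & F x < 0}" if x: "x : {x:T. F x < 0}" for x
   proof -
    have "0 <= b * (c x)^2" using b by simp
    thus ?thesis using Fq[of x] x rT by (simp add: cr)
   qed
  qed (auto simp: cr)
 }
 {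
  assume b: "b < 0"
  let ?X = "{x:T. F x < 0}"
  define A where "A = {x:T. F x < 0 & (0 < c x | F (?r x) < 0)}"
  define B where "B = {x:T. F x < 0 & (c x < 0 | F (?r x) < 0)}"
  have Fle: "F x <= F (?r x)" if "x : T" for x using Fq[OF that] b by (simp add: mult_nonpos_nonneg)
  have AB: "A Un B = ?X"
  proof (intro equalityI subsetI)
   fix x assume x: "x : ?X"
   thus "x : A Un B" using Fq[of x] by (cases "c x = 0") (auto simp: A_def B_def)
  qed (auto simp: A_def B_def)
  have AiB: "A Int B = {x:T. F (?r x) < 0}" using Fle by (auto simp: A_def B_def) force+
  have cFr: "continuous_on T (%x. F (?r x))" by (rule continuous_on_compose2[OF F]) (use c rT in \<open>auto intro!: continuous_intros\<close>)
  have oA: "openin (top_of_set T) A"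
  proof -
   have "A = {x:T. F x < 0} Int ({x:T. - c x < 0} Un {x:T. F (?r x) < 0})" by (auto simp: A_def)
   thus ?thesis by (simp only:) (intro openin_Int openin_Un openin_sublevel continuous_on_minus F c cFr)
  qed
  have oB: "openin (top_of_set T) B"
  proof -
   have "B = {x:T. F x < 0} Int ({x:T. c x < 0} Un {x:T. F (?r x) < 0})" by (auto simp: B_def)
   thus ?thesis by (simp only:) (intro openin_Int openin_Un openin_sublevel F c cFr)
  qed
  have sub: "A Un B <= T" by (auto simp: A_def B_def)
  have half: "acyclic_set {x:T. F x < 0 & (0 < e * c x | F (?r x) < 0)}" if e: "\<bar>e\<bar> = 1" for e
  proof (rule acyclic_starlike[of "e *. u"])
   have ee: "e * e = 1" using e by (auto simp: abs_if split: if_splits)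
   have F0: "F 0 = 0" by (rule homogeneous2_0[OF hF])
   have ceu: "c (e *. u) = e" using c by (simp add: linear_cmul)
   have "F (e *. u) = b" using Fq[of "e *. u"] T u ceu ee F0 by (simp add: subspace_scale power2_eq_square)
   thus base: "e *. u : {x:T. F x < 0 & (0 < e * c x | F (?r x) < 0)}" using b T u ceu ee by (simp add: subspace_scale)
   fix x and s :: real assume x: "x : {x:T. F x < 0 & (0 < e * c x | F (?r x) < 0)}" and s: "0 <= s" "s <= 1"
   let ?y = "(1 - s) *. e *. u + s *. x"
   have yT: "?y : T" using x T u by (simp add: subspace_add subspace_scale)
   have cy: "c ?y = (1 - s) * e + s * c x" using c by (simp add: linear_add linear_cmul)
   have ry: "?r ?y = s *. ?r x" unfolding cy by (simp add: algebra_simps)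
   have Fry: "F (?r ?y) = s^2 * F (?r x)" unfolding ry by (rule homogeneous2D[OF hF s(1)])
   show "?y : {x:T. F x < 0 & (0 < e * c x | F (?r x) < 0)}"
   proof (cases "s = 0")
    case True
    thus ?thesis using base by simp
   next
    case False
    hence s0: "0 < s" using s by simp
    show ?thesis
    proof (cases "F (?r x) < 0")
     case True
     hence "F (?r ?y) < 0" using Fry s0 by (simp add: mult_pos_neg)
     thus ?thesis using Fle[OF yT] yT by auto
    next
     case False
     hence ec: "0 < e * c x" using x by simp
     have eey: "e * c ?y = (1 - s) + s * (e * c x)" unfolding cy using ee by (simp add: algebra_simps)
     have pos: "0 < e * c ?y" using ec s s0 unfolding eey by (simp add: add_nonneg_pos)
     have sq: "(e * z)^2 = z^2" for z using ee by (simp add: power_mult_distrib power2_eq_square)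
     have "s * (e * c x) <= e * c ?y" using s eey by simp
     hence "(s * (e * c x))^2 <= (e * c ?y)^2" using s0 ec by (intro power_mono) auto
     hence "s^2 * (c x)^2 <= (c ?y)^2" unfolding power_mult_distrib[of s] sq .
     hence "b * (c ?y)^2 <= b * (s^2 * (c x)^2)" using b by (intro mult_left_mono_neg) auto
     hence "F ?y <= s^2 * F (?r x) + b * (s^2 * (c x)^2)" using Fq[OF yT] Fry by simp
     also have "... = s^2 * F x" using Fq[of x] x by (simp add: algebra_simps)
     also have "... < 0" using x s0 by (simp add: mult_pos_neg)
     finally show ?thesis using yT pos by simp
    qed
   qed
  qed
  have "acyclic_set A" "acyclic_set B" using half[of 1] half[of "-1"] by (simp_all add: A_def B_def)
  hence "hiso (A Int B) p (A Un B) (p + 1)" by (intro hiso_suspension openin_subset_trans[OF oA _ sub] openin_subset_trans[OF oB _ sub]) auto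
  moreover have "hiso {x:T. c x = 0 & F x < 0} p (A Int B) p" unfolding AiB
  proof (rule hiso_deformation[where H="%s x. x - (s * c x) *. u"])
   show "continuous_on ({0..1} \<times> {x:T. F (?r x) < 0}) (%z. snd z - (fst z * c (snd z)) *. u)" by (rule cont)
   show "x - (s * c x) *. u : {x:T. F (?r x) < 0}" if "x : {x:T. F (?r x) < 0}" for s x using that rT by (simp add: cr algebra_simps)
  qed (use rT in \<open>auto simp: cr\<close>)
  ultimately show "hiso {x:T. c x = 0 & F x < 0} p {x:T. F x < 0} (p + 1)" unfolding AB by (rule hiso_trans[rotated])
 }
qed

lemma subspace_basis_exists:
 fixes W :: "'a::real_vector set"
 assumes "subspace W" "finite B0" "W <= span B0"
 obtains B where "finite B" "independent B" "B <= W" "span B = W"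
proof -
 obtain B where B: "B <= W" "independent B" "W <= span B" by (rule maximal_independent_subset)
 hence "B <= span B0" using assms by blast
 hence "finite B" using independent_span_bound[OF assms(2) B(2)] by blast
 moreover have "span B = W" using B assms(1) span_minimal by blast
 ultimately show thesis using that B by blast
qed

text \<open>Induction on the dimension of \<open>W\<close>. Nondegeneracy and polarisation provide a
  vector with \<open>b u u ~= 0\<close>; its orthogonal complement inherits all hypotheses, and
  \<open>hiso_add_line\<close> restores \<open>u\<close>. Thus \<open>i\<close> counts negative
  squares. It is evaluated only for negative semidefinite \<open>b\<close>, which yields the
  homology of spheres.\<close>

lemma hiso_add_quadratic:
 fixes f :: "'a::real_normed_vector => real" and b :: "'a => 'a => real"
 assumes b: "bounded_bilinear b" and sym: "!!x y. b x y = b y x"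
  and f: "continuous_on UNIV f" and hf: "homogeneous2 f"
 shows "subspace T ==> subspace W ==> W <= T ==> finite B ==> independent B ==> span B = W ==> card B = n ==>
  (!!x w. w : W ==> f (x + w) = f x) ==> (!!w. w : W ==> (!!w'. w' : W ==> b w w' = 0) ==> w = 0) ==>
  (!!x. x : T ==> (!!w. w : W ==> b x w = 0) ==> b x x = 0) ==>
  EX i. (ALL p. hiso {x:T. f x < 0 & (ALL w:W. b x w = 0)} p {x:T. f x + b x x < 0} (p + int i)) &
   ((ALL w:W. b w w <= 0) --> i = n)"
proof (induction n arbitrary: T W B)
 case 0
 hence W: "W = {0}" by simp
 interpret bounded_bilinear b by (rule b)
 have "b x x = 0" if "x : T" for x using 0(10)[OF that] W by (simp add: zero_right)
 hence "{x:T. f x < 0 & (ALL w:W. b x w = 0)} = {x:T. f x + b x x < 0}" using W by (auto simp: zero_right)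
 thus ?case by (intro exI[of _ 0]) (auto simp: hiso_refl)
next
 case (Suc n)
 interpret bounded_bilinear b by (rule b)
 note T = Suc.prems(1) and W = Suc.prems(2) and WT = Suc.prems(3) and B = Suc.prems(4-7)
  and fW = Suc.prems(8) and nd = Suc.prems(9) and rad = Suc.prems(10)
 obtain w0 where w0: "w0 : W" "w0 ~= 0"
 proof -
  have "B ~= {}" using B by auto
  then obtain w where "w : B" by blast
  moreover have "w ~= 0" using B(2) \<open>w : B\<close> dependent_zero by blast
  ultimately show thesis using that B(3) span_base by blast
 qed
 have "EX u:W. b u u ~= 0"
 proof (rule ccontr)
  assume none: "\<not> (EX u:W. b u u ~= 0)"
  have z: "b w w = 0" if "w : W" for w using none that by blast
  have "b w0 w' = 0" if "w' : W" for w'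
  proof -
   have "b (w0 + w') (w0 + w') = 0" using z W w0 that by (simp add: subspace_add)
   thus ?thesis using z[OF w0(1)] z[OF that] sym[of w' w0] by (simp add: add_left add_right)
  qed
  thus False using nd[OF w0(1)] w0(2) by blast
 qed
 then obtain u where u: "u : W" "b u u ~= 0" by blast
 define c where "c x = b x u / b u u" for x
 have lc: "linear c" unfolding c_def by (rule linearI) (simp_all add: add_left scaleR_left add_divide_distrib)
 have cc: "continuous_on S c" for S unfolding c_def using u by (intro continuous_intros) (auto intro: bounded_linear.continuous_on[OF bounded_linear_left])
 have cu: "c u = 1" using u by (simp add: c_def)
 define T' where "T' = {x:T. c x = 0}"
 define W' where "W' = {x:W. c x = 0}"
 have T': "subspace T'" using T lc by (auto simp: T'_def subspace_def linear_add linear_cmul linear_0)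
 have W': "subspace W'" using W lc by (auto simp: W'_def subspace_def linear_add linear_cmul linear_0)
 have c0: "c x = 0 \<longleftrightarrow> b x u = 0" for x using u by (simp add: c_def)
 have dec: "w - c w *. u : W'" if "w : W" for w using that u W lc cu by (auto simp: W'_def subspace_diff subspace_scale linear_diff linear_cmul)
 have perp: "(ALL w:W. b x w = 0) \<longleftrightarrow> c x = 0 & (ALL w:W'. b x w = 0)" for x
 proof
  assume "c x = 0 & (ALL w:W'. b x w = 0)"
  hence x: "b x u = 0" "!!w. w : W' ==> b x w = 0" using c0 by auto
  show "ALL w:W. b x w = 0"
  proof
   fix w assume "w : W"
   hence "b x (w - c w *. u) = 0" using x(2) dec by blast
   thus "b x w = 0" using x(1) by (simp add: diff_right scaleR_right)
  qed
 qed (use u c0 in \<open>auto simp: W'_def\<close>)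
 obtain B' where B': "finite B'" "independent B'" "B' <= W'" "span B' = W'" using subspace_basis_exists[OF W' B(1)] B(3) by (auto simp: W'_def)
 have uB': "u ~: span B'" using B'(4) cu by (auto simp: W'_def)
 have ind: "independent (insert u B')" using B'(2) uB' by (simp add: independent_insert)
 have sp: "W <= span (insert u B')"
 proof
  fix w assume "w : W"
  hence "w - c w *. u : span B'" using dec B'(4) by blast
  thus "w : span (insert u B')" by (auto simp: span_insert)
 qed
 have "card (insert u B') <= card B" using independent_span_bound[OF B(1) ind] u B(3) B'(3) by (auto simp: W'_def)
 moreover have "card B <= card (insert u B')" using independent_span_bound[of "insert u B'" B] B sp B'(1) span_superset[of B] by auto
 moreover have "u ~: B'" using uB' span_base by blast
 ultimately have card: "card B' = n" using B'(1) B(4) by simp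
 have "EX i. (ALL p. hiso {x:T'. f x < 0 & (ALL w:W'. b x w = 0)} p {x:T'. f x + b x x < 0} (p + int i)) &
   ((ALL w:W'. b w w <= 0) --> i = n)"
 proof (rule Suc.IH[OF T' W' _ B'(1,2,4) card])
  show "W' <= T'" using WT by (auto simp: T'_def W'_def)
  show "f (x + w) = f x" if "w : W'" for x w using fW that by (auto simp: W'_def)
  show "w = 0" if w: "w : W'" and z: "!!w'. w' : W' ==> b w w' = 0" for w
  proof (rule nd)
   show "w : W" using w by (simp add: W'_def)
   have "c w = 0" using w by (simp add: W'_def)
   thus "b w w' = 0" if "w' : W" for w' using perp[of w] z that by blast
  qed
  show "b x x = 0" if "x : T'" "!!w. w : W' ==> b x w = 0" for x
  proof (rule rad)
   show "x : T" using that by (simp add: T'_def)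
   have "c x = 0" using that by (simp add: T'_def)
   thus "b x w = 0" if "w : W" for w using perp[of x] \<open>!!w. w : W' ==> b x w = 0\<close> that by blast
  qed
 qed
 then obtain i where i: "!!p. hiso {x:T'. f x < 0 & (ALL w:W'. b x w = 0)} p {x:T'. f x + b x x < 0} (p + int i)"
  "(ALL w:W'. b w w <= 0) ==> i = n" by blast
 have eq1: "{x:T'. f x < 0 & (ALL w:W'. b x w = 0)} = {x:T. f x < 0 & (ALL w:W. b x w = 0)}" using perp by (auto simp: T'_def)
 let ?F = "%x. f x + b x x"
 have eq2: "{x:T'. ?F x < 0} = {x:T. c x = 0 & ?F x < 0}" by (auto simp: T'_def)
 have uT: "u : T" using u WT by blast
 have FT: "continuous_on T ?F" by (intro continuous_intros continuous_on_subset[OF f] continuous_on) auto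
 have hF: "homogeneous2 ?F" using hf by (auto simp: homogeneous2_def scaleR_left scaleR_right power2_eq_square algebra_simps)
 have Fq: "?F x = ?F (x - c x *. u) + b u u * (c x)^2" if "x : T" for x
 proof -
  have "f (x - c x *. u) = f x" using fW[of "- (c x *. u)" x] W u by (simp add: subspace_neg subspace_scale)
  moreover have "b x u = c x * b u u" using u by (simp add: c_def)
  ultimately show ?thesis by (simp add: diff_left diff_right scaleR_left scaleR_right sym[of u x] power2_eq_square algebra_simps)
 qed
 note line = hiso_add_line[OF T uT lc cc cu FT hF Fq]
 show ?case
 proof (cases "0 < b u u")
  case True
  show ?thesis
  proof (intro exI[of _ i] conjI allI impI)
   show "hiso {x:T. f x < 0 & (ALL w:W. b x w = 0)} p {x:T. f x + b x x < 0} (p + int i)" for p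
    by (rule hiso_trans[OF i(1)[of p, unfolded eq1 eq2] line(1)]) (use True in auto)
   assume "ALL w:W. b w w <= 0"
   hence False using True u(1) by (meson not_le)
   thus "i = Suc n" ..
  qed
 next
  case False
  hence neg: "b u u < 0" using u by simp
  show ?thesis
  proof (intro exI[of _ "Suc i"] conjI allI impI)
   show "hiso {x:T. f x < 0 & (ALL w:W. b x w = 0)} p {x:T. f x + b x x < 0} (p + int (Suc i))" for p
    using hiso_trans[OF i(1)[of p, unfolded eq1 eq2] line(2)[OF _ neg]] by (simp add: ac_simps)
   assume "ALL w:W. b w w <= 0"
   thus "Suc i = Suc n" using i(2) by (simp add: W'_def)
  qed
 qed
qed

section \<open>Duality for sublevel cones\<close>

lemma chains2_empty: "0 <= p ==> chains2 {} p = {0}"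
proof -
 assume p: "0 <= p"
 have "\<not> singular_simplex q (top_of_set ({} :: 'a set)) f" for q f by (rule singular_simplex_empty) simp
 hence "aug_simplices p (top_of_set ({} :: 'a set)) = {}" using p by (simp add: aug_simplices_def)
 thus ?thesis by (auto simp: chains2_def)
qed

lemma cycles2_empty: "0 <= p ==> cycles2 {} p = {0}" by (auto simp: cycles2_def chains2_empty)

lemma bounds2_empty: "0 <= p + 1 ==> bounds2 {} p = {0}" by (simp add: bounds2_def chains2_empty)

lemma augmentation_generator: "single (%_. undefined) 1 : cycles2 {} (- 1)" by (simp add: cycles2_def chains2_def aug_simplices_def)

lemma cycles2_empty_minus1:
 assumes "x : cycles2 {} (- 1)" "x ~= 0"
 shows "x = single (%_. undefined) 1"
proof -
 have "keys x <= {%_. undefined}" using assms by (auto simp: cycles2_def chains2_def aug_simplices_def)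
 hence "x = single (%_. undefined) (lookup x (%_. undefined))" by (intro poly_mapping_eqI) (auto simp: lookup_single when_def in_keys_iff)
 thus ?thesis using assms(2) by (cases "lookup x (%_. undefined)") auto
qed

text \<open>The reduced homology of the empty set in degree \<open>-1\<close> is Z2 and serves as
  the model of a group of order two.\<close>

lemma hiso_order_two:
 fixes A :: "'a::topological_space set"
 assumes "hiso ({} :: 'b::topological_space set) (- 1) A p"
 shows "EX z:cycles2 A p. z ~: bounds2 A p"
  and "!!z z'. z : cycles2 A p ==> z' : cycles2 A p ==> z ~: bounds2 A p ==> z' ~: bounds2 A p ==> z + z' : bounds2 A p"
proof -
 let ?E = "{} :: 'b set"
 obtain R where "correspondence ?E (- 1) A p R" using assms by (auto simp: hiso_def)
 note R = correspondenceD[OF this]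
 have b: "bounds2 ?E (- 1) = {0}" by (rule bounds2_empty) simp
 let ?u = "single (%_. undefined) 1 :: 'b chain2"
 have u0: "?u ~= 0" by (metis lookup_single_eq lookup_zero zero_neq_one)
 obtain y where "(?u, y) : R" using R(2) augmentation_generator by blast
 thus "EX z:cycles2 A p. z ~: bounds2 A p" using R(1,5) b u0 by blast
 fix z z' assume z: "z : cycles2 A p" "z' : cycles2 A p" "z ~: bounds2 A p" "z' ~: bounds2 A p"
 obtain x x' where x: "(x, z) : R" "(x', z') : R" using R(3) z by blast
 hence "x ~= 0" "x' ~= 0" using R(5) z b by blast+
 hence "x = x'" using cycles2_empty_minus1 x R(1) by blast
 hence "(0, z + z') : R" using R(4) x by (metis pm_double)
 thus "z + z' : bounds2 A p" using R(5) bounds2_0 by blast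
qed

text \<open>The punctured space is the negative set of minus the squared norm, so
  \<open>hiso_add_quadratic\<close> with \<open>f = 0\<close> builds it up from the empty
  set.\<close>

lemma hiso_punctured:
 "hiso ({} :: 'a::euclidean_space set) p (- {0 :: 'a}) (p + int DIM('a))"
proof -
 let ?b = "%x y :: 'a. - inner x y"
 have bb: "bounded_bilinear ?b"
 proof -
  have "bounded_bilinear (%x y :: 'a. inner (- x) y)" by (rule bounded_bilinear.comp1[OF bounded_bilinear_inner]) (intro bounded_linear_minus bounded_linear_ident)
  thus ?thesis by simp
 qed
 have "EX i. (ALL p. hiso {x:UNIV. (0::real) < 0 & (ALL w:UNIV. ?b x w = 0)} p
   {x:UNIV. 0 + ?b x x < 0} (p + int i)) & ((ALL w:UNIV. ?b w w <= 0) --> i = DIM('a))"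
 proof (rule hiso_add_quadratic[OF bb, where f="%x::'a. 0" and B=Basis])
  show "w = 0" if "!!w'. w' : UNIV ==> ?b w w' = 0" for w using that[of w] by simp
  show "?b x x = 0" if "!!w. w : UNIV ==> ?b x w = 0" for x using that by blast
 qed (auto simp: homogeneous2_def inner_commute independent_Basis)
 hence i: "hiso {x::'a. False} p {x:UNIV. 0 + ?b x x < 0} (p + int DIM('a))" for p by auto
 have "{x:UNIV. 0 + ?b x x < 0} = - {0}" by auto
 thus ?thesis using i[of p] by simp
qed

lemma Mayer_Vietoris_open:
 assumes "open A" "open B" "a : chains2 A (p + 1)" "b : chains2 B (p + 1)"
  "boundary2 (p + 1) a = z" "boundary2 (p + 1) b = z" "a + b : bounds2 (A Un B) (p + 1)"
 shows "z : bounds2 (A Int B) p" using Mayer_Vietoris_inter[of A B a p b z] assms by (simp add: open_subset)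

text \<open>Closed convex cones that contain no line. The class is stable under intersection, so
  Mayer--Vietoris inductions over unions of such cones stay inside it.\<close>

definition good_cone :: "'a::real_normed_vector set => bool" where
 "good_cone C \<longleftrightarrow> closed C & 0 : C & (ALL x:C. ALL y:C. x + y : C) &
   (ALL x:C. ALL t>=0. t *. x : C) & (ALL x:C. - x : C --> x = 0)"

lemma good_coneD:
 assumes "good_cone C"
 shows "closed C" "0 : C" "!!x y. x : C ==> y : C ==> x + y : C"
  "!!x t. x : C ==> 0 <= t ==> t *. x : C" "!!x. x : C ==> - x : C ==> x = 0" using assms by (auto simp: good_cone_def)

text \<open>The complement is star-shaped about \<open>- a\<close> for any nonzero \<open>a\<close>
  in the cone: if a point between \<open>- a\<close> and \<open>x\<close> were in the cone, adding a
  multiple of \<open>a\<close> and rescaling would put \<open>x\<close> there.\<close>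

lemma acyclic_Compl_good_cone:
 assumes C: "good_cone C" and ne: "C ~= {0}"
 shows "acyclic_set (- C)"
proof -
 note c = good_coneD[OF C]
 obtain a where a: "a : C" "a ~= 0" using ne c(2) by blast
 show ?thesis
 proof (rule acyclic_starlike[of "- a"])
  show "- a : - C" using c(5)[OF a(1)] a(2) by blast
  fix x and u :: real assume x: "x : - C" and u: "0 <= u" "u <= 1"
  show "(1 - u) *. - a + u *. x : - C"
  proof (cases "u = 0")
   case True
   thus ?thesis using c(5)[OF a(1)] a(2) by auto
  next
   case False
   show ?thesis
   proof
    assume "(1 - u) *. - a + u *. x : C"
    moreover have "(1 - u) *. a : C" using c(4)[OF a(1), of "1 - u"] u by simp
    ultimately have "(1 - u) *. - a + u *. x + (1 - u) *. a : C" by (rule c(3))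
    hence "u *. x : C" by simp
    hence "(1 / u) *. (u *. x) : C" using c(4) u by (meson zero_le_divide_1_iff)
    thus False using x False by simp
   qed
  qed
 qed
qed

lemma good_cone_Int: "good_cone C ==> good_cone D ==> good_cone (C Int D)" by (auto simp: good_cone_def)

text \<open>Induction with Mayer--Vietoris. The intersections of the old cones with the new one form
  a family that is no larger than the old one, so the induction runs over a bound for the number of
  cones. \<open>K = {0}\<close> is exceptional in degree \<open>DIM('a) - 1\<close>, where the
  punctured space has the homology of a sphere.\<close>

lemma Compl_cones_vanish:
 fixes \<F> :: "'a::euclidean_space set set"
 assumes "finite \<F>" "!!C. C : \<F> ==> good_cone C" "K = insert 0 (\<Union>\<F>)"
 shows "int DIM('a) <= k ==> cycles2 (- K) k <= bounds2 (- K) k"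
  and "K ~= {0} ==> int DIM('a) - 1 <= k ==> cycles2 (- K) k <= bounds2 (- K) k"
proof -
 let ?n = "int DIM('a)"
 let ?P = "%K :: 'a set. (ALL k. ?n <= k --> cycles2 (- K) k <= bounds2 (- K) k) &
  (K ~= {0} --> (ALL k. ?n - 1 <= k --> cycles2 (- K) k <= bounds2 (- K) k))"
 have "?P (insert 0 (\<Union>\<F>))" if "finite \<F>" "card \<F> <= m" "!!C. C : \<F> ==> good_cone C" for m and \<F> :: "'a set set" using that
 proof (induction m arbitrary: \<F>)
  case 0
  hence "\<F> = {}" by simp
  moreover have "cycles2 (- {0::'a}) k <= bounds2 (- {0}) k" if "?n <= k" for k
  proof -
   have "hiso ({} :: 'a set) (k - ?n) (- {0 :: 'a}) k" using hiso_punctured[where 'a='a and p="k - ?n"] by simp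
   thus ?thesis by (rule hiso_zero) (use that in \<open>simp add: cycles2_empty\<close>)
  qed
  ultimately show ?case by simp
 next
  case (Suc m)
  show ?case
  proof (cases "\<F> = {}")
   case True
   thus ?thesis using Suc.IH[of "{}"] by simp
  next
   case False
   then obtain C \<G> where CG: "\<F> = insert C \<G>" "C ~: \<G>" by (meson mk_disjoint_insert ex_in_conv)
   hence G: "finite \<G>" "card \<G> <= m" "!!C. C : \<G> ==> good_cone C" and C: "good_cone C" using Suc.prems by auto
   let ?K1 = "insert 0 (\<Union>\<G>)"
   have IH: "?P ?K1" by (rule Suc.IH[OF G(1,2)]) (rule G(3))
   have K: "insert 0 (\<Union>\<F>) = ?K1 Un C" using CG good_coneD(2)[OF C] by auto
  consider "C = {0}" | "C ~= {0}" "?K1 = {0}" | "C ~= {0}" "?K1 ~= {0}" by blast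
  thus ?thesis
  proof cases
   case 1
   hence "insert 0 (\<Union>\<F>) = ?K1" using K by auto
   thus ?thesis using IH by metis
  next
   case 2
   hence eq: "insert 0 (\<Union>\<F>) = C" using K good_coneD(2)[OF C] by auto
   show ?thesis unfolding eq using acyclic_Compl_good_cone[OF C 2(1)] by (simp add: acyclic_set_def)
  next
   case 3
   have ac: "acyclic_set (- C)" using acyclic_Compl_good_cone[OF C 3(1)] .
    let ?H = "(%D. D Int C) ` \<G>"
    have H: "?K1 Int C = insert 0 (\<Union>?H)" using good_coneD(2)[OF C] by auto
    have IH2: "?P (insert 0 (\<Union>?H))"
    proof (rule Suc.IH)
     show "finite ?H" using G by simp
     show "card ?H <= m" using card_image_le[OF G(1), of "%D. D Int C"] G(2) by linarith
     show "good_cone D" if "D : ?H" for D using that G(3) C good_cone_Int by blast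
    qed
    have oK: "open (- ?K1)" "open (- C)" using G good_coneD(1) C by (auto intro!: open_Compl closed_insert closed_Union)
    have "cycles2 (- (?K1 Un C)) k <= bounds2 (- (?K1 Un C)) k" if k: "?n - 1 <= k" for k
    proof
     fix z assume z: "z : cycles2 (- (?K1 Un C)) k"
     have "z : cycles2 (- ?K1) k" "z : cycles2 (- C) k" using z cycles2_mono[of "- (?K1 Un C)" "- ?K1" k] cycles2_mono[of "- (?K1 Un C)" "- C" k] by auto
     hence "z : bounds2 (- ?K1) k" "z : bounds2 (- C) k" using IH 3(2) k acyclic_setD[OF ac] by blast+
     then obtain a b where ab: "a : chains2 (- ?K1) (k + 1)" "boundary2 (k + 1) a = z"
      "b : chains2 (- C) (k + 1)" "boundary2 (k + 1) b = z" by (metis bounds2E)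
     have U: "- ?K1 Un - C = - (?K1 Int C)" "- ?K1 Int - C = - (?K1 Un C)" by auto
     have "a + b : cycles2 (- (?K1 Int C)) (k + 1)" using ab chains2_mono[of "- ?K1" "- (?K1 Int C)"] chains2_mono[of "- C" "- (?K1 Int C)"]
      by (auto simp: cycles2_def boundary2_add intro!: chains2_add)
     moreover have "cycles2 (- insert 0 (\<Union>?H)) (k + 1) <= bounds2 (- insert 0 (\<Union>?H)) (k + 1)" by (rule conjunct1[OF IH2, rule_format]) (use k in simp)
     ultimately have "a + b : bounds2 (- (?K1 Int C)) (k + 1)" unfolding H by (rule subsetD[rotated])
     hence "a + b : bounds2 (- ?K1 Un - C) (k + 1)" unfolding U(1) .
     from Mayer_Vietoris_open[OF oK ab(1,3,2,4) this] show "z : bounds2 (- (?K1 Un C)) k" unfolding U(2) .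
    qed
    thus ?thesis unfolding K by (intro conjI allI impI) simp_all
   qed
  qed
 qed
 from this[OF assms(1) order_refl assms(2)]
 show "int DIM('a) <= k ==> cycles2 (- K) k <= bounds2 (- K) k"
  and "K ~= {0} ==> int DIM('a) - 1 <= k ==> cycles2 (- K) k <= bounds2 (- K) k" unfolding assms(3) by blast+
qed

subsection \<open>Linking with pairs of rays\<close>

definition ray :: "'a::real_vector => 'a set" where
 "ray x = {t *. x |t. 0 <= t}"

lemma good_cone_ray:
 fixes x :: "'a::euclidean_space"
 assumes "x ~= 0" shows "good_cone (ray x)" "ray x ~= {0}" "x : ray x"
proof -
 show 1: "x : ray x" by (auto simp: ray_def intro: exI[of _ 1])
 thus "ray x ~= {0}" using assms by blast
 have "ray x = {y. norm x * norm y <= inner x y}"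
 proof (intro equalityI subsetI)
  fix y assume "y : ray x"
  thus "y : {y. norm x * norm y <= inner x y}" by (auto simp: ray_def power2_norm_eq_inner[symmetric] power2_eq_square)
 next
  fix y assume "y : {y. norm x * norm y <= inner x y}"
  hence "inner x y = norm x * norm y" using norm_cauchy_schwarz[of x y] by simp
  hence "norm x *. y = norm y *. x" by (simp add: norm_cauchy_schwarz_eq)
  hence "(1 / norm x) *. (norm x *. y) = (1 / norm x) *. (norm y *. x)" by simp
  hence "y = (norm y / norm x) *. x" using assms by simp
  thus "y : ray x" unfolding ray_def by (blast intro: divide_nonneg_nonneg norm_ge_zero)
 qed
 hence "closed (ray x)" by (simp only:) (intro closed_Collect_le continuous_intros)
 thus "good_cone (ray x)" unfolding good_cone_def
 proof (intro conjI ballI allI impI)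
  show "0 : ray x" by (auto simp: ray_def intro: exI[of _ 0])
  show "y + z : ray x" if "y : ray x" "z : ray x" for y z using that by (auto simp: ray_def) (metis add_nonneg_nonneg scaleR_left.add)
  show "t *. y : ray x" if "y : ray x" "0 <= t" for y t using that by (auto simp: ray_def)
  show "y = 0" if y: "y : ray x" "- y : ray x" for y
  proof -
   obtain s t where st: "y = s *. x" "0 <= s" "- y = t *. x" "0 <= t" using y by (auto simp: ray_def)
   hence "(s + t) *. x = 0" by (simp add: scaleR_left.add flip: st(1,3))
   thus ?thesis using assms st by (simp add: add_nonneg_eq_0_iff)
  qed
 qed
qed

lemma ray_subset_good_cone: "good_cone C ==> x : C ==> ray x <= C" by (auto simp: ray_def good_cone_def)

lemma ray_Int:
 assumes "ray x Int ray y ~= {0}" shows "ray x = ray y"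
proof -
 have "0 : ray x Int ray y" by (auto simp: ray_def intro: exI[of _ 0])
 then obtain z where z: "z : ray x" "z : ray y" "z ~= 0" using assms by blast
 have "ray v = ray z" if zv: "z : ray v" for v
 proof -
  obtain t where t: "z = t *. v" "0 < t" using zv z(3) by (auto simp: ray_def order_le_less)
  hence v: "v = (1 / t) *. z" by simp
  show ?thesis
  proof (intro equalityI subsetI)
   fix y assume "y : ray v"
   then obtain s where "y = s *. v" "0 <= s" by (auto simp: ray_def)
   hence "y = (s / t) *. z" "0 <= s / t" using v t(2) by auto
   thus "y : ray z" unfolding ray_def by blast
  next
   fix y assume "y : ray z"
   then obtain s where "y = s *. z" "0 <= s" by (auto simp: ray_def)
   hence "y = (s * t) *. v" "0 <= s * t" using t by auto
   thus "y : ray v" unfolding ray_def by blast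
  qed
 qed
 thus ?thesis using z by metis
qed

text \<open>Two different rays form a broken line through the origin that runs to infinity on both
  sides. A cycle of degree \<open>DIM('a) - 2\<close> off it has a mod 2 linking number with it, and
  bounding in the complement means that this number is 0.\<close>

definition unlinked :: "'a::euclidean_space chain2 => 'a => 'a => bool" where
 "unlinked z x y \<longleftrightarrow> z : bounds2 (- (ray x Un ray y)) (int DIM('a) - 2)"

lemma unlinked_sym: "unlinked z x y ==> unlinked z y x" by (simp add: unlinked_def Un_commute)

text \<open>Each of \<open>a\<close> and \<open>b\<close> differs from \<open>c\<close> by a cycle
  that avoids one ray, and the complement of a ray is acyclic.\<close>

lemma sum_of_fillings_bounds:
 fixes x y :: "'a::euclidean_space"
 assumes x: "x ~= 0" and y: "y ~= 0"
  and a: "a : chains2 (- ray x) k" and b: "b : chains2 (- ray y) k"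
  and c: "c : chains2 (- (ray x Un ray y)) k"
  and z: "boundary2 k a = z" "boundary2 k b = z" "boundary2 k c = z"
 shows "a + b : bounds2 (- {0}) k"
proof -
 have 1: "w + c : bounds2 (- {0}) k" if v: "v ~= 0" "ray v <= ray x Un ray y" and w: "w : chains2 (- ray v) k" "boundary2 k w = z"
  for w and v :: 'a
 proof -
  have "c : chains2 (- ray v) k" using c chains2_mono[of "- (ray x Un ray y)" "- ray v" k] v(2) by blast
  hence "w + c : cycles2 (- ray v) k" using w z by (simp add: cycles2_def boundary2_add chains2_add)
  hence "w + c : bounds2 (- ray v) k" by (rule acyclic_setD[OF acyclic_Compl_good_cone[OF good_cone_ray(1,2)[OF v(1)]]])
  moreover have "- ray v <= - {0}" using good_coneD(2)[OF good_cone_ray(1)[OF v(1)]] by blast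
  ultimately show ?thesis using bounds2_mono by blast
 qed
 have "(a + c) + (b + c) : bounds2 (- {0}) k" using 1[OF x _ a z(1)] 1[OF y _ b z(2)] bounds2_add by blast
 thus ?thesis by (simp add: ac_simps)
qed

text \<open>The two fillings differ by a cycle off \<open>ray y\<close>. If the other two rays meet
  only in 0, the complement of \<open>ray y\<close> lies in the union of their complements, and
  Mayer--Vietoris produces a filling that avoids both.\<close>

lemma unlinked_trans:
 fixes x y w :: "'a::euclidean_space"
 assumes nz: "x ~= 0" "y ~= 0" "w ~= 0" and xy: "unlinked z x y" and yw: "unlinked z y w"
 shows "unlinked z x w"
proof -
 let ?k = "int DIM('a) - 2"
 obtain c where c: "c : chains2 (- (ray x Un ray y)) (?k + 1)" "boundary2 (?k + 1) c = z" using xy unfolding unlinked_def by (metis bounds2E)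
 obtain d where d: "d : chains2 (- (ray y Un ray w)) (?k + 1)" "boundary2 (?k + 1) d = z" using yw unfolding unlinked_def by (metis bounds2E)
 have cx: "c : chains2 (- ray x) (?k + 1)" and cy: "c : chains2 (- ray y) (?k + 1)" using c(1) chains2_mono[of "- (ray x Un ray y)"] by blast+
 have dw: "d : chains2 (- ray w) (?k + 1)" and dy: "d : chains2 (- ray y) (?k + 1)" using d(1) chains2_mono[of "- (ray y Un ray w)"] by blast+
 show ?thesis
 proof (cases "ray x Int ray w = {0}")
  case False
  hence "- (ray x Un ray w) = - ray x" using ray_Int by blast
  thus ?thesis using cx c(2) boundary_in_bounds2[of c "- ray x" ?k] by (simp add: unlinked_def)
 next
  case True
  have "c + d : cycles2 (- ray y) (?k + 1)" using cy dy c d by (simp add: cycles2_def boundary2_add chains2_add)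
  hence "c + d : bounds2 (- ray y) (?k + 1)" by (rule acyclic_setD[OF acyclic_Compl_good_cone[OF good_cone_ray(1,2)[OF nz(2)]]])
  moreover have "ray x Int ray w <= ray y" unfolding True using good_coneD(2)[OF good_cone_ray(1)[OF nz(2)]] by simp
  hence "- ray y <= - ray x Un - ray w" by auto
  ultimately have "c + d : bounds2 (- ray x Un - ray w) (?k + 1)" using bounds2_mono by blast
  moreover have "open (- ray x)" "open (- ray w)" using good_coneD(1)[OF good_cone_ray(1)] nz by (auto simp: open_Compl)
  ultimately have "z : bounds2 (- ray x Int - ray w) ?k" using Mayer_Vietoris_open[OF _ _ cx dw c(2) d(2)] by simp
  thus ?thesis by (simp add: unlinked_def)
 qed
qed

lemma unlinked_good_cone:
 assumes C: "good_cone C" and x: "x : C" "x ~= 0" and y: "y : C" and z: "z : cycles2 (- C) (int DIM('a) - 2)"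
 shows "unlinked z x (y :: 'a::euclidean_space)"
proof -
 have "acyclic_set (- C)" by (rule acyclic_Compl_good_cone[OF C]) (use x in blast)
 hence "z : bounds2 (- C) (int DIM('a) - 2)" using z acyclic_setD by blast
 moreover have "- C <= - (ray x Un ray y)" using ray_subset_good_cone[OF C] x y by blast
 ultimately show ?thesis unfolding unlinked_def using bounds2_mono by blast
qed

text \<open>One degree below the vanishing range: the sum of the two fillings has to bound off
  \<open>?K1 Int C\<close>. If this intersection is just the origin, the obstruction is the linking
  number with one ray from each part, which the hypothesis excludes.\<close>

lemma Compl_cones_unlinked:
 fixes \<F> :: "'a::euclidean_space set set"
 assumes "finite \<F>" "!!C. C : \<F> ==> good_cone C" "insert 0 (\<Union>\<F>) ~= {0}"
  and "z : cycles2 (- insert 0 (\<Union>\<F>)) (int DIM('a) - 2)"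
  and "!!x y. x : \<Union>\<F> - {0} ==> y : \<Union>\<F> - {0} ==> unlinked z x y"
 shows "z : bounds2 (- insert 0 (\<Union>\<F>)) (int DIM('a) - 2)" using assms
proof (induction \<F> rule: finite_induct)
 case empty
 thus ?case by simp
next
 case (insert C \<G>)
 let ?k = "int DIM('a) - 2"
 let ?K1 = "insert 0 (\<Union>\<G>)"
 have C: "good_cone C" and G: "!!C. C : \<G> ==> good_cone C" using insert.prems by auto
 have K: "insert 0 (\<Union>(insert C \<G>)) = ?K1 Un C" using good_coneD(2)[OF C] by auto
 have z: "z : cycles2 (- (?K1 Un C)) ?k" using insert.prems(3) unfolding K .
 have z1: "z : cycles2 (- ?K1) ?k" and zC: "z : cycles2 (- C) ?k" using z cycles2_mono[of "- (?K1 Un C)" "- ?K1" ?k] cycles2_mono[of "- (?K1 Un C)" "- C" ?k] by auto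
 consider "C = {0}" | "C ~= {0}" "?K1 = {0}" | "C ~= {0}" "?K1 ~= {0}" by blast
 thus ?case
 proof cases
  case 1
  hence eq: "insert 0 (\<Union>(insert C \<G>)) = ?K1" by auto
  have "?K1 ~= {0}" using insert.prems(2) unfolding eq .
  show ?thesis unfolding eq by (rule insert.IH[OF G \<open>?K1 ~= {0}\<close> z1]) (use insert.prems(4) in auto)
 next
  case 2
  hence eq: "insert 0 (\<Union>(insert C \<G>)) = C" using K good_coneD(2)[OF C] by auto
  show ?thesis unfolding eq using acyclic_setD[OF acyclic_Compl_good_cone[OF C 2(1)] zC] .
 next
  case 3
  have "z : bounds2 (- ?K1) ?k" by (rule insert.IH) (use insert.prems(4) G z1 3 in auto)
  then obtain a where a: "a : chains2 (- ?K1) (?k + 1)" "boundary2 (?k + 1) a = z" by (metis bounds2E)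
  have "z : bounds2 (- C) ?k" using acyclic_setD[OF acyclic_Compl_good_cone[OF C 3(1)] zC] .
  then obtain b where b: "b : chains2 (- C) (?k + 1)" "boundary2 (?k + 1) b = z" by (metis bounds2E)
  have oK: "open (- ?K1)" "open (- C)" using G insert.hyps(1) good_coneD(1) C by (auto intro!: open_Compl closed_insert closed_Union)
  have U: "- ?K1 Un - C = - (?K1 Int C)" "- ?K1 Int - C = - (?K1 Un C)" by auto
  have "a + b : bounds2 (- (?K1 Int C)) (?k + 1)"
  proof (cases "?K1 Int C = {0}")
   case False
   have H: "?K1 Int C = insert 0 (\<Union>((%D. D Int C) ` \<G>))" using good_coneD(2)[OF C] by auto
   have "cycles2 (- (?K1 Int C)) (?k + 1) <= bounds2 (- (?K1 Int C)) (?k + 1)"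
    by (rule Compl_cones_vanish(2)[OF _ _ H False]) (use insert.hyps(1) G C in \<open>auto intro: good_cone_Int\<close>)
   moreover have "a + b : cycles2 (- (?K1 Int C)) (?k + 1)" using a b chains2_mono[of "- ?K1" "- (?K1 Int C)"] chains2_mono[of "- C" "- (?K1 Int C)"]
    by (auto simp: cycles2_def boundary2_add intro!: chains2_add)
   ultimately show ?thesis by blast
  next
   case True
   obtain x where x: "x : ?K1" "x ~= 0" using 3 by blast
   then obtain D where D: "D : \<G>" "x : D" by blast
   obtain y where y: "y : C" "y ~= 0" using 3 good_coneD(2)[OF C] by blast
   have "unlinked z x y" using insert.prems(4)[of x y] D x y by auto
   then obtain c where c: "c : chains2 (- (ray x Un ray y)) (?k + 1)" "boundary2 (?k + 1) c = z" unfolding unlinked_def by (metis bounds2E)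
   have "ray x <= ?K1" using ray_subset_good_cone[OF G[OF D(1)] D(2)] D(1) by blast
   hence "a : chains2 (- ray x) (?k + 1)" using a(1) chains2_mono[of "- ?K1" "- ray x"] by blast
   moreover have "b : chains2 (- ray y) (?k + 1)" using b(1) chains2_mono[of "- C" "- ray y"] ray_subset_good_cone[OF C y(1)] by blast
   ultimately show ?thesis unfolding True using sum_of_fillings_bounds[OF x(2) y(2) _ _ c(1) a(2) b(2) c(2)] by blast
  qed
  hence "a + b : bounds2 (- ?K1 Un - C) (?k + 1)" unfolding U(1) .
  from Mayer_Vietoris_open[OF oK a(1) b(1) a(2) b(2) this] show ?thesis unfolding K U(2) .
 qed
qed

lemma chains2_compact_support:
 assumes "z : chains2 A k"
 obtains K where "compact K" "K <= A" "z : chains2 K k"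
proof (cases "k < 0")
 case True
 hence "z : chains2 {} k" using assms by (auto simp: chains2_def aug_simplices_def)
 thus ?thesis using that[of "{}"] by simp
next
 case False
 then obtain q where q: "k = int q" by (metis nonneg_int_cases not_less)
 let ?K = "UN f:keys z. f ` standard_simplex q"
 have f: "singular_simplex q (top_of_set A) f" if "f : keys z" for f using assms that q by (auto simp: chains2_nat)
 have "compact (f ` standard_simplex q)" if "f : keys z" for f
 proof -
  have "continuous_map (simplex_space q) euclidean f" using f[OF that] continuous_map_into_fulltopology by (auto simp: singular_simplex_def)
  moreover have "compactin (simplex_space q) (standard_simplex q)" using compactin_standard_simplex by (simp add: compactin_subtopology)
  ultimately have "compactin euclidean (f ` standard_simplex q)" by (rule image_compactin[rotated])
  thus ?thesis by simp
 qed
 hence "compact ?K" by (intro compact_UN) auto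
 moreover have "?K <= A" using f by (auto simp: singular_simplex_subtopology image_subset_iff)
 moreover have "z : chains2 ?K k"
 proof -
  have "singular_simplex q (top_of_set ?K) g" if "g : keys z" for g
  proof -
   have "g ` standard_simplex q <= ?K" using that by blast
   thus ?thesis using f[OF that] by (auto simp: singular_simplex_subtopology)
  qed
  thus ?thesis unfolding q chains2_nat by blast
 qed
 ultimately show ?thesis using that by blast
qed

lemma cycles2_compact_support:
 assumes "z : cycles2 A k"
 obtains K where "compact K" "K <= A" "z : cycles2 K k" using chains2_compact_support[of z A k] assms by (auto simp: cycles2_def)

subsection \<open>Reduced homology in degree zero\<close>

abbreviation vertex0 :: "nat => real" where
 "vertex0 \<equiv> %j. if j = 0 then 1 else 0"

definition point_simplex :: "'a => (nat => real) => 'a" where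
 "point_simplex x = restrict (%_. x) (standard_simplex 0)"

lemma point_simplex_vertex [simp]: "point_simplex x vertex0 = x" by (simp add: point_simplex_def standard_simplex_0)

lemma singular_0_simplex:
 assumes "singular_simplex 0 X f"
 shows "f = point_simplex (f vertex0)"
proof
 fix x
 have "f : extensional (standard_simplex 0)" using assms by (simp add: singular_simplex_def)
 hence "x ~= vertex0 ==> f x = undefined" by (simp add: extensional_def standard_simplex_0)
 thus "f x = point_simplex (f vertex0) x" by (cases "x = vertex0") (simp_all add: point_simplex_def standard_simplex_0)
qed

lemma point_simplex_chain: "x : A ==> single (point_simplex x) 1 : chains2 A 0" using chains2_nat[of A 0] by (auto simp: singular_simplex_def point_simplex_def)

lemma path_boundary:
 assumes g: "path g" "path_image g <= A"
 shows "single (point_simplex (pathstart g)) 1 + single (point_simplex (pathfinish g)) 1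
   : bounds2 A 0"
proof -
 let ?e = "restrict (%y. g (y 1)) (standard_simplex 1)"
 have 1: "continuous_map (simplex_space 1) (top_of_set {0..1}) (%y. y 1)" by (auto simp: continuous_map_in_subtopology standard_simplex_def
    intro!: continuous_map_from_subtopology continuous_map_product_projection)
 have 2: "continuous_map (top_of_set {0..1}) (top_of_set A) g" using g by (auto simp: path_def path_image_def)
 have "continuous_map (simplex_space 1) (top_of_set A) (%y. g (y 1))" using continuous_map_compose[OF 1 2] by (simp add: o_def)
 hence "singular_simplex 1 (top_of_set A) ?e" by (auto simp: singular_simplex_def elim!: continuous_map_eq)
 hence e: "single ?e 1 : chains2 A (0 + 1)" using chains2_nat[of A 1] by simp
 have v: "vertex0 : standard_simplex 0" by (simp add: standard_simplex_0)
 have 3: "singular_face 1 k ?e = point_simplex (g (simplical_face k vertex0 1))" if "k <= 1" for k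
 proof
  fix x
  show "singular_face 1 k ?e x = point_simplex (g (simplical_face k vertex0 1)) x" using that simplical_face_in_standard_simplex[of 1 k vertex0] v
   by (cases "x = vertex0") (simp_all add: singular_face_def point_simplex_def standard_simplex_0)
 qed
 have "boundary2 (0 + 1) (single ?e 1) =
   single (singular_face 1 0 ?e) 1 + single (singular_face 1 1 ?e) 1" by (simp add: boundary2_single aug_face_def)
 also have "... = single (point_simplex (pathfinish g)) 1 + single (point_simplex (pathstart g)) 1"
  using 3[of 0] 3[of 1] by (simp add: simplical_face_def pathstart_def pathfinish_def)
 finally show ?thesis using boundary_in_bounds2[OF e] by (simp add: add.commute)
qed

text \<open>The number of points of a 0-chain in \<open>D\<close>, mod 2; \<open>vertex0\<close> is
  the only point of the standard 0-simplex.\<close>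

definition parity :: "'a set => 'a chain2 => bit" where
 "parity D a = (SUM f:keys a. if f vertex0 : D then lookup a f else 0)"

lemma parity_alt:
 assumes "finite K" "keys a <= K"
 shows "parity D a = (SUM f:K. if f vertex0 : D then lookup a f else 0)" unfolding parity_def
 by (rule sum.mono_neutral_left) (use assms in \<open>auto simp: in_keys_iff\<close>)

lemma parity_add: "parity D (a + b) = parity D a + parity D b"
proof -
 let ?K = "keys a Un keys b"
 have "keys (a + b) <= ?K" by (rule keys_add)
 thus ?thesis by (simp add: parity_alt[of ?K] sum.distrib[symmetric] lookup_add if_distrib cong: if_cong)
qed

lemma parity_0 [simp]: "parity D 0 = 0" by (simp add: parity_def)

lemma parity_single: "parity D (single f 1) = (if f vertex0 : D then 1 else 0)" by (simp add: parity_def)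

lemma parity_sum: "parity D (sum g I) = (SUM i:I. parity D (g i))" by (induction I rule: infinite_finite_induct) (auto simp: parity_add)

lemma single_expansion: "a = (SUM f:keys (a :: 'a \<Rightarrow>\<^sub>0 bit). single f 1)"
proof (intro poly_mapping_eqI)
 fix x :: 'a
 have "lookup (SUM f:K. single f (1::bit)) x = (if x : K then 1 else 0)"
  if "finite K" for K :: "'a set" using that by (induction K rule: finite_induct) (auto simp: lookup_add lookup_single when_def)
 from this[OF finite_keys[of a]] show "lookup a x = lookup (SUM f:keys a. single f 1) x" by (cases "lookup a x") (auto simp: in_keys_iff)
qed

lemma boundary2_sum: "boundary2 p (sum g I) = (SUM i:I. boundary2 p (g i))" by (induction I rule: infinite_finite_induct) (auto simp: boundary2_add)

lemma parity_boundary: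
 assumes D: "D : components A" and a: "a : bounds2 A 0"
 shows "parity D a = 0"
proof -
 obtain e where e: "e : chains2 A (int 1)" "boundary2 (int 1) e = a" using a bounds2E[of a A 0] by auto
 have zero: "parity D (boundary2 (int 1) (single f 1)) = 0" if "f : keys e" for f
 proof -
  have f: "continuous_map (simplex_space 1) (top_of_set A) f" using e(1) that unfolding chains2_nat by (auto simp: singular_simplex_def)
  have "connectedin (simplex_space 1) (standard_simplex 1)" using connectedin_standard_simplex by (simp add: connectedin_subtopology)
  from connectedin_continuous_map_image[OF f this]
  have conn: "connected (f ` standard_simplex 1)" "f ` standard_simplex 1 <= A" by (auto simp: connectedin_subtopology)
  have in_s: "simplical_face k vertex0 : standard_simplex 1" if "k <= 1" for k
   using simplical_face_in_standard_simplex[of 1 k vertex0] that by (simp add: standard_simplex_0)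
  have val: "singular_face 1 k f vertex0 = f (simplical_face k vertex0)" for k by (simp add: singular_face_def standard_simplex_0)
  have "f x : D \<longleftrightarrow> f y : D" if "x : standard_simplex 1" "y : standard_simplex 1" for x y
  proof -
   have "f z : D ==> z : standard_simplex 1 ==> f ` standard_simplex 1 <= D" for z using components_maximal[OF D conn] by blast
   thus ?thesis using that by blast
  qed
  hence "singular_face 1 0 f vertex0 : D \<longleftrightarrow> singular_face 1 1 f vertex0 : D" using in_s val by simp
  thus ?thesis by (simp add: boundary2_single aug_face_def parity_add parity_single)
 qed
 have "parity D a = parity D (boundary2 (int 1) (SUM f:keys e. single f 1))" using e(2) single_expansion[of e] by simp
 also have "... = 0" unfolding boundary2_sum parity_sum by (rule sum.neutral) (use zero in blast)
 finally show ?thesis .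
qed

text \<open>Vanishing parity puts a second point of the chain into the component of any given one. A
  path joins the two, and adding its boundary leaves fewer points.\<close>

lemma parity_zero_bounds:
 fixes A :: "'a::real_normed_vector set"
 assumes A: "open A" and a: "a : chains2 A 0" and par: "!!D. D : components A ==> parity D a = 0"
 shows "a : bounds2 A 0" using a par
proof (induction "card (keys a)" arbitrary: a rule: less_induct)
 case less
 show ?case
 proof (cases "a = 0")
  case False
  then obtain f where f: "f : keys a" by (metis keys_eq_empty ex_in_conv)
  have simp: "g = point_simplex (g vertex0)" "g vertex0 : A" if "g : keys a" for g
  proof -
   have g: "singular_simplex 0 (top_of_set A) g" using less.prems(1) that chains2_nat[of A 0] by auto
   thus "g = point_simplex (g vertex0)" by (rule singular_0_simplex)
   show "g vertex0 : A" using g by (auto simp: singular_simplex_subtopology standard_simplex_0)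
  qed
  define D where "D = connected_component_set A (f vertex0)"
  have D: "D : components A" "f vertex0 : D" using simp(2)[OF f] by (auto simp: D_def components_def)
  have one: "lookup a g = 1" if "g : keys a" for g using that by (cases "lookup a g") (auto simp: in_keys_iff)
  obtain g where g: "g : keys a" "g ~= f" "g vertex0 : D"
  proof (rule ccontr)
   assume no: "\<not> thesis"
   have "parity D a = (SUM g:{f}. if g vertex0 : D then lookup a g else 0)" unfolding parity_def by (rule sum.mono_neutral_right) (use f no that in auto)
   also have "... = 1" using D one[OF f] by simp
   finally show False using less.prems(2)[OF D(1)] by simp
  qed
  have "connected D" by (rule in_components_connected[OF D(1)])
  have "open D" by (rule open_components[OF A D(1)])
  have "D <= A" by (rule in_components_subset[OF D(1)])
  have "path_connected D" by (rule connected_open_path_connected) fact+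
  then obtain \<gamma> where \<gamma>: "path \<gamma>" "path_image \<gamma> <= D" "pathstart \<gamma> = f vertex0" "pathfinish \<gamma> = g vertex0"
   using D(2) g(3) unfolding path_connected_def by blast
  let ?b = "single f 1 + single g (1::bit)"
  have b: "?b : bounds2 A 0" using path_boundary[of \<gamma> A] \<gamma> \<open>D <= A\<close> simp(1)[OF f] simp(1)[OF g(1)] by auto
  have "keys (a + ?b) <= keys a - {f}" using one f g by (auto simp: in_keys_iff lookup_add lookup_single when_def split: if_splits)
  hence "card (keys (a + ?b)) < card (keys a)" using f card_mono[of "keys a - {f}" "keys (a + ?b)"]
    card_Diff1_less[of "keys a" f] by simp
  moreover have "a + ?b : chains2 A 0"
  proof (rule chains2_add[OF less.prems(1)])
   show "?b : chains2 A 0" using b bounds2_cycles2[of A 0] unfolding cycles2_def by blast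
  qed
  moreover have "parity E (a + ?b) = 0" if "E : components A" for E unfolding parity_add[of E a] using less.prems(2)[OF that] parity_boundary[OF that b] by simp
  ultimately have "a + ?b : bounds2 A 0" using less.hyps by blast
  hence "(a + ?b) + ?b : bounds2 A 0" using b bounds2_add by blast
  thus ?thesis by (simp add: ac_simps)
 qed simp
qed

subsection \<open>The codimension one duality\<close>

lemma good_cone_neighbourhood:
 fixes a :: "'a::euclidean_space"
 assumes U: "open U" "0 ~: U" "!!x t. x : U ==> 0 < t ==> t *. x : U" and a: "a : U"
 obtains C T where "good_cone C" "C - {0} <= U" "open T" "a : T" "T <= C" "!!x t. x : T ==> 0 < t ==> t *. x : T"
proof -
 have a0: "a ~= 0" using U a by blast
 define b where "b = (1 / norm a) *. a"
 have b: "norm b = 1" "b : U" using a0 U(3)[OF a, of "1 / norm a"] by (auto simp: b_def)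
 obtain e where e: "0 < e" "ball b e <= U" using U(1) b(2) openE by blast
 \<comment> \<open>Unit vectors \<open>y\<close> with \<open>r <= inner b y\<close> satisfy
   \<open>(norm (y - b))^2 <= 2 - 2 * r < e^2\<close>; positivity of \<open>r\<close> makes the
   round cone pointed.\<close>
 define r where "r = max (1 / 2) (1 - e^2 / 4)"
 have "1 - e^2 / 4 <= r" by (simp add: r_def)
 hence r: "2 - 2 * r <= e^2 / 2" "0 < r" "r < 1" using e(1) by (linarith, simp_all add: r_def less_max_iff_disj)
 define C where "C = {x. r * norm x <= inner b x}"
 define T where "T = {x. r * norm x < inner b x}"
 have 1: "good_cone C" unfolding good_cone_def
 proof (intro conjI ballI allI impI)
  show "closed C" unfolding C_def by (intro closed_Collect_le continuous_intros)
  show "x + y : C" if "x : C" "y : C" for x y using that r norm_triangle_ineq[of x y] mult_left_mono[of "norm (x + y)" "norm x + norm y" r]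
   by (simp add: C_def inner_add_right distrib_left)
  show "t *. x : C" if "x : C" "0 <= t" for x t using mult_left_mono[of "r * norm x" "inner b x" t] that by (simp add: C_def algebra_simps)
  show "x = 0" if "x : C" "- x : C" for x
  proof -
   have "r * norm x <= 0" using that by (simp add: C_def)
   thus ?thesis using r by (simp add: mult_le_0_iff)
  qed
 qed (simp add: C_def)
 have 2: "C - {0} <= U"
 proof
  fix x assume x: "x : C - {0}"
  define y where "y = (1 / norm x) *. x"
  have y: "norm y = 1" "r <= inner b y" "x = norm x *. y" using x by (auto simp: y_def C_def divide_simps)
  have "(norm (y - b))^2 = 2 - 2 * inner b y" using y(1) b(1) by (simp add: power2_norm_eq_inner inner_diff_left inner_diff_right norm_eq_1 inner_commute)
  also have "... < e^2" using y(2) r e by (smt (verit) field_sum_of_halves zero_less_power)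
  finally have "norm (y - b) < e" using e(1) by (meson less_le power_less_imp_less_base)
  hence "y : U" using e(2) by (auto simp: dist_norm norm_minus_commute)
  hence "norm x *. y : U" using U(3) x by simp
  thus "x : U" using y(3) by simp
 qed
 have 3: "open T" unfolding T_def by (intro open_Collect_less continuous_intros)
 have 4: "a : T"
 proof -
  have "inner b a = norm a" using a0 by (simp add: b_def power2_norm_eq_inner[symmetric] power2_eq_square)
  thus ?thesis using r a0 by (simp add: T_def)
 qed
 have 5: "t *. x : T" if "x : T" "0 < t" for x t using mult_strict_left_mono[of "r * norm x" "inner b x" t] that by (simp add: T_def algebra_simps)
 show thesis by (rule that[OF 1 2 3 4 _ 5]) (auto simp: T_def C_def)
qed

text \<open>\<open>unlinked z\<close> is an equivalence relation with open classes, because each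
  point of \<open>U\<close> has a neighbourhood inside a good cone that avoids
  \<open>A\<close>.\<close>

lemma unlinked_connected:
 fixes x y :: "'a::euclidean_space"
 assumes U: "open U" "0 ~: U" "!!x t. x : U ==> 0 < t ==> t *. x : U"
  and z: "z : cycles2 A (int DIM('a) - 2)" and A: "A Int U = {}" "0 ~: A"
  and S: "connected S" "S <= U" and xy: "x : S" "y : S"
 shows "unlinked z x y"
proof (rule connected_equivalence_relation[OF S(1) xy])
 show "unlinked z y x" if "unlinked z x y" for x y using that by (rule unlinked_sym)
 show "unlinked z x w" if "unlinked z x y" "unlinked z y w" "x : S" "y : S" "w : S" for x y w by (rule unlinked_trans[of x y w]) (use that S(2) U(2) in auto)
 fix a assume a: "a : S"
 hence "a : U" using S(2) by blast
 from good_cone_neighbourhood[OF U this] obtain C T where C: "good_cone C" "C - {0} <= U" "open T" "a : T" "T <= C" by metis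
 have "A <= - C" using C(2) A by blast
 hence z': "z : cycles2 (- C) (int DIM('a) - 2)" using z cycles2_mono by blast
 have a0: "a ~= 0" using \<open>a : U\<close> U(2) by blast
 have "unlinked z a x" if "x : T" for x by (rule unlinked_good_cone[OF C(1) _ a0 _ z']) (use C that in auto)
 thus "EX T. openin (top_of_set S) T & a : T & (ALL x:T. unlinked z a x)" using C a by (intro exI[of _ "S Int T"]) (auto simp: openin_open)
qed

lemma cycles2_sum: "(!!i. i : I ==> g i : cycles2 A p) ==> sum g I : cycles2 A p" by (induction I rule: infinite_finite_induct) (auto intro: cycles2_add)

definition link :: "'a::euclidean_space chain2 => 'a => 'a => bit" where
 "link z x y = (if unlinked z x y then 0 else 1)"

lemma unlinked_same_ray:
 fixes x y :: "'a::euclidean_space"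
 assumes "x ~= 0" "ray x = ray y" "z : cycles2 (- (ray x Un ray y)) (int DIM('a) - 2)"
 shows "unlinked z x y" using acyclic_Compl_good_cone[OF good_cone_ray(1,2)[OF assms(1)]] assms(2,3) by (simp add: unlinked_def acyclic_setD)

text \<open>Off two different rays the homology in degree \<open>DIM('a) - 2\<close> is Z2, by
  suspension to the punctured space, and in a group of order two the indicator of nonzero elements
  is additive.\<close>

lemma link_add:
 fixes x y :: "'a::euclidean_space"
 assumes nz: "x ~= 0" "y ~= 0"
  and z: "z : cycles2 (- (ray x Un ray y)) (int DIM('a) - 2)" "z' : cycles2 (- (ray x Un ray y)) (int DIM('a) - 2)"
 shows "link (z + z') x y = link z x y + link z' x y"
proof (cases "ray x = ray y")
 case True
 thus ?thesis using unlinked_same_ray[OF nz(1) True] z cycles2_add[OF z] by (simp add: link_def)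
next
 case False
 let ?A = "- (ray x Un ray y)" and ?n = "int DIM('a)"
 have susp: "hiso (- ray x Int - ray y) (?n - 2) (- ray x Un - ray y) (?n - 2 + 1)"
 proof (rule hiso_suspension)
  show "acyclic_set (- ray x)" "acyclic_set (- ray y)" using acyclic_Compl_good_cone good_cone_ray nz by blast+
  have "open (- ray x)" "open (- ray y)" using good_coneD(1)[OF good_cone_ray(1)] nz by auto
  thus "openin (top_of_set (- ray x Un - ray y)) (- ray x)" "openin (top_of_set (- ray x Un - ray y)) (- ray y)" by (auto intro!: open_subset)
 qed
 have e1: "- ray x Un - ray y = - {0}" using ray_Int[of x y] False by blast
 have e2: "- ray x Int - ray y = ?A" by blast
 have e3: "?n - 2 + 1 = ?n - 1" by simp
 have "hiso ?A (?n - 2) (- {0 :: 'a}) (?n - 1)" using susp unfolding e1 e2 e3 .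
 moreover have "hiso ({} :: 'a set) (- 1) (- {0 :: 'a}) (?n - 1)" using hiso_punctured[where 'a='a and p="- 1"] by simp
 ultimately have h: "hiso ({} :: 'a set) (- 1) ?A (?n - 2)" using hiso_sym hiso_trans by blast
 have u: "unlinked w x y \<longleftrightarrow> w : bounds2 ?A (?n - 2)" for w by (simp add: unlinked_def)
 have "z + z' : bounds2 ?A (?n - 2) \<longleftrightarrow> (z : bounds2 ?A (?n - 2) \<longleftrightarrow> z' : bounds2 ?A (?n - 2))"
  using bounds2_add[of _ ?A "?n - 2"] hiso_order_two(2)[OF h z] by (metis add.commute pm_double_left)
 thus ?thesis unfolding link_def u by auto
qed

lemma link_sum:
 fixes x y :: "'a::euclidean_space"
 assumes "x ~= 0" "y ~= 0" "!!i. i : I ==> z i : cycles2 (- (ray x Un ray y)) (int DIM('a) - 2)"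
 shows "link (sum z I) x y = (SUM i:I. link (z i) x y)" using assms(3)
proof (induction I rule: infinite_finite_induct)
 case (insert i I)
 thus ?case using assms(1,2) by (simp add: link_add cycles2_sum)
qed (simp_all add: link_def unlinked_def)

lemma parity_Union:
 assumes "finite \<D>" "disjoint \<D>"
 shows "parity (\<Union>\<D>) a = (SUM D:\<D>. parity D a)" using assms
proof (induction \<D> rule: finite_induct)
 case empty
 thus ?case by (simp add: parity_def)
next
 case (insert D \<D>)
 have "D Int E = {}" if "E : \<D>" for E using disjointD[OF insert.prems, of D E] that insert.hyps(2) by auto
 hence "D Int \<Union>\<D> = {}" by blast
 hence "parity (D Un \<Union>\<D>) a = parity D a + parity (\<Union>\<D>) a" unfolding parity_def sum.distrib[symmetric] by (intro sum.cong refl) auto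
 moreover have "disjoint \<D>" using insert.prems by (simp add: disjoint_def)
 ultimately show ?case using insert by simp
qed

lemma parity_cycle:
 assumes "a : cycles2 A 0" shows "parity A a = 0"
proof -
 have "a : chains2 A (int 0)" "boundary2 0 a = 0" using assms by (auto simp: cycles2_def)
 hence "(SUM f:keys a. lookup a f) = 0" using boundary2_0_eq[of "keys a" a] by (metis finite_keys lookup_single_eq lookup_zero order_refl)
 moreover have "f vertex0 : A" if "f : keys a" for f using that \<open>a : chains2 A (int 0)\<close> unfolding chains2_nat
  by (auto simp: singular_simplex_subtopology standard_simplex_0)
 ultimately show ?thesis by (simp add: parity_def)
qed

lemma finite_good_cone_cover:
 fixes Z U :: "'a::euclidean_space set"
 assumes U: "open U" "0 ~: U" "!!x t. x : U ==> 0 < t ==> t *. x : U"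
  and Z: "closed Z" "!!x t. x : Z ==> 0 < t ==> t *. x : Z" and ZU: "Z - {0} <= U"
 obtains \<F> where "finite \<F>" "!!C. C : \<F> ==> good_cone C" "\<Union>\<F> - {0} <= U" "Z <= insert 0 (\<Union>\<F>)"
proof -
 have "EX C T. good_cone C & C - {0} <= U & open T & a : T & T <= C" if "a : Z Int sphere 0 1" for a
 proof -
  have "a : U" using that ZU by auto
  from good_cone_neighbourhood[OF U this] show ?thesis by metis
 qed
 then obtain C T where CT: "!!a. a : Z Int sphere 0 1 ==> good_cone (C a) & C a - {0} <= U & open (T a) & a : T a & T a <= C a" by metis
 have "compact (Z Int sphere 0 1)" using Z(1) by (simp add: closed_Int_compact)
 from compactE_image[OF this, of "Z Int sphere 0 1" T]
 obtain X where X: "X <= Z Int sphere 0 1" "finite X" "Z Int sphere 0 1 <= \<Union>(T ` X)" using CT by blast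
 show thesis
 proof (rule that[of "C ` X"])
  show "finite (C ` X)" using X(2) by simp
  show "good_cone D" if "D : C ` X" for D using that CT X(1) by blast
  show "\<Union>(C ` X) - {0} <= U" using CT X(1) by blast
  show "Z <= insert 0 (\<Union>(C ` X))"
  proof
   fix x assume x: "x : Z"
   show "x : insert 0 (\<Union>(C ` X))"
   proof (cases "x = 0")
    case False
    hence "(1 / norm x) *. x : Z Int sphere 0 1" using Z(2)[OF x, of "1 / norm x"] by simp
    then obtain a where a: "a : X" "(1 / norm x) *. x : C a" using X CT by blast
    hence "norm x *. (1 / norm x) *. x : C a" using CT X(1) good_coneD(4)[of "C a"] by (metis norm_ge_zero subsetD)
    thus ?thesis using a(1) False by auto
   qed simp
  qed
 qed
qed

text \<open>The zero set need not be regular. Its substitute is the push \<open>flow\<close>: it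
  carries the conical neighbourhood \<open>nbhd width\<close> of the nonzero points with
  \<open>h x <= 0\<close> into \<open>Neg\<close>, and on the way it does not leave any smaller
  \<open>nbhd d\<close> from which it starts.\<close>

locale pushable_cone =
 fixes h :: "'a::euclidean_space => real" and v k C
 assumes cont: "continuous_on UNIV h" and hom: "homogeneous2 h" and push: "pushable UNIV h v k C"
begin

abbreviation "Neg \<equiv> {x. h x < 0}"
abbreviation "Pos \<equiv> {x. h x > 0}"
abbreviation "nbhd d \<equiv> {x. h x < d * (norm x)^2}"
abbreviation "flow x \<equiv> x - v x"

lemma h0: "h 0 = 0" using hom by (rule homogeneous2_0)

lemma open_Neg: "open Neg" and open_Pos: "open Pos" and open_nbhd: "open (nbhd d)" using cont by (auto intro!: open_Collect_less continuous_intros)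

lemma closed_nonpos: "closed {x. h x <= 0}" using cont by (auto intro!: closed_Collect_le continuous_intros)

lemma nbhd_cone: "x : nbhd d ==> 0 < t ==> t *. x : nbhd d" using homogeneous2D[OF hom, of t x] by (simp add: power_mult_distrib mult.left_commute)

lemma Neg_cone: "x : Neg ==> 0 < t ==> t *. x : Neg" using nbhd_cone[of x 0 t] by simp

lemma continuous_flow: "continuous_on UNIV flow" using pushableD(3)[OF push] by (intro continuous_intros)

text \<open>\<open>width < k\<close> brings a push into \<open>Neg\<close>;
  \<open>2 * C * width < k\<close> compensates for a possible loss of norm on the way. The
  denominator secures both.\<close>

definition width :: real where "width = k / (2 * C + 2)"

lemma width: "0 < width" "width < k" "2 * C * width < k"
proof -
 have kC: "0 < k" "0 <= C" using pushableD[OF push] by auto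
 thus "0 < width" by (simp add: width_def)
 have e: "width * (2 * C + 2) = k" using kC by (simp add: width_def)
 have "0 <= width * C" using kC \<open>0 < width\<close> by simp
 thus "width < k" "2 * C * width < k" using e \<open>0 < width\<close> by (auto simp: algebra_simps)
qed

lemma segment_nbhd:
 assumes d: "0 <= d" "d <= width" and x: "x : nbhd d" and s: "0 <= s" "s <= 1"
 shows "x - s *. v x : nbhd d"
proof -
 let ?y = "x - s *. v x"
 have kC: "0 < k" "0 <= C" using pushableD[OF push] by auto
 have 1: "h ?y <= h x - s * k * (norm x)^2" using pushableD(6)[OF push _ s] by simp
 have "s * norm (v x) <= s * (C * norm x)" using pushableD(4)[OF push, of x] s by (intro mult_left_mono) auto
 hence ny: "norm x - s * (C * norm x) <= norm ?y" using norm_triangle_ineq2[of x "s *. v x"] s by simp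
 have 2: "(norm x)^2 - 2 * s * C * (norm x)^2 <= (norm ?y)^2"
 proof (cases "0 <= norm x - s * (C * norm x)")
  case True
  have "(norm x - s * (C * norm x))^2 <= (norm ?y)^2" using ny True by (intro power_mono)
  moreover have "(norm x - s * (C * norm x))^2 = (norm x)^2 - 2 * s * C * (norm x)^2 + (s * (C * norm x))^2" by (simp add: power2_eq_square algebra_simps)
  ultimately show ?thesis using zero_le_power2[of "s * (C * norm x)"] by linarith
 next
  case False
  hence "norm x * norm x <= (s * (C * norm x)) * norm x" by (intro mult_right_mono) auto
  hence "(norm x)^2 <= s * C * (norm x)^2" by (simp add: power2_eq_square algebra_simps)
  moreover have "0 <= s * C * (norm x)^2" using s kC by simp
  ultimately show ?thesis using zero_le_power2[of "norm ?y"] by linarith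
 qed
 have "d * ((norm x)^2 - 2 * s * C * (norm x)^2) <= d * (norm ?y)^2" using 2 d(1) by (rule mult_left_mono)
 moreover have "2 * C * d * (s * (norm x)^2) <= k * (s * (norm x)^2)"
 proof (rule mult_right_mono)
  have "2 * C * d <= 2 * C * width" using d kC by (intro mult_left_mono) auto
  thus "2 * C * d <= k" using width(3) by linarith
 qed (use s in simp)
 ultimately have "d * (norm x)^2 - s * k * (norm x)^2 <= d * (norm ?y)^2" by (simp add: algebra_simps)
 thus ?thesis using 1 x by simp
qed

lemma flow_Neg:
 assumes "x : nbhd width" shows "flow x : Neg"
proof -
 have "h (flow x) <= h x - k * (norm x)^2" using pushableD(6)[OF push, of x 1] by simp
 also have "... < width * (norm x)^2 - k * (norm x)^2" using assms by simp
 also have "... <= 0" using mult_right_mono[of width k "(norm x)^2"] width(2) by simp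
 finally show ?thesis by simp
qed

lemma nonpos_nbhd: "h x <= 0 ==> x ~= 0 ==> 0 < d ==> x : nbhd d" by (simp add: le_less_trans[of "h x" 0])

lemma zero_notin: "0 ~: nbhd d" "0 ~: Neg" "0 ~: Pos" by (simp_all add: h0)

definition seg :: "'a => 'a set" where "seg x = (%s. x - s *. v x) ` {0..1}"

lemma seg: "connected (seg x)" "x : seg x" "flow x : seg x"
  "0 <= d ==> d <= width ==> x : nbhd d ==> seg x <= nbhd d"
proof -
 show "connected (seg x)" unfolding seg_def by (intro connected_continuous_image continuous_intros) simp
 show "x : seg x" unfolding seg_def by (rule image_eqI[of _ _ 0]) auto
 show "flow x : seg x" unfolding seg_def by (rule image_eqI[of _ _ 1]) auto
 show "seg x <= nbhd d" if "0 <= d" "d <= width" "x : nbhd d" using segment_nbhd[OF that] by (auto simp: seg_def)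
qed

lemma flow_component:
 assumes "D : components Neg" "x : Neg"
 shows "flow x : D \<longleftrightarrow> x : D"
proof -
 have "seg x <= Neg" using seg(4)[of 0 x] assms(2) width by simp
 hence "y : D ==> y : seg x ==> seg x <= D" for y using components_maximal[OF assms(1) seg(1)] by blast
 thus ?thesis using seg(2,3) by blast
qed

lemma nonpos_cover:
 assumes d: "0 < d"
 obtains \<F> where "finite \<F>" "!!C. C : \<F> ==> good_cone C" "\<Union>\<F> - {0} <= nbhd d" "{x. h x <= 0} <= insert 0 (\<Union>\<F>)"
proof (rule finite_good_cone_cover[OF open_nbhd _ nbhd_cone closed_nonpos])
 show "t *. x : {x. h x <= 0}" if "x : {x. h x <= 0}" "0 < t" for x t using that homogeneous2D[OF hom, of t x] by (simp add: mult_le_0_iff)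
 show "{x. h x <= 0} - {0} <= nbhd d" using nonpos_nbhd d by blast
qed (use zero_notin in auto)

text \<open>The nonpositive set is covered by finitely many good cones within
  \<open>nbhd width\<close>. Each of them without its apex is connected and is pushed into a single
  component, and every component is reached because pushes do not leave it.\<close>

lemma finite_components: "finite (components Neg)"
proof -
 obtain \<F> where F: "finite \<F>" "!!C. C : \<F> ==> good_cone C" "\<Union>\<F> - {0} <= nbhd width" "{x. h x <= 0} <= insert 0 (\<Union>\<F>)"
  using nonpos_cover[OF width(1)] by metis
 have "components Neg <= (%C. THE D. D : components Neg & flow ` (C - {0}) <= D) ` \<F>"
 proof
  fix D assume D: "D : components Neg"
  obtain x where x: "x : D" "x : Neg" using in_components_nonempty[OF D] in_components_subset[OF D] by blast
  hence "x : {x. h x <= 0}" "x ~= 0" using zero_notin(2) by auto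
  then obtain C where C: "C : \<F>" "x : C - {0}" using F(4) by blast
  note c = good_coneD[OF F(2)[OF C(1)]]
  have "convex (C - {0})" unfolding convex_alt
  proof (intro ballI allI impI)
   fix a b and u :: real assume ab: "a : C - {0}" "b : C - {0}" and u: "0 <= u & u <= 1"
   have in_C: "(1 - u) *. a : C" "u *. b : C" using ab u c(4) by auto
   have "(1 - u) *. a + u *. b ~= 0"
   proof
    assume 0: "(1 - u) *. a + u *. b = 0"
    hence "- ((1 - u) *. a) = u *. b" by (simp add: eq_neg_iff_add_eq_0 neg_eq_iff_add_eq_0)
    hence "(1 - u) *. a = 0" using c(5)[OF in_C(1)] in_C(2) by simp
    thus False using 0 ab by auto
   qed
   thus "(1 - u) *. a + u *. b : C - {0}" using c(3)[OF in_C] by simp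
  qed
  hence conn: "connected (flow ` (C - {0}))" by (intro connected_continuous_image convex_connected continuous_on_subset[OF continuous_flow]) auto
  have sub: "flow ` (C - {0}) <= Neg" using flow_Neg F(3) C(1) by blast
  have "flow x : D" using flow_component[OF D x(2)] x(1) by simp
  hence fD: "flow ` (C - {0}) <= D" using components_maximal[OF D conn sub] C(2) by blast
  have "(THE D. D : components Neg & flow ` (C - {0}) <= D) = D"
  proof (rule the_equality)
   show "E = D" if "E : components Neg & flow ` (C - {0}) <= E" for E using components_nonoverlap[of E Neg D] that D \<open>flow x : D\<close> C(2) by blast
  qed (use D fD in simp)
  thus "D : (%C. THE D. D : components Neg & flow ` (C - {0}) <= D) ` \<F>" using C(1) by blast
 qed
 thus ?thesis using F(1) by (rule finite_surj[rotated])
qed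

text \<open>A cycle in \<open>Pos\<close> has compact support, on which \<open>h x\<close> is at
  least \<open>d * (norm x)^2\<close> for some positive \<open>d\<close>. So finitely many good
  cones cover the nonpositive set and avoid the support, and it is enough to work in their
  complement.\<close>

lemma cone_cover:
 assumes ne: "Neg ~= {}" and z: "z : cycles2 Pos m"
 obtains d K \<F> where "0 < d" "d <= width" "z : cycles2 K m" "K Int nbhd d = {}" "0 ~: K"
  "finite \<F>" "ALL C:\<F>. good_cone C" "\<Union>\<F> - {0} <= nbhd d" "z : cycles2 (- insert 0 (\<Union>\<F>)) m"
  "insert 0 (\<Union>\<F>) ~= {0}" "bounds2 (- insert 0 (\<Union>\<F>)) m <= bounds2 Pos m"
proof -
 obtain K where K: "compact K" "K <= Pos" "z : cycles2 K m" using cycles2_compact_support[OF z] .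
 obtain d where d: "0 < d" "d <= width" "K Int nbhd d = {}"
 proof (cases "K = {}")
  case True
  thus ?thesis using that[of width] width by simp
 next
  case False
  have K0: "x ~= 0" if "x : K" for x using that K(2) zero_notin(3) by blast
  have "continuous_on K (%x. h x / (norm x)^2)" using K0 by (intro continuous_intros continuous_on_subset[OF cont]) auto
  from continuous_attains_inf[OF K(1) False this] obtain a where
   a: "a : K" "!!x. x : K ==> h a / (norm a)^2 <= h x / (norm x)^2" by blast
  have pos: "0 < h a / (norm a)^2" using a(1) K(2) K0 by auto
  show ?thesis
  proof (rule that[of "min width (h a / (norm a)^2)"])
   show "0 < min width (h a / (norm a)^2)" using pos width(1) by simp
   have "min width (h a / (norm a)^2) * (norm x)^2 <= h x" if "x : K" for x
   proof -
    have "min width (h a / (norm a)^2) <= h x / (norm x)^2" using a(2)[OF that] by linarith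
    thus ?thesis using K0[OF that] by (simp add: le_divide_eq)
   qed
   thus "K Int nbhd (min width (h a / (norm a)^2)) = {}" by fastforce
  qed simp
 qed
 obtain \<F> where F: "finite \<F>" "!!C. C : \<F> ==> good_cone C" "\<Union>\<F> - {0} <= nbhd d" "{x. h x <= 0} <= insert 0 (\<Union>\<F>)"
  using nonpos_cover[OF d(1)] by metis
 let ?K = "insert 0 (\<Union>\<F>)"
 have 0: "0 ~: K" using K(2) zero_notin(3) by blast
 hence "K <= - ?K" using d(3) F(3) by blast
 hence 1: "z : cycles2 (- ?K) m" using K(3) cycles2_mono by blast
 obtain x where x: "x : Neg" using ne by blast
 hence "x : {x. h x <= 0}" "x ~= 0" using zero_notin(2) by auto
 hence 2: "?K ~= {0}" using F(4) by blast
 have "- ?K <= Pos" using F(4) by (auto simp: not_le[symmetric])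
 hence "bounds2 (- ?K) m <= bounds2 Pos m" by (rule bounds2_mono)
 thus thesis using that[OF d(1,2) K(3) d(3) 0 F(1) _ F(3) 1 2] F(2) by blast
qed

theorem positive_homology_vanishes:
 assumes "Neg ~= {}" "int DIM('a) - 1 <= m"
 shows "cycles2 Pos m <= bounds2 Pos m"
proof
 fix z assume z: "z : cycles2 Pos m"
 obtain d K \<F> where *: "0 < d" "d <= width" "z : cycles2 K m" "K Int nbhd d = {}" "0 ~: K"
  "finite \<F>" "ALL C:\<F>. good_cone C" "\<Union>\<F> - {0} <= nbhd d" "z : cycles2 (- insert 0 (\<Union>\<F>)) m"
  "insert 0 (\<Union>\<F>) ~= {0}" "bounds2 (- insert 0 (\<Union>\<F>)) m <= bounds2 Pos m" using cone_cover[OF assms(1) z] .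
 show "z : bounds2 Pos m" using Compl_cones_vanish(2)[OF *(6) bspec[OF *(7)] refl *(10) assms(2)] *(9,11) by blast
qed

lemma unlinked_component:
 assumes "z : cycles2 Pos (int DIM('a) - 2)" "connected S" "S <= Neg" "x : S" "y : S"
 shows "unlinked z x y" by (rule unlinked_connected[OF open_Neg zero_notin(2) Neg_cone assms(1) _ zero_notin(3) assms(2-5)]) auto

text \<open>Points of the covering cones may have positive \<open>h\<close>, but a push leads them
  into \<open>Neg\<close> inside \<open>nbhd d\<close>, hence off the support of the cycle; so the
  linking hypothesis extends to them.\<close>

lemma all_unlinked_bounds:
 assumes ne: "Neg ~= {}" and z: "z : cycles2 Pos (int DIM('a) - 2)"
  and all: "!!x y. x : Neg ==> y : Neg ==> unlinked z x y"
 shows "z : bounds2 Pos (int DIM('a) - 2)"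
proof -
 let ?k = "int DIM('a) - 2"
 obtain d K \<F> where *: "0 < d" "d <= width" "z : cycles2 K ?k" "K Int nbhd d = {}" "0 ~: K"
  "finite \<F>" "ALL C:\<F>. good_cone C" "\<Union>\<F> - {0} <= nbhd d" "z : cycles2 (- insert 0 (\<Union>\<F>)) ?k"
  "insert 0 (\<Union>\<F>) ~= {0}" "bounds2 (- insert 0 (\<Union>\<F>)) ?k <= bounds2 Pos ?k" using cone_cover[OF ne z] .
 have fl: "unlinked z x (flow x) & flow x : Neg & x ~= 0" if "x : \<Union>\<F> - {0}" for x
 proof (intro conjI)
  have x: "x : nbhd d" using that *(8) by blast
  hence "seg x <= nbhd d" using seg(4)[of d x] *(1,2) by simp
  thus "unlinked z x (flow x)" by (intro unlinked_connected[OF open_nbhd zero_notin(1) nbhd_cone *(3,4,5) seg(1) _ seg(2,3)])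
  have "d * (norm x)^2 <= width * (norm x)^2" using *(2) by (intro mult_right_mono) auto
  hence "x : nbhd width" using x by simp
  thus "flow x : Neg" by (rule flow_Neg)
 qed (use that in simp)
 have "unlinked z x y" if xy: "x : \<Union>\<F> - {0}" "y : \<Union>\<F> - {0}" for x y
 proof -
  have x: "unlinked z x (flow x)" "flow x : Neg" "x ~= 0" and y: "unlinked z y (flow y)" "flow y : Neg" "y ~= 0" using fl xy by blast+
  have nz: "flow x ~= 0" "flow y ~= 0" using x(2) y(2) zero_notin(2) by metis+
  have "unlinked z x (flow y)" by (rule unlinked_trans[OF x(3) nz(1) nz(2) x(1) all[OF x(2) y(2)]])
  thus ?thesis by (rule unlinked_trans[OF x(3) nz(2) y(3) _ unlinked_sym[OF y(1)]])
 qed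
 from Compl_cones_unlinked[OF *(6) bspec[OF *(7)] *(10,9) this] show ?thesis using *(11) by blast
qed

end

lemma point_pair_cycle:
 assumes "x : A" "y : A"
 shows "single (point_simplex x) 1 + single (point_simplex y) 1 : cycles2 A 0"
proof -
 have "boundary2 0 (single f 1) = single (%_. undefined) 1" for f :: "(nat => real) => 'a" using boundary2_0_eq[of "{f}" "single f 1"] by simp
 thus ?thesis using assms point_simplex_chain by (auto simp: cycles2_def boundary2_add intro: chains2_add)
qed

context pushable_cone
begin

lemma Pos_ray: "x : Neg ==> ray x <= - Pos"
proof
 fix y assume x: "x : Neg" and "y : ray x"
 then obtain t where t: "0 <= t" "y = t *. x" by (auto simp: ray_def)
 have "h y = t^2 * h x" unfolding t(2) using hom t(1) by (rule homogeneous2D)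
 moreover have "t^2 * h x <= 0" using x by (simp add: mult_nonneg_nonpos)
 ultimately show "y : - Pos" by simp
qed

lemma Pos_rays: "x : Neg ==> y : Neg ==> z : cycles2 Pos p ==> z : cycles2 (- (ray x Un ray y)) p"
 using Pos_ray[of x] Pos_ray[of y] cycles2_mono[of Pos "- (ray x Un ray y)" p] by blast

lemma link_Neg_add:
 assumes "x : Neg" "y : Neg" "z : cycles2 Pos (int DIM('a) - 2)" "z' : cycles2 Pos (int DIM('a) - 2)"
 shows "link (z + z') x y = link z x y + link z' x y" using assms Pos_rays zero_notin(2) by (intro link_add) blast+

text \<open>The separating cycle is the boundary of one half of the fundamental cycle of the punctured
  space, cut along the closed cones of those points that flow into, respectively outside, \<open>D\<close>.\<close>

lemma separating_cycle:
 assumes D: "D : components Neg"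
 obtains z where "z : cycles2 Pos (int DIM('a) - 2)"
  "!!x y. x : Neg ==> y : Neg ==> unlinked z x y \<longleftrightarrow> (x : D \<longleftrightarrow> y : D)"
proof -
 let ?n = "int DIM('a)" and ?k = "int DIM('a) - 2"
 define A where "A = Pos Un (- {0} Int flow -` (Neg - D))"
 define B where "B = Pos Un (- {0} Int flow -` D)"
 have oD: "open D" by (rule open_components[OF open_Neg D])
 have "closedin (top_of_set Neg) D" by (rule closedin_component[OF D])
 hence oND: "open (Neg - D)" using openin_open_trans[of Neg "Neg - D"] open_Neg openin_diff[of "top_of_set Neg" Neg D] by simp
 have pre: "open (flow -` U)" if "open U" for U using continuous_flow that by (simp add: continuous_on_open_vimage)
 have oA: "open A" unfolding A_def by (intro open_Un open_Int open_Pos pre oND) auto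
 have oB: "open B" unfolding B_def by (intro open_Un open_Int open_Pos pre oD) auto
 have DN: "D <= Neg" by (rule in_components_subset[OF D])
 have nonpos: "flow x : Neg" if "x ~: Pos" "x ~= 0" for x
 proof (rule flow_Neg)
  show "x : nbhd width" using nonpos_nbhd[of x width] that width(1) by simp
 qed
 have un: "A Un B = - {0}"
 proof
  show "A Un B <= - {0}" using zero_notin(3) by (auto simp: A_def B_def)
  show "- {0} <= A Un B"
  proof
   fix x :: 'a assume "x : - {0}"
   thus "x : A Un B" using nonpos[of x] by (auto simp: A_def B_def)
  qed
 qed
 have int: "A Int B = Pos" by (auto simp: A_def B_def)
 have "hiso ({} :: 'a set) (- 1) (- {0 :: 'a}) (?n - 1)" using hiso_punctured[where 'a='a and p="- 1"] by simp
 from hiso_order_two(1)[OF this] obtain w where w: "w : cycles2 (- {0}) (?n - 1)" "w ~: bounds2 (- {0 :: 'a}) (?n - 1)" ..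
 have e: "?n - 1 = ?k + 1" by simp
 have w': "w : cycles2 (A Un B) (?k + 1)" using w(1) unfolding un e .
 obtain a b where ab: "a : chains2 A (?k + 1)" "b : chains2 B (?k + 1)"
  "boundary2 (?k + 1) a = boundary2 (?k + 1) b" "boundary2 (?k + 1) a : cycles2 (A Int B) ?k"
  "a + b + w : bounds2 (A Un B) (?k + 1)" using Mayer_Vietoris_split[OF _ _ w'] oA oB by (auto intro!: open_subset)
 define z where "z = boundary2 (?k + 1) a"
 have zc: "z : cycles2 Pos ?k" using ab(4) unfolding int z_def .
 have same: "x : D \<longleftrightarrow> y : D" if y: "y = t *. x" and t: "0 < t" and x: "x : Neg" for t and x y :: 'a
 proof -
  let ?S = "(%s. s *. x) ` {min t 1..max t 1}"
  have "connected ?S" by (intro connected_continuous_image continuous_intros) simp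
  moreover have "?S <= Neg"
  proof (rule image_subsetI)
   fix s assume "s : {min t 1..max t 1}"
   hence "0 < s" using t by (auto simp: min_def split: if_splits)
   thus "s *. x : Neg" using x by (intro Neg_cone)
  qed
  moreover have "x : ?S" by (rule image_eqI[of _ _ 1]) auto
  moreover have "y : ?S" unfolding y by (rule imageI) auto
  ultimately show ?thesis using components_maximal[OF D] by blast
 qed
 have Aray: "A <= - ray x" if x: "x : D" for x
 proof
  fix y assume y: "y : A"
  show "y : - ray x"
  proof
   assume r: "y : ray x"
   then obtain t where t: "0 <= t" "y = t *. x" by (auto simp: ray_def)
   have "y ~: Pos" using Pos_ray[of x] x DN r by blast
   hence y': "y ~= 0" "flow y : Neg - D" using y by (auto simp: A_def)
   have "y : D" using same[OF t(2)] t x DN y'(1) by (cases "t = 0") auto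
   thus False using flow_component[OF D, of y] y'(2) DN by blast
  qed
 qed
 have Bray: "B <= - ray x" if x: "x : Neg - D" for x
 proof
  fix y assume y: "y : B"
  show "y : - ray x"
  proof
   assume r: "y : ray x"
   then obtain t where t: "0 <= t" "y = t *. x" by (auto simp: ray_def)
   have "y ~: Pos" using Pos_ray[of x] x r by blast
   hence y': "y ~= 0" "flow y : D" using y by (auto simp: B_def)
   have t0: "0 < t" using t y'(1) by (cases "t = 0") auto
   hence yN: "y : Neg" unfolding t(2) using x by (intro Neg_cone) auto
   hence yD: "y : D" using flow_component[OF D, of y] y'(2) by blast
   have "x : D" using same[OF t(2) t0] yD x by blast
   thus False using x by blast
  qed
 qed
 have k1: "?k + 1 = ?n - 1" by simp
 \<comment> \<open>An unlinked pair would make \<open>a + b\<close> bound in the punctured space,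
   and with it the fundamental cycle \<open>w\<close>.\<close>
 have linked: "\<not> unlinked z x y" if x: "x : D" and y: "y : Neg - D" for x y
 proof
  assume "unlinked z x y"
  then obtain c where c: "c : chains2 (- (ray x Un ray y)) (?k + 1)" "boundary2 (?k + 1) c = z" unfolding unlinked_def using bounds2E by blast
  have "a + b : bounds2 (- {0}) (?k + 1)"
  proof (rule sum_of_fillings_bounds)
   show "x ~= 0" "y ~= 0" using x y DN zero_notin(2) by blast+
   show "a : chains2 (- ray x) (?k + 1)" using ab(1) Aray[OF x] chains2_mono by blast
   show "b : chains2 (- ray y) (?k + 1)" using ab(2) Bray[OF y] chains2_mono by blast
   show "boundary2 (?k + 1) a = z" "boundary2 (?k + 1) b = z" using ab(3) by (simp_all only: z_def)
  qed (use c in auto)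
  hence "(a + b) + (a + b + w) : bounds2 (- {0}) (?k + 1)" using ab(5) unfolding un by (rule bounds2_add)
  thus False using w(2) unfolding k1 by (simp only: pm_double_left)
 qed
 show thesis
 proof (rule that[OF zc])
  fix x y assume xy: "x : Neg" "y : Neg"
  consider "x : D" "y : D" | "x : D" "y : Neg - D" | "y : D" "x : Neg - D" | "x : Neg - D" "y : Neg - D" using xy by blast
  thus "unlinked z x y \<longleftrightarrow> (x : D \<longleftrightarrow> y : D)"
  proof cases
   case 1
   have "A <= - (ray x Un ray y)" using Aray 1 by blast
   hence "z : bounds2 (- (ray x Un ray y)) ?k" using ab(1) chains2_mono unfolding z_def by (intro boundary_in_bounds2) blast
   thus ?thesis using 1 by (simp add: unlinked_def)
  next
   case 2
   thus ?thesis using linked by blast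
  next
   case 3
   thus ?thesis using linked[of y x] unlinked_sym by blast
  next
   case 4
   have "B <= - (ray x Un ray y)" using Bray 4 by blast
   hence "z : bounds2 (- (ray x Un ray y)) ?k" using ab(2,3) chains2_mono unfolding z_def by (metis boundary_in_bounds2 subsetD)
   thus ?thesis using 4 by (simp add: unlinked_def)
  qed
 qed
qed

lemma link_unlinked: "link z x y = 0 \<longleftrightarrow> unlinked z x y" by (simp add: link_def)

text \<open>A cycle \<open>z\<close> in \<open>Pos\<close> corresponds to a 0-cycle \<open>a\<close>
  if the linking number of \<open>z\<close> with the rays of \<open>x\<close> and \<open>x0\<close>
  is the parity of \<open>a\<close> in the component of \<open>x\<close>. The component of the base
  point \<open>x0\<close> is left out of \<open>\<D>\<close>: its parity is determined by the
  others, since all parities of a reduced 0-cycle add up to 0.\<close>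

theorem codimension_one_duality:
 assumes ne: "Neg ~= {}"
 shows "hiso Pos (int DIM('a) - 2) Neg 0"
proof -
 let ?k = "int DIM('a) - 2"
 obtain x0 where x0: "x0 : Neg" using ne by blast
 define \<D> where "\<D> = {D:components Neg. x0 ~: D}"
 have fin: "finite \<D>" using finite_components by (simp add: \<D>_def)
 have comp: "!!D. D : \<D> ==> D : components Neg" by (simp add: \<D>_def)
 define r where "r D = (SOME x. x : D)" for D :: "'a set"
 have r: "r D : D" "r D : Neg" if "D : \<D>" for D
 proof -
  show "r D : D" unfolding r_def using in_components_nonempty[OF comp[OF that]] by (simp add: some_in_eq)
  thus "r D : Neg" using in_components_subset[OF comp[OF that]] by blast
 qed
 have same: "x : D \<longleftrightarrow> D = E" if "D : \<D>" "E : \<D>" "x : E" for D E x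
  using components_nonoverlap[OF comp[OF that(1)] comp[OF that(2)]] that(3) by blast
 define R where "R = {(z, a). z : cycles2 Pos ?k & a : cycles2 Neg 0 &
  (ALL D:\<D>. ALL x:D. link z x x0 = parity D a)}"
 have DN: "x : Neg" if "D : \<D>" "x : D" for D x using in_components_subset[OF comp[OF that(1)]] that(2) by blast
 show ?thesis
 proof (rule hisoI[of R], goal_cases)
  case (1 z a)
  thus ?case by (simp add: R_def)
 next
  case (2 z)
  let ?P = "%D. single (point_simplex (r D)) 1 + single (point_simplex x0) (1 :: bit)"
  define \<E> where "\<E> = {D:\<D>. link z (r D) x0 = 1}"
  define a where "a = (SUM D:\<E>. ?P D)"
  have a: "a : cycles2 Neg 0" unfolding a_def by (rule cycles2_sum, rule point_pair_cycle) (use r x0 in \<open>auto simp: \<E>_def\<close>)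
  have "link z x x0 = parity E a" if E: "E : \<D>" "x : E" for E x
  proof -
   have "parity E a = (SUM D:\<E>. if D = E then 1 else 0)" unfolding a_def parity_sum
   proof (rule sum.cong[OF refl])
    fix D assume "D : \<E>"
    hence D: "D : \<D>" by (simp add: \<E>_def)
    have "r D : E \<longleftrightarrow> E = D" by (rule same[OF E(1) D r(1)[OF D]])
    moreover have "x0 ~: E" using E(1) by (simp add: \<D>_def)
    ultimately show "parity E (?P D) = (if D = E then 1 else 0)" by (auto simp: parity_add parity_single)
   qed
   also have "... = (if E : \<E> then 1 else 0)" using fin by (simp add: \<E>_def)
   finally have 1: "parity E a = (if E : \<E> then 1 else 0)" .
   have "unlinked z x (r E)" by (rule unlinked_component[OF 2 in_components_connected[OF comp[OF E(1)]] in_components_subset[OF comp[OF E(1)]] E(2) r(1)[OF E(1)]])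
   hence "unlinked z x x0 \<longleftrightarrow> unlinked z (r E) x0"
    using unlinked_trans unlinked_sym DN[OF E] r(2)[OF E(1)] x0 zero_notin(2) by (metis (no_types, lifting))
   hence "link z x x0 = link z (r E) x0" by (simp add: link_def)
   also have "... = (if E : \<E> then 1 else 0)" using E(1) by (cases "link z (r E) x0") (auto simp: \<E>_def)
   finally show ?thesis using 1 by simp
  qed
  hence "(z, a) : R" using 2 a by (simp add: R_def)
  thus ?case ..
 next
  case (3 a)
  define sep where "sep z D \<longleftrightarrow> z : cycles2 Pos ?k &
   (ALL x:Neg. ALL y:Neg. unlinked z x y \<longleftrightarrow> (x : D \<longleftrightarrow> y : D))" for z D
  define \<zeta> where "\<zeta> D = (SOME z. sep z D)" for D
  have "sep (\<zeta> D) D" if D: "D : \<D>" for D unfolding \<zeta>_def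
  proof (rule someI_ex)
   show "EX z. sep z D" by (rule separating_cycle[OF comp[OF D]], rule exI, unfold sep_def) (intro conjI ballI, assumption, blast)
  qed
  hence \<zeta>: "!!D. D : \<D> ==> \<zeta> D : cycles2 Pos ?k"
   "!!D x y. D : \<D> ==> x : Neg ==> y : Neg ==> unlinked (\<zeta> D) x y \<longleftrightarrow> (x : D \<longleftrightarrow> y : D)" unfolding sep_def by blast+
  define \<E> where "\<E> = {D:\<D>. parity D a = 1}"
  have E\<D>: "!!D. D : \<E> ==> D : \<D>" by (simp add: \<E>_def)
  have z: "sum \<zeta> \<E> : cycles2 Pos ?k" by (rule cycles2_sum) (use \<zeta>(1) E\<D> in blast)
  have "link (sum \<zeta> \<E>) x x0 = parity E a" if E: "E : \<D>" "x : E" for E x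
  proof -
   have nz: "x ~= 0" "x0 ~= 0" using DN[OF E] x0 zero_notin(2) by metis+
   have "link (sum \<zeta> \<E>) x x0 = (SUM D:\<E>. link (\<zeta> D) x x0)" by (rule link_sum[OF nz]) (use Pos_rays[OF DN[OF E] x0] \<zeta>(1) E\<D> in blast)
   also have "... = (SUM D:\<E>. if D = E then 1 else 0)"
   proof (rule sum.cong[OF refl])
    fix D assume "D : \<E>"
    hence D: "D : \<D>" by (rule E\<D>)
    hence "x0 ~: D" by (simp add: \<D>_def)
    thus "link (\<zeta> D) x x0 = (if D = E then 1 else 0)" using \<zeta>(2)[OF D DN[OF E] x0] same[OF D E] by (simp add: link_def)
   qed
   also have "... = (if E : \<E> then 1 else 0)" using fin by (simp add: \<E>_def)
   also have "... = parity E a" using E(1) by (cases "parity E a") (auto simp: \<E>_def)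
   finally show ?thesis .
  qed
  hence "(sum \<zeta> \<E>, a) : R" using 3 z by (simp add: R_def)
  thus ?case ..
 next
  case (4 z a z' a')
  have "link (z + z') x x0 = parity D (a + a')" if "D : \<D>" "x : D" for D x using 4 that link_Neg_add[OF DN[OF that] x0, of z z'] by (simp add: R_def parity_add)
  thus ?case using 4 by (auto simp: R_def intro: cycles2_add)
 next
  case (5 z a)
  hence z: "z : cycles2 Pos ?k" and a: "a : cycles2 Neg 0"
   and l: "!!D x. D : \<D> ==> x : D ==> link z x x0 = parity D a" by (auto simp: R_def)
  show ?case
  proof
   assume zb: "z : bounds2 Pos ?k"
   have par0: "parity D a = 0" if D: "D : \<D>" for D
   proof -
    have "Pos <= - (ray (r D) Un ray x0)" using Pos_ray[OF r(2)[OF D]] Pos_ray[OF x0] by blast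
    hence "unlinked z (r D) x0" unfolding unlinked_def using zb bounds2_mono by blast
    thus ?thesis using l[OF D r(1)[OF D]] by (simp add: link_def)
   qed
   show "a : bounds2 Neg 0"
   proof (rule parity_zero_bounds[OF open_Neg])
    show "a : chains2 Neg 0" using a by (simp add: cycles2_def)
    fix D assume D: "D : components Neg"
    show "parity D a = 0"
    proof (cases "D : \<D>")
     case False
     hence "x0 : D" using D by (simp add: \<D>_def)
     have other: "E : \<D>" if "E : components Neg - {D}" for E using that components_nonoverlap[OF D, of E] \<open>x0 : D\<close> by (auto simp: \<D>_def)
     have "0 = parity (\<Union>(components Neg)) a" using parity_cycle[OF a] Union_components[of Neg] by simp
     also have "... = (SUM E:components Neg. parity E a)" using pairwise_disjoint_components[of Neg]
      by (intro parity_Union finite_components) (simp add: pairwise_def disjnt_def)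
     also have "... = parity D a + (SUM E:components Neg - {D}. parity E a)" by (rule sum.remove[OF finite_components D])
     also have "(SUM E:components Neg - {D}. parity E a) = 0" by (rule sum.neutral) (use other par0 in blast)
     finally show ?thesis by simp
    qed (rule par0)
   qed
  next
   assume ab: "a : bounds2 Neg 0"
   have u0: "unlinked z x x0" if x: "x : Neg" for x
   proof -
    obtain D where D: "D : components Neg" "x : D" using x Union_components[of Neg] by blast
    show ?thesis
    proof (cases "D : \<D>")
     case True
     thus ?thesis using l[OF True D(2)] parity_boundary[OF D(1) ab] by (simp add: link_unlinked)
    next
     case False
     hence "x0 : D" using D by (simp add: \<D>_def)
     thus ?thesis by (rule unlinked_component[OF z in_components_connected[OF D(1)] in_components_subset[OF D(1)] D(2)])
    qed
   qed
   show "z : bounds2 Pos ?k"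
   proof (rule all_unlinked_bounds[OF ne z])
    fix x y assume xy: "x : Neg" "y : Neg"
    hence "x ~= 0" "y ~= 0" "x0 ~= 0" using x0 zero_notin(2) by metis+
    thus "unlinked z x y" using unlinked_trans[OF _ _ _ u0[OF xy(1)] unlinked_sym[OF u0[OF xy(2)]]] by simp
   qed
  qed
 qed
qed

end

section \<open>Finitely supported families as an inner product space\<close>

text \<open>The number of polygon vertices is chosen inside a proof and so cannot index a type. All
  polygon spaces are therefore coordinate subspaces of one space of finitely supported
  families.\<close>

instantiation poly_mapping :: (type, real_inner) real_inner
begin

definition scaleR_poly_mapping :: "real => ('a \<Rightarrow>\<^sub>0 'b) => ('a \<Rightarrow>\<^sub>0 'b)" where
 "r *. x = Poly_Mapping.map ((*.) r) x"

definition inner_poly_mapping :: "('a \<Rightarrow>\<^sub>0 'b) => ('a \<Rightarrow>\<^sub>0 'b) => real" where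
 "inner x y = (SUM i:keys x. inner (lookup x i) (lookup y i))"

definition "norm (x :: 'a \<Rightarrow>\<^sub>0 'b) = sqrt (inner x x)"

definition "sgn (x :: 'a \<Rightarrow>\<^sub>0 'b) = inverse (norm x) *. x"

definition "dist (x :: 'a \<Rightarrow>\<^sub>0 'b) y = norm (x - y)"

definition "(uniformity :: (('a \<Rightarrow>\<^sub>0 'b) \<times> ('a \<Rightarrow>\<^sub>0 'b)) filter) = (INF e\<in>{0 <..}. principal {(x :: 'a \<Rightarrow>\<^sub>0 'b, y). dist x y < e})"

definition "open (U :: ('a \<Rightarrow>\<^sub>0 'b) set) \<longleftrightarrow> (ALL x:U. \<forall>\<^sub>F (x', y) in uniformity. x' = x --> y : U)"

lemma lookup_scaleR_aux: "lookup (r *. x) i = r *. lookup (x :: 'a \<Rightarrow>\<^sub>0 'b) i"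
 unfolding scaleR_poly_mapping_def by (simp add: Poly_Mapping.map.rep_eq when_def)

lemma inner_alt:
 assumes "finite K" "keys x <= K"
 shows "inner x (y :: 'a \<Rightarrow>\<^sub>0 'b) = (SUM i:K. inner (lookup x i) (lookup y i))"
 unfolding inner_poly_mapping_def by (rule sum.mono_neutral_left) (use assms in \<open>auto simp: in_keys_iff\<close>)

instance
proof
 fix x y z :: "'a \<Rightarrow>\<^sub>0 'b" and r s :: real
 show "r *. (x + y) = r *. x + r *. y" "(r + s) *. x = r *. x + s *. x"
  "r *. s *. x = (r * s) *. x" "1 *. x = x" by (intro poly_mapping_eqI; simp add: lookup_scaleR_aux lookup_add algebra_simps)+
 let ?K = "keys x Un keys y Un keys z"
 have K: "finite ?K" "keys x <= ?K" "keys y <= ?K" by auto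
 have sub: "keys (x + y) <= ?K" "keys (r *. x) <= ?K" using keys_add[of x y] by (auto simp: in_keys_iff lookup_scaleR_aux)
 show "inner x y = inner y x" using inner_alt[OF K(1,2), of y] inner_alt[OF K(1,3), of x] by (simp add: inner_commute)
 show "inner (x + y) z = inner x z + inner y z" using inner_alt[OF K(1,2), of z] inner_alt[OF K(1,3), of z] inner_alt[OF K(1) sub(1), of z]
  by (simp add: lookup_add inner_add_left sum.distrib)
 show "inner (r *. x) y = r * inner x y" using inner_alt[OF K(1,2), of y] inner_alt[OF K(1) sub(2), of y] by (simp add: lookup_scaleR_aux sum_distrib_left)
 show "0 <= inner x x" by (simp add: inner_poly_mapping_def sum_nonneg)
 show "inner x x = 0 \<longleftrightarrow> x = 0"
 proof
  assume "inner x x = 0"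
  hence "ALL i:keys x. inner (lookup x i) (lookup x i) = 0" by (simp add: inner_poly_mapping_def sum_nonneg_eq_0_iff)
  thus "x = 0" by (metis in_keys_iff inner_eq_zero_iff lookup_zero poly_mapping_eqI)
 qed (simp add: inner_poly_mapping_def)
qed (simp_all add: norm_poly_mapping_def sgn_poly_mapping_def dist_poly_mapping_def
   uniformity_poly_mapping_def open_poly_mapping_def)

end

text \<open>The derivative exists off 0 only. Segments avoiding 0 use the mean value inequality;
  comparing \<open>x\<close> with its half gives the bound against 0 by homogeneity; a segment
  through 0 splits into two radial ones.\<close>

lemma homogeneous_lipschitz:
 fixes F :: "'a::euclidean_space => 'b::real_normed_vector"
 assumes hom: "!!c x. 0 <= c ==> F (c *. x) = c *. F x"
  and der: "!!x. x ~= 0 ==> (F has_derivative F' x) (at x)"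
  and bd: "!!x v. x ~= 0 ==> norm (F' x v) <= L * norm v"
 shows "norm (F x - F y) <= L * norm (x - y)"
proof -
 have seg: "norm (F x - F y) <= L * norm (x - y)" if "0 ~: closed_segment x y" for x y
 proof (rule differentiable_bound[OF convex_closed_segment, of x y F F' L])
  fix z assume "z : closed_segment x y"
  hence "z ~= 0" using that by blast
  thus "(F has_derivative F' z) (at z within closed_segment x y)" using der has_derivative_at_withinI by blast
  show "onorm (F' z) <= L" by (rule onorm_le) (rule bd[OF \<open>z ~= 0\<close>])
 qed auto
 have F0: "F 0 = 0" using hom[of 0 0] by simp
 have ray: "norm (F x) <= L * norm x" for x
 proof (cases "x = 0")
  case False
  have "0 ~: closed_segment x ((1 / 2) *. x)"
  proof
   assume "0 : closed_segment x ((1 / 2) *. x)"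
   then obtain u where u: "0 <= u" "u <= 1" "0 = (1 - u) *. x + u *. (1 / 2) *. x" by (auto simp: in_segment)
   hence "((1 - u) + u / 2) *. x = 0" unfolding scaleR_left_distrib by simp
   thus False using False u(2) by simp
  qed
  from seg[OF this] have "norm (F x - (1 / 2) *. F x) <= L * norm (x - (1 / 2) *. x)" by (simp add: hom)
  moreover have "F x - (1 / 2) *. F x = (1 / 2) *. F x" "x - (1 / 2) *. x = (1 / 2) *. x"
   by (simp_all add: scaleR_half_double[symmetric] algebra_simps flip: scaleR_add_left)
  ultimately show ?thesis by simp
 qed (simp add: F0)
 show ?thesis
 proof (cases "0 : closed_segment x y")
  case True
  hence "norm (x - y) = norm x + norm y" using between[of x y 0] by (simp add: between_mem_segment dist_norm)
  hence "L * norm (x - y) = L * norm x + L * norm y" by (simp add: distrib_left)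
  thus ?thesis using ray[of x] ray[of y] norm_triangle_ineq4[of "F x" "F y"] by linarith
 qed (rule seg)
qed

text \<open>Scaling to norm 1 reduces the claim to uniform continuity on a compact annulus.\<close>

lemma homogeneous_uniformly_continuous:
 fixes Y :: "'a::euclidean_space => 'b::real_normed_vector"
 assumes hom: "!!c x. 0 <= c ==> Y (c *. x) = c *. Y x" and c: "continuous_on (- {0}) Y" and d: "0 < d"
 obtains e where "0 < e" "e <= 1 / 2" "!!x y. norm (y - x) <= e * norm x ==> norm (Y y - Y x) <= d * norm x"
proof -
 let ?K = "cball 0 2 - ball 0 (1 / 2) :: 'a set"
 have "compact ?K" by (intro compact_diff) auto
 moreover have "continuous_on ?K Y" by (rule continuous_on_subset[OF c]) auto
 ultimately have "uniformly_continuous_on ?K Y" by (rule compact_uniformly_continuous[rotated])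
 then obtain e where e: "0 < e" "!!x y. x : ?K ==> y : ?K ==> dist y x < e ==> dist (Y y) (Y x) < d" unfolding uniformly_continuous_on_def using d by metis
 show thesis
 proof (rule that[of "min (e / 2) (1 / 2)"])
  fix x y :: 'a assume xy: "norm (y - x) <= min (e / 2) (1 / 2) * norm x"
  show "norm (Y y - Y x) <= d * norm x"
  proof (cases "x = 0")
   case True
   thus ?thesis using xy by simp
  next
   case False
   define r where "r = 1 / norm x"
   have r: "0 < r" "r * norm x = 1" using False by (auto simp: r_def)
   have n: "norm (r *. y - r *. x) <= min (e / 2) (1 / 2)"
   proof -
    have "norm (r *. y - r *. x) = r * norm (y - x)" using r(1) by (simp flip: scaleR_diff_right)
    also have "... <= r * (min (e / 2) (1 / 2) * norm x)" using r xy by (intro mult_left_mono) auto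
    also have "... = min (e / 2) (1 / 2)" using r(2) by (simp add: mult.left_commute)
    finally show ?thesis .
   qed
   have nx: "norm (r *. x) = 1" using r by simp
   have "norm (r *. y) <= 2" "1 / 2 <= norm (r *. y)" using n nx norm_triangle_ineq2[of "r *. y" "r *. x"] norm_triangle_ineq3[of "r *. y" "r *. x"] by auto
   hence "dist (Y (r *. y)) (Y (r *. x)) < d" using n nx e(1) by (intro e(2)) (auto simp: dist_norm)
   hence "r * norm (Y y - Y x) < d" using r(1) by (simp add: hom dist_norm flip: scaleR_diff_right)
   hence "norm x * (r * norm (Y y - Y x)) <= norm x * d" by (intro mult_left_mono) auto
   moreover have "norm x * (r * norm (Y y - Y x)) = (r * norm x) * norm (Y y - Y x)" by simp
   ultimately show ?thesis using r(2) by (simp add: mult.commute)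
  qed
 qed (use e(1) in auto)
qed

section \<open>Homogeneous symplectic flows\<close>

text \<open>\<open>liouville\<close> says that the flow preserves the 1-form
  \<open>inner (J x) v\<close>, up to a factor a primitive of the symplectic form; this fits
  homogeneity of degree 1 and makes the flow symplectic. Derivatives are required off 0 only, since
  a positively homogeneous map is in general not differentiable at 0.\<close>

locale symplectic_flow =
 fixes J :: "'v::euclidean_space => 'v" and \<psi> :: "real => 'v => 'v" and D :: "real => 'v => 'v => 'v" and Y :: "'v => 'v"
 assumes J: "linear J" "!!x. J (J x) = - x" "!!x y. inner (J x) (J y) = inner x y"
  and flow: "!!x. \<psi> 0 x = x" "!!s t x. \<psi> (s + t) x = \<psi> s (\<psi> t x)" "!!x. \<psi> 1 x = x"
  and free: "!!t x. x ~= 0 ==> \<psi> t x = x ==> t : \<int>"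
  and hom: "!!c t x. 0 <= c ==> \<psi> t (c *. x) = c *. \<psi> t x"
  and der: "!!t x. x ~= 0 ==> (\<psi> t has_derivative D t x) (at x)"
  and contD: "!!v. continuous_on (UNIV \<times> (- {0})) (%z. D (fst z) (snd z) v)"
  and field: "!!x. ((%t. \<psi> t x) has_vector_derivative Y x) (at 0)" and contY: "continuous_on (- {0}) Y"
  and liouville: "!!t x v. x ~= 0 ==> inner (J (\<psi> t x)) (D t x v) = inner (J x) v"
begin

abbreviation \<omega> :: "'v => 'v => real" where "\<omega> u v \<equiv> inner (J u) v"

lemma bounded_linear_J: "bounded_linear J" using J(1) by (rule linear_conv_bounded_linear[THEN iffD1])

lemma J_simps [simp]: "J (x + y) = J x + J y" "J (x - y) = J x - J y" "J (- x) = - J x" "J (c *. x) = c *. J x" "J 0 = 0"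
 using J(1) by (simp_all add: linear_add linear_diff linear_neg linear_scale linear_0)

lemma norm_J [simp]: "norm (J x) = norm x" using J(3)[of x x] by (simp add: norm_eq_sqrt_inner)

lemma omega_swap: "\<omega> u v = - \<omega> v u" using J(3)[of u "J v"] by (simp add: J(2) inner_commute)

lemma omega_self [simp]: "\<omega> u u = 0" using omega_swap[of u u] by simp

lemma psi_0 [simp]: "\<psi> t 0 = 0" using hom[of 0 t 0] by simp

lemma psi_neg [simp]: "\<psi> (- t) (\<psi> t x) = x" "\<psi> t (\<psi> (- t) x) = x" using flow(2)[of "- t" t x] flow(2)[of t "- t" x] flow(1) by simp_all

lemma psi_eq_0 [simp]: "\<psi> t x = 0 \<longleftrightarrow> x = 0" by (metis psi_neg(1) psi_0)

lemma psi_periodic: "\<psi> (t + of_int n) x = \<psi> t x"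
proof -
 have nat: "\<psi> (real k) x = x" for k x by (induction k) (simp_all add: flow(1) flow(2)[of 1] flow(3))
 have "\<psi> (of_int n) x = x"
 proof (cases "0 <= n")
  case True
  thus ?thesis using nat[of "nat n" x] by simp
 next
  case False
  hence "\<psi> (real (nat (- n))) (\<psi> (of_int n) x) = x" using psi_neg(2)[of "- of_int n" x] by simp
  thus ?thesis using nat by simp
 qed
 thus ?thesis by (simp add: flow(2))
qed

lemma D_0: "x ~= 0 ==> D 0 x v = v"
proof -
 assume x: "x ~= 0"
 have "\<psi> 0 = (%x. x)" using flow(1) by auto
 hence "((%x. x) has_derivative D 0 x) (at x)" using der[OF x, of 0] by simp
 hence "D 0 x = (%x. x)" by (rule has_derivative_unique) (rule has_derivative_ident)
 thus ?thesis by simp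
qed

lemma D_linear: "x ~= 0 ==> bounded_linear (D t x)" using der has_derivative_bounded_linear by blast

lemma D_homogeneous:
 assumes x: "x ~= 0" and c: "0 < c"
 shows "D t (c *. x) = D t x"
proof -
 have 1: "((%y. c *. y) has_derivative (%y. c *. y)) (at x)" by (intro derivative_intros)
 have "c *. x ~= 0" using x c by simp
 from diff_chain_at[OF 1 der[OF this, of t]]
 have "((%y. c *. \<psi> t y) has_derivative D t (c *. x) \<circ> (%y. c *. y)) (at x)" using c by (simp add: o_def hom)
 moreover have "((%y. c *. \<psi> t y) has_derivative (%v. c *. D t x v)) (at x)" by (intro derivative_intros der[OF x])
 ultimately have "D t (c *. x) \<circ> (%y. c *. y) = (%v. c *. D t x v)" by (rule has_derivative_unique)
 hence "D t (c *. x) (c *. v) = c *. D t x v" for v by (metis comp_apply)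
 thus ?thesis using c linear_scale[OF bounded_linear.linear[OF D_linear[OF \<open>c *. x ~= 0\<close>, of t]]] by auto
qed

lemma basis_bound:
 assumes "bounded_linear A" "!!b. b : Basis ==> norm (A b) <= d" "0 <= d"
 shows "norm (A (v :: 'v)) <= real DIM('v) * d * norm v"
proof -
 have "norm (A v) <= (SUM b:Basis. norm (A (inner v b *. b)))" using euclidean_representation[of v] norm_sum[of "%b. A (inner v b *. b)" Basis]
   linear_sum[OF bounded_linear.linear[OF assms(1)], of "%b. inner v b *. b" Basis] by simp
 also have "... <= (SUM b:(Basis :: 'v set). norm v * d)" using assms by (intro sum_mono) (simp add: linear_scale[OF bounded_linear.linear] mult_mono Basis_le_norm)
 finally show ?thesis by (simp add: mult.commute mult.left_commute)
qed

text \<open>The derivative is homogeneous of degree 0 in the point, so compactness of the unit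
  sphere gives one time bound for all points.\<close>

lemma D_near_id:
 assumes "0 < d"
 obtains \<sigma> where "0 < \<sigma>" "!!t x v. \<bar>t\<bar> <= \<sigma> ==> x ~= 0 ==> norm (D t x v - v) <= d * norm v"
proof -
 define d' where "d' = d / (real DIM('v))"
 have d': "0 < d'" using assms by (simp add: d'_def)
 let ?K = "{-1..1::real} \<times> sphere (0::'v) 1"
 have "EX e>0. ALL t x. \<bar>t\<bar> <= 1 --> \<bar>t\<bar> < e --> norm x = 1 --> norm (D t x b - b) <= d'" for b
 proof -
  have "compact ?K" by (intro compact_Times) auto
  moreover have "continuous_on ?K (%z. D (fst z) (snd z) b)" by (rule continuous_on_subset[OF contD]) auto
  ultimately have "uniformly_continuous_on ?K (%z. D (fst z) (snd z) b)" by (rule compact_uniformly_continuous[rotated])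
  then obtain e where e: "0 < e"
   "!!z w. z : ?K ==> w : ?K ==> dist w z < e ==> dist (D (fst w) (snd w) b) (D (fst z) (snd z) b) < d'" unfolding uniformly_continuous_on_def using d' by metis
  have "norm (D t x b - b) <= d'" if t: "\<bar>t\<bar> <= 1" "\<bar>t\<bar> < e" "norm x = 1" for t x
  proof -
   have "dist (t, x) (0, x) < e" using t(2) by (simp add: dist_Pair_Pair)
   hence "dist (D t x b) (D 0 x b) < d'" using e(2)[of "(0, x)" "(t, x)"] t by (auto simp: abs_le_iff)
   moreover have "x ~= 0" using t(3) by auto
   ultimately show ?thesis using D_0[of x b] by (simp add: dist_norm)
  qed
  thus ?thesis using e(1) by blast
 qed
 then obtain e where e: "!!b. 0 < e b" "!!b t x. \<bar>t\<bar> <= 1 ==> \<bar>t\<bar> < e b ==> norm x = 1 ==> norm (D t x b - b) <= d'" by metis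
 define \<sigma> where "\<sigma> = min 1 (Min (e ` Basis) / 2)"
 have M: "0 < Min (e ` (Basis :: 'v set))" using e(1) by (subst Min_gr_iff) auto
 show thesis
 proof (rule that[of \<sigma>])
  show "0 < \<sigma>" using M by (simp add: \<sigma>_def)
  fix t x and v :: 'v assume t: "\<bar>t\<bar> <= \<sigma>" and x: "(x::'v) ~= 0"
  let ?u = "(1 / norm x) *. x"
  have "norm (D t ?u b - b) <= d'" if "b : Basis" for b
  proof (rule e(2))
   have "Min (e ` Basis) <= e b" using that by (intro Min_le) auto
   moreover have "\<bar>t\<bar> <= Min (e ` (Basis :: 'v set)) / 2" using t unfolding \<sigma>_def by (rule order_trans) (rule min.cobounded2)
   ultimately show "\<bar>t\<bar> < e b" using M by linarith
  qed (use t x in \<open>auto simp: \<sigma>_def\<close>)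
  hence "norm (D t x b - b) <= d'" if "b : Basis" for b using that D_homogeneous[OF x, of "1 / norm x" t] x by simp
  hence "norm (D t x v - v) <= real DIM('v) * d' * norm v"
   using basis_bound[of "%v. D t x v - v" d' v] d' bounded_linear_sub[OF D_linear[OF x] bounded_linear_ident] by simp
  thus "norm (D t x v - v) <= d * norm v" by (simp add: d'_def)
 qed
qed

lemma D_bound: obtains L where "1 <= L" "!!t x v. x ~= 0 ==> norm (D t x v) <= L * norm v"
proof -
 let ?K = "{0..1::real} \<times> sphere (0::'v) 1"
 have "EX B. ALL t x. 0 <= t --> t <= 1 --> norm x = 1 --> norm (D t x b) <= B" for b
 proof -
  have "compact ((%z. D (fst z) (snd z) b) ` ?K)" by (intro compact_continuous_image continuous_on_subset[OF contD] compact_Times) auto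
  then obtain B where "ALL w:(%z. D (fst z) (snd z) b) ` ?K. norm w <= B" using compact_imp_bounded bounded_iff by metis
  thus ?thesis by (intro exI[of _ B]) auto
 qed
 then obtain B where B: "!!b t x. 0 <= t ==> t <= 1 ==> norm x = 1 ==> norm (D t x b) <= B b" by metis
 define d where "d = (SUM b:(Basis::'v set). \<bar>B b\<bar>)"
 show thesis
 proof (rule that[of "1 + real DIM('v) * d"])
  show "1 <= 1 + real DIM('v) * d" by (simp add: d_def sum_nonneg)
  fix t x and v :: 'v assume x: "(x::'v) ~= 0"
  have eq: "\<psi> t = \<psi> (frac t)" using psi_periodic[of "frac t" "\<lfloor>t\<rfloor>"] by (auto simp: frac_def)
  hence Dt: "D t x = D (frac t) x" using der[OF x, of t] der[OF x, of "frac t"] has_derivative_unique by metis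
  let ?u = "(1 / norm x) *. x"
  have "norm (D t x b) <= d" if b: "b : Basis" for b
  proof -
   have "norm (D (frac t) ?u b) <= B b" by (rule B) (use x frac_lt_1[of t] in \<open>auto simp: less_imp_le\<close>)
   also have "... <= \<bar>B b\<bar>" by simp
   also have "... <= d" unfolding d_def by (rule member_le_sum[OF b]) auto
   finally show ?thesis using D_homogeneous[OF x, of "1 / norm x"] x Dt by simp
  qed
  hence "norm (D t x v) <= real DIM('v) * d * norm v" by (intro basis_bound D_linear[OF x]) (auto simp: d_def sum_nonneg)
  thus "norm (D t x v) <= (1 + real DIM('v) * d) * norm v" using norm_ge_zero[of v] by (simp only: distrib_right mult_1)
 qed
qed

lemma Y_homogeneous: "0 <= c ==> Y (c *. x) = c *. Y x"
proof -
 assume c: "0 <= c"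
 have "((%t. c *. \<psi> t x) has_vector_derivative c *. Y x) (at 0)" by (rule bounded_linear.has_vector_derivative[OF bounded_linear_scaleR_right field])
 moreover have "((%t. c *. \<psi> t x) has_vector_derivative Y (c *. x)) (at 0)" using field[of "c *. x"] by (simp add: hom[OF c])
 ultimately show ?thesis by (metis vector_derivative_at)
qed

lemma Y_0 [simp]: "Y 0 = 0" using Y_homogeneous[of 0 0] by simp

lemma psi_derivative: "((%t. \<psi> t x) has_vector_derivative Y (\<psi> t x)) (at t)"
proof -
 have "((%s. \<psi> s (\<psi> t x)) \<circ> (%s. s - t) has_vector_derivative 1 *. Y (\<psi> t x)) (at t)"
  by (rule vector_diff_chain_at) (auto intro!: derivative_eq_intros field)
 thus ?thesis by (simp add: o_def flow(2)[symmetric])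
qed

text \<open>A zero of the field would be a rest point of the flow, hence fixed at time 1/2, against
  freeness.\<close>

lemma Y_nonzero: "x ~= 0 ==> Y x ~= 0"
proof
 assume x: "x ~= 0" and Yx: "Y x = 0"
 have "((%t. \<psi> t x) has_vector_derivative 0) (at t)" for t
 proof -
  have "((%s. \<psi> t (\<psi> s x)) has_derivative (%h. D t x (h *. Y x))) (at 0)"
   using diff_chain_at[of "%s. \<psi> s x" "%h. h *. Y x" 0 "\<psi> t" "D t x"] field[of x] der[OF x] flow(1) by (simp add: has_vector_derivative_def o_def)
  hence 1: "((%s. \<psi> (t + s) x) has_vector_derivative 0) (at 0)" using linear_0[OF bounded_linear.linear[OF D_linear[OF x, of t]]] Yx
   by (simp add: flow(2) has_vector_derivative_def)
  have "((%s. \<psi> (t + s) x) \<circ> (%s. s - t) has_vector_derivative 1 *. 0) (at t)"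
   by (rule vector_diff_chain_at) (use 1 in \<open>auto intro!: derivative_eq_intros\<close>)
  thus ?thesis by (simp add: o_def)
 qed
 hence "\<psi> (1 / 2) x = \<psi> 0 x" using has_derivative_zero_constant[of UNIV "%t. \<psi> t x"] by (auto simp: has_vector_derivative_def)
 hence "(1 / 2 :: real) : \<int>" using free[OF x, of "1 / 2"] flow(1)[of x] by metis
 then obtain n :: int where "(1 / 2 :: real) = of_int n" by (auto elim: Ints_cases)
 hence "of_int (2 * n) = (1 :: real)" by simp
 hence "2 * n = 1" using of_int_eq_1_iff by blast
 thus False by presburger
qed

end

context symplectic_flow
begin

lemma psi_minus_id_lipschitz:
 assumes "!!x v. x ~= 0 ==> norm (D s x v - v) <= d * norm v"
 shows "norm ((\<psi> s x - x) - (\<psi> s y - y)) <= d * norm (x - y)" by (rule homogeneous_lipschitz[where F="%x. \<psi> s x - x" and F'="%x v. D s x v - v"])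
  (auto simp: hom scaleR_diff_right assms intro!: derivative_intros der)

lemma psi_close_id:
 assumes "0 < d"
 obtains e where "0 < e" "!!r y. \<bar>r\<bar> <= e ==> norm (\<psi> r y - y) <= d * norm y"
proof -
 obtain e where e: "0 < e" "!!t x v. \<bar>t\<bar> <= e ==> x ~= 0 ==> norm (D t x v - v) <= d * norm v" using D_near_id[OF assms] by blast
 show thesis
 proof (rule that[OF e(1)])
  fix r y assume "\<bar>r\<bar> <= e"
  thus "norm (\<psi> r y - y) <= d * norm y" using psi_minus_id_lipschitz[of r d y 0] e(2) by simp
 qed
qed

lemma psi_lipschitz: obtains L where "1 <= L" "!!t x y. norm (\<psi> t x - \<psi> t y) <= L * norm (x - y)"
proof -
 obtain L where L: "1 <= L" "!!t x v. x ~= 0 ==> norm (D t x v) <= L * norm v" using D_bound by blast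
 have "norm (\<psi> t x - \<psi> t y) <= L * norm (x - y)" for t x y by (rule homogeneous_lipschitz[where F="\<psi> t" and F'="D t"]) (simp_all add: hom der L(2))
 thus thesis using that L(1) by blast
qed

text \<open>Freeness made quantitative: at times off the integers there is no fixed point but 0,
  compactness of the time interval and of the unit sphere gives a positive minimum, and homogeneity
  extends it to all \<open>u\<close>.\<close>

lemma fixed_point_gap:
 assumes "0 < \<epsilon>"
 obtains c where "0 < c" "!!t u. \<epsilon> <= t ==> t <= 1 - \<epsilon> ==> c * norm u <= norm (\<psi> t u - u)"
proof -
 obtain L where L: "1 <= L" "!!t x y. norm (\<psi> t x - \<psi> t y) <= L * norm (x - y)" using psi_lipschitz by blast
 let ?K = "{\<epsilon>..1 - \<epsilon>} \<times> sphere (0::'v) 1"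
 have c: "continuous_on ?K (%z. \<psi> (fst z) (snd z))"
 proof (rule continuous_onI)
  fix z and e :: real assume z: "z : ?K" and e: "0 < e"
  have "isCont (%t. \<psi> t (snd z)) (fst z)" using psi_derivative has_vector_derivative_continuous by blast
  then obtain d where d: "0 < d" "!!t. dist t (fst z) < d ==> dist (\<psi> t (snd z)) (\<psi> (fst z) (snd z)) < e / 2"
   using e unfolding continuous_at_eps_delta by (metis half_gt_zero)
  show "EX d>0. ALL w:?K. dist w z < d --> dist (\<psi> (fst w) (snd w)) (\<psi> (fst z) (snd z)) <= e"
  proof (intro exI[of _ "min d (e / (2 * L))"] conjI ballI impI)
   show "0 < min d (e / (2 * L))" using d(1) e L(1) by simp
   fix w assume w: "dist w z < min d (e / (2 * L))"
   hence 1: "dist (\<psi> (fst w) (snd z)) (\<psi> (fst z) (snd z)) < e / 2" using d(2)[of "fst w"] dist_fst_le[of w z] by simp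
   have "dist (snd w) (snd z) <= e / (2 * L)" using w dist_snd_le[of w z] by simp
   hence "L * dist (snd w) (snd z) <= L * (e / (2 * L))" using L(1) by (intro mult_left_mono) auto
   hence "dist (\<psi> (fst w) (snd w)) (\<psi> (fst w) (snd z)) <= e / 2" using L(2)[of "fst w" "snd w" "snd z"] L(1) by (simp add: dist_norm)
   thus "dist (\<psi> (fst w) (snd w)) (\<psi> (fst z) (snd z)) <= e" using 1
    dist_triangle[of "\<psi> (fst w) (snd w)" "\<psi> (fst z) (snd z)" "\<psi> (fst w) (snd z)"] by linarith
  qed
 qed
 show thesis
 proof (cases "?K = {}")
  case True
  obtain b :: 'v where "norm b = 1" using vector_choose_size[of 1] by auto
  hence K: "{\<epsilon>..1 - \<epsilon>} = {}" using True by auto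
  show thesis
  proof (rule that[of 1])
   fix t u assume "\<epsilon> <= t" "t <= 1 - \<epsilon>"
   hence "t : {\<epsilon>..1 - \<epsilon>}" by simp
   thus "1 * norm u <= norm (\<psi> t u - u)" using K by blast
  qed simp
 next
  case False
  have K: "compact ?K" by (intro compact_Times) auto
  have "continuous_on ?K (%z. norm (\<psi> (fst z) (snd z) - snd z))" by (intro continuous_intros c)
  from continuous_attains_inf[OF K False this]
  obtain z where z: "z : ?K" "!!w. w : ?K ==> norm (\<psi> (fst z) (snd z) - snd z) <= norm (\<psi> (fst w) (snd w) - snd w)"
   by (elim bexE) (rule that, assumption, rule bspec)
  show thesis
  proof (rule that[of "norm (\<psi> (fst z) (snd z) - snd z)"])
   have "fst z ~: \<int>" "snd z ~= 0"
   proof -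
    have t: "0 < fst z" "fst z < 1" using z(1) assms by auto
    show "fst z ~: \<int>"
    proof
     assume "fst z : \<int>"
     then obtain n :: int where "fst z = of_int n" by (auto elim: Ints_cases)
     hence "0 < n" "n < 1" using t by simp_all
     thus False by linarith
    qed
   qed (use z(1) in auto)
   thus "0 < norm (\<psi> (fst z) (snd z) - snd z)" using free by auto
   fix t u assume t: "\<epsilon> <= t" "t <= 1 - \<epsilon>"
   show "norm (\<psi> (fst z) (snd z) - snd z) * norm u <= norm (\<psi> t u - u)"
   proof (cases "u = 0")
    case False
    let ?c = "1 / norm u"
    have "norm (\<psi> (fst z) (snd z) - snd z) <= norm (\<psi> t (?c *. u) - ?c *. u)" using z(2)[of "(t, ?c *. u)"] t False by simp
    also have "\<psi> t (?c *. u) - ?c *. u = ?c *. (\<psi> t u - u)" by (simp add: hom scaleR_diff_right)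
    finally have "norm (\<psi> (fst z) (snd z) - snd z) <= norm (\<psi> t u - u) / norm u" by simp
    thus ?thesis using False by (simp add: pos_le_divide_eq)
   qed simp
  qed
 qed
qed

end

section \<open>Midpoint generating functions for short times\<close>

locale short_flow = symplectic_flow +
 fixes \<sigma> L :: real
 assumes sigma: "0 < \<sigma>" and short: "!!s x v. \<bar>s\<bar> <= \<sigma> ==> x ~= 0 ==> norm (D s x v - v) <= 1 / 2 * norm v"
  and L1: "1 <= L" and lip: "!!t x y. norm (\<psi> t x - \<psi> t y) <= L * norm (x - y)"
begin

text \<open>The midpoint of \<open>x\<close> and its image. For short times \<open>mid s\<close> is
  bijective, so the displacement becomes a function \<open>chord s\<close> of the midpoint, and
  \<open>J\<close> applied to it is a gradient. The midpoint convention makes the generating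
  function odd in \<open>s\<close>.\<close>

definition mid :: "real => 'a => 'a" where "mid s x = x + (1 / 2) *. (\<psi> s x - x)"

definition base :: "real => 'a => 'a" where "base s = inv_into UNIV (mid s)"

definition chord :: "real => 'a => 'a" where "chord s m = \<psi> s (base s m) - base s m"

text \<open>Euler's identity for a function of degree 2 with gradient \<open>J (chord s m)\<close>;
  homogeneity spares an integration.\<close>

definition gen :: "real => 'a => real" where "gen s m = - (1 / 2) * \<omega> m (chord s m)"

lemma step_lip: "\<bar>s\<bar> <= \<sigma> ==> norm ((\<psi> s x - x) - (\<psi> s y - y)) <= 1 / 2 * norm (x - y)" by (rule psi_minus_id_lipschitz) (rule short)

lemma mid_expands:
 assumes "\<bar>s\<bar> <= \<sigma>" shows "norm (x - y) <= 4 / 3 * norm (mid s x - mid s y)"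
proof -
 have "mid s x - mid s y = (x - y) + (1 / 2) *. ((\<psi> s x - x) - (\<psi> s y - y))" by (simp add: mid_def algebra_simps)
 hence "norm (x - y) <= norm (mid s x - mid s y) + norm ((1 / 2) *. ((\<psi> s x - x) - (\<psi> s y - y)))"
  using norm_triangle_ineq4[of "mid s x - mid s y" "(1 / 2) *. ((\<psi> s x - x) - (\<psi> s y - y))"] by simp
 thus ?thesis using step_lip[OF assms, of x y] by simp
qed

text \<open>Solving \<open>mid s z = m\<close> is a fixed point problem whose contraction constant
  1/4 is half of the Lipschitz constant 1/2 of the displacement.\<close>

lemma bij_mid:
 assumes s: "\<bar>s\<bar> <= \<sigma>" shows "bij (mid s)"
proof (rule bijI)
 show "inj (mid s)" using mid_expands[OF s] by (intro injI) (metis diff_self eq_iff_diff_eq_0 mult_zero_right norm_le_zero_iff norm_zero)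
 show "surj (mid s)"
 proof (rule surjI[of _ "%m. SOME z. mid s z = m"])
  fix m
  let ?T = "%z. m - (1 / 2) *. (\<psi> s z - z)"
  have "EX! z:UNIV. ?T z = z"
  proof (rule Banach_fix[where c="1 / 4"])
   have "dist (?T x) (?T y) <= 1 / 4 * dist x y" for x y
   proof -
    have "?T x - ?T y = - ((1 / 2) *. ((\<psi> s x - x) - (\<psi> s y - y)))" by (simp add: algebra_simps)
    hence "norm (?T x - ?T y) = 1 / 2 * norm ((\<psi> s x - x) - (\<psi> s y - y))" by simp
    thus ?thesis using step_lip[OF s, of x y] by (simp add: dist_norm)
   qed
   thus "dist (?T x) (?T y) <= 1 / 4 * dist x y" for x y by blast
  qed (auto simp: complete_UNIV)
  then obtain z where "?T z = z" by blast
  hence "mid s z = m" by (simp add: mid_def algebra_simps)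
  thus "mid s (SOME z. mid s z = m) = m" by (rule someI)
 qed
qed

lemma mid_base [simp]: "\<bar>s\<bar> <= \<sigma> ==> mid s (base s m) = m"
 and base_mid [simp]: "\<bar>s\<bar> <= \<sigma> ==> base s (mid s x) = x" using bij_mid[of s] by (simp_all add: base_def bij_is_surj surj_f_inv_f bij_is_inj)

lemma base_lip: "\<bar>s\<bar> <= \<sigma> ==> norm (base s x - base s y) <= 4 / 3 * norm (x - y)" using mid_expands[of s "base s x" "base s y"] by simp

lemma mid_hom: "0 <= c ==> mid s (c *. x) = c *. mid s x" by (simp add: mid_def hom algebra_simps)

lemma base_hom: "\<bar>s\<bar> <= \<sigma> ==> 0 <= c ==> base s (c *. x) = c *. base s x" by (metis mid_base base_mid mid_hom)

lemma base_0 [simp]: "\<bar>s\<bar> <= \<sigma> ==> base s 0 = 0" using base_hom[of s 0 0] by simp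

lemma chord_hom: "\<bar>s\<bar> <= \<sigma> ==> 0 <= c ==> chord s (c *. x) = c *. chord s x" by (simp add: chord_def base_hom hom scaleR_diff_right)

lemma chord_0 [simp]: "\<bar>s\<bar> <= \<sigma> ==> chord s 0 = 0" using chord_hom[of s 0 0] by simp

lemma base_chord: "\<bar>s\<bar> <= \<sigma> ==> base s m = m - (1 / 2) *. chord s m" using mid_base[of s m] by (simp add: mid_def chord_def algebra_simps)

lemma minus_half: "c - (1 / 2) *. c = (1 / 2) *. (c :: 'a)"
proof -
 have "(1 - 1 / 2) *. c = c - (1 / 2) *. c" unfolding scaleR_left_diff_distrib by simp
 thus ?thesis by simp
qed

lemma psi_base: "\<bar>s\<bar> <= \<sigma> ==> \<psi> s (base s m) = m + (1 / 2) *. chord s m"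
proof -
 assume s: "\<bar>s\<bar> <= \<sigma>"
 have "\<psi> s (base s m) = base s m + chord s m" by (simp add: chord_def)
 also have "... = m + (chord s m - (1 / 2) *. chord s m)" by (simp add: base_chord[OF s])
 finally show ?thesis by (simp only: minus_half)
qed

lemma chord_lip: "\<bar>s\<bar> <= \<sigma> ==> norm (chord s x - chord s y) <= 2 / 3 * norm (x - y)"
 using step_lip[of s "base s x" "base s y"] base_lip[of s x y] by (simp add: chord_def)

lemma chord_le: "\<bar>s\<bar> <= \<sigma> ==> norm (chord s x) <= 2 / 3 * norm x" using chord_lip[of s x 0] by simp

text \<open>A point and its image exchange roles under the inverse map while their midpoint stays
  the same.\<close>

lemma chord_neg: "\<bar>s\<bar> <= \<sigma> ==> chord (- s) m = - chord s m"
proof -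
 assume s: "\<bar>s\<bar> <= \<sigma>"
 have "mid (- s) (\<psi> s (base s m)) = base s m + (chord s m - (1 / 2) *. chord s m)" by (simp add: mid_def chord_def scaleR_diff_right)
 also have "... = mid s (base s m)" by (simp only: minus_half) (simp add: mid_def chord_def)
 finally have "mid (- s) (\<psi> s (base s m)) = mid s (base s m)" .
 hence "base (- s) m = \<psi> s (base s m)" using s base_mid[of "- s" "\<psi> s (base s m)"] by simp
 thus ?thesis by (simp add: chord_def)
qed

lemma gen_neg: "\<bar>s\<bar> <= \<sigma> ==> gen (- s) m = - gen s m" by (simp add: gen_def chord_neg)

lemma gen_homogeneous: "\<bar>s\<bar> <= \<sigma> ==> homogeneous2 (gen s)" by (simp add: homogeneous2_def gen_def chord_hom power2_eq_square)

text \<open>The second conclusion is the derivative of \<open>mid s (base s m) = m\<close>, solved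
  for the term with \<open>D\<close>.\<close>

lemma base_derivative:
 assumes s: "\<bar>s\<bar> <= \<sigma>" and m: "m ~= 0"
 obtains B where "(base s has_derivative B) (at m)" "!!v. D s (base s m) (B v) = 2 *. v - B v"
proof -
 let ?z = "base s m"
 have z: "?z ~= 0" using mid_base[OF s, of m] m mid_hom[of 0 s 0] by auto
 let ?A = "%v. v + (1 / 2) *. (D s ?z v - v)"
 have blA: "bounded_linear ?A" by (intro bounded_linear_intros D_linear[OF z])
 have mid: "(mid s has_derivative ?A) (at ?z)" unfolding mid_def by (intro derivative_intros der[OF z])
 have "inj ?A"
 proof (rule linear_injective_0[OF bounded_linear.linear[OF blA], THEN iffD2, rule_format])
  fix v assume "?A v = 0"
  hence "v = - ((1 / 2) *. (D s ?z v - v))" by (rule eq_neg_iff_add_eq_0[THEN iffD2])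
  hence "norm v = 1 / 2 * norm (D s ?z v - v)" by (metis norm_minus_cancel norm_scaleR abs_of_pos half_gt_zero_iff zero_less_one)
  hence "norm v = 0" using short[OF s z, of v] norm_ge_zero[of v] by linarith
  thus "v = 0" by simp
 qed
 then obtain B where B: "linear B" "B \<circ> ?A = id" "?A \<circ> B = id" using linear_injective_isomorphism[OF bounded_linear.linear[OF blA]] by (auto simp: fun_eq_iff)
 have blB: "bounded_linear B" using B(1) by (rule linear_conv_bounded_linear[THEN iffD1])
 have c: "isCont (base s) m"
 proof -
  have "(4 / 3)-lipschitz_on UNIV (base s)" using base_lip[OF s] by (intro lipschitz_onI) (auto simp: dist_norm)
  thus ?thesis using lipschitz_on_continuous_on continuous_on_eq_continuous_at open_UNIV by blast
 qed
 have "(base s has_derivative B) (at m)" by (rule has_derivative_inverse_basic[OF mid blB B(2) c open_UNIV]) (auto simp: mid_base[OF s])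
 moreover have "D s ?z (B v) = 2 *. v - B v" for v
 proof -
  have "B v + (1 / 2) *. (D s ?z (B v) - B v) = v" using B(3) by (auto simp: fun_eq_iff)
  hence "2 *. (B v + (1 / 2) *. (D s ?z (B v) - B v)) = 2 *. v" by simp
  thus ?thesis by (simp add: algebra_simps scaleR_2)
 qed
 ultimately show thesis using that by blast
qed

text \<open>At 0 a quadratic bound on \<open>gen s\<close> suffices. Elsewhere preservation of the
  Liouville form, tested on the variation \<open>B v\<close> of the base point, turns the derivative
  of Euler's formula into \<open>J (chord s m)\<close>.\<close>

lemma gen_gradient:
 assumes s: "\<bar>s\<bar> <= \<sigma>"
 shows "(gen s has_derivative (%v. inner (J (chord s m)) v)) (at m)"
proof (cases "m = 0")
 case True
 have "bounded_linear (%v. inner (J (chord s m)) v)" by (rule bounded_linear_inner_right)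
 moreover have "norm (gen s y) <= e * norm y" if "0 < e" "norm y < e" for y e
 proof -
  have "\<bar>gen s y\<bar> <= 1 / 2 * (norm y * norm (chord s y))" using Cauchy_Schwarz_ineq2[of "J y" "chord s y"] by (simp add: gen_def abs_mult)
  also have "... <= 1 / 2 * (norm y * (2 / 3 * norm y))" using chord_le[OF s, of y] by (intro mult_left_mono) auto
  also have "... <= norm y * norm y" by simp
  also have "... <= e * norm y" using that by (intro mult_right_mono) auto
  finally show ?thesis by simp
 qed
 moreover have "gen s m = 0" "J (chord s m) = 0" using s True by (simp_all add: gen_def)
 ultimately show ?thesis unfolding has_derivative_at_alt using True by (intro conjI allI impI exI[of _ e for e]) (auto intro: bounded_linear_inner_right[of 0])
next
 case False
 obtain B where B: "(base s has_derivative B) (at m)" "!!v. D s (base s m) (B v) = 2 *. v - B v" using base_derivative[OF s False] by blast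
 have z: "base s m ~= 0" using mid_base[OF s, of m] False mid_hom[of 0 s 0] by auto
 have c: "chord s m = 2 *. (m - base s m)" for m by (simp add: base_chord[OF s])
 have "((%m. - (1 / 2) * inner (J m) (2 *. (m - base s m))) has_derivative
   (%v. - (1 / 2) * (inner (J m) (2 *. (v - B v)) + inner (J v) (2 *. (m - base s m))))) (at m)"
  by (intro derivative_intros B(1) bounded_linear.has_derivative[OF bounded_linear_J])
 moreover have "- (1 / 2) * (inner (J m) (2 *. (v - B v)) + inner (J v) (2 *. (m - base s m))) = inner (J (chord s m)) v" for v
 proof -
  have "inner (J (m + (1 / 2) *. chord s m)) (2 *. v - B v) = inner (J (m - (1 / 2) *. chord s m)) (B v)"
   using liouville[OF z, of s "B v"] unfolding B(2) psi_base[OF s] unfolding base_chord[OF s] .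
  hence "inner (J m) (B v) = inner (J m) v + inner (J (chord s m)) v / 2" by (simp add: inner_add_left inner_diff_left inner_diff_right)
  hence "inner (J m) (2 *. (v - B v)) = - inner (J (chord s m)) v" by (simp add: inner_diff_right algebra_simps)
  moreover have "inner (J v) (2 *. (m - base s m)) = - inner (J (chord s m)) v" using omega_swap[of v "chord s m"] by (simp only: c)
  ultimately show ?thesis by simp
 qed
 ultimately show ?thesis unfolding gen_def[abs_def] c by simp
qed

lemma chord_close:
 assumes "0 < d"
 obtains e where "0 < e" "!!s s' m. \<bar>s\<bar> <= \<sigma> ==> \<bar>s'\<bar> <= \<sigma> ==> \<bar>s - s'\<bar> <= e ==> norm (chord s m - chord s' m) <= d * norm m"
proof -
 have L0: "0 < L" using L1 by simp
 have "0 < d / (2 * L)" using assms L0 by simp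
 then obtain e where e: "0 < e" "!!r y. \<bar>r\<bar> <= e ==> norm (\<psi> r y - y) <= d / (2 * L) * norm y" using psi_close_id by blast
 show thesis
 proof (rule that[OF e(1)])
  fix s s' m assume s: "\<bar>s\<bar> <= \<sigma>" "\<bar>s'\<bar> <= \<sigma>" "\<bar>s - s'\<bar> <= e"
  define z where "z = base s m"
  have "norm (\<psi> s z - \<psi> s' z) <= d / (2 * L) * norm (\<psi> s' z)" using e(2)[OF s(3), of "\<psi> s' z"] flow(2)[of "s - s'" s' z] by simp
  also have "... <= d / (2 * L) * (L * norm z)" using lip[of s' z 0] assms L0 by (intro mult_left_mono) auto
  also have "... = d / 2 * norm z" using L0 by simp
  finally have 1: "norm (\<psi> s z - \<psi> s' z) <= d / 2 * norm z" .
  have "norm (z - base s' m) <= 4 / 3 * norm (mid s' z - mid s z)" using mid_expands[OF s(2), of z "base s' m"] s by (simp add: z_def)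
  also have "mid s' z - mid s z = - ((1 / 2) *. (\<psi> s z - \<psi> s' z))" by (simp add: mid_def algebra_simps)
  finally have 2: "norm (z - base s' m) <= 2 / 3 * norm (\<psi> s z - \<psi> s' z)" by simp
  have "chord s m - chord s' m = - 2 *. (z - base s' m)" unfolding z_def base_chord[OF s(1), of m] base_chord[OF s(2), of m] by (simp add: algebra_simps)
  hence "norm (chord s m - chord s' m) = 2 * norm (z - base s' m)" by simp
  also have "... <= 2 * (2 / 3 * (d / 2 * norm z))" using 1 2 by simp
  also have "... = 2 / 3 * d * norm z" by simp
  also have "... <= 2 / 3 * d * (4 / 3 * norm m)" using base_lip[OF s(1), of m 0] s assms by (intro mult_left_mono) (auto simp: z_def)
  also have "... <= d * norm m" using assms by simp
  finally show "norm (chord s m - chord s' m) <= d * norm m" .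
 qed
qed

text \<open>Along the short orbit from the base point the field stays close to \<open>Y m\<close>.
  The mean value inequality for the orbit minus \<open>t *. Y m\<close> then gives an error that is
  small against \<open>s\<close>.\<close>

lemma chord_field:
 assumes "0 < d"
 obtains e where "0 < e" "e <= \<sigma>" "!!s m. \<bar>s\<bar> <= e ==> norm (chord s m - s *. Y m) <= d * \<bar>s\<bar> * norm m"
proof -
 obtain a where a: "0 < a" "a <= 1 / 2" "!!x y. norm (y - x) <= a * norm x ==> norm (Y y - Y x) <= d * norm x"
  using homogeneous_uniformly_continuous[OF Y_homogeneous contY assms] by blast
 have "0 < a / 4" using a(1) by simp
 then obtain e where e: "0 < e" "!!r y. \<bar>r\<bar> <= e ==> norm (\<psi> r y - y) <= a / 4 * norm y" using psi_close_id by blast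
 show thesis
 proof (rule that[of "min e \<sigma>"])
  fix s m assume s: "\<bar>s\<bar> <= min e \<sigma>"
  hence s': "\<bar>s\<bar> <= \<sigma>" by simp
  let ?z = "base s m"
  have zm: "norm ?z <= 4 / 3 * norm m" using base_lip[OF s', of m 0] s' by simp
  have near: "norm (\<psi> t ?z - m) <= a * norm m" if t: "\<bar>t\<bar> <= \<bar>s\<bar>" for t
  proof -
   have "norm (\<psi> t ?z - ?z) <= a / 4 * norm ?z" using e(2)[of t ?z] t s by simp
   moreover have "norm (?z - m) <= 1 / 2 * (a / 4 * norm ?z)"
   proof -
    have "?z - m = - ((1 / 2) *. chord s m)" by (simp add: base_chord[OF s'])
    hence "norm (?z - m) = 1 / 2 * norm (chord s m)" by simp
    also have "... <= 1 / 2 * (a / 4 * norm ?z)" using e(2)[of s ?z] s by (simp add: chord_def)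
    finally show ?thesis .
   qed
   ultimately have "norm (\<psi> t ?z - m) <= 3 / 2 * (a / 4 * norm ?z)" using norm_triangle_ineq[of "\<psi> t ?z - ?z" "?z - m"] by simp
   also have "... <= 3 / 2 * (a / 4 * (4 / 3 * norm m))" using zm a(1) by (intro mult_left_mono) auto
   also have "... <= a * norm m" using a(1) by simp
   finally show ?thesis .
  qed
  have "norm ((\<psi> s ?z - s *. Y m) - (\<psi> 0 ?z - 0 *. Y m)) <= d * norm m * norm (s - 0)"
  proof (rule differentiable_bound[OF convex_closed_segment, of 0 s "%t. \<psi> t ?z - t *. Y m" "%t h. h *. (Y (\<psi> t ?z) - Y m)"])
   fix t assume t: "t : closed_segment 0 s"
   have 1: "((%t. \<psi> t ?z) has_derivative (%h. h *. Y (\<psi> t ?z))) (at t)" using psi_derivative[of ?z t] by (simp add: has_vector_derivative_def)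
   have 2: "((%t. t *. Y m) has_derivative (%h. h *. Y m)) (at t)" by (rule bounded_linear_imp_has_derivative[OF bounded_linear_scaleR_left])
   from has_derivative_at_withinI[OF has_derivative_diff[OF 1 2]]
   show "((%t. \<psi> t ?z - t *. Y m) has_derivative (%h. h *. (Y (\<psi> t ?z) - Y m))) (at t within closed_segment 0 s)" by (simp add: scaleR_diff_right)
   obtain u where u: "0 <= u" "u <= 1" "t = u * s" using t by (auto simp: in_segment)
   hence "\<bar>t\<bar> <= \<bar>s\<bar>" by (simp add: abs_mult mult_left_le_one_le)
   hence "norm (Y (\<psi> t ?z) - Y m) <= d * norm m" by (intro a(3) near)
   thus "onorm (%h. h *. (Y (\<psi> t ?z) - Y m)) <= d * norm m" by (intro onorm_le) (simp add: mult.commute mult_left_mono)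
  qed auto
  thus "norm (chord s m - s *. Y m) <= d * \<bar>s\<bar> * norm m" by (simp add: chord_def flow(1) algebra_simps)
 qed (use e(1) sigma in auto)
qed

end

section \<open>The Hamiltonian as limit of generating functions\<close>

context short_flow
begin

text \<open>Minus twice the derivative of \<open>gen s\<close> at \<open>s = 0\<close>. In the
  application its restriction to the sphere is the contact form evaluated on the generating
  field.\<close>

definition ham :: "'a => real" where "ham x = \<omega> x (Y x)"

lemma field_bounds: obtains r B where "0 < r" "1 <= B" "!!x. r * norm x <= norm (Y x)" "!!x. norm (Y x) <= B * norm x"
proof -
 let ?S = "sphere (0::'a) 1"
 have c: "continuous_on ?S (%x. norm (Y x))" by (intro continuous_intros continuous_on_subset[OF contY]) auto
 obtain b :: 'a where "norm b = 1" using vector_choose_size[of 1] by auto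
 hence ne: "?S ~= {}" by auto
 obtain u where u: "u : ?S" "ALL x:?S. norm (Y u) <= norm (Y x)" using continuous_attains_inf[OF _ ne c] by auto
 obtain w where w: "w : ?S" "ALL x:?S. norm (Y x) <= norm (Y w)" using continuous_attains_sup[OF _ ne c] by auto
 have *: "norm (Y u) * norm x <= norm (Y x) & norm (Y x) <= (1 + norm (Y w)) * norm x" for x
 proof (cases "x = 0")
  case False
  hence "norm (Y u) <= norm (Y ((1 / norm x) *. x))" "norm (Y ((1 / norm x) *. x)) <= norm (Y w)" using u w by auto
  hence "norm (Y u) * norm x <= norm (Y x)" "norm (Y x) <= norm (Y w) * norm x" using False by (simp_all add: Y_homogeneous pos_le_divide_eq pos_divide_le_eq)
  moreover have "norm (Y w) * norm x <= (1 + norm (Y w)) * norm x" by (intro mult_right_mono) auto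
  ultimately show ?thesis by linarith
 qed simp
 have "u ~= 0" using u(1) by auto
 thus thesis using that[of "norm (Y u)" "1 + norm (Y w)"] * Y_nonzero[of u] by simp
qed

lemma ham_homogeneous: "homogeneous2 ham" by (simp add: homogeneous2_def ham_def Y_homogeneous power2_eq_square)

lemma continuous_Y: "continuous_on UNIV Y"
proof -
 obtain r B where B: "1 <= B" "!!x. norm (Y x) <= B * norm x" using field_bounds by metis
 have "isCont Y x" for x
 proof (cases "x = 0")
  case True
  have "isCont (%x. B * norm x) (0 :: 'a)" by (intro continuous_intros)
  hence "((%x. B * norm x) \<longlongrightarrow> B * norm (0::'a)) (at (0::'a))" by (simp only: isCont_def)
  hence "(Y \<longlongrightarrow> 0) (at 0)" using B(2) by (intro Lim_null_comparison[of Y "%x. B * norm x"]) auto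
  thus ?thesis using True by (simp add: isCont_def)
 next
  case False
  thus ?thesis using contY by (simp add: continuous_on_eq_continuous_at open_Compl)
 qed
 thus ?thesis by (simp add: continuous_at_imp_continuous_on)
qed

lemma gen_ham:
 assumes "0 < d"
 shows "EX e. 0 < e & (ALL s x. 0 < s --> s <= e --> \<bar>gen s x / s + ham x / 2\<bar> <= d * (norm x)^2)"
proof -
 obtain e where e: "0 < e" "e <= \<sigma>" "!!s m. \<bar>s\<bar> <= e ==> norm (chord s m - s *. Y m) <= d * \<bar>s\<bar> * norm m" using chord_field[OF assms] by blast
 show ?thesis
 proof (intro exI[of _ e] conjI e(1) allI impI)
  fix s x assume s: "0 < s" "s <= e"
  have "gen s x / s + ham x / 2 = - (1 / (2 * s)) * inner (J x) (chord s x - s *. Y x)" using s by (simp add: gen_def ham_def inner_diff_right field_simps)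
  hence "\<bar>gen s x / s + ham x / 2\<bar> = 1 / (2 * s) * \<bar>inner (J x) (chord s x - s *. Y x)\<bar>" using s by (simp add: abs_mult)
  also have "... <= 1 / (2 * s) * (norm x * (d * \<bar>s\<bar> * norm x))"
  proof (rule mult_left_mono)
   have "norm x * norm (chord s x - s *. Y x) <= norm x * (d * \<bar>s\<bar> * norm x)" using e(3)[of s x] s by (intro mult_left_mono) auto
   thus "\<bar>inner (J x) (chord s x - s *. Y x)\<bar> <= norm x * (d * \<bar>s\<bar> * norm x)" using Cauchy_Schwarz_ineq2[of "J x" "chord s x - s *. Y x"] by simp
  qed (use s in simp)
  also have "... = d / 2 * (norm x)^2" using s by (simp add: power2_eq_square)
  also have "... <= d * (norm x)^2" using assms by (intro mult_right_mono) auto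
  finally show "\<bar>gen s x / s + ham x / 2\<bar> <= d * (norm x)^2" .
 qed
qed

lemma abs_sign: "c = 1 | c = (- 1 :: real) ==> \<bar>c * a - c * (- b)\<bar> = \<bar>a + b\<bar>" by auto

text \<open>The gradients \<open>J (chord s) / s\<close> converge to \<open>J Y\<close>, so one and the same direction pushes down all
  the rescaled generating functions with small \<open>s\<close>, and hence also their limit.\<close>

lemma gen_pushable:
 assumes c: "c = 1 | c = (- 1 :: real)"
 obtains v k C e where "0 < e" "e <= \<sigma>" "!!s. 0 < s ==> s <= e ==> pushable UNIV (%x. c * (gen s x / s)) v k C"
  "pushable UNIV (%x. - c * ham x) v k C"
proof -
 have cc: "c * c = 1" "\<bar>c\<bar> = 1" using c by auto
 obtain r B where r: "0 < r" "1 <= B" "!!x. r * norm x <= norm (Y x)" "!!x. norm (Y x) <= B * norm x" using field_bounds by metis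
 have "0 < r / 4" "0 < r / 8" using r(1) by auto
 obtain a where a: "0 < a" "a <= 1 / 2" "!!x y. norm (y - x) <= a * norm x ==> norm (Y y - Y x) <= r / 4 * norm x"
  using homogeneous_uniformly_continuous[OF Y_homogeneous contY \<open>0 < r / 4\<close>] by blast
 obtain e where e: "0 < e" "e <= \<sigma>" "!!s m. \<bar>s\<bar> <= e ==> norm (chord s m - s *. Y m) <= r / 8 * \<bar>s\<bar> * norm m"
  using chord_field[OF \<open>0 < r / 8\<close>] by blast
 \<comment> \<open>\<open>a\<close> is a relative radius within which \<open>Y\<close> varies by at
   most \<open>r / 4\<close>; dividing by the bound \<open>B\<close> on \<open>Y\<close> keeps the
   pushes inside it.\<close>
 define \<eta> where "\<eta> = a / B"
 have \<eta>: "0 < \<eta>" "\<eta> * B = a" using a r by (auto simp: \<eta>_def)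
 define v where "v x = (\<eta> * c) *. J (Y x)" for x
 define k where "k = \<eta> * (r^2 / 2)"
 have k: "0 < k" using \<eta> r by (simp add: k_def)
 have vn: "norm (v x) <= a * norm x" for x
 proof -
  have "norm (v x) = \<eta> * norm (Y x)" using \<eta> cc by (simp add: v_def abs_mult)
  also have "... <= \<eta> * (B * norm x)" using r(4) \<eta> by (intro mult_left_mono) auto
  also have "... = a * norm x" using \<eta> by simp
  finally show ?thesis .
 qed
 have vc: "continuous_on UNIV v" unfolding v_def by (intro continuous_intros continuous_Y bounded_linear.continuous_on[OF bounded_linear_J])
 have desc: "c * (gen s (x - u *. v x) / s) <= c * (gen s x / s) - u * k * (norm x)^2"
  if s: "0 < s" "s <= e" and u: "0 <= u" "u <= 1" for s u x
 proof -
  have s': "\<bar>s\<bar> <= \<sigma>" using s e(2) by simp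
  have grad: "gradient_on UNIV (%x. c * (gen s x / s)) (%x. (c / s) *. J (chord s x))"
  proof -
   have "((%x. (c / s) * gen s x) has_derivative (%h. (c / s) * inner (J (chord s x)) h)) (at x within UNIV)" for x
    by (rule has_derivative_mult_right) (rule gen_gradient[OF s'])
   thus ?thesis by (simp add: gradient_on_def)
  qed
  obtain t where t: "0 < t" "t < 1" "c * (gen s (x - u *. v x) / s) - c * (gen s x / s) =
    inner ((c / s) *. J (chord s (x + t *. (x - u *. v x - x)))) (x - u *. v x - x)" by (rule gradient_on_mvt[OF convex_UNIV grad UNIV_I UNIV_I, of "x - u *. v x" x])
  define y where "y = x + t *. (x - u *. v x - x)"
  have "norm (y - x) = (t * u) * norm (v x)" using t u by (simp add: y_def abs_mult)
  also have "... <= 1 * (a * norm x)" using t u vn[of x] by (intro mult_mono) (auto intro: mult_le_one)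
  finally have yx: "norm (y - x) <= a * norm x" by simp
  hence "norm (y - x) <= 1 / 2 * norm x" using a(2) mult_right_mono[of a "1 / 2" "norm x"] by simp
  hence y2: "norm y <= 2 * norm x" using norm_triangle_ineq2[of y x] norm_ge_zero[of x] by linarith
  define w where "w = (1 / s) *. chord s y - Y x"
  have "norm ((1 / s) *. chord s y - Y y) = norm (chord s y - s *. Y y) / s"
  proof -
   have "(1 / s) *. chord s y - Y y = (1 / s) *. (chord s y - s *. Y y)" using s by (simp add: scaleR_diff_right)
   thus ?thesis using s by simp
  qed
  also have "... <= r / 8 * norm y" using e(3)[of s y] s by (simp add: pos_divide_le_eq mult.commute mult.left_commute)
  also have "... <= r / 8 * (2 * norm x)" using y2 r by (intro mult_left_mono) auto
  finally have "norm w <= r / 2 * norm x" using a(3)[OF yx] norm_triangle_ineq[of "(1 / s) *. chord s y - Y y" "Y y - Y x"] by (simp add: w_def)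
  also have "... <= norm (Y x) / 2" using r(3)[of x] by simp
  finally have "norm w <= norm (Y x) / 2" .
  hence "\<bar>inner w (Y x)\<bar> <= norm (Y x) / 2 * norm (Y x)"
   using Cauchy_Schwarz_ineq2[of w "Y x"] mult_right_mono[of "norm w" "norm (Y x) / 2" "norm (Y x)"] by simp
  hence wY: "- inner w (Y x) <= (norm (Y x))^2 / 2" by (simp add: power2_eq_square)
  have "inner ((c / s) *. J (chord s y)) (x - u *. v x - x) = - (u * \<eta>) * (c * c) * inner (J ((1 / s) *. chord s y)) (J (Y x))" by (simp add: v_def)
  also have "... = - (u * \<eta>) * inner ((1 / s) *. chord s y) (Y x)" using cc(1) unfolding J(3) by simp
  also have "inner ((1 / s) *. chord s y) (Y x) = inner w (Y x) + (norm (Y x))^2" by (simp add: w_def inner_diff_left power2_norm_eq_inner)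
  also have "- (u * \<eta>) * (inner w (Y x) + (norm (Y x))^2) <= - (u * \<eta>) * ((norm (Y x))^2 / 2)" using wY u \<eta> by (intro mult_left_mono_neg) auto
  also have "... <= - (u * \<eta>) * ((r * norm x)^2 / 2)" using r(1) r(3)[of x] u \<eta> by (intro mult_left_mono_neg divide_right_mono power_mono) auto
  also have "... = - (u * k * (norm x)^2)" by (simp add: k_def power_mult_distrib)
  finally show ?thesis using t(3) by (simp add: y_def)
 qed
 have p1: "pushable UNIV (%x. c * (gen s x / s)) v k a" if "0 < s" "s <= e" for s unfolding pushable_def using k a(1) vc vn desc[OF that] by auto
 have limit: "c * (- (ham x / 2)) <= c * (- (ham y / 2)) - z"
  if *: "!!s. 0 < s ==> s <= e ==> c * (gen s x / s) <= c * (gen s y / s) - z" for x y z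
 proof (rule field_le_epsilon)
  fix d :: real assume d: "0 < d"
  define d' where "d' = d / ((norm x)^2 + (norm y)^2 + 1)"
  have pos: "0 < (norm x)^2 + (norm y)^2 + 1" using zero_le_power2[of "norm x"] zero_le_power2[of "norm y"] by linarith
  have d': "0 < d'" "d' * (norm x)^2 + d' * (norm y)^2 <= d"
  proof -
   show "0 < d'" using d pos by (simp add: d'_def)
   have "d' * ((norm x)^2 + (norm y)^2 + 1) = d" using pos by (simp add: d'_def)
   thus "d' * (norm x)^2 + d' * (norm y)^2 <= d" using \<open>0 < d'\<close> by (simp add: distrib_left)
  qed
  obtain e' where e': "0 < e'" "ALL s x. 0 < s --> s <= e' --> \<bar>gen s x / s + ham x / 2\<bar> <= d' * (norm x)^2" using gen_ham[OF d'(1)] by (elim exE conjE)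
  define s where "s = min e e'"
  have s: "0 < s" "s <= e" "s <= e'" using e(1) e'(1) by (auto simp: s_def)
  have "\<bar>c * (gen s w / s) - c * (- (ham w / 2))\<bar> <= d' * (norm w)^2" for w using e'(2)[rule_format, OF s(1,3), of w] by (simp only: abs_sign[OF c])
  from this[of x] this[of y] show "c * (- (ham x / 2)) <= c * (- (ham y / 2)) - z + d" using *[OF s(1,2)] d'(2) by (simp add: abs_le_iff)
 qed
 have kk: "- c * ham (x - u *. v x) <= - c * ham x - u * k * (norm x)^2" if u: "0 <= u" "u <= 1" for u x
 proof -
  have "c * (- (ham (x - u *. v x) / 2)) <= c * (- (ham x / 2)) - u * k * (norm x)^2" by (rule limit) (rule desc[OF _ _ u])
  moreover have "0 <= u * k * (norm x)^2" using u k by simp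
  ultimately show ?thesis by simp
 qed
 have "pushable UNIV (%x. - c * ham x) v k a" unfolding pushable_def using k a(1) vc vn kk by auto
 thus thesis using that[OF e(1,2)] p1 by blast
qed

lemma continuous_ham: "continuous_on UNIV ham" unfolding ham_def[abs_def] by (intro continuous_intros continuous_Y bounded_linear.continuous_on[OF bounded_linear_J])

text \<open>The reversal of signs comes from \<open>gen s\<close> being close to
  \<open>- (s / 2) * ham\<close>; after division by \<open>s\<close> both functions are pushable
  with common constants.\<close>

lemma gen_sublevel_aux:
 assumes c: "c = 1 | c = (- 1 :: real)"
 obtains e where "0 < e" "e <= \<sigma>" "!!s p. 0 < s ==> s <= e ==> hiso {x. c * gen s x < 0} p {x. c * ham x > 0} p"
proof -
 obtain v k C e where e: "0 < e" "e <= \<sigma>" "!!s. 0 < s ==> s <= e ==> pushable UNIV (%x. c * (gen s x / s)) v k C"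
  and h: "pushable UNIV (%x. - c * ham x) v k C" using gen_pushable[OF c] by metis
 have kC: "0 < k" "0 <= C" using pushableD[OF h] by auto
 have h2: "pushable UNIV (%x. c * (- (ham x / 2))) v (k / 2) C" using h unfolding pushable_def by (auto simp: algebra_simps)
 have g2: "pushable UNIV (%x. c * (gen s x / s)) v (k / 2) C" if "0 < s" "s <= e" for s using pushable_mono[OF e(3)[OF that], of "k / 2" C] kC by simp
 define d where "d = k / 2 / (4 * (1 + C)^2)"
 have C: "0 < (1 + C)^2" using kC by simp
 have d: "0 < d" "d < k / 2 / (2 * (1 + C)^2)" using kC C by (auto simp: d_def field_simps)
 obtain e' where e': "0 < e'" "ALL s x. 0 < s --> s <= e' --> \<bar>gen s x / s + ham x / 2\<bar> <= d * (norm x)^2" using gen_ham[OF d(1)] by (elim exE conjE)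
 show thesis
 proof (rule that[of "min e e'"])
  fix s p assume s: "0 < s" "s <= min e e'"
  have "\<bar>c * (gen s x / s) - c * (- (ham x / 2))\<bar> <= d * (norm x)^2" for x unfolding abs_sign[OF c] using e'(2) s by auto
  hence "hiso {x:UNIV. c * (gen s x / s) < 0} p {x:UNIV. c * (- (ham x / 2)) < 0} p" using s by (intro pushable_close[OF g2 h2 d(2)]) auto
  moreover have "c * (gen s x / s) < 0 \<longleftrightarrow> c * gen s x < 0" for x unfolding times_divide_eq_right divide_less_0_iff using s by auto
  ultimately show "hiso {x. c * gen s x < 0} p {x. c * ham x > 0} p" by simp
 qed (use e e' in auto)
qed

lemma gen_sublevels:
 obtains e where "0 < e" "e <= \<sigma>" "!!s p. 0 < s ==> s <= e ==> hiso {x. gen s x < 0} p {x. ham x > 0} p"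
  "!!s p. 0 < s ==> s <= e ==> hiso {x. gen (- s) x < 0} p {x. ham x < 0} p"
proof -
 obtain a where a: "0 < a" "a <= \<sigma>" "!!s p. 0 < s ==> s <= a ==> hiso {x. 1 * gen s x < 0} p {x. 1 * ham x > 0} p" using gen_sublevel_aux[of 1] by blast
 obtain b where b: "0 < b" "b <= \<sigma>" "!!s p. 0 < s ==> s <= b ==> hiso {x. - 1 * gen s x < 0} p {x. - 1 * ham x > 0} p" using gen_sublevel_aux[of "- 1"] by blast
 show thesis
 proof (rule that[of "min a b"])
  fix s p assume s: "0 < s" "s <= min a b"
  show "hiso {x. gen s x < 0} p {x. ham x > 0} p" using a(3)[of s p] s by simp
  have "\<bar>s\<bar> <= \<sigma>" using s b by simp
  thus "hiso {x. gen (- s) x < 0} p {x. ham x < 0} p" using b(3)[of s p] s by (simp add: gen_neg)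
 qed (use a b in auto)
qed

lemma ham_pushable_cone:
 assumes c: "c = 1 | c = (- 1 :: real)"
 obtains v k C where "pushable_cone (%x. c * ham x) v k C"
proof -
 have "- c = 1 | - c = - 1" using c by auto
 from gen_pushable[OF this] obtain v k C where p: "pushable UNIV (%x. c * ham x) v k C" by (metis minus_minus)
 have "pushable_cone (%x. c * ham x) v k C"
 proof
  show "continuous_on UNIV (%x. c * ham x)" by (intro continuous_intros continuous_ham)
  show "homogeneous2 (%x. c * ham x)" using ham_homogeneous by (simp add: homogeneous2_def)
 qed (rule p)
 thus thesis by (rule that)
qed

end

section \<open>Coordinate planes in the space of families\<close>

abbreviation coord :: "('i \<Rightarrow>\<^sub>0 'v::zero) => 'i => 'v" where "coord \<equiv> lookup"

lemma coord_linear [simp]: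
 fixes x y :: "'i \<Rightarrow>\<^sub>0 'v::real_inner"
 shows "coord (x + y) i = coord x i + coord y i" "coord (x - y) i = coord x i - coord y i"
  "coord (r *. x) i = r *. coord x i" by (simp_all add: lookup_add lookup_minus lookup_scaleR_aux)

lemma norm_coord_le: "norm (coord x i) <= norm (x :: 'i \<Rightarrow>\<^sub>0 'v::real_inner)"
proof -
 have "inner (coord x i) (coord x i) <= inner x x"
 proof (cases "i : keys x")
  case True
  thus ?thesis unfolding inner_poly_mapping_def by (intro member_le_sum) auto
 qed (simp add: in_keys_iff)
 thus ?thesis by (simp add: norm_eq_sqrt_inner)
qed

lemma bounded_linear_coord: "bounded_linear (%x :: 'i \<Rightarrow>\<^sub>0 'v::real_inner. coord x i)"
 by (rule bounded_linear_intro[of _ 1]) (simp_all add: norm_coord_le)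

definition plane :: "'i set => ('i \<Rightarrow>\<^sub>0 'v::real_inner) set" where
 "plane I = {x. ALL i. i ~: I --> coord x i = 0}"

lemma subspace_plane: "subspace (plane I)" by (auto simp: subspace_def plane_def)

definition tuple :: "nat => (nat => 'v) => nat \<Rightarrow>\<^sub>0 'v::real_inner" where
 "tuple n f = (SUM i<=n. single i (f i))"

lemma coord_sum: "coord (sum g A) i = (SUM j:A. coord (g j :: 'i \<Rightarrow>\<^sub>0 'v::real_inner) i)" by (induction A rule: infinite_finite_induct) auto

lemma coord_tuple [simp]: "coord (tuple n f) i = (if i <= n then f i else 0)" by (simp add: tuple_def coord_sum lookup_single when_def)

lemma tuple_plane: "tuple n f : plane {..n}" by (simp add: plane_def)

lemma plane_tuple: "x : plane {..n} ==> x = tuple n (coord x)" by (intro poly_mapping_eqI) (auto simp: plane_def)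

lemma inner_tuple: "inner (tuple n f) h = (SUM i<=n. inner (f i) (coord h i))"
proof -
 have "keys (tuple n f) <= {..n}" by (auto simp: in_keys_iff split: if_splits)
 thus ?thesis using inner_alt[of "{..n}" "tuple n f" h] by simp
qed

lemma norm_single: "norm (single i v) = norm (v :: 'v::real_inner)" using inner_alt[of "{i}" "single i v" "single i v"] by (simp add: norm_eq_sqrt_inner)

lemma norm_tuple_le: "norm (tuple n f) <= (SUM i<=n. norm (f i))" unfolding tuple_def using norm_sum[of "%i. single i (f i)" "{..n}"] by (simp add: norm_single)

lemma tuple_diff: "tuple n f - tuple n g = tuple n (%i. f i - g i)" by (intro poly_mapping_eqI) simp

lemma norm_plane_le: "(x :: nat \<Rightarrow>\<^sub>0 'v::real_inner) : plane {..n} ==> norm x <= (SUM i<=n. norm (coord x i))"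
 using norm_tuple_le[of n "coord x"] plane_tuple[of x n] by simp

lemma plane_basis:
 obtains B :: "(nat \<Rightarrow>\<^sub>0 'v::euclidean_space) set" where "finite B" "independent B" "span B = plane {..<n}"
proof (rule subspace_basis_exists[OF subspace_plane])
 let ?B = "(%(i, b). single i b) ` ({..<n} \<times> (Basis :: 'v set))"
 show "finite ?B" by simp
 show "plane {..<n} <= span ?B"
 proof
  fix x :: "nat \<Rightarrow>\<^sub>0 'v" assume x: "x : plane {..<n}"
  have "x = (SUM i<n. SUM b:Basis. inner (coord x i) b *. single i b)"
  proof (rule poly_mapping_eqI)
   fix j
   have "coord (SUM i<n. SUM b:Basis. inner (coord x i) b *. single i b) j =
     (SUM i<n. if i = j then coord x j else 0)" unfolding coord_sum
   proof (rule sum.cong[OF refl])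
    fix i
    show "(SUM b:Basis. coord (inner (coord x i) b *. single i b) j) = (if i = j then coord x j else 0)"
     using euclidean_representation[of "coord x j"] by (auto simp: lookup_single when_def)
   qed
   also have "... = coord x j" using x by (simp add: plane_def)
   finally show "coord x j = coord (SUM i<n. SUM b:Basis. inner (coord x i) b *. single i b) j" by simp
  qed
  also have "... : span ?B" by (intro span_sum span_scale span_base) auto
  finally show "x : span ?B" .
 qed
qed (use that in blast)

section \<open>The action of closed polygons\<close>

locale polygon = short_flow +
 fixes K :: nat
 assumes K: "even K" "0 < K"
begin

text \<open>The variables are the midpoints of the edges, since generating functions take midpoints.
  Reflecting the first vertex in all \<open>K + 1\<close> midpoints must lead back to it; for an odd
  number of reflections this determines it, as the alternating sum. Hence the assumption
  \<open>even K\<close>.\<close>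

primrec vertex :: "'a loop => nat => 'a" where
 "vertex x 0 = (SUM i<=K. (- 1) ^ i *. coord x i)"
| "vertex x (Suc i) = 2 *. coord x i - vertex x i"

definition edge :: "'a loop => nat => 'a" where "edge x i = vertex x (Suc i) - vertex x i"

lemma vertex_closed: "vertex x (Suc K) = vertex x 0"
proof -
 have "vertex x n = (- 1) ^ n *. (vertex x 0 - 2 *. (SUM i<n. (- 1) ^ i *. coord x i))" for n
 proof (induction n)
  case (Suc n)
  have sq: "(- 1) ^ n * (- 1 :: real) ^ n = 1" by (simp flip: power_mult_distrib)
  have "(- 1) ^ Suc n *. (vertex x 0 - 2 *. (SUM i<Suc n. (- 1) ^ i *. coord x i)) =
    - ((- 1) ^ n *. (vertex x 0 - 2 *. (SUM i<n. (- 1) ^ i *. coord x i))) + (2 * ((- 1) ^ n * (- 1) ^ n)) *. coord x n" by (simp add: algebra_simps)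
  thus ?case using Suc sq by simp
 qed simp
 from this[of "Suc K"] have "vertex x (Suc K) = - (vertex x 0 - 2 *. vertex x 0)" using K by (simp add: lessThan_Suc_atMost del: vertex.simps(2))
 thus ?thesis by (simp add: scaleR_2)
qed

lemma coord_vertex: "coord x i = (1 / 2) *. (vertex x i + vertex x (Suc i))" by simp

lemma bounded_linear_vertex: "bounded_linear (%x. vertex x i)"
proof (induction i)
 case 0
 show ?case unfolding vertex.simps by (intro bounded_linear_sum bounded_linear_compose[OF bounded_linear_scaleR_right bounded_linear_coord])
next
 case (Suc i)
 show ?case unfolding vertex.simps by (intro bounded_linear_sub Suc bounded_linear_compose[OF bounded_linear_scaleR_right bounded_linear_coord])
qed

lemma bounded_linear_edge: "bounded_linear (%x. edge x i)" unfolding edge_def by (intro bounded_linear_sub bounded_linear_vertex)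

lemma edge_linear: "edge (x + y) i = edge x i + edge y i" "edge (x - y) i = edge x i - edge y i" "edge (r *. x) i = r *. edge x i"
 using linear_add[OF bounded_linear.linear[OF bounded_linear_edge, of i]] linear_diff[OF bounded_linear.linear[OF bounded_linear_edge, of i]]
  linear_scale[OF bounded_linear.linear[OF bounded_linear_edge, of i]] by blast+

lemma vertex_bound: "norm (vertex x i) <= (real K + 1 + 2 * real i) * norm x"
proof (induction i)
 case 0
 have "norm (vertex x 0) <= (SUM i<=K. norm ((- 1) ^ i *. coord x i))" unfolding vertex.simps by (rule norm_sum)
 also have "... <= (SUM i<=K. norm x)" by (intro sum_mono) (simp add: norm_coord_le power_abs)
 finally show ?case by (simp add: algebra_simps)
next
 case (Suc i)
 have "norm (vertex x (Suc i)) <= 2 * norm x + norm (vertex x i)" using norm_triangle_ineq4[of "2 *. coord x i" "vertex x i"] norm_coord_le[of x i] by simp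
 thus ?case using Suc by (simp add: algebra_simps)
qed

lemma edge_bound: "i <= K ==> norm (edge x i) <= (6 * real K + 6) * norm x"
proof -
 assume i: "i <= K"
 have "norm (edge x i) <= (real K + 1 + 2 * real (Suc i)) * norm x + (real K + 1 + 2 * real i) * norm x"
  unfolding edge_def using vertex_bound[of x "Suc i"] vertex_bound[of x i] norm_triangle_ineq4[of "vertex x (Suc i)" "vertex x i"] by linarith
 also have "... = (2 * real K + 4 + 4 * real i) * norm x" by (simp add: algebra_simps)
 also have "... <= (6 * real K + 6) * norm x" using i by (intro mult_right_mono) auto
 finally show ?thesis .
qed

text \<open>The bilinear form whose quadratic form is the symplectic area of the closed polygon,
  \<open>coord x i\<close> being the midpoint of edge \<open>i\<close>.\<close>

definition twist :: "'a loop => 'a loop => real" where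
 "twist x y = (SUM i<=K. inner (J ((1 / 2) *. coord x i)) (edge y i))"

lemma bounded_bilinear_twist: "bounded_bilinear twist"
proof
 fix a a' b b' :: "'a loop" and r :: real
 show "twist (a + a') b = twist a b + twist a' b" "twist a (b + b') = twist a b + twist a b'"
  by (simp_all add: twist_def edge_linear inner_add_left inner_add_right scaleR_add_right sum.distrib)
 show "twist (r *. a) b = r *. twist a b" "twist a (r *. b) = r *. twist a b" by (simp_all add: twist_def edge_linear sum_distrib_left mult.left_commute)
next
 have "norm (twist a b) <= norm a * norm b * ((real K + 1) * (6 * real K + 6))" for a b
 proof -
  have "norm (twist a b) <= (SUM i<=K. norm (inner (J ((1 / 2) *. coord a i)) (edge b i)))" unfolding twist_def by (rule norm_sum)
  also have "... <= (SUM i<=K. norm a * ((6 * real K + 6) * norm b))"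
  proof (rule sum_mono)
   fix i assume "i : {..K}"
   hence "norm (coord a i) * norm (edge b i) <= norm a * ((6 * real K + 6) * norm b)" using norm_coord_le[of a i] edge_bound[of i b] by (intro mult_mono) auto
   moreover have "norm (inner (J ((1 / 2) *. coord a i)) (edge b i)) <= norm (coord a i) * norm (edge b i)"
    using Cauchy_Schwarz_ineq2[of "J (coord a i)" "edge b i"] by simp
   ultimately show "norm (inner (J ((1 / 2) *. coord a i)) (edge b i)) <= norm a * ((6 * real K + 6) * norm b)" by linarith
  qed
  finally show ?thesis by (simp add: ac_simps)
 qed
 thus "EX k. ALL a b. norm (twist a b) <= norm a * norm b * k" by blast
qed

text \<open>Summation by parts: the part that is antisymmetric in \<open>x\<close> and
  \<open>y\<close> telescopes around the closed polygon.\<close>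

lemma twist_sym: "twist x y = twist y x"
proof -
 let ?v = "vertex x" and ?w = "vertex y"
 have half: "twist x y = (1 / 4) * (SUM i<=K. \<omega> (vertex x i) (vertex y (Suc i)) + \<omega> (vertex y i) (vertex x (Suc i)))" for x y
 proof -
  define A where "A i = \<omega> (vertex x i) (vertex y (Suc i)) + \<omega> (vertex y i) (vertex x (Suc i))" for i
  define B where "B i = \<omega> (vertex x (Suc i)) (vertex y (Suc i)) - \<omega> (vertex x i) (vertex y i)" for i
  have "inner (J ((1 / 2) *. coord x i)) (edge y i) = (1 / 4) * A i + (1 / 4) * B i" for i
   unfolding A_def B_def coord_vertex[of x i] edge_def using omega_swap[of "vertex x (Suc i)" "vertex y i"]
   by (simp del: vertex.simps add: inner_add_left inner_diff_right algebra_simps)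
  hence "twist x y = (1 / 4) * sum A {..K} + (1 / 4) * sum B {..K}" unfolding twist_def by (simp only: sum.distrib sum_distrib_left)
  moreover have "sum B {..K} = 0" unfolding B_def using sum_lessThan_telescope[of "%i. \<omega> (vertex x i) (vertex y i)" "Suc K"] vertex_closed
   by (simp del: vertex.simps add: lessThan_Suc_atMost)
  ultimately show ?thesis by (simp add: A_def[abs_def] del: vertex.simps)
 qed
 show ?thesis unfolding half[of x y] half[of y x] by (simp del: vertex.simps add: add.commute)
qed

text \<open>Critical points are the polygons with \<open>edge x i = chord (s i) (coord x i)\<close>,
  where each edge leads from a vertex to its image under \<open>\<psi> (s i)\<close>. They
  correspond to the fixed points of the flow at the sum of the times \<open>s i\<close>.\<close>

definition action :: "(nat => real) => 'a loop => real" where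
 "action s x = twist x x + (SUM i<=K. gen (s i) (coord x i))"

definition defect :: "(nat => real) => 'a loop => nat => 'a" where
 "defect s x i = edge x i - chord (s i) (coord x i)"

definition grad :: "(nat => real) => 'a loop => 'a loop" where
 "grad s x = tuple K (%i. - J (defect s x i))"

lemma action_gradient:
 assumes s: "!!i. i <= K ==> \<bar>s i\<bar> <= \<sigma>"
 shows "(action s has_derivative (%h. inner (grad s x) h)) (at x within S)"
proof -
 have d1: "((%x. twist x x) has_derivative (%h. twist x h + twist h x)) (at x within S)"
  using bounded_bilinear.FDERIV[OF bounded_bilinear_twist has_derivative_ident has_derivative_ident] .
 have d2: "((%x. SUM i<=K. gen (s i) (coord x i)) has_derivative (%h. SUM i<=K. inner (J (chord (s i) (coord x i))) (coord h i))) (at x within S)"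
 proof (rule has_derivative_sum)
  fix i assume "i : {..K}"
  hence "\<bar>s i\<bar> <= \<sigma>" using s by simp
  from has_derivative_compose[OF bounded_linear_imp_has_derivative[OF bounded_linear_coord] gen_gradient[OF this]]
  show "((%x. gen (s i) (coord x i)) has_derivative (%h. inner (J (chord (s i) (coord x i))) (coord h i))) (at x within S)" .
 qed
 have "twist x h + twist h x + (SUM i<=K. inner (J (chord (s i) (coord x i))) (coord h i)) = inner (grad s x) h" for h
 proof -
  have "twist x h + twist h x = (SUM i<=K. \<omega> (coord h i) (edge x i))" using twist_sym[of x h] by (simp add: twist_def flip: sum.distrib)
  moreover have "inner (grad s x) h = (SUM i<=K. \<omega> (coord h i) (edge x i) + inner (J (chord (s i) (coord x i))) (coord h i))"
   unfolding grad_def inner_tuple defect_def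
  proof (rule sum.cong[OF refl])
   fix i
   show "inner (- J (edge x i - chord (s i) (coord x i))) (coord h i) =
     \<omega> (coord h i) (edge x i) + inner (J (chord (s i) (coord x i))) (coord h i)" using omega_swap[of "edge x i" "coord h i"] by (simp add: inner_diff_left)
  qed
  ultimately show ?thesis by (simp add: sum.distrib)
 qed
 thus ?thesis using has_derivative_add[OF d1 d2] by (simp add: action_def[abs_def])
qed

end

context polygon
begin

declare vertex.simps [simp del]

lemma grad_plane: "grad s x : plane {..K}" by (simp add: grad_def tuple_plane)

lemma norm_defect_le: "i <= K ==> norm (defect s x i) <= norm (grad s x)" using norm_coord_le[of "grad s x" i] by (simp add: grad_def)

lemma defect_diff:
 assumes "i <= K" "\<bar>s i\<bar> <= \<sigma>"
 shows "norm (defect s x i - defect s y i) <= (6 * real K + 7) * norm (x - y)"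
proof -
 have "defect s x i - defect s y i = edge (x - y) i - (chord (s i) (coord x i) - chord (s i) (coord y i))" by (simp add: defect_def edge_linear)
 hence "norm (defect s x i - defect s y i) <= norm (edge (x - y) i) + norm (chord (s i) (coord x i) - chord (s i) (coord y i))" using norm_triangle_ineq4 by metis
 also have "... <= (6 * real K + 6) * norm (x - y) + norm (x - y)" using edge_bound[OF assms(1), of "x - y"] chord_lip[OF assms(2), of "coord x i" "coord y i"]
   norm_coord_le[of "x - y" i, unfolded coord_linear] norm_ge_zero[of "coord x i - coord y i"] by linarith
 finally show ?thesis by (simp add: algebra_simps)
qed

definition slope :: real where "slope = (real K + 1) * (6 * real K + 7)"

lemma slope_pos: "0 < slope" by (simp add: slope_def)

lemma grad_lipschitz:
 assumes s: "!!i. i <= K ==> \<bar>s i\<bar> <= \<sigma>"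
 shows "slope-lipschitz_on S (grad s)"
proof (rule lipschitz_onI)
 fix x y
 have "norm (grad s x - grad s y) <= (SUM i<=K. norm (- J (defect s x i) - - J (defect s y i)))" unfolding grad_def tuple_diff by (rule norm_tuple_le)
 also have "... <= (SUM i<=K. (6 * real K + 7) * norm (x - y))"
 proof (rule sum_mono)
  fix i assume i: "i : {..K}"
  have "- J (defect s x i) - - J (defect s y i) = - J (defect s x i - defect s y i)" by simp
  hence "norm (- J (defect s x i) - - J (defect s y i)) = norm (defect s x i - defect s y i)" by (simp only: norm_minus_cancel norm_J)
  thus "norm (- J (defect s x i) - - J (defect s y i)) <= (6 * real K + 7) * norm (x - y)" using defect_diff[of i s x y] s i by simp
 qed
 finally show "dist (grad s x) (grad s y) <= slope * dist x y" by (simp add: dist_norm slope_def algebra_simps)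
qed (simp add: slope_def)

lemma grad_0:
 assumes s: "!!i. i <= K ==> \<bar>s i\<bar> <= \<sigma>"
 shows "grad s 0 = 0"
proof -
 have "edge 0 i = 0" for i using edge_linear(3)[of 0 0 i] by simp
 thus ?thesis using s by (intro poly_mapping_eqI) (simp add: grad_def defect_def)
qed

text \<open>The defect tells how far an edge is from the chord over its midpoint; comparing the
  vertex with the base point of that chord bounds the error of one step.\<close>

lemma vertex_step:
 assumes i: "\<bar>s i\<bar> <= \<sigma>"
 shows "norm (\<psi> (s i) (vertex x i) - vertex x (Suc i)) <= 2 * norm (defect s x i)"
proof -
 let ?z = "base (s i) (coord x i)" and ?d = "defect s x i"
 have c: "coord x i = (1 / 2) *. (vertex x i + vertex x (Suc i))" by (rule coord_vertex)
 have v: "vertex x i = coord x i - (1 / 2) *. edge x i" "vertex x (Suc i) = coord x i + (1 / 2) *. edge x i"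
 proof -
  have h: "(1 / 2) *. a + (1 / 2) *. a = a" for a :: 'a by (simp flip: scaleR_add_left)
  show "vertex x i = coord x i - (1 / 2) *. edge x i" "vertex x (Suc i) = coord x i + (1 / 2) *. edge x i"
   unfolding c edge_def scaleR_add_right scaleR_diff_right using h[of "vertex x i"] h[of "vertex x (Suc i)"] by simp_all
 qed
 have 1: "vertex x i - ?z = - ((1 / 2) *. ?d)" unfolding v(1) base_chord[OF i] defect_def by (simp add: algebra_simps)
 have 2: "\<psi> (s i) ?z - vertex x (Suc i) = - ((1 / 2) *. ?d)" unfolding v(2) psi_base[OF i] defect_def by (simp add: algebra_simps)
 have "norm ((\<psi> (s i) (vertex x i) - vertex x i) - (\<psi> (s i) ?z - ?z)) <= 1 / 2 * norm (vertex x i - ?z)" by (rule step_lip[OF i])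
 moreover have "norm (\<psi> (s i) (vertex x i) - vertex x (Suc i)) <=
   norm ((\<psi> (s i) (vertex x i) - vertex x i) - (\<psi> (s i) ?z - ?z)) + norm (vertex x i - ?z) + norm (\<psi> (s i) ?z - vertex x (Suc i))"
 proof -
  have tri: "norm (a + b + c) <= norm a + norm b + norm c" for a b c :: 'a using norm_triangle_ineq[of "a + b" c] norm_triangle_ineq[of a b] by linarith
  have "\<psi> (s i) (vertex x i) - vertex x (Suc i) =
   ((\<psi> (s i) (vertex x i) - vertex x i) - (\<psi> (s i) ?z - ?z)) + (vertex x i - ?z) + (\<psi> (s i) ?z - vertex x (Suc i))" by simp
  thus ?thesis using tri by metis
 qed
 ultimately have "norm (\<psi> (s i) (vertex x i) - vertex x (Suc i)) <= 1 / 2 * norm (vertex x i - ?z) + norm (vertex x i - ?z) + norm (\<psi> (s i) ?z - vertex x (Suc i))"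
  by linarith
 also have "... = 5 / 4 * norm ?d" unfolding 1 2 by simp
 also have "... <= 2 * norm ?d" by simp
 finally show ?thesis .
qed

lemma shadow:
 assumes s: "!!i. i < n ==> \<bar>s i\<bar> <= \<sigma>"
 shows "norm (\<psi> (SUM i<n. s i) (vertex x 0) - vertex x n) <= 2 * L ^ n * (SUM i<n. norm (defect s x i))" using s
proof (induction n)
 case 0
 thus ?case by (simp add: flow(1))
next
 case (Suc n)
 have "norm (\<psi> (s n) (\<psi> (SUM i<n. s i) (vertex x 0)) - \<psi> (s n) (vertex x n)) <= L * (2 * L ^ n * (SUM i<n. norm (defect s x i)))"
  using lip[of "s n" "\<psi> (SUM i<n. s i) (vertex x 0)" "vertex x n"] Suc L1 by (meson order_trans mult_left_mono less_SucI zero_le_one)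
 moreover have "norm (\<psi> (s n) (vertex x n) - vertex x (Suc n)) <= 2 * L ^ Suc n * norm (defect s x n)"
 proof -
  have "1 <= L ^ Suc n" using L1 by (rule one_le_power)
  hence "1 * norm (defect s x n) <= L ^ Suc n * norm (defect s x n)" by (intro mult_right_mono) auto
  thus ?thesis using vertex_step[of s n x] Suc.prems[of n] by simp
 qed
 ultimately show ?case
  using norm_triangle_ineq[of "\<psi> (s n) (\<psi> (SUM i<n. s i) (vertex x 0)) - \<psi> (s n) (vertex x n)" "\<psi> (s n) (vertex x n) - vertex x (Suc n)"]
  by (simp add: flow(2) add.commute distrib_left mult.assoc mult.left_commute)
qed

lemma shadow_uniform:
 assumes s: "!!i. i <= K ==> \<bar>s i\<bar> <= \<sigma>" and n: "n <= Suc m" "m <= K"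
 shows "norm (\<psi> (SUM i<n. s i) (vertex x 0) - vertex x n) <= 2 * L ^ Suc K * (SUM i<=m. norm (defect s x i))"
proof -
 have "norm (\<psi> (SUM i<n. s i) (vertex x 0) - vertex x n) <= 2 * L ^ n * (SUM i<n. norm (defect s x i))" by (rule shadow) (use s n in auto)
 also have "... <= 2 * L ^ Suc K * (SUM i<=m. norm (defect s x i))" using L1 n by (intro mult_mono power_increasing sum_mono2 sum_nonneg) auto
 finally show ?thesis .
qed

text \<open>A small gradient means small defects, so the first vertex is almost fixed by the flow at
  the total time. The gap \<open>c\<close> then forces it to be small, and the other vertices follow
  it along the flow. The bound \<open>r\<close> is uniform in \<open>s\<close>.\<close>

lemma grad_lower_bound:
 assumes c: "0 < c"
 shows "EX r>0. ALL s x. (ALL i<=K. \<bar>s i\<bar> <= \<sigma>) --> (ALL u. c * norm u <= norm (\<psi> (SUM i<=K. s i) u - u)) -->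
  x : plane {..K} --> r * norm x <= norm (grad s x)"
proof -
 define R where "R = L * (2 * L ^ Suc K / c) + 2 * L ^ Suc K"
 have R: "0 < R" using L1 c by (simp add: R_def add_pos_pos)
 show ?thesis
 proof (intro exI[of _ "1 / ((real K + 1) * (real K + 1) * R)"] conjI allI impI)
  show "0 < 1 / ((real K + 1) * (real K + 1) * R)" using R by simp
  fix s and x :: "'a loop"
  assume "ALL i<=K. \<bar>s i\<bar> <= \<sigma>" and "ALL u. c * norm u <= norm (\<psi> (SUM i<=K. s i) u - u)" and x: "x : plane {..K}"
  hence s: "!!i. i <= K ==> \<bar>s i\<bar> <= \<sigma>" and gap: "!!u. c * norm u <= norm (\<psi> (SUM i<=K. s i) u - u)" by blast+
  define \<delta> where "\<delta> = (SUM i<=K. norm (defect s x i))"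
  have \<delta>0: "0 <= \<delta>" by (simp add: \<delta>_def sum_nonneg)
  have sh: "norm (\<psi> (SUM i<n. s i) (vertex x 0) - vertex x n) <= 2 * L ^ Suc K * \<delta>" if "n <= Suc K" for n
   unfolding \<delta>_def by (rule shadow_uniform) (use s that in auto)
  have "c * norm (vertex x 0) <= 2 * L ^ Suc K * \<delta>" using gap[of "vertex x 0"] sh[of "Suc K"] unfolding lessThan_Suc_atMost vertex_closed by simp
  hence v0: "norm (vertex x 0) <= 2 * L ^ Suc K / c * \<delta>" using c by (simp add: field_simps)
  have v: "norm (vertex x i) <= R * \<delta>" if "i <= Suc K" for i
  proof -
   have "norm (vertex x i) <= norm (\<psi> (SUM j<i. s j) (vertex x 0)) + 2 * L ^ Suc K * \<delta>"
    using sh[OF that] norm_triangle_ineq2[of "vertex x i" "\<psi> (SUM j<i. s j) (vertex x 0)"]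
     norm_minus_commute[of "vertex x i" "\<psi> (SUM j<i. s j) (vertex x 0)"] by linarith
   also have "norm (\<psi> (SUM j<i. s j) (vertex x 0)) <= L * (2 * L ^ Suc K / c * \<delta>)"
   proof -
    have "L * norm (vertex x 0) <= L * (2 * L ^ Suc K / c * \<delta>)" using v0 L1 by (intro mult_left_mono) auto
    thus ?thesis using lip[of "SUM j<i. s j" "vertex x 0" 0] by simp
   qed
   finally show ?thesis by (simp add: R_def algebra_simps)
  qed
  have "norm (coord x i) <= R * \<delta>" if "i <= K" for i
  proof -
   have "norm (coord x i) <= 1 / 2 * (norm (vertex x i) + norm (vertex x (Suc i)))"
    unfolding coord_vertex[of x i] using norm_triangle_ineq[of "vertex x i" "vertex x (Suc i)"] by (simp)
   thus ?thesis using v[of i] v[of "Suc i"] that by (simp)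
  qed
  hence "(SUM i<=K. norm (coord x i)) <= (SUM i<=K. R * \<delta>)" by (intro sum_mono) auto
  hence "norm x <= (real K + 1) * (R * \<delta>)" using norm_plane_le[OF x] by (simp add: algebra_simps)
  also have "\<delta> <= (SUM i<=K. norm (grad s x))" unfolding \<delta>_def by (intro sum_mono norm_defect_le) auto
  hence "(real K + 1) * (R * \<delta>) <= (real K + 1) * (R * ((real K + 1) * norm (grad s x)))" using R by (intro mult_left_mono) (auto simp: algebra_simps)
  finally show "1 / ((real K + 1) * (real K + 1) * R) * norm x <= norm (grad s x)" using R by (simp add: divide_le_eq ac_simps add_pos_pos)
 qed
qed

text \<open>Only the total time has to stay away from fixed points; the single steps may vary within
  \<open>\<sigma>\<close>.\<close>

lemma action_path:
 assumes S: "!!l i. 0 <= l ==> l <= 1 ==> i <= K ==> \<bar>S l i\<bar> <= \<sigma>"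
  and cont: "!!l l' i. 0 <= l ==> l <= 1 ==> 0 <= l' ==> l' <= 1 ==> i <= K ==> \<bar>S l i - S l' i\<bar> <= \<bar>l - l'\<bar>"
  and gap: "0 < c" "!!l u. 0 <= l ==> l <= 1 ==> c * norm u <= norm (\<psi> (SUM i<=K. S l i) u - u)"
 shows "hiso {x:plane {..K}. action (S 0) x < 0} p {x:plane {..K}. action (S 1) x < 0} p"
proof -
 obtain r where r: "0 < r" "ALL s x. (ALL i<=K. \<bar>s i\<bar> <= \<sigma>) --> (ALL u. c * norm u <= norm (\<psi> (SUM i<=K. s i) u - u)) -->
  x : plane {..K} --> r * norm x <= norm (grad s x)" using grad_lower_bound[OF gap(1)] by (elim exE conjE)
 show ?thesis
 proof (rule pushable_family)
  fix l :: real assume l: "0 <= l" "l <= 1"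
  show "pushable (plane {..K}) (action (S l)) (%x. (1 / (2 * slope)) *. grad (S l) x) (r^2 / (4 * slope)) (1 / 2)"
  proof (rule pushable_gradient[OF subspace_plane])
   show "gradient_on (plane {..K}) (action (S l)) (grad (S l))" unfolding gradient_on_def by (intro ballI action_gradient S[OF l])
   show "slope-lipschitz_on (plane {..K}) (grad (S l))" by (rule grad_lipschitz[OF S[OF l]])
   show "r * norm x <= norm (grad (S l) x)" if "x : plane {..K}" for x using r(2)[rule_format, of "S l" x] S[OF l] gap(2)[OF l] that by simp
  qed (use slope_pos r(1) grad_plane grad_0[OF S[OF l]] in auto)
 next
  fix d :: real assume d: "0 < d"
  define d' where "d' = d / (real K + 1)"
  have "0 < d'" using d by (simp add: d'_def)
  from chord_close[OF this] obtain e where e: "0 < e"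
   "!!s s' m. \<bar>s\<bar> <= \<sigma> ==> \<bar>s'\<bar> <= \<sigma> ==> \<bar>s - s'\<bar> <= e ==> norm (chord s m - chord s' m) <= d' * norm m" by metis
  show "EX e>0. ALL s s'. 0 <= s --> s <= 1 --> 0 <= s' --> s' <= 1 --> \<bar>s - s'\<bar> < e -->
   (ALL x:plane {..K}. \<bar>action (S s) x - action (S s') x\<bar> <= d * (norm x)^2)"
  proof (intro exI[of _ e] conjI e(1) allI impI ballI)
   fix l l' :: real and x :: "'a loop" assume l: "0 <= l" "l <= 1" and l': "0 <= l'" "l' <= 1" and ll: "\<bar>l - l'\<bar> < e" and "x : plane {..K}"
   have g: "\<bar>gen (S l i) (coord x i) - gen (S l' i) (coord x i)\<bar> <= d' * (norm x)^2" if i: "i <= K" for i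
   proof -
    let ?m = "coord x i"
    have "gen (S l i) ?m - gen (S l' i) ?m = - (1 / 2) * inner (J ?m) (chord (S l i) ?m - chord (S l' i) ?m)" by (simp add: gen_def inner_diff_right field_simps)
    hence "\<bar>gen (S l i) ?m - gen (S l' i) ?m\<bar> = 1 / 2 * \<bar>inner (J ?m) (chord (S l i) ?m - chord (S l' i) ?m)\<bar>" by (simp add: abs_mult)
    also have "... <= 1 * (norm ?m * norm (chord (S l i) ?m - chord (S l' i) ?m))"
     using Cauchy_Schwarz_ineq2[of "J ?m" "chord (S l i) ?m - chord (S l' i) ?m"] by (intro mult_mono) auto
    also have "... <= 1 * (norm ?m * (d' * norm ?m))" using e(2)[OF S[OF l i] S[OF l' i]] cont[OF l l' i] ll by (intro mult_left_mono) auto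
    also have "... = d' * (norm ?m)^2" by (simp add: power2_eq_square)
    also have "... <= d' * (norm x)^2" using \<open>0 < d'\<close> norm_coord_le[of x i] by (intro mult_left_mono power_mono) auto
    finally show ?thesis .
   qed
   have "action (S l) x - action (S l') x = (SUM i<=K. gen (S l i) (coord x i) - gen (S l' i) (coord x i))" by (simp add: action_def sum_subtractf)
   also have "\<bar>...\<bar> <= (SUM i<=K. \<bar>gen (S l i) (coord x i) - gen (S l' i) (coord x i)\<bar>)" by (rule sum_abs)
   also have "... <= (SUM i<=K. d' * (norm x)^2)" by (intro sum_mono g) auto
   also have "... = (real K + 1) * d' * (norm x)^2" by (simp add: algebra_simps)
   also have "(real K + 1) * d' = d" by (simp add: d'_def)
   finally show "\<bar>action (S l) x - action (S l') x\<bar> <= d * (norm x)^2" .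
  qed
 qed
qed

lemma constant_polygon:
 assumes "!!i. i < K ==> edge x i = 0" and i: "i <= K"
 shows "coord x i = coord x K"
proof -
 have v: "vertex x j = vertex x 0" if "j <= K" for j using that by (induction j) (use assms(1) in \<open>auto simp: edge_def\<close>)
 have c: "coord x j = vertex x 0" if "j <= K" for j
 proof -
  have "vertex x (Suc j) = vertex x 0"
  proof (cases "j = K")
   case True
   thus ?thesis using vertex_closed by simp
  next
   case False
   show ?thesis by (rule v) (use that False in simp)
  qed
  thus ?thesis unfolding coord_vertex[of x j] v[OF that] by simp
 qed
 show ?thesis using c[OF i] c[OF order_refl] by simp
qed

text \<open>The test vector \<open>single i (- J (edge x i))\<close> isolates the squared norm of
  one edge.\<close>

lemma twist_complement:
 assumes "!!w. w : plane {..<K} ==> twist x w = 0" and i: "i < K"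
 shows "edge x i = 0"
proof -
 let ?w = "single i (- J (edge x i))"
 have "?w : plane {..<K}" using i by (auto simp: plane_def lookup_single when_def)
 hence "twist ?w x = 0" using assms(1) twist_sym by metis
 moreover have "twist ?w x = (SUM j<=K. if j = i then 1 / 2 * inner (edge x i) (edge x i) else 0)"
  unfolding twist_def by (intro sum.cong refl) (auto simp: lookup_single when_def J(2))
 ultimately show ?thesis using i by simp
qed

lemma edge_constant: "edge (tuple K (%_. q)) i = 0" if "i <= K"
proof -
 let ?x = "tuple K (%_. q)"
 have alt: "(SUM i<=n. (- 1) ^ i *. q) = (if even n then q else 0)" for n by (induction n) auto
 have v0: "vertex ?x 0 = q" using alt[of K] K by (simp add: vertex.simps)
 have "vertex ?x j = q" if "j <= Suc K" for j using that by (induction j) (use v0 in \<open>auto simp: scaleR_2 vertex.simps\<close>)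
 thus ?thesis using that by (simp add: edge_def)
qed

text \<open>With only the last step nonzero the action is \<open>gen \<epsilon>\<close> of the last
  midpoint plus the form \<open>twist\<close>. This form is nondegenerate on the polygons with last
  midpoint 0, and the orthogonal complement of these consists of the constant polygons.\<close>

lemma action_start:
 assumes e: "\<bar>\<epsilon>\<bar> <= \<sigma>"
 shows "EX i. ALL p. hiso {q. gen \<epsilon> q < 0} p {x:plane {..K}. action (%i. if i = K then \<epsilon> else 0) x < 0} (p + int i)"
proof -
 let ?f = "%x. gen \<epsilon> (coord x K)"
 let ?Z = "{x:plane {..K}. ?f x < 0 & (ALL w:plane {..<K}. twist x w = 0)}"
 obtain B :: "'a loop set" where B: "finite B" "independent B" "span B = plane {..<K}" using plane_basis by blast
 have s0: "\<bar>0\<bar> <= \<sigma>" using sigma by simp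
 have act: "action (%i. if i = K then \<epsilon> else 0) x = ?f x + twist x x" for x
 proof -
  have "gen 0 m = 0" for m using gen_neg[OF s0, of m] by simp
  hence "(SUM i<=K. gen (if i = K then \<epsilon> else 0) (coord x i)) = (SUM i<=K. if i = K then ?f x else 0)" by (intro sum.cong) auto
  thus ?thesis by (simp add: action_def)
 qed
 have "continuous_on UNIV (gen \<epsilon>)" using gen_gradient[OF e] has_derivative_continuous continuous_at_imp_continuous_on by blast
 hence f: "continuous_on UNIV ?f" by (rule continuous_on_compose2) (auto intro: bounded_linear.continuous_on[OF bounded_linear_coord])
 have hf: "homogeneous2 ?f" using gen_homogeneous[OF e] by (simp add: homogeneous2_def)
 have "EX i. (ALL p. hiso ?Z p {x:plane {..K}. ?f x + twist x x < 0} (p + int i)) &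
   ((ALL w:plane {..<K}. twist w w <= 0) --> i = card B)"
 proof (rule hiso_add_quadratic[OF bounded_bilinear_twist twist_sym f hf subspace_plane subspace_plane _ B refl])
  show "plane {..<K} <= (plane {..K} :: 'a loop set)" by (auto simp: plane_def)
  show "?f (x + w) = ?f x" if "w : plane {..<K}" for x w using that by (simp add: plane_def)
  show "w = 0" if w: "w : plane {..<K}" and c: "!!w'. w' : plane {..<K} ==> twist w w' = 0" for w
  proof (rule poly_mapping_eqI)
   fix i
   have e: "edge w i = 0" if "i < K" for i by (rule twist_complement[OF c that])
   have "coord w i = coord w K" if "i <= K" by (rule constant_polygon[OF e that])
   thus "coord w i = coord 0 i" using w by (cases "i <= K") (auto simp: plane_def)
  qed
  show "twist x x = 0" if x: "x : plane {..K}" and c: "!!w. w : plane {..<K} ==> twist x w = 0" for x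
  proof -
   have e: "edge x i = 0" if "i < K" for i by (rule twist_complement[OF c that])
   have ce: "coord x i = coord (tuple K (%_. coord x K)) i" for i using x constant_polygon[OF e, of i] by (cases "i <= K") (auto simp: plane_def)
   have xc: "tuple K (%_. coord x K) = x" by (rule poly_mapping_eqI) (rule ce[symmetric])
   have "edge x i = 0" if "i <= K" for i using edge_constant[OF that, of "coord x K"] unfolding xc .
   thus ?thesis by (simp add: twist_def)
  qed
 qed
 then obtain i where i: "ALL p. hiso ?Z p {x:plane {..K}. ?f x + twist x x < 0} (p + int i)" by (elim exE conjE)
 have Z: "hiso {q. gen \<epsilon> q < 0} p ?Z p" for p
 proof (rule hiso_inverse)
  let ?h = "%q :: 'a. tuple K (%_. q)"
  show "continuous_on ?Z (%x. coord x K)" by (rule bounded_linear.continuous_on[OF bounded_linear_coord continuous_on_id])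
  have "(real K + 1)-lipschitz_on UNIV ?h"
  proof (rule lipschitz_onI)
   fix x y :: 'a
   show "dist (?h x) (?h y) <= (real K + 1) * dist x y" unfolding dist_norm tuple_diff using norm_tuple_le[of K "%_. x - y"] by (simp add: algebra_simps)
  qed simp
  from continuous_on_subset[OF lipschitz_on_continuous_on[OF this] subset_UNIV]
  show "continuous_on {q. gen \<epsilon> q < 0} ?h" .
  show "?h q : ?Z & coord (?h q) K = q" if "q : {q. gen \<epsilon> q < 0}" for q using that twist_sym[of "?h q"] by (simp add: tuple_plane twist_def edge_constant)
  show "coord x K : {q. gen \<epsilon> q < 0} & ?h (coord x K) = x" if x: "x : ?Z" for x
  proof
   show "?h (coord x K) = x"
   proof (rule poly_mapping_eqI)
    fix i
    have "edge x i = 0" if "i < K" for i by (rule twist_complement[OF _ that]) (use x in auto)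
    hence "coord x i = coord x K" if "i <= K" using constant_polygon[of x i] that by simp
    thus "coord (?h (coord x K)) i = coord x i" using x by (cases "i <= K") (simp_all add: plane_def)
   qed
  qed (use x in simp)
 qed
 show ?thesis unfolding act by (intro exI[of _ i] allI hiso_trans[OF Z spec[OF i]])
qed

end

section \<open>Symmetry of second derivatives\<close>

lemma second_derivative_aux:
 fixes g :: "'a::real_inner => 'a"
 assumes f: "!!x. (f has_derivative (%h. inner (g x) h)) (at x)" and g: "(g has_derivative A) (at m)" and e: "0 < e"
 shows "EX d>0. ALL t. 0 < t --> t < d -->
  \<bar>f (m + t *. u + t *. v) - f (m + t *. u) - f (m + t *. v) + f m - t^2 * inner (A u) v\<bar> <= t^2 * (e * ((norm u + 2 * norm v) * norm v))"
proof -
 obtain d where d: "0 < d" "!!y. norm (y - m) < d ==> norm (g y - g m - A (y - m)) <= e * norm (y - m)" using g e unfolding has_derivative_at_alt by blast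
 note lin = bounded_linear.linear[OF has_derivative_bounded_linear[OF g]]
 define d' where "d' = d / (norm u + norm v + 1)"
 have uv: "0 < norm u + norm v + 1" using norm_ge_zero[of u] norm_ge_zero[of v] by linarith
 show ?thesis
 proof (intro exI[of _ d'] conjI allI impI)
  show "0 < d'" using d(1) uv by (simp add: d'_def)
  fix t assume t: "0 < t" "t < d'"
  have "((%y. f (y + t *. u) - f y) has_derivative (%h. inner (g (y + t *. u)) h - inner (g y) h)) (at y within UNIV)" for y
   by (intro has_derivative_diff f has_derivative_compose[where f="%y. y + t *. u", OF _ f, simplified]) (auto intro!: derivative_eq_intros)
  hence "gradient_on UNIV (%y. f (y + t *. u) - f y) (%y. g (y + t *. u) - g y)" by (simp add: gradient_on_def inner_diff_left)
  then obtain s where s: "0 < s" "s < 1"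
   "f (m + t *. v + t *. u) - f (m + t *. v) - (f (m + t *. u) - f m) =
    inner (g (m + s *. (m + t *. v - m) + t *. u) - g (m + s *. (m + t *. v - m))) (m + t *. v - m)"
   by (rule gradient_on_mvt[OF convex_UNIV _ UNIV_I UNIV_I, of _ _ "m + t *. v" m])
  define p where "p = (s * t) *. v"
  have pn: "norm p <= t * norm v" using s t by (simp add: p_def abs_mult mult_left_le_one_le)
  have small: "t * (norm u + norm v) < d"
  proof -
   have "t * (norm u + norm v + 1) < d" using t uv by (simp add: d'_def pos_less_divide_eq)
   thus ?thesis using t by (simp add: distrib_left)
  qed
  have n1: "norm (p + t *. u) <= t * (norm u + norm v)" using pn norm_triangle_ineq[of p "t *. u"] t by (simp add: distrib_left)
  have n2: "norm p <= t * (norm u + norm v)"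
  proof -
   have "0 <= t * norm u" using t by simp
   thus ?thesis using pn unfolding distrib_left by linarith
  qed
  let ?r1 = "g (m + p + t *. u) - g m - A (p + t *. u)" and ?r2 = "g (m + p) - g m - A p"
  have r1: "norm ?r1 <= e * (t * (norm u + norm v))"
  proof -
   have "norm ?r1 <= e * norm (p + t *. u)" using d(2)[of "m + p + t *. u"] n1 small by (simp add: add.assoc)
   also have "... <= e * (t * (norm u + norm v))" using n1 e by (intro mult_left_mono) auto
   finally show ?thesis .
  qed
  have r2: "norm ?r2 <= e * (t * norm v)"
  proof -
   have "norm ?r2 <= e * norm p" using d(2)[of "m + p"] n2 small by simp
   also have "... <= e * (t * norm v)" using pn e by (intro mult_left_mono) auto
   finally show ?thesis .
  qed
  have "norm (?r1 - ?r2) <= e * (t * (norm u + 2 * norm v))" using r1 r2 norm_triangle_ineq4[of ?r1 ?r2] by (simp add: algebra_simps)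
  hence r: "\<bar>inner (?r1 - ?r2) v\<bar> <= e * (t * (norm u + 2 * norm v)) * norm v"
   using Cauchy_Schwarz_ineq2[of "?r1 - ?r2" v] mult_right_mono[of "norm (?r1 - ?r2)" _ "norm v"] by (meson order_trans norm_ge_zero)
  have e1: "f (m + t *. u + t *. v) - f (m + t *. u) - f (m + t *. v) + f m = t * inner (g (m + p + t *. u) - g (m + p)) v" using s(3) by (simp add: p_def ac_simps)
  have e2: "g (m + p + t *. u) - g (m + p) = t *. A u + (?r1 - ?r2)" by (simp add: linear_add[OF lin] linear_scale[OF lin])
  have "f (m + t *. u + t *. v) - f (m + t *. u) - f (m + t *. v) + f m - t^2 * inner (A u) v = t * inner (?r1 - ?r2) v"
   unfolding e1 e2 inner_add_left[of "t *. A u"] by (simp add: power2_eq_square distrib_left)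
  hence "\<bar>f (m + t *. u + t *. v) - f (m + t *. u) - f (m + t *. v) + f m - t^2 * inner (A u) v\<bar> = t * \<bar>inner (?r1 - ?r2) v\<bar>"
   using t(1) by (simp add: abs_mult)
  also have "... <= t * (e * (t * (norm u + 2 * norm v)) * norm v)" using r t by (intro mult_left_mono) auto
  finally show "\<bar>f (m + t *. u + t *. v) - f (m + t *. u) - f (m + t *. v) + f m - t^2 * inner (A u) v\<bar> <= t^2 * (e * ((norm u + 2 * norm v) * norm v))"
   by (simp add: power2_eq_square ac_simps)
 qed
qed

text \<open>The gradient is assumed differentiable at the single point \<open>m\<close>, so
  continuity of second derivatives is not at hand. Instead the mixed second difference, which is
  symmetric in \<open>u\<close> and \<open>v\<close>, is compared with both sides.\<close>

lemma second_derivative_symmetric: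
 fixes g :: "'a::real_inner => 'a"
 assumes f: "!!x. (f has_derivative (%h. inner (g x) h)) (at x)" and g: "(g has_derivative A) (at m)"
 shows "inner (A u) v = inner (A v) u"
proof -
 have *: "\<bar>inner (A u) v - inner (A v) u\<bar> <= e * (2 * (norm u + norm v)^2)" if e: "0 < e" for e
 proof -
  let ?C = "(norm u + 2 * norm v) * norm v" and ?D = "(norm v + 2 * norm u) * norm u"
  obtain d d' where d: "0 < d" "0 < d'"
   "!!t. 0 < t ==> t < d ==> \<bar>f (m + t *. u + t *. v) - f (m + t *. u) - f (m + t *. v) + f m - t^2 * inner (A u) v\<bar> <= t^2 * (e * ?C)"
   "!!t. 0 < t ==> t < d' ==> \<bar>f (m + t *. v + t *. u) - f (m + t *. v) - f (m + t *. u) + f m - t^2 * inner (A v) u\<bar> <= t^2 * (e * ?D)"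
   using second_derivative_aux[OF f g e, of u v] second_derivative_aux[OF f g e, of v u] by blast
  define t where "t = min d d' / 2"
  have t: "0 < t" "t < d" "t < d'" using d(1,2) by (auto simp: t_def min_def)
  have "m + t *. v + t *. u = m + t *. u + t *. v" by simp
  hence "\<bar>t^2 * inner (A u) v - t^2 * inner (A v) u\<bar> <= t^2 * (e * ?C) + t^2 * (e * ?D)"
   using d(3)[OF t(1,2)] d(4)[OF t(1,3)] by (simp only: abs_le_iff) linarith
  hence "t^2 * \<bar>inner (A u) v - inner (A v) u\<bar> <= t^2 * (e * (?C + ?D))" using t(1) by (simp add: distrib_left abs_mult flip: right_diff_distrib)
  hence "\<bar>inner (A u) v - inner (A v) u\<bar> <= e * (?C + ?D)" using t(1) by simp
  also have "?C + ?D = 2 * (norm u + norm v)^2 - 2 * (norm u * norm v)" by (simp add: power2_eq_square algebra_simps)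
  finally have "\<bar>inner (A u) v - inner (A v) u\<bar> <= e * (2 * (norm u + norm v)^2 - 2 * (norm u * norm v))" .
  also have "... <= e * (2 * (norm u + norm v)^2)" using e by (intro mult_left_mono) auto
  finally show ?thesis .
 qed
 have "\<bar>inner (A u) v - inner (A v) u\<bar> <= 0"
 proof (rule field_le_epsilon)
  fix e :: real assume e: "0 < e"
  let ?C = "2 * (norm u + norm v)^2"
  have C: "0 <= ?C" by simp
  have "\<bar>inner (A u) v - inner (A v) u\<bar> <= e / (?C + 1) * ?C" using *[of "e / (?C + 1)"] e C by (simp add: add_nonneg_pos)
  also have "... <= e" using e C by (simp add: divide_le_eq add_nonneg_pos)
  finally show "\<bar>inner (A u) v - inner (A v) u\<bar> <= 0 + e" by simp
 qed
 thus ?thesis by simp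
qed

section \<open>Polygons of total time one and their critical set\<close>

locale fine_polygon = polygon +
 assumes fine: "1 / real K <= \<sigma>"
begin

text \<open>Total time 1 with an idle last step: as the flow at time 1 is the identity, every orbit
  closes up and gives a critical polygon.\<close>

definition steps :: "nat => real" where "steps i = (if i < K then 1 / real K else 0)"

lemma steps: "\<bar>steps i\<bar> <= \<sigma>" "\<bar>1 / real K\<bar> <= \<sigma>" using fine sigma by (simp_all add: steps_def)

lemma sum_steps: "n <= K ==> (SUM i<n. steps i) = real n / real K" by (induction n) (simp_all add: steps_def add_divide_distrib)

text \<open>The critical polygon with last midpoint \<open>q\<close>. The space is fibred by the
  last midpoint, and each fibre contains exactly one such polygon.\<close>

definition orb :: "'a => 'a loop" where
 "orb q = tuple K (%i. if i < K then mid (1 / K) (\<psi> (i / K) q) else q)"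

definition fgrad :: "'a loop => 'a loop" where
 "fgrad y = tuple K (%i. if i < K then - J (defect steps y i) else 0)"

definition fibre :: "'a loop => 'a loop" where
 "fibre x = tuple K (%i. if i < K then coord x i else 0)"

lemma coord_orb [simp]: "coord (orb q) K = q" by (simp add: orb_def)
lemma coord_fibre [simp]: "coord (fibre x) i = (if i < K then coord x i else 0)" by (simp add: fibre_def)
lemma fgrad_fibre: "fgrad y = fibre (grad steps y)" by (intro poly_mapping_eqI) (simp add: fgrad_def grad_def)

lemma mid_alt: "mid s x = (1 / 2) *. (x + \<psi> s x)"
proof -
 have "x - (1 / 2) *. x = (1 / 2) *. x" by (rule minus_half)
 thus ?thesis unfolding mid_def scaleR_diff_right scaleR_add_right by (metis add.commute add_diff_eq diff_add_eq)
qed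

lemma psi_step: "\<psi> (1 / K) (\<psi> (real i / K) q) = \<psi> (real (Suc i) / K) q" by (simp add: flow(2)[symmetric] add_divide_distrib)

text \<open>The orbit points satisfy the recursion of the vertices, hence differ from them by a
  vector of alternating sign; it has to return to itself after an odd number of steps and so
  vanishes.\<close>

lemma vertex_orb: "i <= K ==> vertex (orb q) i = \<psi> (real i / K) q"
proof -
 define u where "u i = (if i <= K then \<psi> (real i / K) q else q)" for i
 have u: "u (Suc i) = 2 *. coord (orb q) i - u i" if "i <= K" for i
 proof (cases "i < K")
  case True
  thus ?thesis using psi_step[of i q] by (simp add: u_def orb_def mid_alt)
 next
  case False
  hence "i = K" using that by simp
  thus ?thesis using flow(3)[of q] K by (simp add: u_def scaleR_2)
 qed
 have e: "vertex (orb q) i - u i = (- 1) ^ i *. (vertex (orb q) 0 - u 0)" if "i <= Suc K" for i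
  using that by (induction i) (use u in \<open>auto simp: vertex.simps(2) algebra_simps\<close>)
 have "u (Suc K) = u 0" by (simp add: u_def flow(1))
 hence "vertex (orb q) 0 - u 0 = - (vertex (orb q) 0 - u 0)" using e[of "Suc K"] K vertex_closed[of "orb q"] by simp
 hence "vertex (orb q) 0 - u 0 = 0" by (simp only: eq_neg_iff_add_eq_0 flip: scaleR_2) simp
 thus "i <= K ==> ?thesis" using e[of i] by (simp add: u_def)
qed

lemma grad_orb: "grad steps (orb q) = 0"
proof -
 have "defect steps (orb q) i = 0" if "i <= K" for i
 proof (cases "i < K")
  case True
  hence "edge (orb q) i = \<psi> (real (Suc i) / K) q - \<psi> (real i / K) q" unfolding edge_def using vertex_orb by simp
  moreover have "chord (1 / K) (coord (orb q) i) = \<psi> (real (Suc i) / K) q - \<psi> (real i / K) q"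
   using True psi_step[of i q] base_mid[OF steps(2)] by (simp add: orb_def chord_def)
  ultimately show ?thesis using True by (simp add: defect_def steps_def)
 next
  case False
  hence "i = K" using that by simp
  moreover have "vertex (orb q) K = q" "vertex (orb q) 0 = q" using vertex_orb[of K q] vertex_orb[of 0 q] K by (simp_all add: flow)
  hence "edge (orb q) K = 0" unfolding edge_def vertex_closed by simp
  moreover have "chord 0 q = 0" by (simp add: chord_def flow(1))
  ultimately show ?thesis by (simp add: defect_def steps_def)
 qed
 thus ?thesis by (intro poly_mapping_eqI) (simp add: grad_def)
qed

lemma orb_hom: "0 <= c ==> orb (c *. q) = c *. orb q" by (intro poly_mapping_eqI) (simp add: orb_def hom mid_hom)

lemma orb_0 [simp]: "orb 0 = 0" using orb_hom[of 0 0] by simp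

definition orb_lip :: real where "orb_lip = (real K + 1) * L"

lemma orb_lipschitz: "norm (orb q - orb q') <= orb_lip * norm (q - q')"
proof -
 have "norm (orb q - orb q') <= (SUM i<=K. norm ((if i < K then mid (1 / K) (\<psi> (i / K) q) else q) - (if i < K then mid (1 / K) (\<psi> (i / K) q') else q')))"
  unfolding orb_def tuple_diff by (rule norm_tuple_le)
 also have "... <= (SUM i<=K. L * norm (q - q'))"
 proof (rule sum_mono)
  fix i assume "i : {..K}"
  have "norm (mid (1 / K) (\<psi> (i / K) q) - mid (1 / K) (\<psi> (i / K) q')) <= L * norm (q - q')"
  proof -
   have "mid (1 / K) (\<psi> (i / K) q) - mid (1 / K) (\<psi> (i / K) q') =
     (1 / 2) *. ((\<psi> (real i / K) q - \<psi> (real i / K) q') + (\<psi> (real (Suc i) / K) q - \<psi> (real (Suc i) / K) q'))"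
    unfolding mid_alt psi_step by (simp add: algebra_simps)
   thus ?thesis using lip[of "real i / K" q q'] lip[of "real (Suc i) / K" q q']
     norm_triangle_ineq[of "\<psi> (real i / K) q - \<psi> (real i / K) q'" "\<psi> (real (Suc i) / K) q - \<psi> (real (Suc i) / K) q'"] by simp
  qed
  moreover have "norm (q - q') <= L * norm (q - q')" using L1 mult_right_mono[of 1 L "norm (q - q')"] by simp
  ultimately show "norm ((if i < K then mid (1 / K) (\<psi> (i / K) q) else q) - (if i < K then mid (1 / K) (\<psi> (i / K) q') else q')) <= L * norm (q - q')" by simp
 qed
 finally show ?thesis by (simp add: orb_lip_def algebra_simps)
qed

definition coer :: real where "coer = 1 / (real K * (2 * L * (2 * L ^ Suc K)) * real K)"

lemma coer_pos: "0 < coer" using L1 K by (simp add: coer_def)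

text \<open>If the first \<open>K\<close> defects are small, the polygon follows an orbit whose end
  returns to its start, because \<open>\<psi> 1\<close> is the identity. The last midpoint is then
  close to that start and the polygon close to its \<open>orb\<close>. This is nondegeneracy along
  the fibre, expressed without a Hessian.\<close>

lemma fibre_bound:
 assumes y: "y : plane {..K}"
 shows "coer * norm (y - orb (coord y K)) <= norm (fgrad y)"
proof -
 define q where "q = coord y K"
 define \<delta> where "\<delta> = 2 * L ^ Suc K * (SUM i<=K - 1. norm (defect steps y i))"
 have sh: "norm (\<psi> (real n / K) (vertex y 0) - vertex y n) <= \<delta>" if "n <= K" for n
  using shadow_uniform[of steps n "K - 1" y] steps that K unfolding \<delta>_def sum_steps[OF that] by simp
 have \<delta>0: "0 <= \<delta>" using L1 by (simp add: \<delta>_def sum_nonneg)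
 have "q = (1 / 2) *. (vertex y K + vertex y 0)" unfolding q_def coord_vertex[of y K] vertex_closed ..
 hence "q - vertex y 0 = (1 / 2) *. (vertex y K - vertex y 0)" using minus_half[of "vertex y 0"] by (simp add: algebra_simps)
 hence q0: "norm (q - vertex y 0) <= \<delta> / 2" using sh[of K] K flow(3)[of "vertex y 0"] by (simp add: norm_minus_commute)
 have v: "norm (vertex y n - \<psi> (real n / K) q) <= 2 * L * \<delta>" if "n <= K" for n
 proof -
  have "norm (\<psi> (real n / K) q - \<psi> (real n / K) (vertex y 0)) <= L * (\<delta> / 2)"
   using lip[of "real n / K" q "vertex y 0"] mult_left_mono[OF q0, of L] L1 by linarith
  hence "norm (vertex y n - \<psi> (real n / K) q) <= \<delta> + L * (\<delta> / 2)"
   using sh[OF that] norm_triangle_ineq4[of "vertex y n - \<psi> (real n / K) (vertex y 0)" "\<psi> (real n / K) q - \<psi> (real n / K) (vertex y 0)"]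
   by (simp add: norm_minus_commute)
  moreover have "\<delta> <= L * \<delta>" using L1 \<delta>0 mult_right_mono[of 1 L \<delta>] by simp
  moreover have "0 <= L * \<delta>" using L1 \<delta>0 by simp
  ultimately show ?thesis by (simp add: mult.assoc)
 qed
 have c: "norm (coord (y - orb q) i) <= (if i < K then 2 * L * \<delta> else 0)" if "i <= K" for i
 proof (cases "i < K")
  case True
  have "coord (y - orb q) i = (1 / 2) *. ((vertex y i - \<psi> (real i / K) q) + (vertex y (Suc i) - \<psi> (real (Suc i) / K) q))"
   unfolding coord_linear coord_vertex[of y i] using True psi_step[of i q] by (simp add: orb_def mid_alt algebra_simps)
  thus ?thesis using v[of i] v[of "Suc i"] True norm_triangle_ineq[of "vertex y i - \<psi> (real i / K) q" "vertex y (Suc i) - \<psi> (real (Suc i) / K) q"] by simp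
 next
  case False
  hence "i = K" using that by simp
  thus ?thesis by (simp add: q_def)
 qed
 have "y - orb q : plane {..K}" using y by (auto simp: plane_def orb_def)
 hence "norm (y - orb q) <= (SUM i<=K. norm (coord (y - orb q) i))" by (rule norm_plane_le)
 also have "... <= (SUM i<=K. if i < K then 2 * L * \<delta> else 0)" by (intro sum_mono) (use c in auto)
 also have "... = real K * (2 * L * \<delta>)"
 proof -
  have "{..K} Int {i. i < K} = {..<K}" by auto
  thus ?thesis by (simp add: sum.If_cases)
 qed
 finally have 1: "norm (y - orb q) <= real K * (2 * L * \<delta>)" .
 have "\<delta> <= 2 * L ^ Suc K * (real K * norm (fgrad y))"
 proof -
  have "(SUM i<=K - 1. norm (defect steps y i)) <= (SUM i<=K - 1. norm (fgrad y))"
  proof (rule sum_mono)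
   fix i assume "i : {..K - 1}"
   hence "i < K" using K by auto
   thus "norm (defect steps y i) <= norm (fgrad y)" using norm_coord_le[of "fgrad y" i] by (simp add: fgrad_def)
  qed
  thus ?thesis unfolding \<delta>_def using K L1 by (intro mult_left_mono) (auto simp: of_nat_diff)
 qed
 hence "real K * (2 * L * \<delta>) <= real K * (2 * L * (2 * L ^ Suc K * (real K * norm (fgrad y))))" using L1 by (intro mult_left_mono) auto
 with 1 have "norm (y - orb q) <= real K * (2 * L * (2 * L ^ Suc K)) * real K * norm (fgrad y)" by (simp add: ac_simps)
 thus ?thesis using L1 K unfolding q_def coer_def by (simp add: divide_le_eq ac_simps)
qed

end

lemma inner_single: "inner (single i v) (x :: 'i \<Rightarrow>\<^sub>0 'v::real_inner) = inner v (coord x i)" using inner_alt[of "{i}" "single i v" x] by simp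

context fine_polygon
begin

abbreviation "tip (v :: 'a) \<equiv> single K v"

lemma fibre_linear: "fibre (x + y) = fibre x + fibre y" "fibre (x - y) = fibre x - fibre y" "fibre (c *. x) = c *. fibre x" by (intro poly_mapping_eqI; simp)+

lemma fibre_plane: "fibre x : plane {..<K}" by (simp add: plane_def)

lemma fibre_id: "w : plane {..<K} ==> fibre w = w" by (intro poly_mapping_eqI) (simp add: plane_def)

lemma fibre_tip [simp]: "fibre (tip v) = 0" by (intro poly_mapping_eqI) (simp add: lookup_single)

lemma coord_tip [simp]: "coord (tip v) K = v" by simp

lemma norm2_scale: "(norm (- (a *. v)))^2 = a * a * (norm v)^2" for v :: "'b::real_normed_vector" by (simp add: power_mult_distrib power2_eq_square[of a])

lemma plane_split: "x : plane {..K} ==> x = fibre x + tip (coord x K)" by (intro poly_mapping_eqI) (auto simp: plane_def lookup_single when_def)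

lemma inner_fibre: "h : plane {..<K} ==> inner (fibre g) h = inner g h"
proof -
 assume h: "h : plane {..<K}"
 hence "keys h <= {..<K}" by (auto simp: plane_def in_keys_iff)
 thus ?thesis using inner_alt[of "{..<K}" h g] inner_alt[of "{..<K}" h "fibre g"] by (simp add: inner_commute[of _ h])
qed

lemma norm_fibre_le: "norm (fibre x) <= norm x"
proof -
 have "(norm (fibre x))^2 <= norm x * norm (fibre x)" using inner_fibre[OF fibre_plane, of x x] norm_cauchy_schwarz[of x "fibre x"] by (simp only: power2_norm_eq_inner)
 hence "norm (fibre x) * norm (fibre x) <= norm x * norm (fibre x)" by (simp only: power2_eq_square)
 thus ?thesis by (cases "fibre x = 0") simp_all
qed

lemma norm_split:
 assumes "w : plane {..<K}" shows "(norm (w + tip v))^2 = (norm w)^2 + (norm v)^2"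
proof -
 have "inner (tip v) w = 0" using assms by (simp add: inner_single plane_def)
 hence "(norm (w + tip v))^2 = (norm w)^2 + (norm (tip v))^2" by (simp add: norm_add_Pythagorean orthogonal_def inner_commute)
 thus ?thesis by (simp add: norm_single)
qed

lemma grad_steps_lipschitz: "slope-lipschitz_on UNIV (grad steps)" by (rule grad_lipschitz) (rule steps(1))

lemma fgrad_lipschitz: "norm (fgrad y - fgrad y') <= slope * norm (y - y')"
 using norm_fibre_le[of "grad steps y - grad steps y'"] lipschitz_onD[OF grad_steps_lipschitz, of y y'] by (simp add: fgrad_fibre fibre_linear dist_norm)

lemma grad_near_orb: "norm (grad steps (orb q + w)) <= slope * norm w"
 using lipschitz_onD[OF grad_steps_lipschitz, of "orb q + w" "orb q"] grad_orb[of q] by (simp add: dist_norm)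

lemma fgrad_near_orb: "norm (fgrad (orb q + w)) <= slope * norm w" using grad_near_orb[of q w] norm_fibre_le[of "grad steps (orb q + w)"] by (simp add: fgrad_fibre)

lemma fgrad_orb: "fgrad (orb q) = 0" using fgrad_near_orb[of q 0] by simp

lemma fgrad_lower: "w : plane {..<K} ==> coer * norm w <= norm (fgrad (orb q + w))" using fibre_bound[of "orb q + w"] by (simp add: plane_def orb_def)

lemma action_grad: "gradient_on UNIV (action steps) (grad steps)" unfolding gradient_on_def by (intro ballI action_gradient steps(1))

text \<open>For \<open>l = 1\<close> the orbit polygon of the last midpoint is added to the fibre
  part, so the zero section becomes the critical set; for \<open>l = 0\<close> only the fibre part
  is left. Accordingly \<open>target\<close> will interpolate between the action in sheared
  coordinates and a sum of a function of the base and a function of the fibre.\<close>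

definition shift :: "real => 'a loop => 'a loop" where "shift l x = orb (l *. coord x K) + fibre x"

lemma shift_lipschitz: "\<bar>l\<bar> <= 1 ==> norm (shift l x - shift l y) <= (orb_lip + 1) * norm (x - y)"
proof -
 assume l: "\<bar>l\<bar> <= 1"
 have "norm (orb (l *. coord x K) - orb (l *. coord y K)) <= orb_lip * norm (x - y)"
 proof -
  have "norm (l *. coord x K - l *. coord y K) <= 1 * norm (x - y)"
  proof -
   have "\<bar>l\<bar> * norm (coord (x - y) K) <= 1 * norm (x - y)" using l norm_coord_le[of "x - y" K] by (intro mult_mono) auto
   thus ?thesis by (simp flip: scaleR_diff_right)
  qed
  hence "orb_lip * norm (l *. coord x K - l *. coord y K) <= orb_lip * norm (x - y)" using L1 by (intro mult_left_mono) (auto simp: orb_lip_def)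
  thus ?thesis using orb_lipschitz order_trans by blast
 qed
 moreover have "norm (fibre x - fibre y) <= norm (x - y)" using norm_fibre_le[of "x - y"] by (simp add: fibre_linear)
 moreover have "shift l x - shift l y = (orb (l *. coord x K) - orb (l *. coord y K)) + (fibre x - fibre y)" by (simp add: shift_def)
 ultimately show ?thesis using norm_triangle_ineq[of "orb (l *. coord x K) - orb (l *. coord y K)" "fibre x - fibre y"] by (simp add: distrib_right)
qed

lemma shift_continuous: "\<bar>l\<bar> <= 1 ==> continuous_on S (shift l)" using shift_lipschitz L1
 by (intro lipschitz_on_continuous_on[of "orb_lip + 1"] lipschitz_onI) (auto simp: dist_norm orb_lip_def)

end

section \<open>Splitting the action into base and fibre\<close>

locale fibred = fine_polygon +
 fixes s \<rho> :: real
 assumes s: "\<bar>s\<bar> <= \<sigma>" and rho: "0 < \<rho>" "!!q. \<rho> * norm q <= norm (chord s q)"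
begin

definition target :: "real => 'a loop => real" where
 "target l x = gen s (coord x K) + action steps (shift l x)"

lemma gen_descent: "gen s y <= gen s x + inner (J (chord s x)) (y - x) + 1 * (norm (y - x))^2"
proof (rule gradient_on_descent[of UNIV])
 show "gradient_on UNIV (gen s) (%x. J (chord s x))" using gen_gradient[OF s] by (simp add: gradient_on_def)
 show "1-lipschitz_on UNIV (%x. J (chord s x))"
 proof (rule lipschitz_onI)
  fix x y :: 'a
  have "norm (J (chord s x) - J (chord s y)) = norm (chord s x - chord s y)" using norm_J[of "chord s x - chord s y"] by simp
  thus "dist (J (chord s x)) (J (chord s y)) <= 1 * dist x y" using chord_lip[OF s, of x y] norm_ge_zero[of "x - y"] unfolding dist_norm by linarith
 qed simp
qed auto

lemma chord_norm_le: "norm (chord s q) <= norm q" using chord_le[OF s, of q] norm_ge_zero[of q] by linarith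

lemma bounded_linear_single: "bounded_linear (%v :: 'a. single (i :: nat) v)"
 by (rule bounded_linear_intro[of _ 1]) (auto simp: norm_single single_add intro!: poly_mapping_eqI simp: lookup_single when_def)

text \<open>A step along the fibre gradient lowers the action by a multiple of the square of the fibre part,
  and a much shorter step in the base lowers the generating function; the coefficient \<open>\<gamma>\<close> is so small
  that the change of the action caused by moving the base point is absorbed.\<close>

lemma target_pushable:
 obtains v k C where "!!l. 0 <= l ==> l <= 1 ==> pushable (plane {..K}) (target l) (v l) k C"
proof -
 define B where "B = orb_lip"
 define \<Gamma> where "\<Gamma> = slope"
 define \<kappa> where "\<kappa> = coer"
 have pos: "0 < B" "0 < \<Gamma>" "0 < \<kappa>" using L1 by (simp_all add: B_def \<Gamma>_def \<kappa>_def orb_lip_def slope_pos coer_pos)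
 \<comment> \<open>The two quotients are what \<open>g1\<close> and \<open>g2\<close> need: the
   mixed term is absorbed by a weighted square inequality, the quadratic one directly.\<close>
 define \<gamma> where "\<gamma> = min 1 (min (\<rho>^2 * \<kappa>^2 / (32 * \<Gamma>^2 * B^2)) (\<rho>^2 / (8 * \<Gamma> * B^2)))"
 define \<eta> where "\<eta> = min (1 / 2) (1 / (2 * \<Gamma>))"
 have g: "0 < \<gamma>" "\<gamma> <= 1" "\<gamma> <= \<rho>^2 * \<kappa>^2 / (32 * \<Gamma>^2 * B^2)" "\<gamma> <= \<rho>^2 / (8 * \<Gamma> * B^2)"
  using pos rho unfolding \<gamma>_def by simp_all
 have e: "0 < \<eta>" "\<eta> <= 1 / 2" "\<eta> <= 1 / (2 * \<Gamma>)" using pos unfolding \<eta>_def by simp_all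
 have e\<Gamma>: "\<eta> * \<Gamma> <= 1 / 2" using e(3) pos(2) by (simp add: field_simps)
 have g1: "4 * \<Gamma>^2 * B^2 * \<gamma> / \<kappa>^2 <= \<rho>^2 / 8" using g(3) pos by (simp add: field_simps)
 have g2: "\<Gamma> * B^2 * \<gamma> <= \<rho>^2 / 8" using g(4) pos by (simp add: field_simps)
 define V where "V l x = \<eta> *. fgrad (shift l x) + tip ((\<eta> * \<gamma>) *. J (chord s (coord x K)))" for l x
 let ?g = "\<eta> * \<gamma>"
 define k where "k = \<eta> * min (\<kappa>^2 / 4) (\<gamma> * \<rho>^2 / 4)"
 have k: "0 < k" using e g pos rho by (simp add: k_def)
 define C where "C = \<eta> * \<Gamma> + \<eta> * \<gamma>"
 have C: "0 <= C" using e g pos by (simp add: C_def)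
 have desc: "target l (x - u *. V l x) <= target l x - u * k * (norm x)^2"
  if l: "0 <= l" "l <= 1" and x: "x : plane {..K}" and u: "0 <= u" "u <= 1" for l x u
 proof -
  define q where "q = coord x K"
  define w where "w = fibre x"
  define p where "p = orb (l *. q) + w"
  define G where "G = fgrad p"
  define q' where "q' = q - (u * ?g) *. J (chord s q)"
  define w' where "w' = w - (u * \<eta>) *. G"
  have wp: "w : plane {..<K}" and Gp: "G : plane {..<K}" by (simp_all add: w_def G_def fgrad_fibre fibre_plane)
  have shift0: "shift l x = p" by (simp add: shift_def p_def q_def w_def)
  have shift1: "shift l (x - u *. V l x) = orb (l *. q') + w'" using fibre_id[OF Gp] Gp shift0
   by (simp add: shift_def V_def fibre_linear q'_def w'_def q_def w_def G_def plane_def algebra_simps)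
  have q1: "coord (x - u *. V l x) K = q'" using Gp by (simp add: V_def shift0 q'_def q_def G_def plane_def)
  have nx: "(norm x)^2 = (norm w)^2 + (norm q)^2" using norm_split[OF fibre_plane, of x "coord x K"] plane_split[OF x] by (simp add: w_def q_def)
  have Gw: "\<kappa> * norm w <= norm G" "norm G <= \<Gamma> * norm w" using fgrad_lower[OF wp] fgrad_near_orb by (simp_all add: G_def p_def \<kappa>_def \<Gamma>_def)
  have 1: "action steps (orb (l *. q) + w') <= action steps p - u * \<eta> / 2 * (\<kappa> * norm w)^2"
  proof -
   have "action steps (orb (l *. q) + w') <= action steps p + inner (grad steps p) (orb (l *. q) + w' - p) + \<Gamma> * (norm (orb (l *. q) + w' - p))^2"
    unfolding \<Gamma>_def by (rule gradient_on_descent[OF convex_UNIV action_grad grad_steps_lipschitz]) auto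
   also have "orb (l *. q) + w' - p = - ((u * \<eta>) *. G)" by (simp add: p_def w'_def)
   also have "inner (grad steps p) (- ((u * \<eta>) *. G)) = - (u * \<eta>) * (norm G)^2"
    using inner_fibre[OF Gp, of "grad steps p"] by (simp add: G_def fgrad_fibre power2_norm_eq_inner)
   also have "\<Gamma> * (norm (- ((u * \<eta>) *. G)))^2 <= u * \<eta> * (norm G)^2 / 2"
   proof -
    have "(u * \<eta>) * ((\<eta> * \<Gamma>) * u) <= (u * \<eta>) * (1 / 2 * 1)" using u e e\<Gamma> pos by (intro mult_left_mono mult_mono) auto
    hence "(u * \<eta>) * ((\<eta> * \<Gamma>) * u) * (norm G)^2 <= (u * \<eta>) * (1 / 2 * 1) * (norm G)^2" by (rule mult_right_mono) simp
    thus ?thesis unfolding norm2_scale by (simp add: ac_simps)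
   qed
   finally have "action steps (orb (l *. q) + w') <= action steps p - u * \<eta> / 2 * (norm G)^2" by (simp add: ac_simps)
   moreover have "u * \<eta> / 2 * (\<kappa> * norm w)^2 <= u * \<eta> / 2 * (norm G)^2" using u e pos Gw by (intro mult_left_mono power_mono) auto
   ultimately show ?thesis by linarith
  qed
  have 2: "action steps (orb (l *. q') + w') <= action steps (orb (l *. q) + w')
    + u * \<eta> * (2 * \<Gamma> * B * \<gamma> * (norm w * norm q)) + u * \<eta> * (\<Gamma> * B^2 * \<gamma> * \<gamma> * (norm q)^2)"
  proof -
   define z where "z = orb (l *. q) + w'"
   define \<Delta> where "\<Delta> = orb (l *. q') - orb (l *. q)"
   have lq: "norm (l *. q' - l *. q) <= 1 * (u * ?g * norm q)"
   proof -
    have "l *. q' - l *. q = - (l * (u * ?g)) *. J (chord s q)" by (simp add: q'_def scaleR_diff_right)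
    hence "norm (l *. q' - l *. q) = l * (u * ?g * norm (chord s q))" using l u e g by (simp add: abs_mult)
    also have "... <= 1 * (u * ?g * norm q)" using l u e g chord_norm_le[of q] by (intro mult_mono) auto
    finally show ?thesis .
   qed
   have D: "norm \<Delta> <= B * (u * ?g * norm q)"
   proof -
    have "norm \<Delta> <= B * norm (l *. q' - l *. q)" unfolding \<Delta>_def B_def by (rule orb_lipschitz)
    also have "... <= B * (1 * (u * ?g * norm q))" by (rule mult_left_mono) (use lq pos in auto)
    finally show ?thesis by simp
   qed
   have "u * \<eta> * norm G <= 1 * \<eta> * norm G" using u e by (intro mult_right_mono) auto
   moreover have "norm ((u * \<eta>) *. G) = u * \<eta> * norm G" using u e by simp
   ultimately have "norm w' <= norm w + \<eta> * norm G" using norm_triangle_ineq4[of w "(u * \<eta>) *. G"] unfolding w'_def by linarith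
   also have "... <= norm w + \<eta> * (\<Gamma> * norm w)" using Gw(2) e by (intro add_left_mono mult_left_mono) auto
   also have "... <= norm w + 1 / 2 * norm w" using mult_right_mono[OF e\<Gamma>, of "norm w"] by (simp add: mult.assoc)
   also have "... <= 2 * norm w" by simp
   finally have "norm (grad steps z) <= \<Gamma> * (2 * norm w)"
    using grad_near_orb[of "l *. q" w'] mult_left_mono[of "norm w'" "2 * norm w" \<Gamma>] pos unfolding z_def \<Gamma>_def by linarith
   hence "norm (grad steps z) * norm \<Delta> <= (\<Gamma> * (2 * norm w)) * (B * (u * ?g * norm q))" using D pos by (intro mult_mono) auto
   hence "inner (grad steps z) \<Delta> <= (\<Gamma> * (2 * norm w)) * (B * (u * ?g * norm q))" using norm_cauchy_schwarz[of "grad steps z" \<Delta>] by linarith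
   moreover have "\<Gamma> * (norm \<Delta>)^2 <= u * \<eta> * (\<Gamma> * B^2 * \<gamma> * \<gamma> * (norm q)^2)"
   proof -
    have "\<Gamma> * (norm \<Delta>)^2 <= \<Gamma> * (B * (u * ?g * norm q))^2" using D pos by (intro mult_left_mono power_mono) auto
    also have "... = (u * \<eta>) * (u * \<eta>) * (\<Gamma> * B^2 * \<gamma> * \<gamma> * (norm q)^2)" by (simp add: power2_eq_square ac_simps)
    also have "... <= (u * \<eta>) * 1 * (\<Gamma> * B^2 * \<gamma> * \<gamma> * (norm q)^2)"
     using u e pos g mult_le_one[of u \<eta>] by (intro mult_right_mono mult_left_mono) auto
    finally show ?thesis by simp
   qed
   moreover have "action steps (z + \<Delta>) <= action steps z + inner (grad steps z) (z + \<Delta> - z) + \<Gamma> * (norm (z + \<Delta> - z))^2"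
    unfolding \<Gamma>_def by (rule gradient_on_descent[OF convex_UNIV action_grad grad_steps_lipschitz]) auto
   moreover have "orb (l *. q') + w' = z + \<Delta>" by (simp add: z_def \<Delta>_def)
   ultimately show ?thesis unfolding z_def[symmetric] by (simp add: ac_simps)
  qed
  have 3: "gen s q' <= gen s q - u * \<eta> * (\<gamma> / 2 * (\<rho> * norm q)^2)"
  proof -
   have "gen s q' <= gen s q + inner (J (chord s q)) (q' - q) + 1 * (norm (q' - q))^2" by (rule gen_descent)
   also have "q' - q = - ((u * ?g) *. J (chord s q))" by (simp add: q'_def)
   also have "inner (J (chord s q)) (- ((u * ?g) *. J (chord s q))) = - (u * ?g) * (norm (chord s q))^2" by (simp add: J(3) power2_norm_eq_inner)
   also have "1 * (norm (- ((u * ?g) *. J (chord s q))))^2 <= (u * ?g) / 2 * (norm (chord s q))^2"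
   proof -
    have "\<eta> * \<gamma> <= 1 / 2 * 1" using e g by (intro mult_mono) auto
    hence "u * ?g <= 1 * (1 / 2)" using u e g by (intro mult_mono) auto
    hence "(u * ?g) * (u * ?g) * (norm (chord s q))^2 <= (u * ?g) * (1 / 2) * (norm (chord s q))^2" using u e g by (intro mult_right_mono mult_left_mono) auto
    moreover have "(norm (- ((u * ?g) *. J (chord s q))))^2 = (u * ?g) * (u * ?g) * (norm (chord s q))^2" by (simp only: norm2_scale norm_J)
    ultimately show ?thesis by simp
   qed
   finally have "gen s q' <= gen s q - u * \<eta> * (\<gamma> / 2 * (norm (chord s q))^2)" by (simp add: ac_simps)
   moreover have "u * \<eta> * (\<gamma> / 2 * (\<rho> * norm q)^2) <= u * \<eta> * (\<gamma> / 2 * (norm (chord s q))^2)"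
    using u e g rho by (intro mult_left_mono power_mono) auto
   ultimately show ?thesis by linarith
  qed
  have am: "2 * \<Gamma> * B * \<gamma> * (norm w * norm q) <= \<kappa>^2 / 4 * (norm w)^2 + \<gamma> * \<rho>^2 / 8 * (norm q)^2"
  proof -
   have "2 * (\<kappa> / 2 * norm w) * (2 * \<Gamma> * B * \<gamma> / \<kappa> * norm q) <= (\<kappa> / 2 * norm w)^2 + (2 * \<Gamma> * B * \<gamma> / \<kappa> * norm q)^2"
    by (rule sum_squares_bound)
   also have "(2 * \<Gamma> * B * \<gamma> / \<kappa> * norm q)^2 = (4 * \<Gamma>^2 * B^2 * \<gamma> / \<kappa>^2) * (\<gamma> * (norm q)^2)"
    by (simp add: power2_eq_square)
   also have "... <= (\<rho>^2 / 8) * (\<gamma> * (norm q)^2)" using g1 g by (intro mult_right_mono) auto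
   finally show ?thesis using pos by (simp add: power_mult_distrib power_divide ac_simps)
  qed
  have "(\<Gamma> * B^2 * \<gamma>) * (\<gamma> * (norm q)^2) <= (\<rho>^2 / 8) * (\<gamma> * (norm q)^2)" using g2 g by (intro mult_right_mono) auto
  hence "\<Gamma> * B^2 * \<gamma> * \<gamma> * (norm q)^2 <= \<gamma> * \<rho>^2 / 8 * (norm q)^2" by (simp add: ac_simps)
  hence "2 * \<Gamma> * B * \<gamma> * (norm w * norm q) + \<Gamma> * B^2 * \<gamma> * \<gamma> * (norm q)^2 <=
    \<kappa>^2 / 4 * (norm w)^2 + \<gamma> * \<rho>^2 / 4 * (norm q)^2" using am by linarith
  hence "u * \<eta> * (2 * \<Gamma> * B * \<gamma> * (norm w * norm q) + \<Gamma> * B^2 * \<gamma> * \<gamma> * (norm q)^2) <=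
    u * \<eta> * (\<kappa>^2 / 4 * (norm w)^2 + \<gamma> * \<rho>^2 / 4 * (norm q)^2)" using u e by (intro mult_left_mono) auto
  moreover have "u * k * (norm x)^2 <= u * \<eta> * (\<kappa>^2 / 4 * (norm w)^2 + \<gamma> * \<rho>^2 / 4 * (norm q)^2)"
  proof -
   have "min (\<kappa>^2 / 4) (\<gamma> * \<rho>^2 / 4) * (norm w)^2 + min (\<kappa>^2 / 4) (\<gamma> * \<rho>^2 / 4) * (norm q)^2 <= \<kappa>^2 / 4 * (norm w)^2 + \<gamma> * \<rho>^2 / 4 * (norm q)^2"
    by (intro add_mono mult_right_mono) auto
   hence "(u * \<eta>) * (min (\<kappa>^2 / 4) (\<gamma> * \<rho>^2 / 4) * ((norm w)^2 + (norm q)^2)) <= (u * \<eta>) * (\<kappa>^2 / 4 * (norm w)^2 + \<gamma> * \<rho>^2 / 4 * (norm q)^2)"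
    using u e by (intro mult_left_mono) (auto simp: distrib_left)
   thus ?thesis unfolding nx k_def by (simp only: mult.assoc)
  qed
  moreover have "u * \<eta> / 2 * (\<kappa> * norm w)^2 + u * \<eta> * (\<gamma> / 2 * (\<rho> * norm q)^2) = 2 * (u * \<eta> * (\<kappa>^2 / 4 * (norm w)^2 + \<gamma> * \<rho>^2 / 4 * (norm q)^2))"
   by (simp add: power_mult_distrib algebra_simps)
  ultimately show ?thesis using 1 2 3 unfolding target_def shift0 shift1 q1 q_def[symmetric] distrib_left by linarith
 qed
 have "pushable (plane {..K}) (target l) (V l) k C" if l: "0 <= l" "l <= 1" for l unfolding pushable_def
 proof (intro conjI ballI allI impI k C)
  have f: "continuous_on UNIV fgrad" using fgrad_lipschitz slope_pos by (intro lipschitz_on_continuous_on[of slope] lipschitz_onI) (auto simp: dist_norm)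
  have c: "continuous_on UNIV (%x. chord s x)" using chord_lip[OF s] by (intro lipschitz_on_continuous_on[of "2 / 3"] lipschitz_onI) (auto simp: dist_norm)
  show "continuous_on (plane {..K}) (V l)" unfolding V_def using l
   by (intro continuous_intros continuous_on_compose2[OF f] shift_continuous bounded_linear.continuous_on[OF bounded_linear_single]
    bounded_linear.continuous_on[OF bounded_linear_J] continuous_on_compose2[OF c] bounded_linear.continuous_on[OF bounded_linear_coord]) auto
 next
  fix x :: "'a loop" assume x: "x : plane {..K}"
  have "norm (V l x) <= \<eta> * norm (fgrad (shift l x)) + \<eta> * \<gamma> * norm (chord s (coord x K))"
   unfolding V_def using norm_triangle_ineq[of "\<eta> *. fgrad (shift l x)" "tip (?g *. J (chord s (coord x K)))"] e g by (simp add: norm_single abs_mult)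
  also have "... <= \<eta> * (\<Gamma> * norm x) + \<eta> * \<gamma> * norm x"
  proof (intro add_mono mult_left_mono)
   have "\<Gamma> * norm (fibre x) <= \<Gamma> * norm x" using pos norm_fibre_le by (intro mult_left_mono) auto
   thus "norm (fgrad (shift l x)) <= \<Gamma> * norm x" unfolding shift_def using fgrad_near_orb[of "l *. coord x K" "fibre x"] by (simp add: \<Gamma>_def)
   show "norm (chord s (coord x K)) <= norm x" using chord_norm_le[of "coord x K"] norm_coord_le[of x K] by linarith
  qed (use e g in auto)
  finally show "norm (V l x) <= C * norm x" by (simp add: C_def algebra_simps)
  fix u :: real assume u: "0 <= u" "u <= 1"
  show "x - u *. V l x : plane {..K}" using x fibre_plane[of "grad steps (shift l x)"] by (auto simp: plane_def V_def fgrad_def lookup_single when_def)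
  show "target l (x - u *. V l x) <= target l x - u * k * (norm x)^2" by (rule desc[OF l x u])
 qed
 thus thesis by (rule that)
qed

end

context fibred
begin

definition ends :: "nat => real" where "ends i = (if i < K then 1 / real K else s)"

lemma gen_zero: "gen 0 m = 0" using gen_neg[of 0 m] sigma by simp

lemma action_ends: "action ends x = gen s (coord x K) + action steps x"
proof -
 have "{..K} = insert K {..<K}" by auto
 thus ?thesis by (simp add: action_def ends_def steps_def gen_zero)
qed

text \<open>This removes the dependence of the fibre function on the base point. The push constants
  are uniform in \<open>l\<close>, and \<open>target\<close> is Lipschitz in \<open>l\<close> up to
  the factor \<open>(norm x)^2\<close>.\<close>

lemma target_family: "hiso {x:plane {..K}. target 0 x < 0} p {x:plane {..K}. target 1 x < 0} p"
proof -
 obtain v k C where v: "!!l. 0 <= l ==> l <= 1 ==> pushable (plane {..K}) (target l) (v l) k C" using target_pushable by blast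
 define M where "M = slope * (3 * (orb_lip + 1)) * orb_lip + 1"
 have B: "0 <= orb_lip" using L1 by (simp add: orb_lip_def)
 have M: "0 < M" using B slope_pos by (simp add: M_def add_nonneg_pos)
 show ?thesis
 proof (rule pushable_family[OF v])
  fix d :: real assume d: "0 < d"
  show "EX e>0. ALL l l'. 0 <= l --> l <= 1 --> 0 <= l' --> l' <= 1 --> \<bar>l - l'\<bar> < e -->
   (ALL x:plane {..K}. \<bar>target l x - target l' x\<bar> <= d * (norm x)^2)"
  proof (intro exI[of _ "d / M"] conjI allI impI ballI)
   show "0 < d / M" using d M by simp
   fix l l' :: real and x :: "'a loop"
   assume l: "0 <= l" "l <= 1" and l': "0 <= l'" "l' <= 1" and ll: "\<bar>l - l'\<bar> < d / M"
   let ?p = "shift l x" and ?p' = "shift l' x"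
   have n: "norm (shift l x) <= (orb_lip + 1) * norm x" if "0 <= l" "l <= 1" for l
   proof -
    have "shift l 0 = 0" by (intro poly_mapping_eqI) (simp add: shift_def)
    thus ?thesis using shift_lipschitz[of l x 0] that by simp
   qed
   have pp: "norm (?p - ?p') <= orb_lip * (\<bar>l - l'\<bar> * norm x)"
   proof -
    have "norm (?p - ?p') <= orb_lip * norm (l *. coord x K - l' *. coord x K)" using orb_lipschitz by (simp add: shift_def)
    also have "l *. coord x K - l' *. coord x K = (l - l') *. coord x K" by (simp add: scaleR_diff_left)
    also have "orb_lip * norm ((l - l') *. coord x K) <= orb_lip * (\<bar>l - l'\<bar> * norm x)" using B norm_coord_le[of x K] by (simp add: mult_left_mono)
    finally show ?thesis .
   qed
   obtain t where t: "0 < t" "t < 1" "action steps ?p - action steps ?p' = inner (grad steps (?p' + t *. (?p - ?p'))) (?p - ?p')"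
    by (rule gradient_on_mvt[OF convex_UNIV action_grad UNIV_I UNIV_I, of ?p ?p'])
   define z where "z = ?p' + t *. (?p - ?p')"
   have "norm z <= norm ?p' + norm (?p - ?p')" using norm_triangle_ineq[of ?p' "t *. (?p - ?p')"] t mult_right_mono[of t 1 "norm (?p - ?p')"] by (simp add: z_def)
   also have "... <= 3 * ((orb_lip + 1) * norm x)" using n[OF l] n[OF l'] norm_triangle_ineq4[of ?p ?p'] by simp
   finally have "slope * norm z <= slope * (3 * ((orb_lip + 1) * norm x))" using slope_pos by (intro mult_left_mono) auto
   hence "norm (grad steps z) <= slope * (3 * ((orb_lip + 1) * norm x))" using grad_near_orb[of 0 z] by simp
   hence "norm (grad steps z) * norm (?p - ?p') <= slope * (3 * ((orb_lip + 1) * norm x)) * (orb_lip * (\<bar>l - l'\<bar> * norm x))"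
    using pp B slope_pos by (intro mult_mono) auto
   moreover have "\<bar>target l x - target l' x\<bar> <= norm (grad steps z) * norm (?p - ?p')"
    using t(3) Cauchy_Schwarz_ineq2[of "grad steps z" "?p - ?p'"] by (simp add: target_def z_def)
   moreover have "slope * (3 * ((orb_lip + 1) * norm x)) * (orb_lip * (\<bar>l - l'\<bar> * norm x)) = (M - 1) * \<bar>l - l'\<bar> * (norm x)^2"
    by (simp add: M_def power2_eq_square)
   moreover have "(M - 1) * \<bar>l - l'\<bar> * (norm x)^2 <= d * (norm x)^2"
   proof (rule mult_right_mono)
    have "(M - 1) * \<bar>l - l'\<bar> <= M * (d / M)" using ll M B slope_pos by (intro mult_mono) (auto simp: M_def)
    thus "(M - 1) * \<bar>l - l'\<bar> <= d" using M by simp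
   qed simp
   ultimately show "\<bar>target l x - target l' x\<bar> <= d * (norm x)^2" by linarith
  qed
 qed
qed

text \<open>\<open>shift 1\<close> is a homeomorphism of the plane carrying one function to the
  other; its inverse \<open>?h\<close> subtracts the orbit polygon and puts the last midpoint
  back.\<close>

lemma target_ends: "hiso {x:plane {..K}. target 1 x < 0} p {x:plane {..K}. action ends x < 0} p"
proof -
 let ?h = "%y. y - orb (coord y K) + tip (coord y K)"
 have P: "shift 1 x : plane {..K}" for x by (simp add: plane_def shift_def orb_def)
 have hP: "?h y : plane {..K}" if "y : plane {..K}" for y using that by (auto simp: plane_def orb_def lookup_single when_def)
 have t: "action ends (shift 1 x) = target 1 x" for x by (simp add: action_ends target_def) (simp add: shift_def)
 have sh: "shift 1 (?h y) = y" if "y : plane {..K}" for y using that by (intro poly_mapping_eqI) (auto simp: shift_def lookup_single when_def plane_def orb_def)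
 have hs: "?h (shift 1 x) = x" if "x : plane {..K}" for x using that by (intro poly_mapping_eqI) (auto simp: shift_def lookup_single when_def plane_def)
 have orb: "continuous_on UNIV orb" using orb_lipschitz L1 by (intro lipschitz_on_continuous_on[of orb_lip] lipschitz_onI) (auto simp: dist_norm orb_lip_def)
 have c: "continuous_on S (%y :: 'a loop. coord y K)" for S by (rule bounded_linear.continuous_on[OF bounded_linear_coord continuous_on_id])
 show ?thesis
 proof (rule hiso_inverse)
  show "continuous_on {x:plane {..K}. target 1 x < 0} (shift 1)" by (rule shift_continuous) simp
  show "continuous_on {x:plane {..K}. action ends x < 0} ?h"
   by (intro continuous_intros bounded_linear.continuous_on[OF bounded_linear_single] continuous_on_compose2[OF orb] c) auto
  show "shift 1 x : {x:plane {..K}. action ends x < 0} & ?h (shift 1 x) = x" if "x : {x:plane {..K}. target 1 x < 0}" for x using that P t hs by simp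
  show "?h y : {x:plane {..K}. target 1 x < 0} & shift 1 (?h y) = y" if "y : {x:plane {..K}. action ends x < 0}" for y using that sh[of y] hP[of y] t[of "?h y"] by simp
 qed
qed

lemma chord_derivative:
 assumes r: "\<bar>r\<bar> <= \<sigma>" and m: "m ~= 0"
 obtains A where "(chord r has_derivative A) (at m)" "!!u v. inner (J (A u)) v = inner (J (A v)) u"
proof -
 obtain B where B: "(base r has_derivative B) (at m)" using base_derivative[OF r m] by blast
 have "chord r = (%m. 2 *. (m - base r m))" by (simp add: base_chord[OF r])
 hence A: "(chord r has_derivative (%v. 2 *. (v - B v))) (at m)" by (simp only:) (intro derivative_intros B)
 have "inner (J (2 *. (u - B u))) v = inner (J (2 *. (v - B v))) u" for u v
  using second_derivative_symmetric[OF gen_gradient[OF r] bounded_linear.has_derivative[OF bounded_linear_J A], of u v] .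
 thus thesis using that A by blast
qed

text \<open>For \<open>q ~= 0\<close> the first \<open>K\<close> midpoints of the orbit polygon are
  nonzero, so their chords are differentiable there; at the zero polygon this may fail.\<close>

lemma fgrad_derivative:
 assumes q: "q ~= 0"
 obtains H where "(fgrad has_derivative H) (at (orb q))" "!!w. H w : plane {..<K}"
  "!!w w'. w : plane {..<K} ==> w' : plane {..<K} ==> inner (H w) w' = inner (H w') w"
proof -
 have nz: "coord (orb q) i ~= 0" if "i < K" for i
 proof
  assume "coord (orb q) i = 0"
  hence "mid (1 / K) (\<psi> (real i / K) q) = mid (1 / K) 0" using that mid_hom[of 0 "1 / K" 0] by (simp add: orb_def)
  hence "\<psi> (real i / K) q = 0" using base_mid[OF steps(2)] by metis
  thus False using q by simp
 qed
 have "EX A. (chord (1 / K) has_derivative A) (at (coord (orb q) i)) & (ALL u v. inner (J (A u)) v = inner (J (A v)) u)" if "i < K" for i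
  using chord_derivative[OF steps(2) nz[OF that]] by metis
 then obtain A where A: "!!i. i < K ==> (chord (1 / K) has_derivative A i) (at (coord (orb q) i))"
  "!!i u v. i < K ==> inner (J (A i u)) v = inner (J (A i v)) u" by metis
 define H where "H w = tuple K (%i. if i < K then - J (edge w i - A i (coord w i)) else 0)" for w
 have "(fgrad has_derivative H) (at (orb q))" unfolding fgrad_def[abs_def] H_def[abs_def] tuple_def
 proof (intro has_derivative_sum bounded_linear.has_derivative[OF bounded_linear_single])
  fix i
  show "((%y. if i < K then - J (defect steps y i) else 0) has_derivative (%w. if i < K then - J (edge w i - A i (coord w i)) else 0)) (at (orb q))"
  proof (cases "i < K")
   case True
   have "((%y. - J (edge y i - chord (1 / K) (coord y i))) has_derivative (%w. - J (edge w i - A i (coord w i)))) (at (orb q))"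
    by (intro has_derivative_minus bounded_linear.has_derivative[OF bounded_linear_J] has_derivative_diff
     bounded_linear_imp_has_derivative[OF bounded_linear_edge]
     has_derivative_compose[OF bounded_linear_imp_has_derivative[OF bounded_linear_coord] A(1)[OF True]])
   thus ?thesis using True by (simp add: defect_def steps_def)
  qed simp
 qed
 moreover have "H w : plane {..<K}" for w by (simp add: H_def plane_def)
 moreover have "inner (H w) w' = inner (H w') w" if w: "w : plane {..<K}" "w' : plane {..<K}" for w w'
 proof -
  have e: "inner (H w) w' = 2 * twist w' w + (SUM i<=K. if i < K then inner (J (A i (coord w i))) (coord w' i) else 0)"
   if w': "w' : plane {..<K}" for w w'
  proof -
   have "inner (if i < K then - J (edge w i - A i (coord w i)) else 0) (coord w' i) =
     2 * inner (J ((1 / 2) *. coord w' i)) (edge w i) + (if i < K then inner (J (A i (coord w i))) (coord w' i) else 0)" for i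
    using w' omega_swap[of "edge w i" "coord w' i"] by (cases "i < K") (simp_all add: plane_def inner_diff_left)
   thus ?thesis unfolding H_def inner_tuple twist_def by (simp only: sum.distrib sum_distrib_left)
  qed
  have "(SUM i<=K. if i < K then inner (J (A i (coord w i))) (coord w' i) else 0) =
    (SUM i<=K. if i < K then inner (J (A i (coord w' i))) (coord w i) else 0)" by (intro sum.cong refl) (use A(2) in auto)
  thus ?thesis unfolding e[OF w(1)] e[OF w(2)] using twist_sym[of w w'] by simp
 qed
 ultimately show thesis using that by blast
qed

lemma bounded_linear_fibre: "bounded_linear fibre" by (rule bounded_linear_intro[of _ 1]) (simp_all add: fibre_linear norm_fibre_le)

text \<open>The fibre part of the action, translated by \<open>a\<close>. \<open>model 0\<close> is
  \<open>target 0\<close> and homogeneous of degree 2; \<open>model (orb q)\<close> has its critical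
  point at an orbit polygon, where a Hessian is available. The difference of the two grows only
  linearly.\<close>

definition model :: "'a loop => 'a loop => real" where
 "model a x = gen s (coord x K) + action steps (a + fibre x)"

definition model_grad :: "'a loop => 'a loop => 'a loop" where
 "model_grad a x = fgrad (a + fibre x) + tip (J (chord s (coord x K)))"

lemma gen_coord_derivative:
 "((%x. gen s (coord x K)) has_derivative (%h. inner (tip (J (chord s (coord x K)))) h)) (at x within S)"
 using has_derivative_compose[OF bounded_linear_imp_has_derivative[OF bounded_linear_coord] gen_gradient[OF s]] by (simp add: inner_single)

lemma model_gradient: "gradient_on S (model a) (model_grad a)" unfolding gradient_on_def
proof
 fix x
 have "((%x. a + fibre x) has_derivative (%h. 0 + fibre h)) (at x within S)"
  by (rule has_derivative_add[OF has_derivative_const bounded_linear_imp_has_derivative[OF bounded_linear_fibre]])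
 from has_derivative_compose[OF this action_gradient[of steps, OF steps(1)]]
 have d: "((%x. action steps (a + fibre x)) has_derivative (%h. inner (grad steps (a + fibre x)) (fibre h))) (at x within S)" by simp
 have "inner (grad steps y) (fibre h) = inner (fgrad y) h" for y h using inner_fibre[OF fibre_plane, of "grad steps y" h] inner_fibre[OF fibre_plane, of h "grad steps y"]
  unfolding fgrad_fibre by (simp add: inner_commute)
 hence "inner (model_grad a x) = (%h. inner (tip (J (chord s (coord x K)))) h + inner (grad steps (a + fibre x)) (fibre h))"
  by (simp add: fun_eq_iff model_grad_def inner_add_left)
 thus "(model a has_derivative inner (model_grad a x)) (at x within S)" using has_derivative_add[OF gen_coord_derivative d] by (simp add: model_def[abs_def])
qed

lemma model_grad_lipschitz: "(slope + 1)-lipschitz_on S (model_grad a)"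
proof (rule lipschitz_onI)
 fix x y
 have "model_grad a x - model_grad a y = (fgrad (a + fibre x) - fgrad (a + fibre y)) + tip (J (chord s (coord x K) - chord s (coord y K)))"
  by (simp add: model_grad_def single_diff)
 hence "norm (model_grad a x - model_grad a y) <= norm (fgrad (a + fibre x) - fgrad (a + fibre y)) + norm (chord s (coord x K) - chord s (coord y K))"
  using norm_triangle_ineq[of "fgrad (a + fibre x) - fgrad (a + fibre y)" "tip (J (chord s (coord x K) - chord s (coord y K)))"] unfolding norm_single norm_J by metis
 moreover have "norm (fgrad (a + fibre x) - fgrad (a + fibre y)) <= slope * norm (x - y)"
 proof -
  have "slope * norm (fibre (x - y)) <= slope * norm (x - y)" using slope_pos norm_fibre_le by (intro mult_left_mono) auto
  thus ?thesis using fgrad_lipschitz[of "a + fibre x" "a + fibre y"] by (simp add: fibre_linear)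
 qed
 moreover have "norm (chord s (coord x K) - chord s (coord y K)) <= norm (x - y)"
  using chord_lip[OF s, of "coord x K" "coord y K"] norm_coord_le[of "x - y" K] norm_ge_zero[of "x - y"] unfolding coord_linear by linarith
 ultimately show "dist (model_grad a x) (model_grad a y) <= (slope + 1) * dist x y" by (simp add: dist_norm distrib_right)
qed (use slope_pos in simp)

lemma norm_tip_lower:
 assumes G: "G : plane {..<K}" "c * norm (fibre x) <= norm G" and x: "x : plane {..K}" and c: "0 < c"
 shows "min c \<rho> * norm x <= norm (G + tip (J (chord s (coord x K))))"
proof (rule power2_le_imp_le)
 have "(min c \<rho> * norm x)^2 = (min c \<rho>)^2 * (norm (fibre x))^2 + (min c \<rho>)^2 * (norm (coord x K))^2"
  using norm_split[OF fibre_plane, of x "coord x K"] plane_split[OF x] by (simp add: power_mult_distrib distrib_left)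
 also have "... <= (c * norm (fibre x))^2 + (\<rho> * norm (coord x K))^2" unfolding power_mult_distrib using c rho by (intro add_mono mult_right_mono power_mono) auto
 also have "... <= (norm G)^2 + (norm (J (chord s (coord x K))))^2" unfolding norm_J using G(2) c rho by (intro add_mono power_mono) auto
 also have "... = (norm (G + tip (J (chord s (coord x K)))))^2" by (rule norm_split[OF G(1), symmetric])
 finally show "(min c \<rho> * norm x)^2 <= (norm (G + tip (J (chord s (coord x K)))))^2" .
qed simp

text \<open>On the segment from 0 to \<open>orb q\<close> all polygons are orbit polygons and hence
  critical.\<close>

lemma action_orb: "action steps (orb q) = 0"
proof -
 obtain t where t: "0 < t" "t < 1" "action steps (orb q) - action steps 0 = inner (grad steps (0 + t *. (orb q - 0))) (orb q - 0)"
  by (rule gradient_on_mvt[OF convex_UNIV action_grad UNIV_I UNIV_I, of "orb q" 0])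
 have "action steps 0 = 0" by (simp add: action_def twist_def gen_def)
 thus ?thesis using t orb_hom[of t q] grad_orb[of "t *. q"] by simp
qed

lemma action_homogeneous: "homogeneous2 (action steps)" using gen_homogeneous[OF steps(1)]
 by (simp add: homogeneous2_def action_def twist_def edge_linear sum_distrib_left distrib_left power2_eq_square ac_simps)

text \<open>\<open>model (orb q)\<close> for one nonzero \<open>q\<close> is near 0 the sum of
  \<open>gen s\<close> and a nondegenerate quadratic form, and at infinity it looks like
  \<open>model 0\<close>. So \<open>hiso_critical_point\<close> evaluates \<open>target 0\<close>,
  from which the family and the shear lead to the action.\<close>

theorem action_end: "EX i. ALL p. hiso {q. gen s q < 0} p {x:plane {..K}. action ends x < 0} (p + int i)"
proof -
 obtain q :: 'a where q: "norm q = 1" using vector_choose_size[of 1] by auto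
 hence "q ~= 0" by auto
 then obtain H where H: "(fgrad has_derivative H) (at (orb q))" "!!w. H w : plane {..<K}"
  "!!w w'. w : plane {..<K} ==> w' : plane {..<K} ==> inner (H w) w' = inner (H w') w" using fgrad_derivative by metis
 have Hl: "bounded_linear H" using H(1) by (rule has_derivative_bounded_linear)
 note lin = bounded_linear.linear[OF Hl]
 have near: "EX e>0. ALL w. norm w <= e --> norm (fgrad (orb q + w) - H w) <= d * norm w" if d: "0 < d" for d
 proof -
  obtain e where e: "0 < e" "!!y. norm (y - orb q) < e ==> norm (fgrad y - fgrad (orb q) - H (y - orb q)) <= d * norm (y - orb q)"
   using H(1) d unfolding has_derivative_at_alt by blast
  have "norm (fgrad (orb q + w) - H w) <= d * norm w" if "norm w <= e / 2" for w using e(2)[of "orb q + w"] e(1) that by (simp add: fgrad_orb)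
  thus ?thesis using e(1) by (intro exI[of _ "e / 2"]) simp
 qed
 \<comment> \<open>After rescaling \<open>w\<close> to the small norm \<open>e\<close>, the
   linearisation error is at most half of the lower bound for \<open>fgrad\<close>.\<close>
 have Hlow: "coer / 2 * norm w <= norm (H w)" if w: "w : plane {..<K}" for w
 proof (cases "w = 0")
  case False
  obtain e where e: "0 < e" "!!w. norm w <= e ==> norm (fgrad (orb q + w) - H w) <= coer / 2 * norm w" using near[of "coer / 2"] coer_pos by auto
  define t where "t = e / norm w"
  have t: "0 < t" "norm (t *. w) = e" using e(1) False by (simp_all add: t_def)
  have "coer * norm (t *. w) <= norm (fgrad (orb q + t *. w))" by (rule fgrad_lower) (use w in \<open>simp add: plane_def\<close>)
  hence "coer / 2 * norm (t *. w) <= norm (H (t *. w))" using e(2)[of "t *. w"] t(2) norm_triangle_ineq2[of "fgrad (orb q + t *. w)" "H (t *. w)"] by simp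
  hence "t * (coer / 2 * norm w) <= t * norm (H w)" using t(1) by (simp add: linear_scale[OF lin] ac_simps)
  thus ?thesis using t(1) by (rule mult_left_le_imp_le)
 qed simp
 \<comment> \<open>Half of the Hessian in the fibre, so that \<open>b x x\<close> is the
   second-order Taylor term.\<close>
 define b where "b x y = inner (H (fibre x)) ((1 / 2) *. fibre y)" for x y
 have bb: "bounded_bilinear b" unfolding b_def[abs_def] by (rule bounded_bilinear.comp[OF bounded_bilinear_inner bounded_linear_compose[OF Hl bounded_linear_fibre]
    bounded_linear_compose[OF bounded_linear_scaleR_right bounded_linear_fibre]])
 have bsym: "b x y = b y x" for x y using H(3)[OF fibre_plane fibre_plane] by (simp add: b_def)
 let ?f = "%x. gen s (coord x K)" and ?T = "plane {..K} :: 'a loop set" and ?W = "plane {..<K} :: 'a loop set"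
 have hf: "homogeneous2 ?f" using gen_homogeneous[OF s] by (simp add: homogeneous2_def)
 have m0: "model 0 = target 0" by (simp add: fun_eq_iff model_def target_def shift_def)
 have crit: "hiso {x:?T. ?f x + b x x < 0} p {x:?T. model 0 x < 0} p" for p
 proof (rule hiso_critical_point[OF subspace_plane])
  show "gradient_on ?T (model (orb q)) (model_grad (orb q))" "gradient_on ?T (model 0) (model_grad 0)" by (rule model_gradient)+
  show "(slope + 1)-lipschitz_on ?T (model_grad (orb q))" "(slope + 1)-lipschitz_on ?T (model_grad 0)" by (rule model_grad_lipschitz)+
  have f0: "fibre 0 = 0" by (intro poly_mapping_eqI) simp
  show "model (orb q) 0 = 0" using action_orb s by (simp add: model_def f0 gen_def)
  show "model_grad (orb q) 0 = 0" "model_grad 0 0 = 0" using fgrad_orb[of q] fgrad_orb[of 0] s by (simp_all add: model_grad_def f0)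
  show "model_grad a x : ?T" for a x using fibre_plane[of "grad steps (a + fibre x)"] by (auto simp: model_grad_def fgrad_def plane_def lookup_single when_def)
  thus "model_grad 0 x : ?T" for x .
  show "min coer \<rho> * norm x <= norm (model_grad (orb q) x)" if "x : ?T" for x
   unfolding model_grad_def by (rule norm_tip_lower[OF _ fgrad_lower[OF fibre_plane] that coer_pos]) (simp add: fgrad_fibre fibre_plane)
  show "min coer \<rho> * norm x <= norm (model_grad 0 x)" if "x : ?T" for x unfolding model_grad_def using fgrad_lower[OF fibre_plane, of x 0]
   by (intro norm_tip_lower[OF _ _ that coer_pos]) (simp_all add: fgrad_fibre fibre_plane)
  show "homogeneous2 (model 0)" using hf action_homogeneous by (simp add: homogeneous2_def model_def fibre_linear distrib_left)
  show "homogeneous2 (%x. ?f x + b x x)" using hf by (simp add: homogeneous2_def b_def fibre_linear linear_scale[OF lin] power2_eq_square algebra_simps)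
  show "0 < min coer \<rho>" using coer_pos rho by simp
  show "norm (model_grad (orb q) x - model_grad 0 x) <= slope * norm (orb q)" for x using fgrad_lipschitz[of "orb q + fibre x" "fibre x"] by (simp add: model_grad_def)
  show "gradient_on ?T (%x. ?f x + b x x) (%x. H (fibre x) + tip (J (chord s (coord x K))))" unfolding gradient_on_def
  proof
   fix x
   have d: "((%x. b x x) has_derivative (%h. b x h + b h x)) (at x within ?T)" using bounded_bilinear.FDERIV[OF bb has_derivative_ident has_derivative_ident] .
   have "b x h + b h x = inner (H (fibre x)) h" for h using bsym[of h x] inner_fibre[OF H(2), of h "fibre x"] by (simp add: b_def inner_commute)
   hence "inner (H (fibre x) + tip (J (chord s (coord x K)))) = (%h. inner (tip (J (chord s (coord x K)))) h + (b x h + b h x))" by (simp add: fun_eq_iff inner_add_left)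
   thus "((%x. ?f x + b x x) has_derivative inner (H (fibre x) + tip (J (chord s (coord x K))))) (at x within ?T)"
    using has_derivative_add[OF gen_coord_derivative d] by simp
  qed
  fix d :: real assume "0 < d"
  from near[OF this] obtain e where e: "0 < e" "!!w. norm w <= e ==> norm (fgrad (orb q + w) - H w) <= d * norm w" by blast
  have "norm (model_grad (orb q) x - (H (fibre x) + tip (J (chord s (coord x K))))) <= d * norm x" if "norm x <= e" for x
  proof -
   have "norm (fgrad (orb q + fibre x) - H (fibre x)) <= d * norm (fibre x)" using e(2) norm_fibre_le[of x] that by simp
   also have "... <= d * norm x" using norm_fibre_le[of x] \<open>0 < d\<close> by (intro mult_left_mono) auto
   finally show ?thesis by (simp add: model_grad_def)
  qed
  thus "EX e>0. ALL x:?T. norm x <= e --> norm (model_grad (orb q) x - (H (fibre x) + tip (J (chord s (coord x K))))) <= d * norm x" using e(1) by blast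
 qed
 obtain B :: "'a loop set" where B: "finite B" "independent B" "span B = ?W" using plane_basis by blast
 have f: "continuous_on UNIV ?f" by (rule has_derivative_continuous_on) (rule gen_coord_derivative)
 have ker: "fibre x = 0" if "!!w. w : ?W ==> b x w = 0" for x
 proof -
  have "b x (H (fibre x)) = 0" using that H(2) by blast
  hence "H (fibre x) = 0" by (simp add: b_def fibre_id[OF H(2)])
  thus ?thesis using Hlow[OF fibre_plane, of x] coer_pos by (simp add: mult_le_0_iff)
 qed
 have "EX i. (ALL p. hiso {x:?T. ?f x < 0 & (ALL w:?W. b x w = 0)} p {x:?T. ?f x + b x x < 0} (p + int i)) &
   ((ALL w:?W. b w w <= 0) --> i = card B)"
 proof (rule hiso_add_quadratic[OF bb bsym f hf subspace_plane subspace_plane _ B refl])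
  show "?W <= ?T" by (auto simp: plane_def)
  show "?f (x + w) = ?f x" if "w : ?W" for x w using that by (simp add: plane_def)
  show "w = 0" if "w : ?W" "!!w'. w' : ?W ==> b w w' = 0" for w using ker[OF that(2)] fibre_id[OF that(1)] by simp
  show "b x x = 0" if "!!w. w : ?W ==> b x w = 0" for x using ker[OF that] by (simp add: b_def)
 qed
 then obtain i where i: "ALL p. hiso {x:?T. ?f x < 0 & (ALL w:?W. b x w = 0)} p {x:?T. ?f x + b x x < 0} (p + int i)" by (elim exE conjE)
 let ?Z = "{x:?T. ?f x < 0 & (ALL w:?W. b x w = 0)}"
 have 1: "hiso {q. gen s q < 0} p ?Z p" for p
 proof (rule hiso_inverse)
  show "continuous_on {q. gen s q < 0} (%v. tip v)" by (rule bounded_linear.continuous_on[OF bounded_linear_single continuous_on_id])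
  show "continuous_on ?Z (%x. coord x K)" by (rule bounded_linear.continuous_on[OF bounded_linear_coord continuous_on_id])
  show "tip q : ?Z & coord (tip q) K = q" if "q : {q. gen s q < 0}" for q using that linear_0[OF lin] by (auto simp: b_def plane_def lookup_single when_def)
  show "coord x K : {q. gen s q < 0} & tip (coord x K) = x" if x: "x : ?Z" for x
  proof -
   have "fibre x = 0" using x by (intro ker) auto
   thus ?thesis using plane_split[of x] x by simp
  qed
 qed
 show ?thesis
 proof (intro exI allI)
  fix p
  have "hiso {q. gen s q < 0} p {x:?T. ?f x + b x x < 0} (p + int i)" using hiso_trans[OF 1 i[rule_format, of p]] .
  from hiso_trans[OF this crit[of "p + int i", unfolded m0]]
  have "hiso {q. gen s q < 0} p {x:?T. target 0 x < 0} (p + int i)" .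
  from hiso_trans[OF hiso_trans[OF this target_family] target_ends]
  show "hiso {q. gen s q < 0} p {x:plane {..K}. action ends x < 0} (p + int i)" .
 qed
qed

end

section \<open>From the positive to the negative cone\<close>

context short_flow
begin

text \<open>The chord is a displacement of the flow, bounded below by the fixed point gap, and the
  base point has at least half the norm of the midpoint.\<close>

lemma chord_lower:
 assumes e: "0 < \<epsilon>" "\<epsilon> <= 1 / 2" "\<epsilon> <= \<sigma>"
 obtains \<rho> where "0 < \<rho>" "!!q. \<rho> * norm q <= norm (chord (- \<epsilon>) q)"
proof -
 obtain c where c: "0 < c" "!!t u. \<epsilon> <= t ==> t <= 1 - \<epsilon> ==> c * norm u <= norm (\<psi> t u - u)" using fixed_point_gap[OF e(1)] by blast
 have s: "\<bar>\<epsilon>\<bar> <= \<sigma>" using e by simp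
 show thesis
 proof (rule that[of "c / 2"])
  fix q
  let ?z = "base \<epsilon> q"
  have "q = ?z + (1 / 2) *. (\<psi> \<epsilon> ?z - ?z)" using mid_base[OF s, of q] by (simp add: mid_def)
  hence "norm q <= norm ?z + 1 / 2 * norm (\<psi> \<epsilon> ?z - ?z)" by (metis norm_scaleR norm_triangle_ineq abs_of_nonneg zero_le_divide_1_iff zero_le_numeral)
  also have "... <= 2 * norm ?z"
  proof -
   have "norm (\<psi> \<epsilon> ?z - ?z) <= 1 / 2 * norm ?z" using step_lip[OF s, of ?z 0] by simp
   thus ?thesis using norm_ge_zero[of ?z] by linarith
  qed
  finally have "c / 2 * norm q <= c * norm ?z" using mult_left_mono[of "norm q" "2 * norm ?z" "c / 2"] c(1) by simp
  also have "... <= norm (\<psi> \<epsilon> ?z - ?z)" using e by (intro c(2)) auto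
  finally show "c / 2 * norm q <= norm (chord (- \<epsilon>) q)" unfolding chord_neg[OF s] norm_minus_cancel unfolding chord_def .
 qed (use c in simp)
qed

theorem positive_negative: "EX d::int. ALL p. hiso {x. ham x > 0} p {x. ham x < 0} (p + d)"
proof -
 obtain e0 where e0: "0 < e0" "e0 <= \<sigma>" "!!s p. 0 < s ==> s <= e0 ==> hiso {x. gen s x < 0} p {x. ham x > 0} p"
  "!!s p. 0 < s ==> s <= e0 ==> hiso {x. gen (- s) x < 0} p {x. ham x < 0} p" using gen_sublevels by blast
 define \<epsilon> where "\<epsilon> = min e0 (1 / 4)"
 have e: "0 < \<epsilon>" "\<epsilon> <= e0" "\<epsilon> <= \<sigma>" "\<epsilon> <= 1 / 4" "\<epsilon> <= 1 / 2" using e0(1,2) by (auto simp: \<epsilon>_def)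
 obtain \<rho> where rho: "0 < \<rho>" "!!q. \<rho> * norm q <= norm (chord (- \<epsilon>) q)" using chord_lower[OF e(1,5,3)] by blast
 obtain c where c: "0 < c" "!!t u. \<epsilon> <= t ==> t <= 1 - \<epsilon> ==> c * norm u <= norm (\<psi> t u - u)" using fixed_point_gap[OF e(1)] by blast
 obtain n :: nat where n: "1 / \<sigma> < real n" using reals_Archimedean2 by blast
 \<comment> \<open>Even, as the recovery of the vertices demands, and at least
   \<open>1 / \<sigma>\<close>.\<close>
 define K where "K = 2 * n"
 have "0 < real n" using n sigma by (meson less_trans zero_less_divide_1_iff)
 hence K: "even K" "0 < K" by (simp_all add: K_def)
 have "1 / \<sigma> <= real K" using n \<open>0 < real n\<close> by (simp add: K_def)
 hence K\<sigma>: "1 / real K <= \<sigma>" using sigma K by (simp add: field_simps)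
 interpret fibred J \<psi> D Y \<sigma> L K "- \<epsilon>" \<rho> by unfold_locales (use K K\<sigma> e rho in auto)
 \<comment> \<open>The first \<open>K\<close> steps grow to \<open>1 / K\<close> while the last one
   runs from \<open>\<epsilon>\<close> to \<open>- \<epsilon>\<close>. The total time is
   \<open>\<epsilon> + (1 - 2 * \<epsilon>) * l\<close> and stays where
   \<open>fixed_point_gap\<close> applies.\<close>
 define S where "S l i = (if i < K then l / real K else \<epsilon> - 2 * \<epsilon> * l)" for l i
 have path: "hiso {x:plane {..K}. action (S 0) x < 0} p {x:plane {..K}. action (S 1) x < 0} p" for p
 proof (rule action_path)
  fix l :: real and i assume l: "0 <= l" "l <= 1"
  have a: "\<bar>l / real K\<bar> <= \<sigma>" using l K\<sigma> K divide_right_mono[of l 1 "real K"] by simp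
  have "2 * \<epsilon> * l <= 2 * \<epsilon> * 1" "0 <= 2 * \<epsilon> * l" using l e by (auto intro: mult_left_mono)
  hence "\<bar>\<epsilon> - 2 * \<epsilon> * l\<bar> <= \<sigma>" using e by (intro abs_leI) linarith+
  thus "\<bar>S l i\<bar> <= \<sigma>" using a by (simp add: S_def)
  fix l' :: real
  have "\<bar>l / real K - l' / real K\<bar> = \<bar>l - l'\<bar> / real K" by (simp flip: diff_divide_distrib)
  also have "... <= \<bar>l - l'\<bar> / 1" using K by (intro divide_left_mono) auto
  finally have "\<bar>l / real K - l' / real K\<bar> <= \<bar>l - l'\<bar>" by simp
  moreover have "\<bar>(\<epsilon> - 2 * \<epsilon> * l) - (\<epsilon> - 2 * \<epsilon> * l')\<bar> <= 1 * \<bar>l - l'\<bar>"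
  proof -
   have "(\<epsilon> - 2 * \<epsilon> * l) - (\<epsilon> - 2 * \<epsilon> * l') = - (2 * \<epsilon>) * (l - l')" by (simp add: algebra_simps)
   hence "\<bar>(\<epsilon> - 2 * \<epsilon> * l) - (\<epsilon> - 2 * \<epsilon> * l')\<bar> = (2 * \<epsilon>) * \<bar>l - l'\<bar>" using e by (simp add: abs_mult)
   also have "... <= 1 * \<bar>l - l'\<bar>" using e by (intro mult_right_mono) auto
   finally show ?thesis .
  qed
  ultimately show "\<bar>S l i - S l' i\<bar> <= \<bar>l - l'\<bar>" by (simp add: S_def)
 next
  fix l :: real and u assume l: "0 <= l" "l <= 1"
  have "{..K} = insert K {..<K}" by auto
  hence sum: "(SUM i<=K. S l i) = l + (\<epsilon> - 2 * \<epsilon> * l)" using K by (simp add: S_def)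
  have "0 <= (1 - 2 * \<epsilon>) * l" "(1 - 2 * \<epsilon>) * l <= (1 - 2 * \<epsilon>) * 1" using l e by (auto intro: mult_left_mono)
  thus "c * norm u <= norm (\<psi> (SUM i<=K. S l i) u - u)" unfolding sum by (intro c(2)) (simp_all add: algebra_simps)
 qed (rule c(1))
 have "action (S 0) = action (%i. if i = K then \<epsilon> else 0)" unfolding action_def S_def by (intro ext arg_cong2[of _ _ _ _ "(+)"] sum.cong refl) auto
 moreover have "action (S 1) = action ends"
 proof -
  have eq: "\<epsilon> - 2 * \<epsilon> * 1 = - \<epsilon>" by simp
  show ?thesis unfolding S_def[abs_def] ends_def[abs_def] eq ..
 qed
 ultimately have path': "hiso {x:plane {..K}. action (%i. if i = K then \<epsilon> else 0) x < 0} p {x:plane {..K}. action ends x < 0} p" for p using path by simp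
 obtain i where i: "ALL p. hiso {q. gen \<epsilon> q < 0} p {x:plane {..K}. action (%i. if i = K then \<epsilon> else 0) x < 0} (p + int i)"
  using action_start[of \<epsilon>] e by auto
 obtain j where j: "ALL p. hiso {q. gen (- \<epsilon>) q < 0} p {x:plane {..K}. action ends x < 0} (p + int j)" using action_end by blast
 show ?thesis
 \<comment> \<open>\<open>i\<close> and \<open>j\<close> are the indices of the quadratic forms at
   the two ends of the path.\<close>
 proof (intro exI[of _ "int i - int j"] allI)
  fix p
  have a: "hiso {x. ham x > 0} p {x:plane {..K}. action ends x < 0} (p + int i)"
   by (rule hiso_trans[OF hiso_trans[OF hiso_sym[OF e0(3)[OF e(1,2)]] i[rule_format]] path'])
  have b: "hiso {x. ham x < 0} (p + (int i - int j)) {x:plane {..K}. action ends x < 0} (p + int i)"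
   using hiso_trans[OF hiso_sym[OF e0(4)[OF e(1,2)]] j[rule_format, of "p + (int i - int j)"]] by simp
  show "hiso {x. ham x > 0} p {x. ham x < 0} (p + (int i - int j))" by (rule hiso_trans[OF a hiso_sym[OF b]])
 qed
qed

end

context symplectic_flow
begin

lemma short_flow: obtains \<sigma> L where "short_flow J \<psi> D Y \<sigma> L"
proof -
 obtain \<sigma> where "0 < \<sigma>" "!!t x v. \<bar>t\<bar> <= \<sigma> ==> x ~= 0 ==> norm (D t x v - v) <= 1 / 2 * norm v" using D_near_id[of "1 / 2"] by auto
 moreover obtain L where "1 <= L" "!!t x y. norm (\<psi> t x - \<psi> t y) <= L * norm (x - y)" using psi_lipschitz by blast
 ultimately have "short_flow J \<psi> D Y \<sigma> L" by unfold_locales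
 thus thesis by (rule that)
qed

end

section \<open>Continuously differentiable maps\<close>

abbreviation C1_on :: "'a set => ('a::real_normed_vector => 'b::real_normed_vector) => bool" where
 "C1_on \<equiv> C_k_on (Suc 0)"

lemma C1_onI:
 assumes "!!x. x : U ==> (f has_derivative f' x) (at x)" "!!v. continuous_on U (%x. f' x v)"
 shows "C1_on U f"
proof -
 have "frechet_derivative f (at x) = f' x" if "x : U" for x using frechet_derivative_at[OF assms(1)[OF that]] by simp
 hence "continuous_on U (%x. frechet_derivative f (at x) v)" for v using assms(2)[of v] by (simp cong: continuous_on_cong)
 thus ?thesis using assms(1) by (auto simp: differentiable_def)
qed

lemma C1_onD:
 assumes "C1_on U f" "x : U" shows "(f has_derivative frechet_derivative f (at x)) (at x)"
proof -
 have "f differentiable (at x)" using assms by simp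
 thus ?thesis by (rule frechet_derivative_works[THEN iffD1])
qed

lemma C1_on_continuous: "C1_on U f ==> continuous_on U f" by (intro continuous_at_imp_continuous_on ballI) (rule has_derivative_continuous[OF C1_onD])

lemma C1_on_cong:
 assumes "C1_on W g" "open W" "!!x. x : W ==> f x = g x" shows "C1_on W f"
proof (rule C1_onI)
 fix x assume x: "x : W"
 show "(f has_derivative frechet_derivative g (at x)) (at x)" by (rule has_derivative_transform_within_open[OF C1_onD[OF assms(1) x] assms(2) x]) (simp add: assms(3))
qed (use assms(1) in simp)

lemma C1_on_local:
 assumes "!!x. x : S ==> EX W. open W & x : W & C1_on W f" shows "C1_on S f"
proof -
 have "f differentiable (at x) & isCont (%x. frechet_derivative f (at x) v) x" if x: "x : S" for x v
 proof -
  obtain W where "open W" "x : W" "C1_on W f" using assms[OF x] by blast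
  thus ?thesis by (auto simp: continuous_on_eq_continuous_at)
 qed
 thus ?thesis by (auto intro: continuous_at_imp_continuous_on)
qed

text \<open>Expansion in the basis reduces joint continuity to continuity for each fixed direction,
  which is the form that \<open>C_k_on\<close> records.\<close>

lemma continuous_on_derivative_apply:
 fixes w :: "'c::topological_space => 'a::euclidean_space"
 assumes lin: "!!x. x : S ==> linear (A x)" and A: "!!v. continuous_on S (%x. A x v)" and w: "continuous_on S w"
 shows "continuous_on S (%x. A x (w x) :: 'b::real_normed_vector)"
proof -
 have "A x (w x) = (SUM b:Basis. inner (w x) b *. A x b)" if "x : S" for x
  using linear_sum[OF lin[OF that], of "%b. inner (w x) b *. b" Basis] linear_scale[OF lin[OF that]] by (simp add: euclidean_representation)
 moreover have "continuous_on S (%x. SUM b:Basis. inner (w x) b *. A x b)" by (intro continuous_intros w A)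
 ultimately show ?thesis by (simp cong: continuous_on_cong)
qed

lemma C1_on_compose:
 fixes g :: "'c::real_normed_vector => 'a::euclidean_space" and f :: "'a => 'b::real_normed_vector"
 assumes f: "C1_on U f" and g: "C1_on W g" and gW: "g ` W <= U"
 shows "C1_on W (%x. f (g x))"
proof (rule C1_onI)
 fix x assume x: "x : W"
 show "((%x. f (g x)) has_derivative (%v. frechet_derivative f (at (g x)) (frechet_derivative g (at x) v))) (at x)"
  by (rule has_derivative_compose[OF C1_onD[OF g x] C1_onD[OF f]]) (use gW x in blast)
next
 fix v
 show "continuous_on W (%x. frechet_derivative f (at (g x)) (frechet_derivative g (at x) v))"
 proof (rule continuous_on_derivative_apply)
  show "linear (frechet_derivative f (at (g x)))" if "x : W" for x by (rule has_derivative_linear[OF C1_onD[OF f]]) (use gW that in blast)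
  show "continuous_on W (%x. frechet_derivative f (at (g x)) v)" for v using f by (intro continuous_on_compose2[OF _ C1_on_continuous[OF g] gW]) simp
 qed (use g in simp)
qed

lemma C1_on_linear: "bounded_linear f ==> C1_on U f" by (rule C1_onI[of _ _ "%_. f"]) (rule bounded_linear_imp_has_derivative, assumption, rule continuous_on_const)

lemma C1_on_bilinear:
 assumes b: "bounded_bilinear b" and f: "C1_on U f" and g: "C1_on U g"
 shows "C1_on U (%x. b (f x) (g x))"
proof (rule C1_onI)
 fix x assume x: "x : U"
 show "((%x. b (f x) (g x)) has_derivative (%h. b (f x) (frechet_derivative g (at x) h) + b (frechet_derivative f (at x) h) (g x))) (at x)"
  by (rule bounded_bilinear.FDERIV[OF b C1_onD[OF f x] C1_onD[OF g x]])
next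
 fix v
 show "continuous_on U (%x. b (f x) (frechet_derivative g (at x) v) + b (frechet_derivative f (at x) v) (g x))" using f g C1_on_continuous[OF f] C1_on_continuous[OF g]
  by (intro continuous_on_add bounded_bilinear.continuous_on[OF b]) auto
qed

lemma C1_on_Pair:
 assumes f: "C1_on U f" and g: "C1_on U g" shows "C1_on U (%x. (f x, g x))"
proof (rule C1_onI)
 show "((%x. (f x, g x)) has_derivative (%v. (frechet_derivative f (at x) v, frechet_derivative g (at x) v))) (at x)" if "x : U" for x
  by (rule has_derivative_Pair[OF C1_onD[OF f that] C1_onD[OF g that]])
 show "continuous_on U (%x. (frechet_derivative f (at x) v, frechet_derivative g (at x) v))" for v by (intro continuous_on_Pair) (use f g in simp_all)
qed

lemma C1_on_sum:
 assumes "!!i. i : I ==> C1_on U (f i)" shows "C1_on U (%x. SUM i:I. f i x)"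
proof (rule C1_onI)
 show "((%x. SUM i:I. f i x) has_derivative (%v. SUM i:I. frechet_derivative (f i) (at x) v)) (at x)" if "x : U" for x by (intro has_derivative_sum C1_onD[OF assms that])
 show "continuous_on U (%x. SUM i:I. frechet_derivative (f i) (at x) v)" for v by (intro continuous_on_sum) (use assms in simp)
qed

definition rsqrt :: "real => real" where "rsqrt r = inverse (sqrt r)"

lemma C1_on_rsqrt: "C1_on {0<..} rsqrt"
proof (rule C1_onI)
 fix r :: real assume r: "r : {0<..}"
 show "(rsqrt has_derivative (%h. - (inverse (sqrt r) * (inverse (sqrt r) / 2) * inverse (sqrt r)) * h)) (at r)" unfolding rsqrt_def[abs_def] using r
  by (auto intro!: derivative_eq_intros simp: has_field_derivative_def[symmetric] field_simps)
next
 show "continuous_on {0<..} (%r. - (inverse (sqrt r) * (inverse (sqrt r) / 2) * inverse (sqrt r)) * h)" for h by (intro continuous_intros) auto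
qed

lemma rsqrt: "0 < r ==> 0 < rsqrt r" "rsqrt 1 = 1" "rsqrt (x * y) = rsqrt x * rsqrt y" "0 < r ==> (rsqrt r)^2 * r = 1"
proof -
 show "(rsqrt r)^2 * r = 1" if "0 < r"
 proof -
  have "sqrt r * sqrt r = r" "sqrt r ~= 0" using that by simp_all
  thus ?thesis unfolding rsqrt_def power2_eq_square by (metis mult.assoc mult.commute mult_1 left_inverse)
 qed
qed (simp_all add: rsqrt_def real_sqrt_mult)

lemma rsqrt_norm: "rsqrt (inner x x) = inverse (norm x)" by (simp add: rsqrt_def norm_eq_sqrt_inner)

lemma C1_on_subset: "C1_on U f ==> W <= U ==> C1_on W f" using continuous_on_subset by (simp add: subset_iff) blast

lemma C2_onD:
 assumes "C_k_on (Suc (Suc 0)) U f"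
 shows "x : U ==> f differentiable (at x)" "C1_on U (%x. frechet_derivative f (at x) v)" using assms unfolding C_k_on.simps(2)[of "Suc 0"] by blast+

lemma C2_on_C1_on: "C_k_on (Suc (Suc 0)) U f ==> C1_on U f" using C1_on_continuous[OF C2_onD(2)] C2_onD(1) by (metis C_k_on.simps)

definition Jc :: "C2 => C2" where "Jc z = (\<i> * fst z, \<i> * snd z)"

lemma Jc: "linear Jc" "Jc (Jc x) = - x" "inner (Jc x) (Jc y) = inner x y" "inner x (Jc x) = 0" "inner (Jc x) x = 0"
 by (auto simp: Jc_def linear_iff inner_prod_def inner_complex_def algebra_simps scaleR_conv_of_real prod_eq_iff)

lemma bounded_linear_Jc: "bounded_linear Jc" using Jc(1) by (rule linear_conv_bounded_linear[THEN iffD1])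

definition unit :: "'a::real_inner => 'a" where "unit x = rsqrt (inner x x) *. x"

lemma norm_unit: "x ~= 0 ==> norm (unit x) = 1" by (simp add: unit_def rsqrt_norm)

lemma unit_scale: "0 < c ==> unit (c *. x) = unit x" unfolding unit_def rsqrt_norm by simp

lemma unit_sphere: "norm x = 1 ==> unit x = x" by (simp add: unit_def rsqrt_norm)

lemma C1_on_rsqrt_compose: "C1_on U f ==> (!!x. x : U ==> 0 < f x) ==> C1_on U (%x. rsqrt (f x))" by (rule C1_on_compose[OF C1_on_rsqrt]) auto

lemma unit_derivative:
 assumes x: "x ~= (0 :: 'a::euclidean_space)"
 shows "EX A. (unit has_derivative A) (at x) & (ALL v. inner x v = 0 --> A v = rsqrt (inner x x) *. v)"
proof -
 let ?R = "frechet_derivative rsqrt (at (inner x x))"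
 have R: "(rsqrt has_derivative ?R) (at (inner x x))" by (rule C1_onD[OF C1_on_rsqrt]) (use x in simp)
 have "((%x. rsqrt (inner x x)) has_derivative (%h. ?R (inner x h + inner h x))) (at x)"
  by (rule has_derivative_compose[OF has_derivative_inner[OF has_derivative_ident has_derivative_ident] R])
 from has_derivative_scaleR[OF this has_derivative_ident]
 have "(unit has_derivative (%h. rsqrt (inner x x) *. h + ?R (inner x h + inner h x) *. x)) (at x)" by (simp add: unit_def[abs_def])
 moreover have "?R 0 = 0" using linear_0[OF has_derivative_linear[OF R]] .
 ultimately show ?thesis by (intro exI[of _ "%h. rsqrt (inner x x) *. h + ?R (inner x h + inner h x) *. x"]) (simp add: inner_commute)
qed

section \<open>The homogeneous lift of a contact flow\<close>

locale contact_flow =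
 fixes \<phi> :: "real => C2 => C2"
 assumes action: "contact_circle_action \<phi>" and free: "free_circle_action \<phi>"
begin

abbreviation "\<Omega> \<equiv> (UNIV :: real set) \<times> (- {0 :: C2})"

lemma phi: "smooth_map_on (UNIV \<times> S3) (%(t, z). \<phi> t z)" "z : S3 ==> \<phi> 0 z = z" "z : S3 ==> \<phi> (s + t) z = \<phi> s (\<phi> t z)"
 "z : S3 ==> \<phi> 1 z = z" "z : S3 ==> \<phi> t z : S3"
 "z : S3 ==> frechet_derivative (\<phi> t) (at z within S3) ` std_contact_plane z = std_contact_plane (\<phi> t z)"
proof -
 have a: "bij_betw (\<phi> t) S3 S3" "ALL z:S3. frechet_derivative (\<phi> t) (at z within S3) ` std_contact_plane z = std_contact_plane (\<phi> t z)" for t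
  using action unfolding contact_circle_action_def contactomorphism_def by blast+
 show "z : S3 ==> \<phi> t z : S3" using bij_betwE[OF a(1)] by blast
 show "z : S3 ==> frechet_derivative (\<phi> t) (at z within S3) ` std_contact_plane z = std_contact_plane (\<phi> t z)" using a(2) by blast
qed (use action in \<open>simp_all add: contact_circle_action_def\<close>)

definition \<Phi> :: "real \<times> C2 => C2" where "\<Phi> p = \<phi> (fst p) (unit (snd p))"

definition nu :: "real \<times> C2 => real \<times> C2" where "nu p = (fst p, unit (snd p))"

definition d\<Phi> :: "real \<times> C2 => C2 => C2" where
 "d\<Phi> p v = frechet_derivative \<Phi> (at p) (0, v)"

definition twirl :: "real \<times> C2 => C2" where "twirl p = d\<Phi> p (Jc (snd p))"

text \<open>\<open>Jc x\<close> is the Reeb direction, on which the contact form is 1 along the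
  sphere; so this is the factor by which \<open>\<phi> t\<close> rescales the contact form.\<close>

definition factor :: "real \<times> C2 => real" where "factor p = inner (Jc (\<Phi> p)) (twirl p)"

lemma open_\<Omega>: "open \<Omega>" by (intro open_Times) auto

lemma norm_\<Phi>: "x ~= 0 ==> norm (\<Phi> (t, x)) = 1" using phi(5)[of "unit x" t] norm_unit[of x] by (simp add: \<Phi>_def)

lemma \<Phi>_scale: "0 < c ==> \<Phi> (t, c *. x) = \<Phi> (t, x)" by (simp add: \<Phi>_def unit_scale)

lemma \<Phi>_add: "x ~= 0 ==> \<Phi> (s + t, x) = \<Phi> (s, \<Phi> (t, x))" using norm_unit[of x] phi(5)[of "unit x" t] by (simp add: \<Phi>_def phi(3) unit_sphere)

lemma C1_snd: "C1_on U (%p :: real \<times> C2. snd p)" by (rule C1_on_linear[OF bounded_linear_snd])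

lemma C1_norm2: "C1_on U (%p :: real \<times> C2. inner (snd p) (snd p))" by (rule C1_on_bilinear[OF bounded_bilinear_inner C1_snd C1_snd])

lemma C1_rnorm: "C1_on \<Omega> (%p. rsqrt (inner (snd p) (snd p)))" by (rule C1_on_rsqrt_compose[OF C1_norm2]) auto

lemma C1_nu: "C1_on \<Omega> nu" unfolding nu_def[abs_def] unit_def
 by (intro C1_on_Pair C1_on_linear[OF bounded_linear_fst] C1_on_bilinear[OF bounded_bilinear_scaleR C1_rnorm C1_snd])

text \<open>Smoothness on the sphere is given through local extensions \<open>G\<close>; composing
  with the normalisation \<open>nu\<close> passes their regularity on to \<open>\<Phi>\<close>.
  Order 2 is kept because \<open>twirl\<close> already contains one derivative.\<close>

lemma local_extension:
 assumes "p : \<Omega>"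
 shows "EX W U G. open W & p : W & W <= \<Omega> & C_k_on (Suc (Suc 0)) U G & nu ` W <= U & (ALL q:W. \<Phi> q = G (nu q))"
proof -
 have nuS: "nu q : UNIV \<times> S3" if "q : \<Omega>" for q using norm_unit[of "snd q"] that by (simp add: nu_def mem_Times_iff)
 obtain U G where U: "open U" "nu p : U" "!!n. C_k_on n U G" "!!y. y : (UNIV \<times> S3) Int U ==> G y = (case y of (t, z) => \<phi> t z)"
  using phi(1) nuS[OF assms] unfolding smooth_map_on_def by metis
 have "open (\<Omega> Int nu -` U)" by (rule continuous_open_preimage[OF C1_on_continuous[OF C1_nu] open_\<Omega> U(1)])
 moreover have "\<Phi> q = G (nu q)" if "q : \<Omega> Int nu -` U" for q using U(4)[of "nu q"] nuS[of q] that by (simp add: nu_def \<Phi>_def)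
 ultimately show ?thesis using assms U(2,3) by (intro exI[of _ "\<Omega> Int nu -` U"] exI[of _ U] exI[of _ G] conjI ballI) auto
qed

lemma C1_\<Phi>: "C1_on \<Omega> \<Phi>"
proof (rule C1_on_local)
 fix p assume "p : \<Omega>"
 from local_extension[OF this] obtain W U G where W: "open W" "p : W" "W <= \<Omega>" "C_k_on (Suc (Suc 0)) U G" "nu ` W <= U"
  and "ALL q:W. \<Phi> q = G (nu q)" by (elim exE conjE)
 hence W6: "!!q. q : W ==> \<Phi> q = G (nu q)" by blast
 have "C1_on W nu" using C1_nu W(3) by (rule C1_on_subset)
 with C2_on_C1_on[OF W(4)] have "C1_on W (%q. G (nu q))" using W(5) by (rule C1_on_compose)
 hence "C1_on W \<Phi>" by (rule C1_on_cong[OF _ W(1) W6])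
 thus "EX W. open W & p : W & C1_on W \<Phi>" using W(1,2) by (intro exI[of _ W] conjI)
qed

lemma d\<Phi>: "x ~= 0 ==> ((%x. \<Phi> (t, x)) has_derivative d\<Phi> (t, x)) (at x)"
proof -
 assume "x ~= 0"
 hence "(\<Phi> has_derivative frechet_derivative \<Phi> (at (t, x))) (at (t, x))" by (intro C1_onD[OF C1_\<Phi>]) simp
 moreover have "((%x. (t, x)) has_derivative (%v. (0, v))) (at x)" by (intro has_derivative_Pair has_derivative_const has_derivative_ident)
 ultimately show ?thesis unfolding d\<Phi>_def[abs_def] by (rule has_derivative_compose[rotated])
qed

lemma d\<Phi>_unique: "x ~= 0 ==> ((%x. \<Phi> (t, x)) has_derivative A) (at x) ==> d\<Phi> (t, x) = A" using has_derivative_unique d\<Phi> by blast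

lemma d\<Phi>_linear: "x ~= 0 ==> linear (d\<Phi> (t, x))" using d\<Phi> has_derivative_linear by blast

lemma C1_twirl: "C1_on \<Omega> twirl"
proof (rule C1_on_local)
 fix p assume "p : \<Omega>"
 from local_extension[OF this] obtain W U G where W: "open W" "p : W" "W <= \<Omega>" "C_k_on (Suc (Suc 0)) U G" "nu ` W <= U"
  and "ALL q:W. \<Phi> q = G (nu q)" by (elim exE conjE)
 hence W6: "!!q. q : W ==> \<Phi> q = G (nu q)" by blast
 let ?u = "%q. rsqrt (inner (snd q) (snd q)) *. Jc (snd q)"
 let ?T = "%q. SUM b:Basis. inner (?u q) b *. frechet_derivative G (at (nu q)) (0, b)"
 have nu: "C1_on W nu" and rn: "C1_on W (%p. rsqrt (inner (snd p) (snd p)))" using C1_on_subset[OF _ W(3)] C1_nu C1_rnorm by blast+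
 have Gd: "(G has_derivative frechet_derivative G (at y)) (at y)" if "y : U" for y using C2_onD(1)[OF W(4) that] by (rule frechet_derivative_works[THEN iffD1])
 have u: "C1_on W ?u" by (intro C1_on_bilinear[OF bounded_bilinear_scaleR rn] C1_on_linear bounded_linear_compose[OF bounded_linear_Jc bounded_linear_snd])
 have Gb: "C1_on W (%q. frechet_derivative G (at (nu q)) (0, b))" for b by (rule C1_on_compose[OF C2_onD(2)[OF W(4)] nu W(5)])
 have "C1_on W (%q. inner (?u q) b)" for b by (rule C1_on_compose[OF C1_on_linear[OF bounded_linear_inner_left] u subset_UNIV])
 hence "C1_on W ?T" by (rule C1_on_sum[OF C1_on_bilinear[OF bounded_bilinear_scaleR _ Gb]])
 moreover have tw: "twirl q = ?T q" if q: "q : W" for q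
 proof -
  obtain t x where tx: "q = (t, x)" "x ~= 0" using q W(3) by (cases q) auto
  obtain A where A: "(unit has_derivative A) (at x)" "ALL v. inner x v = 0 --> A v = rsqrt (inner x x) *. v" using unit_derivative[OF tx(2)] by blast
  have nuU: "(t, unit x) : U" using W(5) q tx by (auto simp: nu_def)
  let ?G = "frechet_derivative G (at (t, unit x))"
  have "((%x. (t, unit x)) has_derivative (%v. (0, A v))) (at x)" by (intro has_derivative_Pair has_derivative_const A(1))
  from has_derivative_compose[OF this Gd[OF nuU]]
  have 1: "((%x. G (t, unit x)) has_derivative (%v. ?G (0, A v))) (at x)" .
  have oW: "open ((%x. (t, x)) -` W)" by (intro open_vimage W(1) continuous_intros)
  have "((%x. \<Phi> (t, x)) has_derivative (%v. ?G (0, A v))) (at x)"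
   by (rule has_derivative_transform_within_open[OF 1 oW]) (use q tx W6 in \<open>auto simp: nu_def\<close>)
  \<comment> \<open>\<open>Jc x\<close> is tangent to the sphere through \<open>x\<close>, so the
    derivative of \<open>unit\<close> merely rescales it.\<close>
  hence "twirl q = ?G (0, ?u q)" using d\<Phi>_unique[OF tx(2)] A(2)[rule_format, of "Jc x"] Jc(4)[of x] by (simp add: twirl_def tx)
  also have "... = (SUM b:Basis. inner (?u q) b *. ?G (0, b))"
  proof -
   have lin: "linear (%v. ?G (0, v))" using has_derivative_linear[OF Gd[OF nuU]] linear_compose[of "%v. (0, v)" ?G] by (auto simp: o_def linear_iff)
   have "?G (0, ?u q) = ?G (0, SUM b:Basis. inner (?u q) b *. b)" by (simp only: euclidean_representation)
   thus ?thesis using linear_sum[OF lin, of "%b. inner (?u q) b *. b" Basis] linear_scale[OF lin] by simp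
  qed
  finally show ?thesis by (simp add: tx nu_def)
 qed
 ultimately have "C1_on W twirl" by (intro C1_on_cong[OF _ W(1) tw])
 thus "EX W. open W & p : W & C1_on W twirl" using W(1,2) by (intro exI[of _ W] conjI)
qed

lemma C1_factor: "C1_on \<Omega> factor" unfolding factor_def[abs_def]
 by (intro C1_on_bilinear[OF bounded_bilinear_inner] C1_twirl C1_on_compose[OF C1_on_linear[OF bounded_linear_Jc, of UNIV] C1_\<Phi>]) auto

text \<open>The derivative within the sphere that occurs in \<^const>\<open>contactomorphism\<close> is an arbitrary choice;
  on tangent vectors it is determined by the curves \<open>cos \<theta> z + sin \<theta> w\<close>.\<close>

lemma derivative_within_sphere:
 fixes f :: "C2 => C2"
 assumes A: "(f has_derivative A) (at z within S3)" and B: "(f has_derivative B) (at z within S3)"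
  and z: "z : S3" and w: "inner z w = 0"
 shows "A w = B w"
proof (cases "w = 0")
 case True
 thus ?thesis using linear_0[OF has_derivative_linear[OF A]] linear_0[OF has_derivative_linear[OF B]] by simp
next
 case False
 define u where "u = (1 / norm w) *. w"
 have u: "norm u = 1" "inner z u = 0" "w = norm w *. u" using False w by (simp_all add: u_def)
 define c where "c \<theta> = cos \<theta> *. z + sin \<theta> *. u" for \<theta>
 have "norm (c \<theta>) = 1" for \<theta>
 proof -
  have "inner (c \<theta>) (c \<theta>) = (cos \<theta>)^2 * inner z z + (sin \<theta>)^2 * inner u u"
   using u(2) by (simp add: c_def inner_add_left inner_add_right inner_commute power2_eq_square)
  thus ?thesis using z u(1) by (simp add: norm_eq_1)
 qed
 hence cS: "range c <= S3" by auto
 have c0: "c 0 = z" by (simp add: c_def)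
 have cd: "(c has_derivative (%h. h *. u)) (at 0)" unfolding c_def[abs_def] by (auto intro!: derivative_eq_intros)
 have "((%\<theta>. f (c \<theta>)) has_derivative (%h. A (h *. u))) (at 0)" "((%\<theta>. f (c \<theta>)) has_derivative (%h. B (h *. u))) (at 0)"
  using has_derivative_in_compose[OF cd, of f A] has_derivative_in_compose[OF cd, of f B]
   has_derivative_subset[OF A cS] has_derivative_subset[OF B cS] by (simp_all add: c0)
 from has_derivative_unique[OF this] have "A (norm w *. u) = B (norm w *. u)" by meson
 thus ?thesis using u(3) by simp
qed

lemma contact:
 assumes x: "x ~= 0" and w: "inner x w = 0" "inner (Jc x) w = 0"
 shows "inner (Jc (\<Phi> (t, x))) (d\<Phi> (t, x) w) = 0"
proof -
 obtain A where A: "(unit has_derivative A) (at x)" "ALL v. inner x v = 0 --> A v = rsqrt (inner x x) *. v" using unit_derivative[OF x] by blast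
 define z where "z = unit x"
 define w' where "w' = rsqrt (inner x x) *. w"
 have z: "z : S3" "z ~= 0" using norm_unit[OF x] by (auto simp: z_def)
 have "((%x. \<Phi> (t, unit x)) has_derivative (%v. d\<Phi> (t, z) (A v))) (at x)" using has_derivative_compose[OF A(1)] d\<Phi>[OF z(2), of t] unfolding z_def by blast
 moreover have "((%x. \<Phi> (t, unit x)) has_derivative d\<Phi> (t, x)) (at x)"
  by (rule has_derivative_transform_within_open[OF d\<Phi>[OF x], of "- {0}"]) (use x in \<open>auto simp: \<Phi>_def unit_sphere norm_unit\<close>)
 ultimately have "d\<Phi> (t, x) = (%v. d\<Phi> (t, z) (A v))" using has_derivative_unique by blast
 hence 1: "d\<Phi> (t, x) w = d\<Phi> (t, z) w'" using A(2)[rule_format, OF w(1)] by (simp add: w'_def)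
 have wz: "inner z w' = 0" "inner (Jc z) w' = 0" using w by (simp_all add: z_def w'_def unit_def linear_scale[OF Jc(1)])
 have "(\<phi> t has_derivative d\<Phi> (t, z)) (at z within S3)"
  by (rule has_derivative_transform[OF z(1) _ has_derivative_at_withinI[OF d\<Phi>[OF z(2)]]]) (simp add: \<Phi>_def unit_sphere)
 moreover from this have "(\<phi> t has_derivative frechet_derivative (\<phi> t) (at z within S3)) (at z within S3)"
  by (intro frechet_derivative_works[THEN iffD1]) (auto simp: differentiable_def)
 ultimately have "frechet_derivative (\<phi> t) (at z within S3) w' = d\<Phi> (t, z) w'" using derivative_within_sphere z(1) wz(1) by metis
 moreover have "w' : std_contact_plane z" using wz by (simp add: std_contact_plane_def std_contact_form_def Jc_def)
 ultimately have "d\<Phi> (t, z) w' : std_contact_plane (\<phi> t z)" using phi(6)[OF z(1), of t] by (metis imageI)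
 thus ?thesis unfolding 1 by (simp add: std_contact_plane_def std_contact_form_def Jc_def \<Phi>_def z_def)
qed

text \<open>Split \<open>v\<close> into radial, Reeb and contact parts. \<open>\<Phi>\<close> is
  constant along rays, the contact part goes to contact planes, and the Reeb part yields the
  factor.\<close>

lemma conformal:
 assumes x: "x ~= 0"
 shows "inner (Jc (\<Phi> (t, x))) (d\<Phi> (t, x) v) = factor (t, x) * inner (Jc x) v / inner x x"
proof -
 note lin = d\<Phi>_linear[OF x, of t]
 have n: "inner x x ~= 0" using x by simp
 define a where "a = inner x v / inner x x"
 define b where "b = inner (Jc x) v / inner x x"
 define w where "w = v - a *. x - b *. Jc x"
 have "inner x w = 0" "inner (Jc x) w = 0" using n by (simp_all add: w_def inner_diff_right Jc a_def b_def)
 hence c: "inner (Jc (\<Phi> (t, x))) (d\<Phi> (t, x) w) = 0" by (rule contact[OF x])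
 have "((%\<theta>. \<Phi> (t, (1 + \<theta>) *. x)) has_derivative (%h. d\<Phi> (t, x) (h *. x))) (at 0)"
  by (rule has_derivative_compose[where f="%\<theta>. (1 + \<theta>) *. x" and g="%x. \<Phi> (t, x)"])
   (use d\<Phi>[OF x] in \<open>auto intro!: derivative_eq_intros\<close>)
 moreover have "((%\<theta>. \<Phi> (t, (1 + \<theta>) *. x)) has_derivative (%h. 0)) (at 0)"
  by (rule has_derivative_transform_within_open[OF has_derivative_const, of "{-1<..}" _ "\<Phi> (t, x)"]) (auto simp: \<Phi>_scale)
 ultimately have "(%h. d\<Phi> (t, x) (h *. x)) = (%h. 0)" by (rule has_derivative_unique)
 hence r: "d\<Phi> (t, x) x = 0" by (metis scaleR_one)
 have "v = w + a *. x + b *. Jc x" by (simp add: w_def)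
 hence "d\<Phi> (t, x) v = d\<Phi> (t, x) w + a *. d\<Phi> (t, x) x + b *. twirl (t, x)" using linear_add[OF lin] linear_scale[OF lin] by (metis twirl_def snd_conv)
 thus ?thesis using c r by (simp add: inner_add_right factor_def b_def)
qed

lemma factor_add:
 assumes x: "x ~= 0" shows "factor (s + t, x) = factor (s, \<Phi> (t, x)) * factor (t, x)"
proof -
 define y where "y = \<Phi> (t, x)"
 have y: "norm y = 1" "y ~= 0" using norm_\<Phi>[OF x, of t] by (auto simp: y_def)
 have "((%x. \<Phi> (s, \<Phi> (t, x))) has_derivative (%v. d\<Phi> (s, y) (d\<Phi> (t, x) v))) (at x)"
  using has_derivative_compose[OF d\<Phi>[OF x, of t]] d\<Phi>[OF y(2), of s] unfolding y_def by blast
 hence "((%x. \<Phi> (s + t, x)) has_derivative (%v. d\<Phi> (s, y) (d\<Phi> (t, x) v))) (at x)"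
  by (rule has_derivative_transform_within_open[of _ _ _ _ "- {0}"]) (use x \<Phi>_add in auto)
 hence "twirl (s + t, x) = d\<Phi> (s, y) (twirl (t, x))" using d\<Phi>_unique[OF x] by (simp add: twirl_def)
 thus ?thesis using conformal[OF y(2), of s "twirl (t, x)"] \<Phi>_add[OF x, of s t] y(1)
  by (simp add: factor_def[of "(s + t, x)"] factor_def[of "(t, x)"] y_def norm_eq_1)
qed

lemma factor_0: "x ~= 0 ==> factor (0, x) = 1"
proof -
 assume x: "x ~= 0"
 obtain A where A: "(unit has_derivative A) (at x)" "ALL v. inner x v = 0 --> A v = rsqrt (inner x x) *. v" using unit_derivative[OF x] by blast
 have "((%x. \<Phi> (0, x)) has_derivative A) (at x)"
  by (rule has_derivative_transform_within_open[OF A(1), of "- {0}"]) (use x in \<open>auto simp: \<Phi>_def phi(2) norm_unit\<close>)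
 hence "twirl (0, x) = rsqrt (inner x x) *. Jc x" using d\<Phi>_unique[OF x] A(2)[rule_format, OF Jc(4)] by (simp add: twirl_def)
 moreover have "\<Phi> (0, x) = rsqrt (inner x x) *. x" using norm_unit[OF x] by (simp add: \<Phi>_def phi(2) unit_def)
 ultimately show ?thesis using rsqrt(4)[of "inner x x"] x by (simp add: factor_def linear_scale[OF Jc(1)] Jc(3) power2_eq_square)
qed

text \<open>The cocycle rule makes the factor nonzero, it is 1 at time 0, and connectedness of the
  time line fixes the sign. This is preservation of the coorientation.\<close>

lemma factor_pos: "x ~= 0 ==> 0 < factor (t, x)"
proof (rule ccontr)
 assume x: "x ~= 0" and neg: "\<not> 0 < factor (t, x)"
 have nz: "factor (s, x) ~= 0" for s using factor_add[OF x, of "- s" s] factor_0[OF x] by auto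
 have "continuous_on UNIV (%s. factor (s, x))"
  by (rule continuous_on_compose2[OF C1_on_continuous[OF C1_factor]]) (use x in \<open>auto intro!: continuous_intros\<close>)
 hence "connected (range (%s. factor (s, x)))" by (rule connected_continuous_image) simp
 hence "0 : range (%s. factor (s, x))" using connectedD_interval[of _ "factor (t, x)" "factor (0, x)" 0] neg factor_0[OF x] by simp
 thus False using nz by auto
qed

lemma factor_scale:
 assumes c: "0 < c" and x: "x ~= 0" shows "factor (t, c *. x) = factor (t, x)"
proof -
 have cx: "c *. x ~= 0" using c x by simp
 have "((%x. \<Phi> (t, c *. x)) has_derivative (%v. d\<Phi> (t, c *. x) (c *. v))) (at x)"
  by (rule has_derivative_compose[OF has_derivative_scaleR_right[OF has_derivative_ident] d\<Phi>[OF cx]])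
 hence "d\<Phi> (t, x) = (%v. d\<Phi> (t, c *. x) (c *. v))" using d\<Phi>_unique[OF x] c by (simp add: \<Phi>_scale)
 thus ?thesis using c by (simp add: factor_def twirl_def \<Phi>_scale linear_scale[OF Jc(1)])
qed

text \<open>The norm of \<open>x\<close> divided by the square root of \<open>factor\<close>. This
  rescaling cancels the conformal factor, since the form \<open>inner (Jc x) v\<close> is quadratic
  in the radius. Products of \<open>rsqrt\<close> terms keep it visibly C1 off 0.\<close>

definition stretch :: "real \<times> C2 => real" where
 "stretch p = inner (snd p) (snd p) * rsqrt (inner (snd p) (snd p)) * rsqrt (factor p)"

definition \<psi> :: "real => C2 => C2" where "\<psi> t x = stretch (t, x) *. \<Phi> (t, x)"

definition \<Psi> :: "real \<times> C2 => C2" where "\<Psi> p = stretch p *. \<Phi> p"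

lemma C1_stretch: "C1_on \<Omega> stretch" unfolding stretch_def[abs_def]
 by (intro C1_on_bilinear[OF bounded_bilinear_mult] C1_norm2 C1_rnorm C1_on_rsqrt_compose[OF C1_factor])
  (use factor_pos[of "snd p" "fst p" for p] in \<open>simp add: mem_Times_iff\<close>)

lemma C1_\<Psi>: "C1_on \<Omega> \<Psi>" unfolding \<Psi>_def[abs_def] by (intro C1_on_bilinear[OF bounded_bilinear_scaleR] C1_stretch C1_\<Phi>)

lemma stretch_alt: "stretch (t, x) = norm x * rsqrt (factor (t, x))"
proof -
 have "inner x x * inverse (norm x) = norm x" by (cases "x = 0") (simp_all add: power2_norm_eq_inner[symmetric] power2_eq_square)
 thus ?thesis by (simp only: stretch_def fst_conv snd_conv rsqrt_norm)
qed

lemma \<psi>_zero: "\<psi> t 0 = 0" by (simp add: \<psi>_def stretch_alt)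

lemma \<psi>_add: "\<psi> (s + t) x = \<psi> s (\<psi> t x)"
proof (cases "x = 0")
 case False
 let ?r = "stretch (t, x)"
 have r: "0 < ?r" using False factor_pos[of x t] rsqrt(1) by (simp add: stretch_alt)
 have y: "norm (\<Phi> (t, x)) = 1" "\<Phi> (t, x) ~= 0" using norm_\<Phi>[OF False, of t] by auto
 have "stretch (s, ?r *. \<Phi> (t, x)) = ?r * rsqrt (factor (s, \<Phi> (t, x)))" using r y by (simp add: stretch_alt[of s] factor_scale)
 also have "... = stretch (s + t, x)" by (simp add: stretch_alt factor_add[OF False] rsqrt(3))
 finally show ?thesis using r by (simp add: \<psi>_def \<Phi>_scale \<Phi>_add[OF False])
qed (simp add: \<psi>_zero)

lemma \<psi>_0: "\<psi> 0 x = x"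
proof (cases "x = 0")
 case False
 thus ?thesis using norm_unit[OF False] by (simp add: \<psi>_def stretch_alt factor_0 rsqrt(2) \<Phi>_def phi(2)) (simp add: unit_def rsqrt_norm)
qed (simp add: \<psi>_zero)

lemma \<psi>_1: "\<psi> 1 x = x"
proof (cases "x = 0")
 case False
 have "(%x. \<Phi> (1, x)) = (%x. if x = 0 then \<Phi> (1, 0) else \<Phi> (0, x))" by (auto simp: fun_eq_iff \<Phi>_def phi(2,4) norm_unit)
 moreover have "((%x. \<Phi> (1, x)) has_derivative d\<Phi> (0, x)) (at x)"
  by (rule has_derivative_transform_within_open[OF d\<Phi>[OF False], of "- {0}"]) (use False in \<open>auto simp: \<Phi>_def phi(2,4) norm_unit\<close>)
 hence "twirl (1, x) = twirl (0, x)" using d\<Phi>_unique[OF False] by (simp add: twirl_def)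
 moreover have "\<Phi> (1, x) = \<Phi> (0, x)" using norm_unit[OF False] by (simp add: \<Phi>_def phi(2,4))
 ultimately have "\<psi> 1 x = \<psi> 0 x" by (simp add: \<psi>_def stretch_alt factor_def)
 thus ?thesis by (simp add: \<psi>_0)
qed (simp add: \<psi>_zero)

text \<open>\<open>\<Psi>\<close> need not be differentiable at the origin, but the path
  \<open>\<psi> t 0\<close> is constant, so 0 is the right value there.\<close>

definition Y :: "C2 => C2" where
 "Y x = (if x = 0 then 0 else frechet_derivative \<Psi> (at (0, x)) (1, 0))"

lemma \<Psi>_derivative: "x ~= 0 ==> (\<Psi> has_derivative frechet_derivative \<Psi> (at (t, x))) (at (t, x))" by (rule C1_onD[OF C1_\<Psi>]) simp

sublocale lift: symplectic_flow Jc \<psi> "%t x v. frechet_derivative \<Psi> (at (t, x)) (0, v)" Y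
proof (rule symplectic_flow.intro)
 show "linear Jc" by (rule Jc)
 show "Jc (Jc x) = - x" for x by (rule Jc)
 show "inner (Jc x) (Jc y) = inner x y" for x y by (rule Jc)
 show "\<psi> 0 x = x" for x by (rule \<psi>_0)
 show "\<psi> (s + t) x = \<psi> s (\<psi> t x)" for s t x by (rule \<psi>_add)
 show "\<psi> 1 x = x" for x by (rule \<psi>_1)
 fix t :: real and x :: "C2"
 show "t : \<int>" if x: "x ~= 0" and fx: "\<psi> t x = x"
 proof -
  have r: "0 < stretch (t, x)" using x factor_pos[of x t] rsqrt(1) by (simp add: stretch_alt)
  have "unit x = unit (\<psi> t x)" using fx by simp
  also have "... = \<Phi> (t, x)" using r norm_\<Phi>[OF x] by (simp add: \<psi>_def unit_scale unit_sphere)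
  finally have "\<phi> t (unit x) = unit x" by (simp add: \<Phi>_def)
  moreover have "unit x : S3" using norm_unit[OF x] by simp
  ultimately show ?thesis using free unfolding free_circle_action_def by blast
 qed
 show "\<psi> t (c *. x) = c *. \<psi> t x" if "0 <= c" for c
  using that by (cases "c = 0 | x = 0") (auto simp: \<psi>_zero \<psi>_def stretch_alt \<Phi>_scale factor_scale)
 show der: "(\<psi> t has_derivative (%v. frechet_derivative \<Psi> (at (t, x)) (0, v))) (at x)" if x: "x ~= 0"
 proof -
  have "((%x. (t, x)) has_derivative (%v. (0, v))) (at x)" by (intro has_derivative_Pair has_derivative_const has_derivative_ident)
  from has_derivative_compose[OF this \<Psi>_derivative[OF x]] show ?thesis by (simp add: \<Psi>_def \<psi>_def[abs_def])
 qed
 \<comment> \<open>The term with the derivative of \<open>stretch\<close> is radial and annihilated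
   by the form; the rest is the conformal identity multiplied by the square of
   \<open>stretch\<close>.\<close>
 show "inner (Jc (\<psi> t x)) (frechet_derivative \<Psi> (at (t, x)) (0, v)) = inner (Jc x) v" if x: "x ~= 0" for v
 proof -
  let ?r = "stretch (t, x)" and ?R = "frechet_derivative stretch (at (t, x))"
  have "((%x. (t, x)) has_derivative (%v. (0, v))) (at x)" by (intro has_derivative_Pair has_derivative_const has_derivative_ident)
  from has_derivative_compose[OF this C1_onD[OF C1_stretch]] x
  have "((%x. stretch (t, x)) has_derivative (%v. ?R (0, v))) (at x)" by simp
  from has_derivative_scaleR[OF this d\<Phi>[OF x]]
  have "(\<psi> t has_derivative (%v. ?r *. d\<Phi> (t, x) v + ?R (0, v) *. \<Phi> (t, x))) (at x)" by (simp add: \<psi>_def[abs_def])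
  from has_derivative_unique[OF der[OF x] this]
  have "frechet_derivative \<Psi> (at (t, x)) (0, v) = ?r *. d\<Phi> (t, x) v + ?R (0, v) *. \<Phi> (t, x)" by meson
  hence "inner (Jc (\<psi> t x)) (frechet_derivative \<Psi> (at (t, x)) (0, v)) = ?r^2 * (factor (t, x) * inner (Jc x) v / inner x x)"
   using conformal[OF x, of t v] by (simp add: \<psi>_def linear_scale[OF Jc(1)] inner_add_right Jc power2_eq_square)
  moreover have "?r^2 * factor (t, x) = inner x x" using rsqrt(4)[OF factor_pos[OF x, of t]] by (simp add: stretch_alt power_mult_distrib power2_norm_eq_inner)
  ultimately show ?thesis using x by (simp add: field_simps)
 qed
 show "((%t. \<psi> t x) has_vector_derivative Y x) (at 0)"
 proof (cases "x = 0")
  case False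
  have "((%t. (t, x)) has_derivative (%h. (h, 0))) (at 0)" by (intro has_derivative_Pair has_derivative_const has_derivative_ident)
  from has_derivative_compose[OF this \<Psi>_derivative[OF False]]
  have "((%t. \<psi> t x) has_derivative (%h. frechet_derivative \<Psi> (at (0, x)) (h, 0))) (at 0)" by (simp add: \<Psi>_def \<psi>_def[abs_def])
  moreover have "frechet_derivative \<Psi> (at (0, x)) (h, 0) = h *. Y x" for h
   using linear_scale[OF has_derivative_linear[OF \<Psi>_derivative[OF False, of 0]], of h "(1, 0)"] False by (simp add: Y_def)
  ultimately show ?thesis by (simp add: has_vector_derivative_def)
 qed (simp add: \<psi>_zero Y_def)
next
 fix v
 show "continuous_on \<Omega> (%z. frechet_derivative \<Psi> (at (fst z, snd z)) (0, v))" using C1_\<Psi> unfolding C_k_on.simps prod.collapse by blast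
next
 have \<Psi>: "continuous_on \<Omega> (%z. frechet_derivative \<Psi> (at z) (1, 0))" using C1_\<Psi> unfolding C_k_on.simps by blast
 have "continuous_on (- {0}) (%x. frechet_derivative \<Psi> (at (0, x)) (1, 0))"
  by (rule continuous_on_compose2[OF \<Psi>, where f="%x. (0, x)"]) (auto intro!: continuous_intros)
 thus "continuous_on (- {0}) Y" by (rule continuous_on_eq) (simp add: Y_def)
qed

text \<open>\<open>Y\<close> differs from the generating field by a radial vector, which the contact
  form does not see.\<close>

lemma positive_set_alt: "positive_set \<phi> = {z:S3. inner (Jc z) (Y z) > 0}"
proof -
 have "std_contact_form z (generating_field \<phi> z) = inner (Jc z) (Y z)" if z: "z : S3" for z
 proof -
  have z0: "z ~= 0" "unit z = z" using z by (auto simp: unit_sphere)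
  have t: "((%t. (t, z)) has_derivative (%h. (h, 0))) (at 0)" by (intro has_derivative_Pair has_derivative_const has_derivative_ident)
  let ?R = "frechet_derivative stretch (at (0, z))" and ?F = "frechet_derivative \<Phi> (at (0, z))"
  have R: "((%t. stretch (t, z)) has_derivative (%h. ?R (h, 0))) (at 0)" and F: "((%t. \<Phi> (t, z)) has_derivative (%h. ?F (h, 0))) (at 0)"
   using has_derivative_compose[OF t C1_onD[OF C1_stretch]] has_derivative_compose[OF t C1_onD[OF C1_\<Phi>]] z0 by simp_all
  have "(%h. ?F (h, 0)) = (%h. h *. ?F (1, 0))"
  proof
   show "?F (h, 0) = h *. ?F (1, 0)" for h using linear_scale[OF has_derivative_linear[OF C1_onD[OF C1_\<Phi>, of "(0, z)"]], of h "(1, 0)"] z0 by simp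
  qed
  moreover have "(%t. \<Phi> (t, z)) = (%t. \<phi> t z)" using z0 by (simp add: \<Phi>_def)
  ultimately have "((%t. \<phi> t z) has_vector_derivative ?F (1, 0)) (at 0)" using F unfolding has_vector_derivative_def by metis
  hence g: "generating_field \<phi> z = ?F (1, 0)" unfolding generating_field_def by (rule vector_derivative_at)
  have "((%t. \<psi> t z) has_derivative (%h. stretch (0, z) *. ?F (h, 0) + ?R (h, 0) *. \<Phi> (0, z))) (at 0)"
   using has_derivative_scaleR[OF R F] by (simp add: \<psi>_def)
  moreover have "((%t. \<psi> t z) has_derivative (%h. h *. Y z)) (at 0)" using lift.field[of z] by (simp add: has_vector_derivative_def)
  ultimately have "(%h. stretch (0, z) *. ?F (h, 0) + ?R (h, 0) *. \<Phi> (0, z)) = (%h. h *. Y z)" by (rule has_derivative_unique)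
  from fun_cong[OF this, of 1] have "Y z = ?F (1, 0) + ?R (1, 0) *. z" using z z0 by (simp add: stretch_alt factor_0 rsqrt(2) \<Phi>_def phi(2))
  thus ?thesis by (simp add: g std_contact_form_def Jc_def[symmetric] inner_add_right Jc(5))
 qed
 thus ?thesis by (auto simp: positive_set_def)
qed

end

section \<open>Comparison of degrees and conclusion\<close>

lemma empty_homology: "p ~= -1 ==> cycles2 ({} :: 'a::topological_space set) p <= bounds2 {} p" by (cases "0 <= p") (auto simp: cycles2_def chains2_empty chains2_neg)

text \<open>In negative degrees there is at most the empty simplex, and it is the boundary of any
  point.\<close>

lemma negative_homology:
 assumes "A ~= {}" "p < 0"
 shows "cycles2 A p <= bounds2 A p"
proof -
 obtain a where a: "a : A" using assms(1) by blast
 have "chains2 A p = chains2 {a} p" using assms(2) by (simp add: chains2_def aug_simplices_def)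
 hence "cycles2 A p = cycles2 {a} p" by (simp add: cycles2_def)
 also have "... <= bounds2 {a} p" using acyclic_singleton[of a] by (simp add: acyclic_set_def)
 also have "... <= bounds2 A p" using a by (intro bounds2_mono) simp
 finally show ?thesis .
qed

lemma hiso_sphere_cone:
 fixes h :: "'a::real_inner => real"
 assumes h: "homogeneous2 h"
 shows "hiso {x:sphere 0 1. 0 < h x} p {x. 0 < h x} p"
proof (rule hiso_deformation[where H="%s x. (1 - s + s * inverse (norm x)) *. x"])
 show "continuous_on ({0..1} \<times> {x. 0 < h x}) (%z. (1 - fst z + fst z * inverse (norm (snd z))) *. snd z)"
  using homogeneous2_0[OF h] by (auto intro!: continuous_intros)
 fix s :: real and x :: 'a assume s: "0 <= s" "s <= 1"
 have "0 < (1 - s + s * inverse (norm x))" if "x ~= 0" using s that by (cases "s = 1") (auto intro: add_pos_nonneg)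
 thus "(1 - s + s * inverse (norm x)) *. x : {x. 0 < h x}" if "x : {x. 0 < h x}"
  using that homogeneous2_0[OF h] homogeneous2D[OF h, of "1 - s + s * inverse (norm x)" x] by fastforce
next
 fix x :: 'a assume x: "x : {x. 0 < h x}"
 hence "x ~= 0" using homogeneous2_0[OF h] by auto
 thus "(1 - 1 + 1 * inverse (norm x)) *. x : {x:sphere 0 1. 0 < h x}" using x homogeneous2D[OF h, of "inverse (norm x)" x] by simp
qed auto

text \<open>If both sets are nonempty then \<open>m = 2 - d\<close>; if one is empty, all homology sits in one degree.\<close>

lemma symmetric_degrees:
 fixes P N :: "'a::topological_space set"
 assumes PN: "!!p. hiso P p N (p + d)"
  and P: "N ~= {} ==> hiso P 2 N 0" "!!p. N ~= {} ==> 3 <= p ==> cycles2 P p <= bounds2 P p"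
  and N: "P ~= {} ==> hiso N 2 P 0" "!!p. P ~= {} ==> 3 <= p ==> cycles2 N p <= bounds2 N p"
 shows "EX m. ALL k. hiso P (m - k) P k"
proof -
 \<comment> \<open>The homology is concentrated in degree \<open>- 1 - e\<close>, and anything
   concentrated in one degree is symmetric about it.\<close>
 have empty: ?thesis if "!!p. hiso P p ({} :: 'a set) (p + e)" for e :: int
 proof (intro exI allI)
  fix k
  have z: "cycles2 P p <= bounds2 P p" if "p ~= - 1 - e" for p
   by (rule hiso_zero[OF hiso_sym[OF \<open>!!p. hiso P p {} (p + e)\<close>] empty_homology]) (use that in simp)
  show "hiso P (- 2 - 2 * e - k) P k"
  proof (cases "k = - 1 - e")
   case True
   hence "- 2 - 2 * e - k = k" by simp
   thus ?thesis by (simp add: hiso_refl)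
  next
   case False
   thus ?thesis by (intro hiso_both_zero z) auto
  qed
 qed
 consider "P = {}" | "N = {}" | "P ~= {}" "N ~= {}" by blast
 thus ?thesis
 proof cases
  case 1
  show ?thesis by (rule empty[of 0]) (simp add: 1 hiso_refl)
 next
  case 2
  show ?thesis by (rule empty[of d]) (use PN 2 in simp)
 next
  case 3
  have zP: "cycles2 P p <= bounds2 P p" if "p < 0 | 3 <= p" for p using that P(2) negative_homology 3 by blast
  have zN: "cycles2 N p <= bounds2 N p" if "p < 0 | 3 <= p" for p using that N(2) negative_homology 3 by blast
  have zPN: "cycles2 P p <= bounds2 P p" if "p + d < 0 | 3 <= p + d" for p by (rule hiso_zero[OF hiso_sym[OF PN] zN[OF that]])
  have 20: "hiso P 2 P (- d)" using hiso_trans[OF P(1)[OF 3(2)] hiso_sym[OF PN[of "- d"], simplified]] .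
  have 02: "hiso P (2 - d) P 0" using hiso_trans[OF PN[of "2 - d", simplified] N(1)[OF 3(1)]] .
  \<comment> \<open>For \<open>d = 0\<close> there is nothing to prove, for \<open>d = 1\<close> and
    \<open>d = - 1\<close> one of the two previous isomorphisms applies, and for larger shifts both
    groups vanish.\<close>
  have 1: "hiso P (1 - d) P 1"
  proof -
   consider "d = 0" | "d = 1" | "d = - 1" | "2 <= \<bar>d\<bar>" by linarith
   thus ?thesis
   proof cases
    case 4
    show ?thesis by (rule hiso_both_zero[OF zP zPN]) (use 4 in auto)
   qed (use 02 20 hiso_sym[OF 02] in \<open>auto simp: hiso_refl\<close>)
  qed
  show ?thesis
  proof (intro exI allI)
   fix k
   consider "k = 0" | "k = 1" | "k = 2" | "k = 2 - d" | "k = 1 - d" | "k = - d" | "k < 0 | 3 <= k" "2 - d - k < 0 | 3 <= 2 - d - k" by linarith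
   thus "hiso P (2 - d - k) P k"
   proof cases
    case 7
    thus ?thesis by (intro hiso_both_zero zP)
   qed (use 1 02 20 hiso_sym[OF 1] hiso_sym[OF 02] hiso_sym[OF 20] in simp_all)
  qed
 qed
qed

theorem corollary1p3:
  fixes \<phi> :: "real \<Rightarrow> complex \<times> complex \<Rightarrow> complex \<times> complex"
  assumes "contact_circle_action \<phi>" and "free_circle_action \<phi>"
  shows "topologically_symmetric \<phi>"
proof -
  interpret contact_flow \<phi> using assms by unfold_locales
  obtain \<sigma> L where "short_flow Jc \<psi> (\<lambda>t x v. frechet_derivative \<Psi> (at (t, x)) (0, v)) Y \<sigma> L" using lift.short_flow .
  then interpret short: short_flow Jc \<psi> "\<lambda>t x v. frechet_derivative \<Psi> (at (t, x)) (0, v)" Y \<sigma> L .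
  let ?P = "{x. short.ham x > 0}" and ?N = "{x. short.ham x < 0}"
  obtain d where d: "\<And>p. hiso ?P p ?N (p + d)" using short.positive_negative by blast
  have dim: "DIM(complex \<times> complex) = 4" by simp
  \<comment> \<open>The duality describes the positive cone only, so it is applied both to
    \<open>ham\<close> and to its negative.\<close>
  obtain v k C where "pushable_cone (\<lambda>x. 1 * short.ham x) v k C" using short.ham_pushable_cone by metis
  then have pos: "pushable_cone short.ham v k C" by simp
  obtain w l B where "pushable_cone (\<lambda>x. - 1 * short.ham x) w l B" using short.ham_pushable_cone by metis
  then have neg: "pushable_cone (\<lambda>x. - short.ham x) w l B" by simp
  have "\<exists>m. \<forall>k. hiso ?P (m - k) ?P k"
  proof (rule symmetric_degrees[OF d])
    show "hiso ?P 2 ?N 0" if "?N \<noteq> {}" using pushable_cone.codimension_one_duality[OF pos] that by (simp add: dim)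
    show "cycles2 ?P p \<subseteq> bounds2 ?P p" if "?N \<noteq> {}" "3 \<le> p" for p using pushable_cone.positive_homology_vanishes[OF pos that(1), of p] that(2) by (simp add: dim)
    show "hiso ?N 2 ?P 0" if "?P \<noteq> {}" using pushable_cone.codimension_one_duality[OF neg] that by (simp add: dim)
    show "cycles2 ?N p \<subseteq> bounds2 ?N p" if "?P \<noteq> {}" "3 \<le> p" for p using pushable_cone.positive_homology_vanishes[OF neg, of p] that by (simp add: dim)
  qed
  moreover have "hiso (positive_set \<phi>) p ?P p" for p
    using hiso_sphere_cone[OF short.ham_homogeneous] unfolding positive_set_alt short.ham_def .
  ultimately have "\<exists>m. \<forall>k. hiso (positive_set \<phi>) (m - k) (positive_set \<phi>) k" by (meson hiso_sym hiso_trans)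
  then show ?thesis unfolding topologically_symmetric_def using hiso_Z2_dim by blast
qed

end
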